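(* Let $(\mathcal F,\mathcal D,U,\Omega)$ be a (potentially non-unitary) Möbius-covariant Wightman CFT on $S^1$ with invariant nondegenerate Hermitian form and antiunitary PCT operator $\theta$ (an involutive Wightman CFT). Then $\mathcal P(I_\pm)\Omega\subset D(V_{\pm i\pi})$, and for every $x\in\mathcal P(I_\pm)$ we have $$V_{\pm i\pi}\,x\Omega=\theta x^*\Omega$$ (with the upper signs, respectively the lower signs, taken throughout).
   Context: **Wightman CFTs.** $S^1\subset\mathbb C$ is the unit circle and $C^\infty(S^1)$ is the space of complex-valued smooth functions, with the Fréchet topology of the norms $\|f\|_{C^N}=\sum_{j=0}^N\|\frac{d^j}{d\theta^j}f\|_\infty$. An interval is an open, connected, nonempty, non-dense subset of $S^1$. $\mathrm{Mob}=\mathrm{PSU}(1,1)$ is the group of holomorphic automorphisms of the unit disk (acting on $S^1$), and $r_\theta\in\mathrm{Mob}$ is rotation by $\theta$. For $\gamma\in\mathrm{Mob}$ put $X_\gamma(e^{i\theta})=-i\frac{d}{d\theta}\log\gamma(e^{i\theta})$, and for $d\in\mathbb Z_{\ge0}$ put $(\beta_d(\gamma)f)(z)=X_\gamma(\gamma^{-1}(z))^{d-1}f(\gamma^{-1}(z))$. Let $\mathcal D$ be a complex vector space. An operator-valued distribution with domain $\mathcal D$ is a linear map $\varphi$ from $C^\infty(S^1)$ to the linear operators on $\mathcal D$. Let $\mathcal F$ be a set of these. A linear functional $\lambda:\mathcal D\to\mathbb C$ is compatible with $\mathcal F$ if $(f_1,\dots,f_k)\mapsto\lambda(\varphi_1(f_1)\cdots\varphi_k(f_k)\Phi)$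 is jointly continuous on $C^\infty(S^1)^k$ for all $k$, $\varphi_j\in\mathcal F$, $\Phi\in\mathcal D$; $\mathcal D_{\mathcal F}^*$ is the space of such functionals. $\mathcal F$ acts regularly if $\mathcal D_{\mathcal F}^*$ separates points of $\mathcal D$. The $\mathcal F$-strong topology on $\mathcal D$ is the finest locally convex topology for which all maps $(f_1,\dots,f_k)\mapsto\varphi_1(f_1)\cdots\varphi_k(f_k)\Phi$ are jointly continuous. $\mathcal D$ carries this topology, and $\operatorname{End}(\mathcal D)$ denotes the continuous linear operators on $\mathcal D$. A Möbius-covariant Wightman CFT on $S^1$ is $(\mathcal F,\mathcal D,U,\Omega)$ with $\mathcal F$ acting regularly on $\mathcal D$, $U:\mathrm{Mob}\to\operatorname{End}(\mathcal D)$ a representation, $0\ne\Omega\in\mathcal D$, such that: (W1) each $\varphi\in\mathcal F$ has a conformal dimension $d_\varphi\in\mathbb Z_{\ge0}$ with $U(\gamma)\varphi(f)U(\gamma)^{-1}=\varphi(\beta_{d_\varphi}(\gamma)f)$ for all $\gamma,f$; (W2) $\varphi_1(f),\varphi_2(g)$ commute if $f,g$ have disjoint supports, $\varphi_1,\varphi_2\in\mathcal F$; (W3) if $d\in\mathbb Z$, $d<0$ and $U(r_\theta)\Phi=e^{id\theta}\Phi$ for all $\theta$, then $\Phi=0$; (W4) $\Omega$ is $U$-invariant and $\mathcal D$ is algebraically spanned by the vectors $\varphi_1(f_1)\cdots\varphi_k(f_k)\Omega$. For an interval $I$, $\mathcal P(I)\subset\operatorname{End}(\mathcal D)$ is the unital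 algebra generated by the $\varphi(f)$ with $\varphi\in\mathcal F$, $\operatorname{supp}f\subset I$. Set $I_\pm=\{z\in S^1:\pm\operatorname{Im}z>0\}$. **Involutive theories.** The CFT is involutive if it is equipped with a nondegenerate, jointly $\mathcal F$-strongly continuous Hermitian form $\langle\cdot,\cdot\rangle$ on $\mathcal D$ (linear in the first variable) and a PCT operator $\theta$, i.e. an antiunitary involution $\theta:\mathcal D\to\mathcal D$ (antilinear, $\theta^2=1$, $\langle\theta\Phi,\theta\Psi\rangle=\overline{\langle\Phi,\Psi\rangle}$) with $\theta\Omega=\Omega$, such that the form is invariant: $\langle\varphi(f)\Phi,\Psi\rangle=\langle\Phi,\varphi^\dagger(\overline f)\Psi\rangle$ for all $\Phi,\Psi\in\mathcal D$, $\varphi\in\mathcal F$, $f\in C^\infty(S^1)$, where $\varphi^\dagger(f):=(-1)^{d_\varphi}\theta\varphi(\overline f\circ z^{-1})\theta$ and $(-1)^{d_\varphi}\varphi^\dagger\in\mathcal F$; and $\langle U(\gamma)\Phi,U(\gamma)\Psi\rangle=\langle\Phi,\Psi\rangle$ for all $\gamma\in\mathrm{Mob}$. $\operatorname{End}_*(\mathcal D)$ is the $*$-algebra of $x\in\operatorname{End}(\mathcal D)$ having an adjoint $x^*\in\operatorname{End}(\mathcal D)$, $\langle x\Phi,\Psi\rangle=\langle\Phi,x^*\Psi\rangle$. Each $\mathcal P(I)$ is a $*$-subalgebra of $\operatorname{End}_*(\mathcal D)$. **The operators $V_\tau$.** Let $v_t(z)=\frac{\cosh(t/2)z-\sinh(t/2)}{-\sinh(t/2)z+\cosh(t/2)}\in\mathrm{Mob}$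 for $t\in\mathbb R$ and $V_t=U(v_t)$. For $\tau\in\mathbb C$, let $\mathbb S_\tau$ be the closed strip bounded by $\mathbb R$ and $\mathbb R+\tau$. The partially defined operator $V_\tau$ on $\mathcal D$ has domain $D(V_\tau)$ consisting of those $\Phi\in\mathcal D$ for which there is $\Psi\in\mathcal D$ such that for every $\Phi'\in\mathcal D$ there is a function $G_{\Phi'}:\mathbb S_\tau\to\mathbb C$, continuous on $\mathbb S_\tau$ and holomorphic in its interior, with $G_{\Phi'}(t)=\langle V_t\Phi,\Phi'\rangle$ and $G_{\Phi'}(\tau+t)=\langle V_t\Psi,\Phi'\rangle$ for all $t\in\mathbb R$. Such $\Psi$ is unique and $V_\tau\Phi:=\Psi$. *)

theory Defs
  imports "HOL-Complex_Analysis.Complex_Analysis"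
begin

section \<open>Smooth functions of a real variable\<close>

definition vderiv :: "(real \<Rightarrow> complex) \<Rightarrow> real \<Rightarrow> complex" where
  "vderiv g = (\<lambda>t. vector_derivative g (at t))"

definition smooth :: "(real \<Rightarrow> complex) \<Rightarrow> bool" where
  "smooth g \<longleftrightarrow> (\<forall>n t. (vderiv ^^ n) g differentiable (at t))"

text \<open>The next predicate only serves to prove closure properties of \<^const>\<open>smooth\<close> by induction.\<close>

primrec diff_times :: "nat \<Rightarrow> (real \<Rightarrow> complex) \<Rightarrow> bool" where
  "diff_times 0 g = True"
| "diff_times (Suc n) g = ((\<forall>t. g differentiable (at t)) \<and> diff_times n (vderiv g))"

lemma diff_times_iff: "diff_times n g \<longleftrightarrow> (\<forall>m<n. \<forall>t. (vderiv ^^ m) g differentiable (at t))"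
proof (induction n arbitrary: g)
  case (Suc n)
  show ?case
    unfolding diff_times.simps Suc.IH
    by (simp add: All_less_Suc2 funpow_Suc_right del: funpow.simps)
qed simp

lemma smooth_iff: "smooth g \<longleftrightarrow> (\<forall>n. diff_times n g)"
  unfolding diff_times_iff smooth_def by blast

lemma vderivI: "(\<And>t. (g has_vector_derivative g' t) (at t)) \<Longrightarrow> vderiv g = g'"
  unfolding vderiv_def using vector_derivative_at by blast

lemma vderiv_works: "\<forall>t. g differentiable (at t) \<Longrightarrow> (g has_vector_derivative vderiv g t) (at t)"
  unfolding vderiv_def using vector_derivative_works by blast

lemma diff_times_SucI:
  assumes "\<And>t. (g has_vector_derivative g' t) (at t)" "diff_times n g'"
  shows "diff_times (Suc n) g"
  using assms vderivI[OF assms(1)] by (auto intro: differentiableI_vector)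

lemma diff_times_SucD: "diff_times (Suc n) g \<Longrightarrow> diff_times n g"
  by (auto simp: diff_times_iff)

lemma diff_times_const: "diff_times n (\<lambda>t. c)"
proof (induction n arbitrary: c)
  case (Suc n)
  show ?case
    by (rule diff_times_SucI[where g' = "\<lambda>t. 0"]) (auto intro: Suc derivative_eq_intros)
qed simp

lemma diff_times_add: "diff_times n f \<Longrightarrow> diff_times n g \<Longrightarrow> diff_times n (\<lambda>t. f t + g t)"
proof (induction n arbitrary: f g)
  case (Suc n)
  show ?case
    by (rule diff_times_SucI[where g' = "\<lambda>t. vderiv f t + vderiv g t"])
      (use Suc in \<open>auto intro!: has_vector_derivative_add vderiv_works\<close>)
qed simp

lemma diff_times_mult: "diff_times n f \<Longrightarrow> diff_times n g \<Longrightarrow> diff_times n (\<lambda>t. f t * g t)"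
proof (induction n arbitrary: f g)
  case (Suc n)
  have *: "diff_times n f" "diff_times n g" using Suc.prems diff_times_SucD by blast+
  show ?case
    by (rule diff_times_SucI[where g' = "\<lambda>t. f t * vderiv g t + vderiv f t * g t"])
      (use Suc * in \<open>auto intro!: has_vector_derivative_mult vderiv_works diff_times_add\<close>)
qed simp

lemma diff_times_uminus: "diff_times n f \<Longrightarrow> diff_times n (\<lambda>t. - f t)"
  using diff_times_mult[OF diff_times_const[of n "-1"]] by simp

lemma diff_times_cnj: "diff_times n f \<Longrightarrow> diff_times n (\<lambda>t. cnj (f t))"
proof (induction n arbitrary: f)
  case (Suc n)
  show ?case
    by (rule diff_times_SucI[where g' = "\<lambda>t. cnj (vderiv f t)"])
      (use Suc in \<open>auto intro!: has_vector_derivative_cnj vderiv_works\<close>)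
qed simp

lemma diff_times_inverse:
  "diff_times n f \<Longrightarrow> (\<And>t. f t \<noteq> 0) \<Longrightarrow> diff_times n (\<lambda>t. inverse (f t))"
proof (induction n)
  case (Suc n)
  have "diff_times n (\<lambda>t. inverse (f t))" using Suc diff_times_SucD by blast
  then have 1: "diff_times n (\<lambda>t. (-1) * (inverse (f t) * vderiv f t * inverse (f t)))"
    using Suc.prems(1) by (intro diff_times_mult diff_times_const) auto
  have 2: "((\<lambda>t. inverse (f t)) has_vector_derivative
      (-1) * (inverse (f t) * vderiv f t * inverse (f t))) (at t)" for t
  proof -
    have "(f has_vector_derivative vderiv f t) (at t)"
      using Suc.prems by (auto intro!: vderiv_works)
    then have "(f has_derivative (\<lambda>x. x *\<^sub>R vderiv f t)) (at t)"
      by (simp add: has_vector_derivative_def)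
    from Deriv.has_derivative_inverse[OF Suc.prems(2) this]
    show ?thesis by (simp add: has_vector_derivative_def)
  qed
  show ?case by (rule diff_times_SucI[OF 2 1])
qed simp

lemma diff_times_power: "diff_times n f \<Longrightarrow> diff_times n (\<lambda>t. f t ^ k)"
  by (induction k) (auto intro: diff_times_const diff_times_mult)

lemma diff_times_powi:
  assumes "diff_times n f" "\<And>t. f t \<noteq> 0"
  shows "diff_times n (\<lambda>t. f t powi k)"
proof (cases "k \<ge> 0")
  case True
  then show ?thesis using assms by (simp add: power_int_def diff_times_power)
next
  case False
  have "diff_times n (\<lambda>t. inverse (f t) ^ nat (- k))"
    by (intro diff_times_power diff_times_inverse assms)
  then show ?thesis using False by (simp add: power_int_def power_inverse)
qed

lemma diff_times_compose:
  assumes h: "\<And>t. (h has_real_derivative h' t) (at t)"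
    and "diff_times n (\<lambda>t. complex_of_real (h' t))"
  shows "diff_times n f \<Longrightarrow> diff_times n (\<lambda>t. f (h t))"
  using assms(2)
proof (induction n arbitrary: f)
  case (Suc n)
  have *: "diff_times n (\<lambda>t. complex_of_real (h' t))" using Suc.prems(2) diff_times_SucD by blast
  have "((\<lambda>t. f (h t)) has_vector_derivative complex_of_real (h' t) * vderiv f (h t)) (at t)" for t
  proof -
    have "(f has_vector_derivative vderiv f (h t)) (at (h t))"
      using Suc.prems by (auto intro!: vderiv_works)
    from vector_diff_chain_at[OF h[of t, THEN has_real_derivative_iff_has_vector_derivative[THEN iffD1]] this]
    show ?thesis by (simp add: o_def scaleR_conv_of_real)
  qed
  then show ?case
    by (rule diff_times_SucI) (use Suc * in \<open>auto intro!: diff_times_mult\<close>)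
qed simp

lemma diff_times_cis: "diff_times n (\<lambda>t. c * cis (s * t))"
proof (induction n arbitrary: c)
  case (Suc n)
  have "((\<lambda>t. c * cis (s * t)) has_vector_derivative (c * \<i> * of_real s) * cis (s * t)) (at t)" for t
  proof -
    have "((\<lambda>t. c * exp (\<i> * (of_real s * t))) has_field_derivative
        (c * \<i> * of_real s) * exp (\<i> * (of_real s * z))) (at z)" for z
      by (auto intro!: derivative_eq_intros)
    from has_vector_derivative_real_field[OF this, of t UNIV]
    show ?thesis by (simp add: cis_conv_exp)
  qed
  then show ?case by (rule diff_times_SucI) (rule Suc)
qed simp


section \<open>The space of smooth functions on the unit circle\<close>

text \<open>A function on the unit circle is encoded as a function on the complex plane which vanishes
  off the circle, so that equality of functions on the circle is equality in HOL.\<close>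

typedef smooth_circle =
  "{f :: complex \<Rightarrow> complex. (\<forall>z. cmod z \<noteq> 1 \<longrightarrow> f z = 0) \<and> smooth (\<lambda>t. f (cis t))}"
  morphisms apply_circle Abs_smooth_circle
  by (rule exI[of _ "\<lambda>z. 0"]) (auto simp: smooth_iff diff_times_const)

setup_lifting type_definition_smooth_circle

instantiation smooth_circle :: ab_group_add
begin

lift_definition zero_smooth_circle :: smooth_circle is "\<lambda>z. 0"
  by (auto simp: smooth_iff diff_times_const)

lift_definition plus_smooth_circle :: "smooth_circle \<Rightarrow> smooth_circle \<Rightarrow> smooth_circle"
  is "\<lambda>f g z. f z + g z"
  by (auto simp: smooth_iff diff_times_add)

lift_definition uminus_smooth_circle :: "smooth_circle \<Rightarrow> smooth_circle" is "\<lambda>f z. - f z"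
  by (simp add: smooth_iff diff_times_uminus)

definition minus_smooth_circle :: "smooth_circle \<Rightarrow> smooth_circle \<Rightarrow> smooth_circle" where
  "minus_smooth_circle f g = f + (- g)"

instance
proof
  fix f g h :: smooth_circle
  show "f + g + h = f + (g + h)" by transfer (simp add: add.assoc)
  show "f + g = g + f" by transfer (simp add: add.commute)
  show "0 + f = f" by transfer simp
  show "- f + f = 0" by transfer simp
  show "f - g = f + - g" by (simp add: minus_smooth_circle_def)
qed

end

lift_definition scale_circle :: "complex \<Rightarrow> smooth_circle \<Rightarrow> smooth_circle"
  is "\<lambda>c f z. c * f z"
  by (simp add: smooth_iff diff_times_mult[OF diff_times_const])

lift_definition cnj_circle :: "smooth_circle \<Rightarrow> smooth_circle" is "\<lambda>f z. cnj (f z)"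
  by (auto simp: smooth_iff diff_times_cnj)

lift_definition reflect_circle :: "smooth_circle \<Rightarrow> smooth_circle" is "\<lambda>f z. f (inverse z)"
proof -
  fix f :: "complex \<Rightarrow> complex"
  assume f: "(\<forall>z. cmod z \<noteq> 1 \<longrightarrow> f z = 0) \<and> smooth (\<lambda>t. f (cis t))"
  have "diff_times n (\<lambda>t. f (cis (- t)))" for n
    by (rule diff_times_compose[where h = uminus and h' = "\<lambda>t. -1"])
      (use f diff_times_const[of n "-1"] in \<open>auto simp: smooth_iff intro!: derivative_eq_intros\<close>)
  then show "(\<forall>z. cmod z \<noteq> 1 \<longrightarrow> f (inverse z) = 0) \<and> smooth (\<lambda>t. f (inverse (cis t)))"
    using f by (auto simp: smooth_iff norm_inverse)
qed

definition supp_circle :: "smooth_circle \<Rightarrow> complex set" where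
  "supp_circle f = closure {z. apply_circle f z \<noteq> 0}"

definition CN_norm :: "nat \<Rightarrow> smooth_circle \<Rightarrow> real" where
  "CN_norm N f = (\<Sum>j\<le>N. SUP t. cmod ((vderiv ^^ j) (\<lambda>s. apply_circle f (cis s)) t))"

text \<open>The suprema are finite by periodicity.\<close>

lemma vderiv_periodic:
  assumes "smooth g" "\<And>t. g (t + p) = g t"
  shows "vderiv g (t + p) = vderiv g t"
proof -
  have "\<forall>t. g differentiable (at t)"
    using assms(1) unfolding smooth_def by (metis funpow_0)
  from vderiv_works[OF this, of "t + p"]
  have "((\<lambda>t. g (t + p)) has_vector_derivative vderiv g (t + p)) (at t)"
    using vector_diff_chain_at[of "\<lambda>t. t + p" 1 t g "vderiv g (t + p)"]
      has_vector_derivative_add[OF has_vector_derivative_id[of "at t"] has_vector_derivative_const[of p]]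
    by (simp add: o_def)
  then show ?thesis
    unfolding assms(2) using vector_derivative_at unfolding vderiv_def by metis
qed

lemma bdd_above_CN:
  "bdd_above (range (\<lambda>t. cmod ((vderiv ^^ j) (\<lambda>s. apply_circle f (cis s)) t)))"
proof -
  define g where "g j = (vderiv ^^ j) (\<lambda>s. apply_circle f (cis s))" for j
  have f: "smooth (\<lambda>s. apply_circle f (cis s))" using apply_circle[of f] by auto
  have sm: "smooth (g j)" for j
    using f unfolding smooth_def g_def by (metis comp_apply funpow_add)
  have per: "g j (t + 2 * pi) = g j t" for j t
  proof (induction j arbitrary: t)
    case 0
    show ?case by (simp add: g_def flip: cis_mult)
  next
    case (Suc j)
    then show ?case using vderiv_periodic[OF sm] by (simp add: g_def)
  qed
  interpret periodic_fun_simple "g j" "2 * pi" by standard (rule per)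
  have "continuous_on {0..2 * pi} (g j)"
    using sm[of j] unfolding smooth_def
    by (metis continuous_at_imp_continuous_on differentiable_imp_continuous_within funpow_0)
  then have "bounded (g j ` {0..2 * pi})"
    by (intro compact_imp_bounded compact_continuous_image) auto
  then obtain B where B: "\<And>t. t \<in> {0..2 * pi} \<Longrightarrow> cmod (g j t) \<le> B"
    unfolding bounded_iff by (metis image_eqI)
  have "cmod (g j t) \<le> B" for t
  proof -
    define k where "k = \<lfloor>t / (2 * pi)\<rfloor>"
    have "of_int k \<le> t / (2 * pi)" "t / (2 * pi) \<le> of_int k + 1"
      unfolding k_def by linarith+
    then have "t - of_int k * (2 * pi) \<in> {0..2 * pi}"
      by (simp add: field_simps)
    from B[OF this] show ?thesis by (simp add: minus_of_int)
  qed
  then show ?thesis unfolding g_def by (auto simp: bdd_above_def)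
qed

instantiation smooth_circle :: topological_space
begin

definition open_smooth_circle :: "smooth_circle set \<Rightarrow> bool" where
  "open_smooth_circle = generate_topology {{g. CN_norm N (g - f) < e} | f N e. e > 0}"

instance
  by standard (simp_all add: open_smooth_circle_def generate_topology.UNIV generate_topology.Int
    generate_topology.UN)

end


section \<open>Moebius transformations\<close>

text \<open>An element of PSU(1,1) is encoded as its action on the closed unit disk, extended by the
  identity to the complex plane, so that the group operations are \<open>\<circ>\<close> and \<^const>\<open>inv\<close>.\<close>

definition mob :: "complex \<Rightarrow> complex \<Rightarrow> complex \<Rightarrow> complex" where
  "mob a b z = (if cmod z \<le> 1 then (a * z + b) / (cnj b * z + cnj a) else z)"

definition Mob :: "(complex \<Rightarrow> complex) set" where
  "Mob = {mob a b | a b. (cmod a)\<^sup>2 - (cmod b)\<^sup>2 = 1}"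

definition rot :: "real \<Rightarrow> complex \<Rightarrow> complex" where
  "rot \<theta> z = (if cmod z \<le> 1 then cis \<theta> * z else z)"

definition boost :: "real \<Rightarrow> complex \<Rightarrow> complex" where
  "boost t = mob (of_real (cosh (t / 2))) (- of_real (sinh (t / 2)))"

lemma rot_in_Mob: "rot \<theta> \<in> Mob"
proof -
  have "cis \<theta> = cis (\<theta> / 2) / cnj (cis (\<theta> / 2))"
    by (simp add: cis_cnj cis_divide)
  then have "rot \<theta> = mob (cis (\<theta> / 2)) 0"
    by (simp add: rot_def mob_def fun_eq_iff)
  then show ?thesis unfolding Mob_def by force
qed

lemma boost_in_Mob: "boost t \<in> Mob"
proof -
  have "(cmod (of_real (cosh (t / 2))))\<^sup>2 - (cmod (- of_real (sinh (t / 2))))\<^sup>2 = 1"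
    by (simp add: cosh_square_eq)
  then show ?thesis unfolding boost_def Mob_def by blast
qed

text \<open>The logarithmic derivative of \<open>\<gamma>\<close> along the circle, which does not depend on a branch of
  the logarithm.\<close>

definition X_mob :: "(complex \<Rightarrow> complex) \<Rightarrow> complex \<Rightarrow> complex" where
  "X_mob \<gamma> z = - \<i> * (vector_derivative (\<lambda>t. \<gamma> (z * cis t)) (at 0) / \<gamma> z)"

definition \<beta> :: "nat \<Rightarrow> (complex \<Rightarrow> complex) \<Rightarrow> smooth_circle \<Rightarrow> smooth_circle" where
  "\<beta> d \<gamma> f = Abs_smooth_circle
     (\<lambda>z. X_mob \<gamma> (inv \<gamma> z) powi (int d - 1) * apply_circle f (inv \<gamma> z))"


lemma mob_norm_identity:
  "(cmod (cnj b * z + cnj a))\<^sup>2 - (cmod (a * z + b))\<^sup>2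
    = ((cmod a)\<^sup>2 - (cmod b)\<^sup>2) * (1 - (cmod z)\<^sup>2)"
proof -
  have "complex_of_real ((cmod (cnj b * z + cnj a))\<^sup>2 - (cmod (a * z + b))\<^sup>2)
      = complex_of_real (((cmod a)\<^sup>2 - (cmod b)\<^sup>2) * (1 - (cmod z)\<^sup>2))"
    by (simp only: of_real_diff of_real_mult of_real_1 complex_norm_square)
      (simp add: algebra_simps)
  then show ?thesis by (simp only: of_real_eq_iff)
qed

lemma mob_denominator_nonzero:
  assumes "(cmod a)\<^sup>2 - (cmod b)\<^sup>2 = 1" "cmod z \<le> 1"
  shows "cnj b * z + cnj a \<noteq> 0"
proof
  assume "cnj b * z + cnj a = 0"
  then have "cmod (cnj a) = cmod (cnj b * z)"
    by (metis add_eq_0_iff norm_minus_cancel)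
  then have "cmod a \<le> cmod b"
    using assms(2) by (simp add: norm_mult mult_left_le)
  then have "(cmod a)\<^sup>2 \<le> (cmod b)\<^sup>2" by (intro power_mono) auto
  with assms(1) show False by simp
qed

lemma cmod_mob:
  assumes ab: "(cmod a)\<^sup>2 - (cmod b)\<^sup>2 = 1" and z: "cmod z \<le> 1"
  shows "cmod (mob a b z) \<le> 1" "cmod (mob a b z) = 1 \<longleftrightarrow> cmod z = 1"
proof -
  let ?N = "cmod (a * z + b)" and ?D = "cmod (cnj b * z + cnj a)"
  have D: "?D > 0" using mob_denominator_nonzero[OF ab z] by simp
  have id: "?D\<^sup>2 - ?N\<^sup>2 = 1 - (cmod z)\<^sup>2"
    using mob_norm_identity[of b z a] ab by simp
  have z2: "(cmod z)\<^sup>2 \<le> 1" using z by (simp add: power_le_one)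
  have m: "cmod (mob a b z) = ?N / ?D" using z by (simp add: mob_def norm_divide)
  have "?N\<^sup>2 \<le> ?D\<^sup>2" using id z2 by linarith
  then have "?N \<le> ?D" by (simp add: power2_le_iff_abs_le)
  then show "cmod (mob a b z) \<le> 1" using m D by simp
  have "cmod (mob a b z) = 1 \<longleftrightarrow> ?N = ?D" using m D by auto
  also have "\<dots> \<longleftrightarrow> ?N\<^sup>2 = ?D\<^sup>2" by (simp add: power2_eq_iff_nonneg)
  also have "\<dots> \<longleftrightarrow> (cmod z)\<^sup>2 = 1" using id by linarith
  also have "\<dots> \<longleftrightarrow> cmod z = 1" by (simp add: abs_square_eq_1)
  finally show "cmod (mob a b z) = 1 \<longleftrightarrow> cmod z = 1" .
qed

lemma mob_mob:
  assumes ab: "(cmod a)\<^sup>2 - (cmod b)\<^sup>2 = 1" and cd: "(cmod c)\<^sup>2 - (cmod d)\<^sup>2 = 1"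
  shows "mob a b (mob c d z) = mob (a * c + b * cnj d) (a * d + b * cnj c) z"
proof (cases "cmod z \<le> 1")
  case True
  define D where "D = cnj d * z + cnj c"
  define w where "w = mob c d z"
  have D: "D \<noteq> 0" unfolding D_def by (rule mob_denominator_nonzero[OF cd True])
  have wD: "w * D = c * z + d" using D True by (simp add: w_def mob_def D_def)
  have w: "cmod w \<le> 1" unfolding w_def by (rule cmod_mob[OF cd True])
  have "mob a b w = (a * w + b) / (cnj b * w + cnj a)" using w by (simp add: mob_def)
  also have "\<dots> = ((a * w + b) * D) / ((cnj b * w + cnj a) * D)" using D by simp
  also have "(a * w + b) * D = a * (w * D) + b * D" by (simp add: algebra_simps)
  also have "(cnj b * w + cnj a) * D = cnj b * (w * D) + cnj a * D" by (simp add: algebra_simps)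
  also have "(a * (w * D) + b * D) / (cnj b * (w * D) + cnj a * D)
      = mob (a * c + b * cnj d) (a * d + b * cnj c) z"
    unfolding wD using True by (simp add: mob_def D_def algebra_simps)
  finally show ?thesis by (simp add: w_def)
qed (simp add: mob_def)

lemma mob_id: "mob 1 0 = id"
  by (simp add: mob_def fun_eq_iff)

lemma mob_inverse:
  assumes "(cmod a)\<^sup>2 - (cmod b)\<^sup>2 = 1"
  shows "mob (cnj a) (- b) \<circ> mob a b = id" "mob a b \<circ> mob (cnj a) (- b) = id"
    "inv (mob a b) = mob (cnj a) (- b)"
proof -
  have ab: "a * cnj a - b * cnj b = 1"
    using arg_cong[OF assms, of complex_of_real]
    by (simp only: of_real_diff complex_norm_square of_real_1)
  have assms': "(cmod (cnj a))\<^sup>2 - (cmod (- b))\<^sup>2 = 1" using assms by simp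
  have *: "cnj a * a - b * cnj b = 1" "a * cnj a - b * cnj b = 1"
    using ab by (simp_all add: mult.commute)
  show 1: "mob (cnj a) (- b) \<circ> mob a b = id"
    using * mob_mob[OF assms' assms] by (simp add: fun_eq_iff mult.commute mob_id)
  show 2: "mob a b \<circ> mob (cnj a) (- b) = id"
    using * mob_mob[OF assms assms'] by (simp add: fun_eq_iff mult.commute mob_id)
  show "inv (mob a b) = mob (cnj a) (- b)"
    by (rule inv_unique_comp[OF 2 1])
qed

lemma id_in_Mob: "id \<in> Mob"
proof -
  have "(cmod 1)\<^sup>2 - (cmod 0)\<^sup>2 = 1" by simp
  then show ?thesis unfolding Mob_def mob_id[symmetric] by blast
qed

lemma comp_in_Mob:
  assumes "\<gamma> \<in> Mob" "\<delta> \<in> Mob"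
  shows "\<gamma> \<circ> \<delta> \<in> Mob"
proof -
  from assms obtain a b c d where ab: "(cmod a)\<^sup>2 - (cmod b)\<^sup>2 = 1" "\<gamma> = mob a b"
    and cd: "(cmod c)\<^sup>2 - (cmod d)\<^sup>2 = 1" "\<delta> = mob c d" by (auto simp: Mob_def)
  have "complex_of_real ((cmod (a * c + b * cnj d))\<^sup>2 - (cmod (a * d + b * cnj c))\<^sup>2)
      = complex_of_real (((cmod a)\<^sup>2 - (cmod b)\<^sup>2) * ((cmod c)\<^sup>2 - (cmod d)\<^sup>2))"
    by (simp only: of_real_diff of_real_mult complex_norm_square) (simp add: algebra_simps)
  then have 1: "(cmod (a * c + b * cnj d))\<^sup>2 - (cmod (a * d + b * cnj c))\<^sup>2 = 1"
    using ab cd by (simp only: of_real_eq_iff)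
  have 2: "\<gamma> \<circ> \<delta> = mob (a * c + b * cnj d) (a * d + b * cnj c)"
    using mob_mob[OF ab(1) cd(1)] ab cd by (simp add: fun_eq_iff)
  show ?thesis unfolding Mob_def using 1 2 by blast
qed

lemma inv_in_Mob:
  assumes "\<gamma> \<in> Mob"
  shows "bij \<gamma>" "inv \<gamma> \<in> Mob"
proof -
  from assms obtain a b where ab: "(cmod a)\<^sup>2 - (cmod b)\<^sup>2 = 1" "\<gamma> = mob a b"
    by (auto simp: Mob_def)
  have "(cmod (cnj a))\<^sup>2 - (cmod (- b))\<^sup>2 = 1" using ab by simp
  then show "inv \<gamma> \<in> Mob" unfolding ab(2) mob_inverse(3)[OF ab(1)] Mob_def by blast
  show "bij \<gamma>" using mob_inverse(1,2)[OF ab(1)] ab(2) o_bij by blast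
qed

lemma X_mob_eq:
  assumes ab: "(cmod a)\<^sup>2 - (cmod b)\<^sup>2 = 1" and z: "cmod z = 1"
  shows "X_mob (mob a b) z = inverse (of_real ((cmod (cnj b * z + cnj a))\<^sup>2))"
proof -
  define N where "N = a * z + b"
  define D where "D = cnj b * z + cnj a"
  have D: "D \<noteq> 0" unfolding D_def using mob_denominator_nonzero[OF ab] z by simp
  have zz: "z * cnj z = 1" using z complex_norm_square[of z] by simp
  have N: "N = z * cnj D" unfolding N_def D_def using zz by (simp add: algebra_simps)
  have ab': "a * cnj a - b * cnj b = 1"
    using arg_cong[OF ab, of complex_of_real]
    by (simp only: of_real_diff complex_norm_square of_real_1)
  have eq: "(\<lambda>t. mob a b (z * cis t))
      = (\<lambda>t. (a * (z * exp (\<i> * of_real t)) + b) / (cnj b * (z * exp (\<i> * of_real t)) + cnj a))"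
    using z by (simp add: mob_def norm_mult cis_conv_exp fun_eq_iff)
  have "((\<lambda>t. (a * (z * exp (\<i> * t)) + b) / (cnj b * (z * exp (\<i> * t)) + cnj a))
      has_field_derivative
      ((a * (z * \<i>)) * D - N * (cnj b * (z * \<i>))) / (D * D)) (at (of_real 0))"
    using D unfolding N_def D_def by (auto intro!: derivative_eq_intros)
  from has_vector_derivative_real_field[OF this]
  have "vector_derivative (\<lambda>t. mob a b (z * cis t)) (at 0)
      = ((a * (z * \<i>)) * D - N * (cnj b * (z * \<i>))) / (D * D)"
    unfolding eq by (intro vector_derivative_at) simp
  also have "(a * (z * \<i>)) * D - N * (cnj b * (z * \<i>)) = \<i> * z * (a * cnj a - b * cnj b)"
    unfolding N_def D_def by (simp add: algebra_simps)
  also have "\<dots> = \<i> * z" by (simp add: ab')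
  finally have "X_mob (mob a b) z = - \<i> * (\<i> * z / (D * D) / (N / D))"
    using z by (simp add: X_mob_def mob_def N_def D_def)
  also have "\<dots> = inverse (D * cnj D)"
    unfolding N using D z by (auto simp: divide_simps)
  finally show ?thesis by (simp only: complex_norm_square D_def)
qed

lemma mob_lift:
  assumes ab: "(cmod a)\<^sup>2 - (cmod b)\<^sup>2 = 1"
  obtains h h' where "\<And>t. mob a b (cis t) = cis (h t)" "\<And>t. (h has_real_derivative h' t) (at t)"
    "\<And>n. diff_times n (\<lambda>t. complex_of_real (h' t))"
proof
  define w where "w = (\<lambda>t. 1 + b / a * cis (- 1 * t))"
  define w' where "w' = (\<lambda>t. b / a * (- \<i>) * cis (- 1 * t))"
  define h where "h = (\<lambda>t. t + 2 * Arg a + 2 * Im (Ln (w t)))"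
  define h' where "h' = (\<lambda>t. 1 + 2 * Im (w' t * inverse (w t)))"
  have "(cmod b)\<^sup>2 < (cmod a)\<^sup>2" using ab by linarith
  then have "cmod b < cmod a" by (rule power2_less_imp_less) simp
  then have a0: "a \<noteq> 0" and q: "cmod (b / a) < 1"
    by (auto simp: norm_divide divide_simps)
  have Re_w: "Re (w t) > 0" for t
  proof -
    have "cmod (b / a * cis (- 1 * t)) < 1" using q by (simp add: norm_mult norm_divide)
    then have "\<bar>Re (b / a * cis (- 1 * t))\<bar> < 1"
      using abs_Re_le_cmod le_less_trans by blast
    moreover have "Re (w t) = 1 + Re (b / a * cis (- 1 * t))" unfolding w_def by simp
    ultimately show ?thesis by linarith
  qed
  have w0: "w t \<noteq> 0" for t using Re_w[of t] by auto
  have wn: "w t \<notin> \<real>\<^sub>\<le>\<^sub>0" for t using Re_w[of t] by (simp add: complex_nonpos_Reals_iff)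
  have w_deriv: "(w has_vector_derivative w' t) (at t)" for t
  proof -
    have "((\<lambda>t. 1 + c * exp (- \<i> * t)) has_field_derivative c * (- \<i>) * exp (- \<i> * z)) (at z)" for c z
      by (auto intro!: derivative_eq_intros)
    from has_vector_derivative_real_field[OF this, of "b / a" t UNIV]
    show ?thesis by (simp add: w_def w'_def cis_conv_exp)
  qed
  have polar: "v / cnj v = cis (2 * s)" if "v = of_real r * cis s" "r \<noteq> 0" for v r s
    using that by (simp add: cis_cnj cis_divide)
  show "mob a b (cis t) = cis (h t)" for t
  proof -
    have 1: "a * cis t + b = cis t * (a * w t)"
      using a0 by (simp add: w_def algebra_simps cis_mult)
    have 2: "cnj b * cis t + cnj a = cnj (a * w t)"
      using a0 by (simp add: w_def algebra_simps cis_cnj)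
    have A: "a / cnj a = cis (2 * Arg a)"
      by (rule polar[of _ "cmod a"]) (use a0 rcis_cmod_Arg[of a] in \<open>auto simp: rcis_def\<close>)
    have "w t = exp (Ln (w t))" using w0 by simp
    also have "\<dots> = of_real (exp (Re (Ln (w t)))) * cis (Im (Ln (w t)))"
      by (rule exp_eq_polar)
    finally have W: "w t / cnj (w t) = cis (2 * Im (Ln (w t)))"
      by (rule polar) simp
    have "mob a b (cis t) = cis t * (a / cnj a) * (w t / cnj (w t))"
      unfolding mob_def 1 2 by simp
    then show ?thesis unfolding A W h_def by (simp add: cis_mult)
  qed
  show "(h has_real_derivative h' t) (at t)" for t
  proof -
    have "(Ln \<circ> w has_vector_derivative w' t * inverse (w t)) (at t)"
      by (rule field_vector_diff_chain_at[OF w_deriv has_field_derivative_Ln[OF wn]])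
    from bounded_linear.has_vector_derivative[OF bounded_linear_Im this]
    have "((\<lambda>t. Im (Ln (w t))) has_real_derivative Im (w' t * inverse (w t))) (at t)"
      by (simp add: has_real_derivative_iff_has_vector_derivative)
    from DERIV_add[OF DERIV_add[OF DERIV_ident DERIV_const] DERIV_cmult[OF this, of 2]]
    show ?thesis unfolding h_def h'_def by simp
  qed
  show "diff_times n (\<lambda>t. complex_of_real (h' t))" for n
  proof -
    have w: "diff_times n w"
      unfolding w_def by (intro diff_times_add diff_times_const diff_times_cis)
    have q: "diff_times n (\<lambda>t. w' t * inverse (w t))"
      by (intro diff_times_mult diff_times_inverse w w0) (unfold w'_def, rule diff_times_cis)
    have "diff_times n
        (\<lambda>t. 1 + (- \<i>) * (w' t * inverse (w t) + - cnj (w' t * inverse (w t))))"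
      by (intro diff_times_add diff_times_mult[OF diff_times_const] diff_times_uminus
          diff_times_const q diff_times_cnj)
    moreover have "complex_of_real (1 + 2 * Im q) = 1 + (- \<i>) * (q + - cnj q)" for q
      by (simp add: complex_eq_iff)
    then have "complex_of_real (h' t)
        = 1 + (- \<i>) * (w' t * inverse (w t) + - cnj (w' t * inverse (w t)))" for t
      unfolding h'_def by blast
    ultimately show ?thesis by simp
  qed
qed

lemma apply_\<beta>:
  assumes "\<gamma> \<in> Mob"
  shows "apply_circle (\<beta> d \<gamma> f) z
    = X_mob \<gamma> (inv \<gamma> z) powi (int d - 1) * apply_circle f (inv \<gamma> z)"
proof -
  from assms obtain a b where ab: "(cmod a)\<^sup>2 - (cmod b)\<^sup>2 = 1" and \<gamma>: "\<gamma> = mob a b"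
    by (auto simp: Mob_def)
  have ab': "(cmod (cnj a))\<^sup>2 - (cmod (- b))\<^sup>2 = 1" using ab by simp
  have f: "cmod z \<noteq> 1 \<Longrightarrow> apply_circle f z = 0" "smooth (\<lambda>t. apply_circle f (cis t))" for z
    using apply_circle[of f] by auto
  let ?\<delta> = "mob (cnj a) (- b)"
  have inv: "inv \<gamma> = ?\<delta>" unfolding \<gamma> by (rule mob_inverse(3)[OF ab])
  have 1: "cmod (?\<delta> z) \<noteq> 1" if "cmod z \<noteq> 1" for z
    using cmod_mob(2)[OF ab'] that by (cases "cmod z \<le> 1") (auto simp: mob_def)
  obtain h h' where h: "\<And>t. ?\<delta> (cis t) = cis (h t)"
    and h': "\<And>t. (h has_real_derivative h' t) (at t)"
      "\<And>n. diff_times n (\<lambda>t. complex_of_real (h' t))"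
    using mob_lift[OF ab'] by blast
  have f': "diff_times n (\<lambda>t. apply_circle f (?\<delta> (cis t)))" for n
    unfolding h by (rule diff_times_compose[OF h'])
      (use f in \<open>auto simp: smooth_iff\<close>)
  define D where "D = (\<lambda>t. cnj b * cis (h t) + cnj a)"
  have D0: "D t \<noteq> 0" for t
    unfolding D_def by (rule mob_denominator_nonzero[OF ab]) simp
  have D: "diff_times n D" for n
    unfolding D_def
    by (intro diff_times_add diff_times_const diff_times_compose[OF h', where f = "\<lambda>s. cnj b * cis s"])
      (use diff_times_cis[of n "cnj b" 1] in simp)
  have X: "X_mob \<gamma> (?\<delta> (cis t)) = inverse (D t * cnj (D t))" for t
    unfolding \<gamma> h by (subst X_mob_eq[OF ab]) (simp, simp only: D_def complex_norm_square)
  have "diff_times n (\<lambda>t. X_mob \<gamma> (?\<delta> (cis t)) powi (int d - 1) * apply_circle f (?\<delta> (cis t)))" for n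
    unfolding X using D0
    by (intro diff_times_mult f' diff_times_powi diff_times_inverse D diff_times_cnj) auto
  then have "(\<lambda>z. X_mob \<gamma> (inv \<gamma> z) powi (int d - 1) * apply_circle f (inv \<gamma> z))
      \<in> {f. (\<forall>z. cmod z \<noteq> 1 \<longrightarrow> f z = 0) \<and> smooth (\<lambda>t. f (cis t))}"
    unfolding inv using 1 f(1) by (auto simp: smooth_iff)
  then show ?thesis unfolding \<beta>_def by (simp add: Abs_smooth_circle_inverse)
qed


section \<open>Operator-valued distributions on a complex vector space\<close>

text \<open>A complex vector space is a type \<open>'v\<close> with a scalar multiplication
  \<open>scaleV :: complex \<Rightarrow> 'v \<Rightarrow> 'v\<close> satisfying \<^term>\<open>vector_space scaleV\<close>.\<close>

type_synonym 'v opdist = "smooth_circle \<Rightarrow> 'v \<Rightarrow> 'v"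

definition operator_valued_distribution ::
    "(complex \<Rightarrow> 'v \<Rightarrow> 'v) \<Rightarrow> ('v::ab_group_add) opdist \<Rightarrow> bool" where
  "operator_valued_distribution scaleV \<phi> \<longleftrightarrow>
     (\<forall>f. Vector_Spaces.linear scaleV scaleV (\<phi> f)) \<and>
     (\<forall>f g \<Phi>. \<phi> (f + g) \<Phi> = \<phi> f \<Phi> + \<phi> g \<Phi>) \<and>
     (\<forall>c f \<Phi>. \<phi> (scale_circle c f) \<Phi> = scaleV c (\<phi> f \<Phi>))"

text \<open>The vector \<open>\<phi>\<^sub>1(f\<^sub>1) \<dots> \<phi>\<^sub>k(f\<^sub>k) \<Phi>\<close>, with indices starting at 0.\<close>

definition word :: "'v opdist list \<Rightarrow> (nat \<Rightarrow> smooth_circle) \<Rightarrow> 'v \<Rightarrow> 'v" where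
  "word \<phi>s f \<Phi> = foldr (\<lambda>j. (\<phi>s ! j) (f j)) [0..<length \<phi>s] \<Phi>"

definition circle_power_topology :: "nat \<Rightarrow> (nat \<Rightarrow> smooth_circle) topology" where
  "circle_power_topology k = product_topology (\<lambda>_. euclidean) {..<k}"

definition compatible_functional ::
    "(complex \<Rightarrow> 'v \<Rightarrow> 'v) \<Rightarrow> ('v::ab_group_add) opdist set \<Rightarrow> ('v \<Rightarrow> complex) \<Rightarrow> bool" where
  "compatible_functional scaleV F l \<longleftrightarrow>
     Vector_Spaces.linear scaleV (*) l \<and>
     (\<forall>\<phi>s \<Phi>. set \<phi>s \<subseteq> F \<longrightarrow>
        continuous_map (circle_power_topology (length \<phi>s)) euclidean (\<lambda>f. l (word \<phi>s f \<Phi>)))"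

definition acts_regularly ::
    "(complex \<Rightarrow> 'v \<Rightarrow> 'v) \<Rightarrow> ('v::ab_group_add) opdist set \<Rightarrow> bool" where
  "acts_regularly scaleV F \<longleftrightarrow>
     (\<forall>\<Phi> \<Psi>. \<Phi> \<noteq> \<Psi> \<longrightarrow> (\<exists>l. compatible_functional scaleV F l \<and> l \<Phi> \<noteq> l \<Psi>))"

text \<open>Locally convex topologies are not required to be Hausdorff. When \<open>F\<close> acts regularly, the
  strong topology below is Hausdorff anyway, since compatible functionals are continuous for it.\<close>

definition locally_convex_topology ::
    "(complex \<Rightarrow> 'v \<Rightarrow> 'v) \<Rightarrow> ('v::ab_group_add) topology \<Rightarrow> bool" where
  "locally_convex_topology scaleV T \<longleftrightarrow>
     topspace T = UNIV \<and>
     continuous_map (prod_topology T T) T (\<lambda>(x, y). x + y) \<and>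
     continuous_map (prod_topology euclidean T) T (\<lambda>(c, x). scaleV c x) \<and>
     (\<forall>W. openin T W \<and> 0 \<in> W \<longrightarrow> (\<exists>C. openin T C \<and> 0 \<in> C \<and> C \<subseteq> W \<and>
        (\<forall>x\<in>C. \<forall>y\<in>C. \<forall>t\<in>{0..1}. scaleV (of_real (1 - t)) x + scaleV (of_real t) y \<in> C)))"

definition words_continuous :: "'v opdist set \<Rightarrow> 'v topology \<Rightarrow> bool" where
  "words_continuous F T \<longleftrightarrow>
     (\<forall>\<phi>s \<Phi>. set \<phi>s \<subseteq> F \<longrightarrow>
        continuous_map (circle_power_topology (length \<phi>s)) T (\<lambda>f. word \<phi>s f \<Phi>))"

definition strong_topology ::
    "(complex \<Rightarrow> 'v \<Rightarrow> 'v) \<Rightarrow> ('v::ab_group_add) opdist set \<Rightarrow> 'v topology" where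
  "strong_topology scaleV F = topology_generated_by
     {W. \<exists>T. locally_convex_topology scaleV T \<and> words_continuous F T \<and> openin T W}"

lemma openin_strong_topology:
  assumes "locally_convex_topology scaleV T" "words_continuous F T" "openin T W"
  shows "openin (strong_topology scaleV F) W"
  unfolding strong_topology_def openin_topology_generated_by_iff
  using assms by (auto intro: generate_topology_on.Basis)

lemma locally_convex_indiscrete:
  fixes scaleV :: "complex \<Rightarrow> 'v \<Rightarrow> 'v::ab_group_add" and F :: "'v opdist set"
  assumes "vector_space scaleV"
  shows "locally_convex_topology scaleV (topology_generated_by {UNIV})"
    "words_continuous F (topology_generated_by {UNIV})"
proof -
  interpret vector_space scaleV by fact
  have *: "openin (topology_generated_by {UNIV}) W \<longleftrightarrow> W = {} \<or> W = UNIV" for W :: "'v set"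
  proof
    assume "openin (topology_generated_by {UNIV}) W"
    then have "generate_topology_on {UNIV} W" by (simp add: openin_topology_generated_by_iff)
    then show "W = {} \<or> W = UNIV" by induction auto
  qed (auto simp: openin_topology_generated_by_iff intro: generate_topology_on.intros)
  have cont: "continuous_map X (topology_generated_by {UNIV}) g" for X :: "'x topology" and g :: "'x \<Rightarrow> 'v"
    by (auto simp: continuous_map_def *)
  show "locally_convex_topology scaleV (topology_generated_by {UNIV})"
    unfolding locally_convex_topology_def
    by (intro conjI cont allI impI exI[of _ UNIV]) (auto simp: *)
  show "words_continuous F (topology_generated_by {UNIV})"
    unfolding words_continuous_def by (intro allI impI cont)
qed

lemma topspace_strong_topology:
  fixes scaleV :: "complex \<Rightarrow> 'v \<Rightarrow> 'v::ab_group_add"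
  assumes "vector_space scaleV"
  shows "topspace (strong_topology scaleV F) = UNIV"
proof -
  have "openin (topology_generated_by {UNIV}) UNIV"
    by (simp add: openin_topology_generated_by_iff generate_topology_on.Basis)
  from openin_strong_topology[OF locally_convex_indiscrete[OF assms] this]
  show ?thesis using openin_subset by blast
qed

lemma words_continuous_strong_topology:
  assumes "vector_space scaleV"
  shows "words_continuous F (strong_topology scaleV F)"
  unfolding words_continuous_def
proof (intro allI impI)
  fix \<phi>s \<Phi> assume "set \<phi>s \<subseteq> F"
  then show "continuous_map (circle_power_topology (length \<phi>s)) (strong_topology scaleV F) (\<lambda>f. word \<phi>s f \<Phi>)"
    using topspace_strong_topology[OF assms, of F] unfolding strong_topology_def
    by (intro continuous_on_generated_topo)
      (auto simp: words_continuous_def continuous_map_def vimage_def Int_def conj_commute)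
qed

lemma locally_convex_strong_topology:
  assumes "vector_space scaleV"
  shows "locally_convex_topology scaleV (strong_topology scaleV F)"
proof -
  let ?S = "strong_topology scaleV F"
  let ?B = "{W. \<exists>T. locally_convex_topology scaleV T \<and> words_continuous F T \<and> openin T W}"
  interpret vector_space scaleV by fact
  note top = topspace_strong_topology[OF assms, of F]
  have coarser: "continuous_map ?S T id"
    if "locally_convex_topology scaleV T" "words_continuous F T" for T
    using that openin_strong_topology[OF that] top
    by (auto simp: continuous_map_def locally_convex_topology_def)
  have into: "continuous_map X ?S g"
    if cont: "\<And>T. locally_convex_topology scaleV T \<Longrightarrow> words_continuous F T \<Longrightarrow> continuous_map X T g"
    for X :: "'x topology" and g
  proof -
    have "openin X (g -` W \<inter> topspace X)" if W: "W \<in> ?B" for W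
    proof -
      from W obtain T where T: "locally_convex_topology scaleV T" "words_continuous F T" "openin T W"
        by blast
      have "g -` W \<inter> topspace X = {x \<in> topspace X. g x \<in> W}" by auto
      then show ?thesis
        using openin_continuous_map_preimage[OF cont[OF T(1,2)] T(3)] by simp
    qed
    moreover have "g ` topspace X \<subseteq> \<Union> ?B"
      using top unfolding strong_topology_def topology_generated_by_topspace by simp
    ultimately show ?thesis
      unfolding strong_topology_def by (rule continuous_on_generated_topo)
  qed
  show ?thesis
    unfolding locally_convex_topology_def
  proof (intro conjI)
    show "continuous_map (prod_topology ?S ?S) ?S (\<lambda>(x, y). x + y)"
    proof (rule into)
      fix T assume T: "locally_convex_topology scaleV T" "words_continuous F T"
      have "continuous_map (prod_topology ?S ?S) (prod_topology T T) (\<lambda>(x, y). (id x, id y))"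
        by (intro continuous_map_prod_top[THEN iffD2] disjI2 conjI coarser T)
      from continuous_map_compose[OF this, of T "\<lambda>(x, y). x + y"] T(1)
      show "continuous_map (prod_topology ?S ?S) T (\<lambda>(x, y). x + y)"
        by (simp add: locally_convex_topology_def o_def case_prod_unfold)
    qed
    show "continuous_map (prod_topology euclidean ?S) ?S (\<lambda>(c, x). scaleV c x)"
    proof (rule into)
      fix T assume T: "locally_convex_topology scaleV T" "words_continuous F T"
      have "continuous_map (prod_topology euclidean ?S) (prod_topology euclidean T)
          (\<lambda>(c, x). (id c, id x))"
        by (intro continuous_map_prod_top[THEN iffD2] disjI2 conjI coarser T continuous_map_id)
      from continuous_map_compose[OF this, of T "\<lambda>(c, x). scaleV c x"] T(1)
      show "continuous_map (prod_topology euclidean ?S) T (\<lambda>(c, x). scaleV c x)"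
        by (simp add: locally_convex_topology_def o_def case_prod_unfold)
    qed
    let ?cvx = "\<lambda>C. \<forall>x\<in>C. \<forall>y\<in>C. \<forall>t\<in>{0..1}. scaleV (of_real (1 - t)) x + scaleV (of_real t) y \<in> C"
    have "0 \<in> W \<longrightarrow> (\<exists>C. openin ?S C \<and> 0 \<in> C \<and> C \<subseteq> W \<and> ?cvx C)"
      if "generate_topology_on ?B W" for W
      using that
    proof induction
      case Empty
      then show ?case by simp
    next
      case (Int a b)
      show ?case
      proof
        assume "0 \<in> a \<inter> b"
        with Int obtain C D where "openin ?S C \<and> 0 \<in> C \<and> C \<subseteq> a \<and> ?cvx C"
          "openin ?S D \<and> 0 \<in> D \<and> D \<subseteq> b \<and> ?cvx D" by auto
        then show "\<exists>C. openin ?S C \<and> 0 \<in> C \<and> C \<subseteq> a \<inter> b \<and> ?cvx C"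
          by (intro exI[of _ "C \<inter> D"]) (auto intro: openin_Int)
      qed
    next
      case (UN K)
      show ?case
      proof
        assume "0 \<in> \<Union> K"
        then obtain k where "k \<in> K" "0 \<in> k" by blast
        with UN obtain C where "openin ?S C \<and> 0 \<in> C \<and> C \<subseteq> k \<and> ?cvx C" by meson
        with \<open>k \<in> K\<close> show "\<exists>C. openin ?S C \<and> 0 \<in> C \<and> C \<subseteq> \<Union> K \<and> ?cvx C" by blast
      qed
    next
      case (Basis s)
      then obtain T where T: "locally_convex_topology scaleV T" "words_continuous F T" "openin T s"
        by blast
      show ?case
      proof
        assume "0 \<in> s"
        with T obtain C where "openin T C \<and> 0 \<in> C \<and> C \<subseteq> s \<and> ?cvx C"
          unfolding locally_convex_topology_def by meson
        with openin_strong_topology[OF T(1,2)]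
        show "\<exists>C. openin ?S C \<and> 0 \<in> C \<and> C \<subseteq> s \<and> ?cvx C" by blast
      qed
    qed
    then show "\<forall>W. openin ?S W \<and> 0 \<in> W \<longrightarrow> (\<exists>C. openin ?S C \<and> 0 \<in> C \<and> C \<subseteq> W \<and> ?cvx C)"
      by (simp add: strong_topology_def openin_topology_generated_by_iff)
  qed (rule top)
qed

definition End_op :: "(complex \<Rightarrow> 'v \<Rightarrow> 'v) \<Rightarrow> ('v::ab_group_add) opdist set \<Rightarrow> ('v \<Rightarrow> 'v) set" where
  "End_op scaleV F = {x. Vector_Spaces.linear scaleV scaleV x \<and>
     continuous_map (strong_topology scaleV F) (strong_topology scaleV F) x}"

inductive_set local_alg ::
    "(complex \<Rightarrow> 'v \<Rightarrow> 'v) \<Rightarrow> ('v::ab_group_add) opdist set \<Rightarrow> complex set \<Rightarrow> ('v \<Rightarrow> 'v) set"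
  for scaleV :: "complex \<Rightarrow> 'v \<Rightarrow> 'v" and F :: "'v opdist set" and I :: "complex set" where
  id: "id \<in> local_alg scaleV F I"
| field: "\<phi> \<in> F \<Longrightarrow> supp_circle f \<subseteq> I \<Longrightarrow> \<phi> f \<in> local_alg scaleV F I"
| comp: "x \<in> local_alg scaleV F I \<Longrightarrow> y \<in> local_alg scaleV F I \<Longrightarrow> x \<circ> y \<in> local_alg scaleV F I"
| add: "x \<in> local_alg scaleV F I \<Longrightarrow> y \<in> local_alg scaleV F I \<Longrightarrow>
    (\<lambda>\<Phi>. x \<Phi> + y \<Phi>) \<in> local_alg scaleV F I"
| smult: "x \<in> local_alg scaleV F I \<Longrightarrow> (\<lambda>\<Phi>. scaleV c (x \<Phi>)) \<in> local_alg scaleV F I"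

definition I_plus :: "complex set" where
  "I_plus = {z. cmod z = 1 \<and> Im z > 0}"

definition I_minus :: "complex set" where
  "I_minus = {z. cmod z = 1 \<and> Im z < 0}"


section \<open>Wightman conformal field theories\<close>

locale wightman_cft =
  fixes scaleV :: "complex \<Rightarrow> 'v \<Rightarrow> ('v::ab_group_add)"
    and F :: "'v opdist set"
    and d :: "'v opdist \<Rightarrow> nat"
    and U :: "(complex \<Rightarrow> complex) \<Rightarrow> 'v \<Rightarrow> 'v"
    and \<Omega> :: 'v
  assumes vector_space: "vector_space scaleV"
    and distributions: "\<And>\<phi>. \<phi> \<in> F \<Longrightarrow> operator_valued_distribution scaleV \<phi>"
    and regular: "acts_regularly scaleV F"
    and U_End: "\<And>\<gamma>. \<gamma> \<in> Mob \<Longrightarrow> U \<gamma> \<in> End_op scaleV F"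
    and U_id: "U id = id"
    and U_comp: "\<And>\<gamma> \<delta>. \<gamma> \<in> Mob \<Longrightarrow> \<delta> \<in> Mob \<Longrightarrow> U (\<gamma> \<circ> \<delta>) = U \<gamma> \<circ> U \<delta>"
    and vacuum_nonzero: "\<Omega> \<noteq> 0"
    and covariance: "\<And>\<phi> \<gamma> f. \<phi> \<in> F \<Longrightarrow> \<gamma> \<in> Mob \<Longrightarrow>
      U \<gamma> \<circ> \<phi> f \<circ> inv (U \<gamma>) = \<phi> (\<beta> (d \<phi>) \<gamma> f)"
    and locality: "\<And>\<phi>1 \<phi>2 f g. \<phi>1 \<in> F \<Longrightarrow> \<phi>2 \<in> F \<Longrightarrow> supp_circle f \<inter> supp_circle g = {} \<Longrightarrow>
      \<phi>1 f \<circ> \<phi>2 g = \<phi>2 g \<circ> \<phi>1 f"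
    and spectrum: "\<And>(n::int) \<Phi>. n < 0 \<Longrightarrow>
      (\<forall>\<theta>. U (rot \<theta>) \<Phi> = scaleV (cis (of_int n * \<theta>)) \<Phi>) \<Longrightarrow> \<Phi> = 0"
    and vacuum_invariant: "\<And>\<gamma>. \<gamma> \<in> Mob \<Longrightarrow> U \<gamma> \<Omega> = \<Omega>"
    and vacuum_cyclic: "module.span scaleV {word \<phi>s f \<Omega> | \<phi>s f. set \<phi>s \<subseteq> F} = UNIV"

definition dagger ::
    "(complex \<Rightarrow> 'v \<Rightarrow> 'v) \<Rightarrow> ('v opdist \<Rightarrow> nat) \<Rightarrow> ('v \<Rightarrow> 'v) \<Rightarrow> 'v opdist \<Rightarrow> 'v opdist" where
  "dagger scaleV d \<Theta> \<phi> =
     (\<lambda>f \<Phi>. scaleV ((-1) ^ d \<phi>) (\<Theta> (\<phi> (reflect_circle (cnj_circle f)) (\<Theta> \<Phi>))))"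

locale involutive_wightman_cft = wightman_cft scaleV F d U \<Omega>
  for scaleV :: "complex \<Rightarrow> 'v \<Rightarrow> ('v::ab_group_add)" and F d U \<Omega> +
  fixes form :: "'v \<Rightarrow> 'v \<Rightarrow> complex"
    and \<Theta> :: "'v \<Rightarrow> 'v"
  assumes form_linear: "\<And>\<Psi>. Vector_Spaces.linear scaleV (*) (\<lambda>\<Phi>. form \<Phi> \<Psi>)"
    and form_hermitian: "\<And>\<Phi> \<Psi>. form \<Psi> \<Phi> = cnj (form \<Phi> \<Psi>)"
    and form_nondegenerate: "\<And>\<Phi>. (\<forall>\<Psi>. form \<Phi> \<Psi> = 0) \<Longrightarrow> \<Phi> = 0"
    and form_continuous: "continuous_map (prod_topology (strong_topology scaleV F) (strong_topology scaleV F))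
      euclidean (\<lambda>(\<Phi>, \<Psi>). form \<Phi> \<Psi>)"
    and PCT_add: "\<And>\<Phi> \<Psi>. \<Theta> (\<Phi> + \<Psi>) = \<Theta> \<Phi> + \<Theta> \<Psi>"
    and PCT_scale: "\<And>c \<Phi>. \<Theta> (scaleV c \<Phi>) = scaleV (cnj c) (\<Theta> \<Phi>)"
    and PCT_involution: "\<And>\<Phi>. \<Theta> (\<Theta> \<Phi>) = \<Phi>"
    and PCT_antiunitary: "\<And>\<Phi> \<Psi>. form (\<Theta> \<Phi>) (\<Theta> \<Psi>) = cnj (form \<Phi> \<Psi>)"
    and PCT_vacuum: "\<Theta> \<Omega> = \<Omega>"
    and dagger_closed: "\<And>\<phi>. \<phi> \<in> F \<Longrightarrow>
      (\<lambda>f \<Phi>. scaleV ((-1) ^ d \<phi>) (dagger scaleV d \<Theta> \<phi> f \<Phi>)) \<in> F"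
    and form_invariant: "\<And>\<phi> f \<Phi> \<Psi>. \<phi> \<in> F \<Longrightarrow>
      form (\<phi> f \<Phi>) \<Psi> = form \<Phi> (dagger scaleV d \<Theta> \<phi> (cnj_circle f) \<Psi>)"
    and form_Mob_invariant: "\<And>\<gamma> \<Phi> \<Psi>. \<gamma> \<in> Mob \<Longrightarrow> form (U \<gamma> \<Phi>) (U \<gamma> \<Psi>) = form \<Phi> \<Psi>"

text \<open>\<open>adjoint_op scaleV F form x\<close> is meaningful only if \<open>x\<close> has an adjoint in
  \<^const>\<open>End_op\<close>; the adjoint is then unique, because the form is nondegenerate.\<close>

definition adjoint_op ::
    "(complex \<Rightarrow> 'v \<Rightarrow> 'v) \<Rightarrow> ('v::ab_group_add) opdist set \<Rightarrow> ('v \<Rightarrow> 'v \<Rightarrow> complex) \<Rightarrow>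
     ('v \<Rightarrow> 'v) \<Rightarrow> 'v \<Rightarrow> 'v" where
  "adjoint_op scaleV F form x =
     (THE y. y \<in> End_op scaleV F \<and> (\<forall>\<Phi> \<Psi>. form (x \<Phi>) \<Psi> = form \<Phi> (y \<Psi>)))"

definition strip :: "complex \<Rightarrow> complex set" where
  "strip \<tau> = {z. min 0 (Im \<tau>) \<le> Im z \<and> Im z \<le> max 0 (Im \<tau>)}"

definition boost_graph ::
    "((complex \<Rightarrow> complex) \<Rightarrow> 'v \<Rightarrow> 'v) \<Rightarrow> ('v \<Rightarrow> 'v \<Rightarrow> complex) \<Rightarrow> complex \<Rightarrow> 'v \<Rightarrow> 'v \<Rightarrow> bool" where
  "boost_graph U form \<tau> \<Phi> \<Psi> \<longleftrightarrow>
     (\<forall>\<Phi>'. \<exists>G. continuous_on (strip \<tau>) G \<and> G holomorphic_on interior (strip \<tau>) \<and>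
        (\<forall>t::real. G (of_real t) = form (U (boost t) \<Phi>) \<Phi>' \<and>
                   G (\<tau> + of_real t) = form (U (boost t) \<Psi>) \<Phi>'))"

definition boost_dom ::
    "((complex \<Rightarrow> complex) \<Rightarrow> 'v \<Rightarrow> 'v) \<Rightarrow> ('v \<Rightarrow> 'v \<Rightarrow> complex) \<Rightarrow> complex \<Rightarrow> 'v set" where
  "boost_dom U form \<tau> = {\<Phi>. \<exists>\<Psi>. boost_graph U form \<tau> \<Phi> \<Psi>}"

definition boost_op ::
    "((complex \<Rightarrow> complex) \<Rightarrow> 'v \<Rightarrow> 'v) \<Rightarrow> ('v \<Rightarrow> 'v \<Rightarrow> complex) \<Rightarrow> complex \<Rightarrow> 'v \<Rightarrow> 'v" where
  "boost_op U form \<tau> \<Phi> = (THE \<Psi>. boost_graph U form \<tau> \<Phi> \<Psi>)"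

end

theory Submission
  imports Defs "HOL-Probability.Distributions" "HOL-Real_Asymp.Real_Asymp"
begin

text \<open>
  In the coordinate \<open>u = ln tan (\<theta>/2)\<close> on the upper half circle the boosts are translations. Let \<open>q\<close> be
  entire and decay faster than every power of \<open>1 / cosh\<close> in horizontal strips, and let \<open>f\<close> be the
  test function \<open>(sin \<theta>) ^ (d - 1) * q u\<close>. Then its boost by \<open>t\<close> corresponds to \<open>q (u - t)\<close>, which
  is an entire function of \<open>t\<close> with values in the test functions supported in the closed upper half
  circle. Hence a vector \<open>\<phi>\<^sub>1(f\<^sub>1) \<dots> \<phi>\<^sub>k(f\<^sub>k) \<Omega>\<close> with such \<open>f\<^sub>j\<close> is an entire vector for the boosts,
  and its continuation to \<open>t = \<i> \<pi>\<close> is \<open>\<phi>\<^sub>1(g\<^sub>1) \<dots> \<phi>\<^sub>k(g\<^sub>k) \<Omega>\<close> with \<open>g\<^sub>j\<close> given by \<open>q\<^sub>j (u - \<i> \<pi>)\<close>.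

  For one field, \<open>g - (-1)\<^sup>d f(1/z)\<close> is the boundary value of \<open>z\<^sup>1\<^sup>-\<^sup>d A(z)\<close> with \<open>A\<close> holomorphic in the disc,
  and the modes \<open>\<phi>(z\<^sup>n)\<close> with \<open>n > -d\<close> annihilate the vacuum (by the spectrum condition for \<open>n > 0\<close>, and
  by Moebius covariance for the remaining ones). Hence \<open>\<phi>(g) \<Omega> = (-1)\<^sup>d \<phi>(f(1/z)) \<Omega>\<close>. For several fields
  one applies this to the last field and moves it to the front by locality, which reverses the order of
  the fields one after the other; the result is the PCT operator applied to the adjoint.

  For arbitrary \<open>f\<^sub>j\<close> supported in the open upper half circle, convolving with Gaussians in the
  coordinate \<open>u\<close> gives approximations of the above kind. Multiplied by \<open>exp (- t\<^sup>2)\<close>, the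
  corresponding matrix elements converge uniformly on the boundary of the strip, hence on the strip by
  the maximum principle. The lower half circle is reduced to the upper one by the rotation by \<open>\<pi>\<close>.
\<close>

section \<open>Smooth functions on the circle\<close>

text \<open>The power \<open>sin \<theta> ^ (d - 1)\<close> is there because it cancels the factor
  \<open>X_mob powi (d - 1)\<close> of the covariance law, so that boosts become pure translations
  in every dimension. Translates of compactly supported functions have no analytic continuation,
  while functions entire in \<open>u\<close> have supports reaching the fixed points 1 and -1 of the
  boosts. Both defects must be repaired: locality, which asks for disjoint closed supports, is
  reached by dilating the angle about \<pi>/2, and compact supports are recovered by quantitative
  approximation.

  The form need not be definite, so no Hilbert space norm keeps boosted vectors bounded. What is
  available is joint continuity: a matrix element of a product of fields is bounded by a product of
  \<open>CN_norm\<close>s, and these grow under the boost by \<open>t\<close> like a power of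
  \<open>cosh t\<close>. Hence the weights \<open>cosh ^ M\<close> in all estimates, and the
  Gaussian factor before the maximum principle. Vector identities are tested on compatible
  functionals, which separate points and include the matrix elements of the form. Since
  \<open>boost_op\<close> is a definite description, uniqueness of the continuation is proved as
  well.\<close>

definition smooth_family :: "(nat \<Rightarrow> real \<Rightarrow> complex) \<Rightarrow> bool" where
  "smooth_family f \<longleftrightarrow> (\<forall>j t. (f j has_vector_derivative f (Suc j) t) (at t))"

definition cderiv :: "smooth_circle \<Rightarrow> nat \<Rightarrow> real \<Rightarrow> complex" where
  "cderiv f j = (vderiv ^^ j) (\<lambda>s. apply_circle f (cis s))"

definition circ :: "(complex \<Rightarrow> complex) \<Rightarrow> smooth_circle" where
  "circ h = Abs_smooth_circle (\<lambda>z. if cmod z = 1 then h z else 0)"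

lemma smooth_family_vderiv:
  assumes "smooth_family f" shows "(vderiv ^^ j) (f 0) = f j"
proof (induction j)
  case (Suc j)
  have "vderiv (f j) = f (Suc j)"
    by (rule vderivI) (use assms in \<open>auto simp: smooth_family_def\<close>)
  with Suc show ?case by simp
qed simp

lemma smooth_family_smooth:
  assumes "smooth_family f" shows "smooth (f 0)"
  unfolding smooth_def smooth_family_vderiv[OF assms]
  using assms by (auto simp: smooth_family_def intro: differentiableI_vector)

lemma smooth_family_of_smooth:
  assumes "smooth g" shows "smooth_family (\<lambda>j. (vderiv ^^ j) g)"
  unfolding smooth_family_def using assms unfolding smooth_def
  by (auto intro: vderiv_works)

lemma smooth_family_cderiv: "smooth_family (cderiv f)"
  unfolding cderiv_def by (rule smooth_family_of_smooth) (use apply_circle[of f] in auto)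

lemma smooth_familyD: "smooth_family f \<Longrightarrow> (f j has_vector_derivative f (Suc j) t) (at t)"
  by (auto simp: smooth_family_def)

lemma smooth_family_continuous: "smooth_family f \<Longrightarrow> continuous_on S (f j)"
  by (meson smooth_familyD has_vector_derivative_continuous continuous_at_imp_continuous_on)

lemma cderiv_0: "cderiv f 0 t = apply_circle f (cis t)"
  by (simp add: cderiv_def)

text \<open>Explicit derivative formulas are all obtained this way: a whole sequence of candidates
  is given at once and each is checked against the next, so that iterated \<open>vderiv\<close> is
  never computed directly.\<close>

lemma cderiv_eqI:
  assumes "smooth_family g" "\<And>t. apply_circle f (cis t) = g 0 t"
  shows "cderiv f = g"
  unfolding cderiv_def assms(2) using smooth_family_vderiv[OF assms(1)] by (auto simp: fun_eq_iff)

lemma circle_eqI: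
  assumes "\<And>t. apply_circle f (cis t) = apply_circle g (cis t)"
  shows "f = g"
proof -
  have "apply_circle f z = apply_circle g z" for z
  proof (cases "cmod z = 1")
    case True
    then have "z = cis (Arg z)" using rcis_cmod_Arg[of z] by (simp add: rcis_def)
    then show ?thesis using assms by metis
  next
    case False
    then show ?thesis using apply_circle[of f] apply_circle[of g] by auto
  qed
  then show ?thesis by (metis apply_circle_inject ext)
qed

text \<open>\<open>circ\<close> applies the abstraction function without a proof of smoothness; a
  smooth family for the pullback along \<open>cis\<close> supplies this proof and makes the values
  available.\<close>

lemma apply_circ:
  assumes "smooth_family f" "\<And>t. h (cis t) = f 0 t"
  shows "apply_circle (circ h) z = (if cmod z = 1 then h z else 0)"
proof -
  have "(\<lambda>z. if cmod z = 1 then h z else 0) \<in> {f. (\<forall>z. cmod z \<noteq> 1 \<longrightarrow> f z = 0) \<and> smooth (\<lambda>t. f (cis t))}"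
    using assms smooth_family_smooth[OF assms(1)] by auto
  then show ?thesis unfolding circ_def by (simp add: Abs_smooth_circle_inverse)
qed

lemma cderiv_circ:
  assumes "smooth_family f" "\<And>t. h (cis t) = f 0 t"
  shows "cderiv (circ h) = f"
  by (rule cderiv_eqI[OF assms(1)]) (simp add: apply_circ[OF assms] assms(2))

lemma apply_circle_simps [simp]:
  "apply_circle (f + g) z = apply_circle f z + apply_circle g z"
  "apply_circle (f - g) z = apply_circle f z - apply_circle g z"
  "apply_circle (- f) z = - apply_circle f z"
  "apply_circle 0 z = 0"
  "apply_circle (scale_circle c f) z = c * apply_circle f z"
  "apply_circle (reflect_circle f) z = apply_circle f (inverse z)"
  "apply_circle (cnj_circle f) z = cnj (apply_circle f z)"
  by (simp_all add: plus_smooth_circle.rep_eq minus_smooth_circle_def uminus_smooth_circle.rep_eq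
      zero_smooth_circle.rep_eq scale_circle.rep_eq reflect_circle.rep_eq cnj_circle.rep_eq
      del: add_uminus_conv_diff)

lemma cderiv_add: "cderiv (f + g) j t = cderiv f j t + cderiv g j t"
proof -
  have "cderiv (f + g) = (\<lambda>j t. cderiv f j t + cderiv g j t)"
    by (rule cderiv_eqI)
      (auto simp: smooth_family_def cderiv_0 intro!: has_vector_derivative_add smooth_familyD[OF smooth_family_cderiv])
  then show ?thesis by simp
qed

lemma cderiv_scale: "cderiv (scale_circle c f) j t = c * cderiv f j t"
proof -
  have "cderiv (scale_circle c f) = (\<lambda>j t. c * cderiv f j t)"
    by (rule cderiv_eqI)
      (auto simp: smooth_family_def cderiv_0 intro!: has_vector_derivative_mult_right smooth_familyD[OF smooth_family_cderiv])
  then show ?thesis by simp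
qed

lemma scale_circle_minus1: "- f = scale_circle (-1) f"
  by (rule circle_eqI) simp

lemma cderiv_diff: "cderiv (f - g) j t = cderiv f j t - cderiv g j t"
  unfolding diff_conv_add_uminus scale_circle_minus1 cderiv_add cderiv_scale by simp

section \<open>Calculus of the norms \<open>CN_norm\<close> and the topology they define\<close>

lemma CN_norm_alt: "CN_norm N f = (\<Sum>j\<le>N. SUP t. cmod (cderiv f j t))"
  by (simp add: CN_norm_def cderiv_def)

lemma cderiv_le_SUP: "cmod (cderiv f j t) \<le> (SUP t. cmod (cderiv f j t))"
  using bdd_above_CN[of j f] unfolding cderiv_def[symmetric] by (intro cSUP_upper) auto

lemma SUP_cderiv_nonneg: "0 \<le> (SUP t. cmod (cderiv f j t))"
  using cderiv_le_SUP[of f j 0] norm_ge_zero order_trans by blast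

lemma CN_norm_nonneg: "0 \<le> CN_norm N f"
  unfolding CN_norm_alt by (intro sum_nonneg SUP_cderiv_nonneg)

lemma cderiv_le_CN_norm: "j \<le> N \<Longrightarrow> cmod (cderiv f j t) \<le> CN_norm N f"
  unfolding CN_norm_alt
  by (rule order_trans[OF cderiv_le_SUP], rule member_le_sum) (auto intro: SUP_cderiv_nonneg)

lemma CN_norm_le:
  assumes "\<And>j t. j \<le> N \<Longrightarrow> cmod (cderiv f j t) \<le> e"
  shows "CN_norm N f \<le> (real N + 1) * e"
proof -
  have "CN_norm N f \<le> (\<Sum>j\<le>N. e)"
    unfolding CN_norm_alt by (intro sum_mono cSUP_least) (auto intro: assms)
  then show ?thesis by (simp add: algebra_simps)
qed

lemma CN_norm_triangle: "CN_norm N (f + g) \<le> CN_norm N f + CN_norm N g"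
proof -
  have "(SUP t. cmod (cderiv (f + g) j t)) \<le> (SUP t. cmod (cderiv f j t)) + (SUP t. cmod (cderiv g j t))" for j
    unfolding cderiv_add
    by (intro cSUP_least) (auto intro!: order_trans[OF norm_triangle_ineq] add_mono cderiv_le_SUP)
  then show ?thesis unfolding CN_norm_alt by (simp add: sum_mono flip: sum.distrib)
qed

lemma CN_norm_scale_le: "CN_norm N (scale_circle c f) \<le> cmod c * CN_norm N f"
proof -
  have "(SUP t. cmod (cderiv (scale_circle c f) j t)) \<le> cmod c * (SUP t. cmod (cderiv f j t))" for j
    unfolding cderiv_scale norm_mult by (intro cSUP_least mult_left_mono cderiv_le_SUP) auto
  then show ?thesis unfolding CN_norm_alt by (simp add: sum_mono sum_distrib_left)
qed

lemma CN_norm_mono: "M \<le> N \<Longrightarrow> CN_norm M f \<le> CN_norm N f"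
  unfolding CN_norm_alt by (intro sum_mono2) (auto intro: SUP_cderiv_nonneg)

lemma CN_norm_zero_iff: "CN_norm N f = 0 \<longleftrightarrow> f = 0"
proof
  assume "CN_norm N f = 0"
  then have "cmod (cderiv f 0 t) \<le> 0" for t using cderiv_le_CN_norm[of 0 N f t] by simp
  then show "f = 0" by (intro circle_eqI) (simp add: cderiv_0)
next
  assume "f = 0"
  then have f: "f = scale_circle 0 0" by (intro circle_eqI) simp
  show "CN_norm N f = 0" using CN_norm_scale_le[of N 0 0] CN_norm_nonneg[of N f] unfolding f by simp
qed

text \<open>The norms increase with \<open>N\<close>, so an intersection of two balls of different
  orders still contains a ball around each of its points: take the larger order and the smaller
  radius.\<close>

lemma open_contains_CN_ball:
  fixes W :: "smooth_circle set"
  assumes "open W" "f \<in> W"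
  obtains N e where "e > 0" "\<And>g. CN_norm N (g - f) < e \<Longrightarrow> g \<in> W"
proof -
  have "generate_topology {{g. CN_norm N (g - f) < e} | f N e. e > 0} W"
    using assms(1) by (simp add: open_smooth_circle_def)
  then have "f \<in> W \<Longrightarrow> \<exists>N e. e > 0 \<and> (\<forall>g. CN_norm N (g - f) < e \<longrightarrow> g \<in> W)"
  proof induction
    case UNIV
    then show ?case by (auto intro: exI[of _ 1])
  next
    case (Int a b)
    then obtain N e N' e' where *: "e > 0" "\<forall>g. CN_norm N (g - f) < e \<longrightarrow> g \<in> a"
      "e' > 0" "\<forall>g. CN_norm N' (g - f) < e' \<longrightarrow> g \<in> b" by auto
    show ?case
    proof (intro exI[of _ "max N N'"] exI[of _ "min e e'"] conjI allI impI)
      fix g assume "CN_norm (max N N') (g - f) < min e e'"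
      moreover have "CN_norm N (g - f) \<le> CN_norm (max N N') (g - f)"
        "CN_norm N' (g - f) \<le> CN_norm (max N N') (g - f)" by (auto intro: CN_norm_mono)
      ultimately show "g \<in> a \<inter> b" using * by auto
    qed (use * in auto)
  next
    case (UN K)
    then show ?case by blast
  next
    case (Basis s)
    then obtain f' N e where s: "s = {g. CN_norm N (g - f') < e}" by auto
    with Basis have d: "CN_norm N (f - f') < e" by simp
    show ?case
    proof (intro exI[of _ N] exI[of _ "e - CN_norm N (f - f')"] conjI allI impI)
      fix g assume g: "CN_norm N (g - f) < e - CN_norm N (f - f')"
      have "g - f' = (g - f) + (f - f')" by simp
      then have "CN_norm N (g - f') \<le> CN_norm N (g - f) + CN_norm N (f - f')"
        by (metis CN_norm_triangle)
      with g show "g \<in> s" by (simp add: s)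
    qed (use d in simp)
  qed
  with assms(2) that show ?thesis by auto
qed

lemma tendsto_circleI:
  fixes c :: "'a \<Rightarrow> smooth_circle"
  assumes "\<And>N. ((\<lambda>x. CN_norm N (c x - f)) \<longlongrightarrow> 0) Fl"
  shows "(c \<longlongrightarrow> f) Fl"
proof (rule topological_tendstoI)
  fix W assume "open W" "f \<in> W"
  then obtain N e where *: "e > 0" "\<And>g. CN_norm N (g - f) < e \<Longrightarrow> g \<in> W"
    by (rule open_contains_CN_ball) auto
  have "eventually (\<lambda>x. CN_norm N (c x - f) < e) Fl"
    using assms *(1) by (rule order_tendstoD(2))
  then show "eventually (\<lambda>x. c x \<in> W) Fl" by eventually_elim (rule *(2))
qed

lemma tendsto_circleI_cderiv:
  assumes "\<And>j e. e > 0 \<Longrightarrow> eventually (\<lambda>x. \<forall>t. cmod (cderiv (c x) j t - cderiv f j t) \<le> e) Fl"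
  shows "(c \<longlongrightarrow> f) Fl"
proof (rule tendsto_circleI, rule tendstoI)
  fix N and e :: real assume e: "e > 0"
  define e' where "e' = e / (2 * (real N + 1))"
  have e': "e' > 0" unfolding e'_def using e by (auto intro!: divide_pos_pos mult_pos_pos add_nonneg_pos)
  have "eventually (\<lambda>x. \<forall>j\<in>{..N}. \<forall>t. cmod (cderiv (c x) j t - cderiv f j t) \<le> e') Fl"
    by (intro eventually_ball_finite ballI assms e') auto
  then show "eventually (\<lambda>x. dist (CN_norm N (c x - f)) 0 < e) Fl"
  proof eventually_elim
    case (elim x)
    have "CN_norm N (c x - f) \<le> (real N + 1) * e'"
      by (rule CN_norm_le) (use elim in \<open>auto simp: cderiv_diff\<close>)
    also have "\<dots> = e / 2" unfolding e'_def by (simp add: field_simps)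
    also have "\<dots> < e" using e by simp
    finally show ?case using CN_norm_nonneg[of N "c x - f"] by simp
  qed
qed

section \<open>Continuous multilinear functionals\<close>

text \<open>Arguments are infinite sequences of which only the first \<open>k\<close> entries count.
  The last clause says so, and lets an argument be restricted to an extensional function, which is
  where \<open>circle_power_topology\<close> lives.\<close>

definition multilinear :: "nat \<Rightarrow> ((nat \<Rightarrow> smooth_circle) \<Rightarrow> complex) \<Rightarrow> bool" where
  "multilinear k M \<longleftrightarrow>
     (\<forall>f i g h. i < k \<longrightarrow> M (f(i := g + h)) = M (f(i := g)) + M (f(i := h))) \<and>
     (\<forall>f i c g. i < k \<longrightarrow> M (f(i := scale_circle c g)) = c * M (f(i := g))) \<and>
     (\<forall>f f'. (\<forall>i<k. f i = f' i) \<longrightarrow> M f = M f')"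

definition cont_multilinear :: "nat \<Rightarrow> ((nat \<Rightarrow> smooth_circle) \<Rightarrow> complex) \<Rightarrow> bool" where
  "cont_multilinear k M \<longleftrightarrow> multilinear k M \<and>
     continuous_map (circle_power_topology k) euclidean M"

lemma multilinear_cong: "multilinear k M \<Longrightarrow> (\<And>i. i < k \<Longrightarrow> f i = f' i) \<Longrightarrow> M f = M f'"
  by (auto simp: multilinear_def)

lemma multilinear_scale_all:
  assumes "multilinear k M"
  shows "M (\<lambda>i. scale_circle (c i) (f i)) = (\<Prod>i<k. c i) * M f"
proof -
  have "m \<le> k \<Longrightarrow> M (\<lambda>i. if i < m then scale_circle (c i) (f i) else f i) = (\<Prod>i<m. c i) * M f" for m
  proof (induction m)
    case (Suc m)
    let ?g = "\<lambda>i. if i < m then scale_circle (c i) (f i) else f i"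
    have "M (\<lambda>i. if i < Suc m then scale_circle (c i) (f i) else f i) = M (?g(m := scale_circle (c m) (f m)))"
      by (rule arg_cong[of _ _ M]) (auto simp: fun_eq_iff less_Suc_eq)
    also have "\<dots> = c m * M (?g(m := f m))" using assms Suc.prems by (auto simp: multilinear_def)
    also have "?g(m := f m) = ?g" by auto
    also have "M ?g = (\<Prod>i<m. c i) * M f" using Suc by simp
    finally show ?case by (simp add: mult_ac)
  qed simp
  from this[of k] have "M (\<lambda>i. if i < k then scale_circle (c i) (f i) else f i) = (\<Prod>i<k. c i) * M f"
    by simp
  moreover have "M (\<lambda>i. if i < k then scale_circle (c i) (f i) else f i) = M (\<lambda>i. scale_circle (c i) (f i))"
    by (rule multilinear_cong[OF assms]) auto
  ultimately show ?thesis by simp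
qed

lemma scale_circle_simps:
  "scale_circle a (scale_circle b f) = scale_circle (a * b) f"
  "scale_circle 1 f = f" "scale_circle 0 f = 0" "scale_circle a 0 = 0"
  "scale_circle a (f + g) = scale_circle a f + scale_circle a g"
  "scale_circle a (f - g) = scale_circle a f - scale_circle a g"
  by (rule circle_eqI, simp add: algebra_simps)+

lemma multilinear_zero:
  assumes "multilinear k M" "i < k" "f i = 0" shows "M f = 0"
proof -
  have "M f = M (f(i := scale_circle 0 0))" using assms(3) by (intro arg_cong[of _ _ M]) (auto simp: scale_circle_simps)
  also have "\<dots> = 0 * M (f(i := 0))" using assms(1,2) unfolding multilinear_def by blast
  finally show ?thesis by simp
qed

text \<open>Continuity at zero gives a neighbourhood on which \<open>M\<close> varies by less than
  1, and homogeneity in each slot turns this into an estimate. One order \<open>N\<close> serves all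
  slots because they are finitely many. The constants do not depend on the arguments, so the bound
  can be used along a whole strip of boost parameters.\<close>

lemma cont_multilinear_bound:
  assumes "cont_multilinear k M"
  obtains C N where "C \<ge> 0" "\<And>f. cmod (M f) \<le> C * (\<Prod>i<k. CN_norm N (f i))"
proof -
  have ml: "multilinear k M" and co: "continuous_map (circle_power_topology k) euclidean M"
    using assms by (auto simp: cont_multilinear_def)
  let ?T = "circle_power_topology k"
  let ?z = "restrict (\<lambda>i. 0 :: smooth_circle) {..<k}"
  have top: "topspace ?T = (\<Pi>\<^sub>E i\<in>{..<k}. UNIV)" by (simp add: circle_power_topology_def)
  have *: "M ?z = M (\<lambda>i. 0)" by (rule multilinear_cong[OF ml]) auto
  define V where "V = {x \<in> topspace ?T. M x \<in> ball (M ?z) 1}"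
  have "openin ?T V" unfolding V_def
    by (rule openin_continuous_map_preimage[OF co]) auto
  moreover have "?z \<in> V" unfolding V_def by (auto simp: top)
  ultimately have "\<exists>B. (\<forall>i\<in>{..<k}. openin euclidean (B i)) \<and> ?z \<in> Pi\<^sub>E {..<k} B \<and> Pi\<^sub>E {..<k} B \<subseteq> V"
    unfolding circle_power_topology_def openin_product_topology_alt by blast
  then obtain B where B: "\<And>i. i < k \<Longrightarrow> open (B i)"
    "?z \<in> Pi\<^sub>E {..<k} B" "Pi\<^sub>E {..<k} B \<subseteq> V"
    by (metis lessThan_iff open_openin)
  have "\<exists>N e. e > 0 \<and> (\<forall>g. CN_norm N (g - 0) < e \<longrightarrow> g \<in> B i)" if "i < k" for i
  proof -
    have "0 \<in> B i" using B(2) that by (auto simp: PiE_iff restrict_def)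
    from open_contains_CN_ball[OF B(1)[OF that] this] show ?thesis by metis
  qed
  then obtain N e where Ne: "\<And>i. i < k \<Longrightarrow> e i > (0::real)"
    "\<And>i g. i < k \<Longrightarrow> CN_norm (N i) g < e i \<Longrightarrow> g \<in> B i"
    by (metis diff_zero)
  \<comment> \<open>The inserted 0 and 1 keep maximum and minimum meaningful for
    \<open>k = 0\<close>.\<close>
  define N0 where "N0 = Max (insert 0 (N ` {..<k}))"
  define e0 where "e0 = Min (insert 1 (e ` {..<k}))"
  have N0: "N i \<le> N0" if "i < k" for i unfolding N0_def using that by (intro Max_ge) auto
  have e0: "e0 > 0" unfolding e0_def using Ne(1) by (subst Min_gr_iff) auto
  have e0': "e0 \<le> e i" if "i < k" for i unfolding e0_def using that by (intro Min_le) auto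
  have small: "cmod (M g - M (\<lambda>i. 0)) < 1" if g: "\<And>i. i < k \<Longrightarrow> CN_norm N0 (g i) < e0" for g
  proof -
    have "g i \<in> B i" if i: "i < k" for i
    proof (rule Ne(2)[OF i])
      have "CN_norm (N i) (g i) \<le> CN_norm N0 (g i)" by (rule CN_norm_mono[OF N0[OF i]])
      also have "\<dots> < e0" by (rule g[OF i])
      also have "\<dots> \<le> e i" by (rule e0'[OF i])
      finally show "CN_norm (N i) (g i) < e i" .
    qed
    then have "restrict g {..<k} \<in> Pi\<^sub>E {..<k} B" by auto
    then have "restrict g {..<k} \<in> V" using B(3) by (rule subsetD[rotated])
    then have "cmod (M (restrict g {..<k}) - M ?z) < 1"
      unfolding V_def by (simp add: dist_norm norm_minus_commute)
    moreover have "M (restrict g {..<k}) = M g" by (rule multilinear_cong[OF ml]) auto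
    ultimately show ?thesis using * by simp
  qed
  show ?thesis
  proof (cases "k = 0")
    \<comment> \<open>Without slots \<open>M\<close> is a constant that may differ from zero;
      homogeneity says nothing, and the empty product equals 1.\<close>
    case True
    have "M f = M (\<lambda>i. 0)" for f by (rule multilinear_cong[OF ml]) (use True in auto)
    then have "cmod (M f) \<le> cmod (M (\<lambda>i. 0)) * (\<Prod>i<k. CN_norm 0 (f i))" for f
      using True by (metis lessThan_0 mult.right_neutral order_refl prod.empty)
    then show ?thesis by (rule that[OF norm_ge_zero])
  next
    case False
    then have M0: "M (\<lambda>i. 0) = 0" by (intro multilinear_zero[OF ml, of 0]) auto
    show ?thesis
    proof (rule that)
      show "(2 / e0) ^ k \<ge> 0" using e0 by simp
      fix f
      show "cmod (M f) \<le> (2 / e0) ^ k * (\<Prod>i<k. CN_norm N0 (f i))"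
      proof (cases "\<exists>i<k. f i = 0")
        case True
        then have "M f = 0" using multilinear_zero[OF ml] by blast
        then show ?thesis using e0 by (simp add: prod_nonneg CN_norm_nonneg)
      next
        case nz: False
        define n where "n i = CN_norm N0 (f i)" for i
        have n: "n i > 0" if "i < k" for i
          using nz that CN_norm_nonneg[of N0 "f i"] CN_norm_zero_iff[of N0 "f i"] unfolding n_def by force
        \<comment> \<open>Scales each argument to norm at most \<open>e0 / 2\<close>, strictly
          inside the neighbourhood.\<close>
        define c where "c i = complex_of_real (e0 / (2 * n i))" for i
        have "cmod (M (\<lambda>i. scale_circle (c i) (f i)) - M (\<lambda>i. 0)) < 1"
        proof (rule small)
          fix i assume i: "i < k"
          have "CN_norm N0 (scale_circle (c i) (f i)) \<le> cmod (c i) * n i"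
            unfolding n_def by (rule CN_norm_scale_le)
          also have "\<dots> = e0 / 2" using e0 n[OF i] unfolding c_def norm_of_real by (simp add: field_simps)
          finally show "CN_norm N0 (scale_circle (c i) (f i)) < e0" using e0 by simp
        qed
        then have "(\<Prod>i<k. cmod (c i)) * cmod (M f) < 1"
          unfolding M0 multilinear_scale_all[OF ml] by (simp add: norm_mult prod_norm)
        moreover have "(\<Prod>i<k. cmod (c i)) = (\<Prod>i<k. (e0 / 2) / n i)"
          by (rule prod.cong) (use e0 n in \<open>auto simp: c_def norm_divide norm_mult\<close>, metis abs_of_pos)
        moreover have "\<dots> = (e0 / 2) ^ k / (\<Prod>i<k. n i)" unfolding prod_dividef by (simp add: power_divide)
        moreover have "(\<Prod>i<k. n i) > 0" by (intro prod_pos) (use n in auto)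
        moreover have "(e0/2)^k > 0" using e0 by simp
        ultimately have "cmod (M f) < (\<Prod>i<k. n i) / (e0 / 2) ^ k" by (simp add: field_simps)
        also have "\<dots> = (2 / e0) ^ k * (\<Prod>i<k. n i)" by (simp add: power_divide)
        finally show ?thesis by (simp add: n_def)
      qed
    qed
  qed
qed

lemma cont_multilinear_tendsto:
  assumes "cont_multilinear k M" "\<And>i. i < k \<Longrightarrow> ((\<lambda>x. c x i) \<longlongrightarrow> f i) Fl"
  shows "((\<lambda>x. M (c x)) \<longlongrightarrow> M f) Fl"
proof -
  have ml: "multilinear k M" and co: "continuous_map (circle_power_topology k) euclidean M"
    using assms(1) by (auto simp: cont_multilinear_def)
  have "limitin (circle_power_topology k) (\<lambda>x. restrict (c x) {..<k}) (restrict f {..<k}) Fl"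
    unfolding circle_power_topology_def limitin_componentwise using assms(2) by auto
  from continuous_map_limit[OF co this]
  have "((\<lambda>x. M (restrict (c x) {..<k})) \<longlongrightarrow> M (restrict f {..<k})) Fl" by (simp add: o_def)
  moreover have "M (restrict g {..<k}) = M g" for g by (rule multilinear_cong[OF ml]) auto
  ultimately show ?thesis by simp
qed

text \<open>Continuity at \<open>w\<close> is recorded beside the difference quotient because
  differentiating a multilinear expression evaluates some slots at \<open>w + h\<close> while
  another slot carries the quotient.\<close>

definition circle_deriv :: "(complex \<Rightarrow> smooth_circle) \<Rightarrow> smooth_circle \<Rightarrow> complex \<Rightarrow> bool" where
  "circle_deriv c c' w \<longleftrightarrow> (\<lambda>h. c (w + h)) \<midarrow>0\<rightarrow> c w \<and>
     (\<lambda>h. scale_circle (inverse h) (c (w + h) - c w)) \<midarrow>0\<rightarrow> c'"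

text \<open>Telescoping: the arguments are moved from \<open>w\<close> to \<open>w + h\<close> one
  slot at a time, and each difference is \<open>h\<close> times \<open>M\<close> with a difference
  quotient in that slot. Joint continuity yields its limit although the earlier slots still vary
  with \<open>h\<close>.\<close>

lemma cont_multilinear_differentiable:
  assumes M: "cont_multilinear k M" and c: "\<And>i. i < k \<Longrightarrow> circle_deriv (c i) (c' i) w"
  shows "(\<lambda>w. M (\<lambda>i. c i w)) field_differentiable (at w)"
proof -
  have ml: "multilinear k M" using M by (auto simp: cont_multilinear_def)
  define g where "g m h = (\<lambda>i. if i < m then c i (w + h) else c i w)" for m h
  have step: "\<exists>D. ((\<lambda>h. (M (g m h) - M (g 0 h)) / h) \<longlongrightarrow> D) (at 0)" if "m \<le> k" for m
    using that
  proof (induction m)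
    case 0
    then show ?case by auto
  next
    case (Suc m)
    then obtain D where D: "((\<lambda>h. (M (g m h) - M (g 0 h)) / h) \<longlongrightarrow> D) (at 0)" by auto
    define q where "q h = (g m h)(m := scale_circle (inverse h) (c m (w + h) - c m w))" for h
    have "((\<lambda>h. M (q h)) \<longlongrightarrow> M ((\<lambda>i. c i w)(m := c' m))) (at 0)"
    proof (rule cont_multilinear_tendsto[OF M])
      fix i assume "i < k"
      then show "((\<lambda>h. q h i) \<longlongrightarrow> ((\<lambda>i. c i w)(m := c' m)) i) (at 0)"
        using c[of i] unfolding q_def g_def circle_deriv_def by (cases "i < m"; cases "i = m") auto
    qed
    moreover have "M (q h) = (M (g (Suc m) h) - M (g m h)) / h" for h
    proof -
      have 1: "g (Suc m) h = (g m h)(m := (c m (w + h) - c m w) + c m w)"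
        "(g m h)(m := c m w) = g m h" by (auto simp: g_def fun_eq_iff less_Suc_eq)
      have "M (g (Suc m) h) = M ((g m h)(m := c m (w + h) - c m w)) + M (g m h)"
        using ml Suc.prems 1(2) unfolding 1(1) multilinear_def by (metis Suc_le_lessD)
      moreover have "M (q h) = inverse h * M ((g m h)(m := c m (w + h) - c m w))"
        using ml Suc.prems unfolding q_def multilinear_def by (metis Suc_le_lessD)
      ultimately show ?thesis by (simp add: field_simps)
    qed
    ultimately have "((\<lambda>h. (M (g (Suc m) h) - M (g m h)) / h) \<longlongrightarrow> M ((\<lambda>i. c i w)(m := c' m))) (at 0)"
      by simp
    from tendsto_add[OF D this] show ?case
      by (auto simp: add_divide_distrib diff_divide_distrib intro!: exI)
  qed
  obtain D where D: "((\<lambda>h. (M (g k h) - M (g 0 h)) / h) \<longlongrightarrow> D) (at 0)" using step[of k] by auto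
  have "M (g k h) = M (\<lambda>i. c i (w + h))" for h
    by (rule multilinear_cong[OF ml]) (auto simp: g_def)
  moreover have "M (g 0 h) = M (\<lambda>i. c i w)" for h by (simp add: g_def)
  ultimately have "((\<lambda>w. M (\<lambda>i. c i w)) has_field_derivative D) (at w)"
    using D unfolding DERIV_def by simp
  then show ?thesis by (auto simp: field_differentiable_def)
qed

section \<open>Boundary values of functions holomorphic in the disc\<close>

definition circle_functional :: "(smooth_circle \<Rightarrow> complex) \<Rightarrow> bool" where
  "circle_functional l \<longleftrightarrow> (\<forall>f g. l (f + g) = l f + l g) \<and>
     (\<forall>c f. l (scale_circle c f) = c * l f) \<and> continuous_on UNIV l"

lemma circle_functional_tendsto:
  assumes "circle_functional l" "(c \<longlongrightarrow> f) Fl"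
  shows "((\<lambda>x. l (c x)) \<longlongrightarrow> l f) Fl"
  by (rule continuous_on_tendsto_compose[of UNIV l]) (use assms in \<open>auto simp: circle_functional_def\<close>)

lemma circle_functional_simps:
  assumes "circle_functional l"
  shows "l 0 = 0" "l (- f) = - l f" "l (f - g) = l f - l g" "l (sum h A) = (\<Sum>x\<in>A. l (h x))"
proof -
  have a: "l (f + g) = l f + l g" and s: "l (scale_circle c f) = c * l f" for f g c
    using assms by (auto simp: circle_functional_def)
  show z: "l 0 = 0" using s[of 0 0] by (simp add: scale_circle_simps)
  show m: "l (- f) = - l f" for f unfolding scale_circle_minus1 s by simp
  show "l (f - g) = l f - l g" unfolding diff_conv_add_uminus a m by simp
  show "l (sum h A) = (\<Sum>x\<in>A. l (h x))"
    by (induction A rule: infinite_finite_induct) (auto simp: z a)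
qed

lemma multilinear_slot_functional:
  assumes "cont_multilinear k M" "i < k"
  shows "circle_functional (\<lambda>f. M (F(i := f)))"
  unfolding circle_functional_def continuous_on_def
proof (intro conjI allI ballI)
  fix f
  show "((\<lambda>g. M (F(i := g))) \<longlongrightarrow> M (F(i := f))) (at f within UNIV)"
    by (rule cont_multilinear_tendsto[OF assms(1)]) auto
qed (use assms in \<open>auto simp: cont_multilinear_def multilinear_def\<close>)

definition emode :: "int \<Rightarrow> smooth_circle" where
  "emode n = circ (\<lambda>z. z powi n)"

text \<open>\<open>B\<close> plays the role of the sequence of complex derivatives of \<open>B 0\<close>, up to the boundary of
  the disc.\<close>

definition boundary_family :: "(nat \<Rightarrow> complex \<Rightarrow> complex) \<Rightarrow> bool" where
  "boundary_family B \<longleftrightarrow>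
     (\<forall>i t. ((\<lambda>t. B i (cis t)) has_vector_derivative \<i> * cis t * B (Suc i) (cis t)) (at t))"

text \<open>The \<open>j\<close>-th derivative in \<open>t\<close> of
  \<open>z powi m * B i z\<close> at \<open>z = cis t\<close>. Differentiating the power gives the
  factor \<open>\<i> * m\<close>; differentiating \<open>B i\<close> along the circle gives
  \<open>\<i> * z\<close>, which raises \<open>m\<close> by one and passes to
  \<open>B (Suc i)\<close>.\<close>

primrec laurent_cderiv :: "nat \<Rightarrow> (nat \<Rightarrow> complex \<Rightarrow> complex) \<Rightarrow> int \<Rightarrow> nat \<Rightarrow> real \<Rightarrow> complex" where
  "laurent_cderiv 0 B m i t = cis (of_int m * t) * B i (cis t)"
| "laurent_cderiv (Suc j) B m i t =
     \<i> * of_int m * laurent_cderiv j B m i t + \<i> * laurent_cderiv j B (m + 1) (Suc i) t"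

lemma cis_has_vector_derivative:
  "((\<lambda>t. cis (a * t)) has_vector_derivative \<i> * of_real a * cis (a * t)) (at t)"
proof -
  have "((\<lambda>z. exp (\<i> * of_real a * z)) has_field_derivative \<i> * of_real a * exp (\<i> * of_real a * z)) (at z)" for z
    by (auto intro!: derivative_eq_intros)
  from has_vector_derivative_real_field[OF this, of t UNIV] show ?thesis
    by (simp add: cis_conv_exp mult_ac)
qed

lemma cis_powi: "cis t powi m = cis (of_int m * t)"
proof (cases m)
  case (nonneg n)
  then show ?thesis by (simp only: power_int_of_nat Complex.DeMoivre of_int_of_nat_eq)
next
  case (neg n)
  have "cis t powi m = inverse (cis t ^ Suc n)" unfolding neg by (simp add: power_int_minus del: of_nat_Suc power_Suc)
  also have "\<dots> = cis (of_int m * t)" unfolding Complex.DeMoivre neg by (simp only: cis_inverse of_int_minus of_int_of_nat_eq mult_minus_left)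
  finally show ?thesis .
qed

lemma laurent_cderiv_deriv:
  assumes "boundary_family B"
  shows "(laurent_cderiv j B m i has_vector_derivative laurent_cderiv (Suc j) B m i t) (at t)"
proof (induction j arbitrary: m i)
  case 0
  have "((\<lambda>t. cis (of_int m * t) * B i (cis t)) has_vector_derivative
      cis (of_int m * t) * (\<i> * cis t * B (Suc i) (cis t)) + (\<i> * of_real (of_int m) * cis (of_int m * t)) * B i (cis t)) (at t)"
    by (rule has_vector_derivative_mult[OF cis_has_vector_derivative])
      (use assms in \<open>auto simp: boundary_family_def\<close>)
  moreover have "cis (of_int (m + 1) * t) = cis (of_int m * t) * cis t"
    by (simp add: cis_mult algebra_simps)
  ultimately show ?case by (simp add: algebra_simps)
next
  case (Suc j)
  have eq: "laurent_cderiv (Suc j) B m i = (\<lambda>t. \<i> * of_int m * laurent_cderiv j B m i t + \<i> * laurent_cderiv j B (m + 1) (Suc i) t)"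
    by (simp add: fun_eq_iff)
  have "((\<lambda>t. \<i> * of_int m * laurent_cderiv j B m i t + \<i> * laurent_cderiv j B (m + 1) (Suc i) t) has_vector_derivative
      \<i> * of_int m * laurent_cderiv (Suc j) B m i t + \<i> * laurent_cderiv (Suc j) B (m + 1) (Suc i) t) (at t)"
    by (intro has_vector_derivative_add has_vector_derivative_mult_right Suc.IH)
  then show ?case unfolding eq by simp
qed

text \<open>The constant is independent of \<open>B\<close> and of the bounds \<open>e\<close>.
  Applied to differences, the estimate therefore turns uniform convergence of the complex
  derivatives on the circle into convergence of test functions.\<close>

lemma laurent_cderiv_bound:
  "\<exists>C\<ge>0. \<forall>B e t. (\<forall>k t. cmod (B k (cis t)) \<le> e k) \<longrightarrow>
     cmod (laurent_cderiv j B m i t) \<le> C * (\<Sum>k\<le>i + j. e k)"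
proof (induction j arbitrary: m i)
  case 0
  show ?case
  proof (intro exI[of _ 1] conjI allI impI)
    fix B :: "nat \<Rightarrow> complex \<Rightarrow> complex" and e t
    assume *: "\<forall>k t. cmod (B k (cis t)) \<le> e k"
    have "0 \<le> e k" for k using * norm_ge_zero order_trans by blast
    then have "e i \<le> (\<Sum>k\<le>i + 0. e k)" by (intro member_le_sum) auto
    then show "cmod (laurent_cderiv 0 B m i t) \<le> 1 * (\<Sum>k\<le>i + 0. e k)"
      using * by (auto simp: norm_mult intro: order_trans)
  qed simp
next
  case (Suc j)
  obtain C where C: "C \<ge> 0" "\<forall>B e t. (\<forall>k t. cmod (B k (cis t)) \<le> e k) \<longrightarrow>
      cmod (laurent_cderiv j B m i t) \<le> C * (\<Sum>k\<le>i + j. e k)"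
    using Suc.IH[of m i] by (elim exE conjE)
  obtain C' where C': "C' \<ge> 0" "\<forall>B e t. (\<forall>k t. cmod (B k (cis t)) \<le> e k) \<longrightarrow>
      cmod (laurent_cderiv j B (m + 1) (Suc i) t) \<le> C' * (\<Sum>k\<le>Suc i + j. e k)"
    using Suc.IH[of "m + 1" "Suc i"] by (elim exE conjE)
  note C2 = C(2)[THEN spec, THEN spec, THEN spec, THEN mp] C'(2)[THEN spec, THEN spec, THEN spec, THEN mp]
  show ?case
  proof (intro exI[of _ "\<bar>of_int m\<bar> * C + C'"] conjI allI impI)
    fix B :: "nat \<Rightarrow> complex \<Rightarrow> complex" and e t
    assume *: "\<forall>k t. cmod (B k (cis t)) \<le> e k"
    have e: "0 \<le> e k" for k using * norm_ge_zero order_trans by blast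
    have "cmod (laurent_cderiv (Suc j) B m i t)
        \<le> \<bar>of_int m\<bar> * cmod (laurent_cderiv j B m i t) + cmod (laurent_cderiv j B (m + 1) (Suc i) t)"
      unfolding laurent_cderiv.simps by (rule order_trans[OF norm_triangle_ineq]) (simp add: norm_mult)
    also have "\<dots> \<le> \<bar>of_int m\<bar> * (C * (\<Sum>k\<le>i + Suc j. e k)) + C' * (\<Sum>k\<le>i + Suc j. e k)"
    proof (intro add_mono mult_left_mono)
      show "cmod (laurent_cderiv j B m i t) \<le> C * (\<Sum>k\<le>i + Suc j. e k)"
        by (rule order_trans[OF C2(1)[OF *] mult_left_mono[OF sum_mono2]]) (use C(1) e in auto)
      show "cmod (laurent_cderiv j B (m + 1) (Suc i) t) \<le> C' * (\<Sum>k\<le>i + Suc j. e k)"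
        using C2(2)[OF *] by simp
    qed auto
    finally show "cmod (laurent_cderiv (Suc j) B m i t) \<le> (\<bar>of_int m\<bar> * C + C') * (\<Sum>k\<le>i + Suc j. e k)"
      by (simp add: algebra_simps)
  qed (use C(1) C'(1) in auto)
qed

lemma laurent_cderiv_diff:
  "laurent_cderiv j (\<lambda>i z. B i z - B' i z) m i t = laurent_cderiv j B m i t - laurent_cderiv j B' m i t"
proof (induction j arbitrary: m i)
  case (Suc j)
  show ?case unfolding laurent_cderiv.simps Suc.IH by (simp add: algebra_simps)
qed (simp add: algebra_simps)

definition laurent :: "int \<Rightarrow> (complex \<Rightarrow> complex) \<Rightarrow> smooth_circle" where
  "laurent m h = circ (\<lambda>z. z powi m * h z)"

lemma
  assumes "boundary_family B"
  shows apply_laurent: "apply_circle (laurent m (B 0)) (cis t) = cis t powi m * B 0 (cis t)"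
    and cderiv_laurent: "cderiv (laurent m (B 0)) j t = laurent_cderiv j B m 0 t"
proof -
  have *: "smooth_family (\<lambda>j. laurent_cderiv j B m 0)"
    using laurent_cderiv_deriv[OF assms] by (auto simp: smooth_family_def simp del: laurent_cderiv.simps)
  have eq: "cis t powi m * B 0 (cis t) = laurent_cderiv 0 B m 0 t" for t by (simp add: cis_powi)
  show "apply_circle (laurent m (B 0)) (cis t) = cis t powi m * B 0 (cis t)"
    unfolding laurent_def using apply_circ[OF * eq] by simp
  show "cderiv (laurent m (B 0)) j t = laurent_cderiv j B m 0 t"
    unfolding laurent_def using cderiv_circ[OF * eq] by simp
qed

lemma laurent_tendsto:
  assumes "boundary_family B" "\<And>x. boundary_family (B' x)"
    and lim: "\<And>i e. e > 0 \<Longrightarrow> eventually (\<lambda>x. \<forall>t. cmod (B' x i (cis t) - B i (cis t)) \<le> e) Fl"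
  shows "((\<lambda>x. laurent m (B' x 0)) \<longlongrightarrow> laurent m (B 0)) Fl"
proof (rule tendsto_circleI_cderiv)
  fix j and e :: real assume e: "e > 0"
  obtain C where C: "C \<ge> 0" "\<forall>B e t. (\<forall>k t. cmod (B k (cis t)) \<le> e k) \<longrightarrow>
      cmod (laurent_cderiv j B m 0 t) \<le> C * (\<Sum>k\<le>0 + j. e k)"
    using laurent_cderiv_bound[of j m 0] by (elim exE conjE)
  define e' where "e' = e / ((C + 1) * (real j + 1))"
  have e': "e' > 0" unfolding e'_def using e C(1) by (auto intro!: divide_pos_pos mult_pos_pos)
  have "eventually (\<lambda>x. \<forall>i\<in>{..j}. \<forall>t. cmod (B' x i (cis t) - B i (cis t)) \<le> e') Fl"
    by (intro eventually_ball_finite ballI lim e') auto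
  then show "eventually (\<lambda>x. \<forall>t. cmod (cderiv (laurent m (B' x 0)) j t - cderiv (laurent m (B 0)) j t) \<le> e) Fl"
  proof eventually_elim
    case (elim x)
    show ?case
    proof
      fix t
      \<comment> \<open>The estimate asks for a bound at every index, but smallness is known only
        for \<open>i \<le> j\<close>. Higher entries do not enter the \<open>j\<close>-th derivative
        and may be replaced by 0.\<close>
      define D where "D = (\<lambda>i z. if i \<le> j then B' x i z - B i z else 0)"
      have cut: "laurent_cderiv j' E m i t = laurent_cderiv j' E' m i t"
        if "\<And>k. k \<le> i + j' \<Longrightarrow> E k = E' k" for j' E E' m i
        using that by (induction j' arbitrary: m i) auto
      have "laurent_cderiv j D m 0 t = laurent_cderiv j (\<lambda>i z. B' x i z - B i z) m 0 t"
        by (rule cut) (auto simp: D_def)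
      also have "\<dots> = cderiv (laurent m (B' x 0)) j t - cderiv (laurent m (B 0)) j t"
        unfolding cderiv_laurent[OF assms(1)] cderiv_laurent[OF assms(2)] by (rule laurent_cderiv_diff)
      finally have "cmod (cderiv (laurent m (B' x 0)) j t - cderiv (laurent m (B 0)) j t)
          = cmod (laurent_cderiv j D m 0 t)" by simp
      also have "\<dots> \<le> C * (\<Sum>k\<le>0 + j. e')" by (rule C(2)[THEN spec, THEN spec, THEN spec, THEN mp]) (use elim e' in \<open>auto simp: D_def\<close>)
      also have "\<dots> \<le> (C + 1) * ((real j + 1) * e')" using e' C(1) by (auto intro!: mult_mono)
      also have "\<dots> = (C + 1) * (real j + 1) * e / ((C + 1) * (real j + 1))" unfolding e'_def by simp
      also have "\<dots> = e" by (rule nonzero_mult_div_cancel_left) (use C(1) in auto)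
      finally show "cmod (cderiv (laurent m (B' x 0)) j t - cderiv (laurent m (B 0)) j t) \<le> e" .
    qed
  qed
qed

lemma boundary_family_holomorphic:
  assumes "h holomorphic_on S" "open S" "sphere 0 1 \<subseteq> S"
  shows "boundary_family (\<lambda>i. (deriv ^^ i) h)"
  unfolding boundary_family_def
proof (intro allI)
  fix i t
  have "(deriv ^^ i) h holomorphic_on S" by (rule holomorphic_higher_deriv[OF assms(1,2)])
  moreover have "cis t \<in> S" using assms(3) by auto
  ultimately have "((deriv ^^ i) h has_field_derivative (deriv ^^ Suc i) h (cis t)) (at (cis t))"
    using assms(2) by (simp add: holomorphic_derivI)
  moreover have "(cis has_vector_derivative \<i> * cis t) (at t)"
    using cis_has_vector_derivative[of 1 t] by simp
  ultimately show "((\<lambda>t. (deriv ^^ i) h (cis t)) has_vector_derivative \<i> * cis t * (deriv ^^ Suc i) h (cis t)) (at t)"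
    using field_vector_diff_chain_at[of cis "\<i> * cis t" t "(deriv ^^ i) h"] by (simp add: o_def)
qed

lemma apply_emode: "apply_circle (emode n) (cis t) = cis t powi n"
proof -
  have "boundary_family (\<lambda>i z. if i = 0 then 1 else 0)"
    by (auto simp: boundary_family_def)
  from apply_laurent[OF this, of n t] show ?thesis by (simp add: laurent_def emode_def)
qed

text \<open>The Taylor polynomials of \<open>h\<close> converge uniformly on a disc larger than the
  unit disc, hence with all derivatives on the circle by Cauchy's inequality. Times
  \<open>z powi m\<close>, such a polynomial is a finite combination of modes killed by
  \<open>l\<close>.\<close>

lemma functional_vanishes_laurent:
  assumes l: "circle_functional l" and em: "\<And>n::nat. l (emode (m + int n)) = 0"
    and hol: "h holomorphic_on ball 0 \<rho>" and \<rho>: "\<rho> > 1"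
  shows "l (laurent m h) = 0"
proof -
  define b where "b k = (deriv ^^ k) h 0 / fact k" for k
  define P where "P n z = (\<Sum>k<n. b k * z ^ k)" for n z
  \<comment> \<open>A radius strictly between 1 and \<rho>: convergence is uniform on the closed
    disc of radius \<rho>', and every point of the circle keeps a disc of radius
    \<open>\<rho>' - 1\<close> for Cauchy's inequality.\<close>
  define \<rho>' where "\<rho>' = (1 + \<rho>) / 2"
  have \<rho>': "1 < \<rho>'" "\<rho>' < \<rho>" using \<rho> by (auto simp: \<rho>'_def)
  have sums: "(\<lambda>k. b k * z ^ k) sums h z" if "z \<in> ball 0 \<rho>" for z
    using holomorphic_power_series[OF hol that] by (simp add: b_def)
  have holP: "P n holomorphic_on S" for n S unfolding P_def by (intro holomorphic_intros)
  have "uniform_limit (cball 0 \<rho>') (\<lambda>n x. \<Sum>i<n. b i * (x - 0) ^ i) (\<lambda>x. \<Sum>i. b i * (x - 0) ^ i) sequentially"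
  proof (rule powser_uniform_limit)
    \<comment> \<open>Convergence at the midpoint of \<rho>' and \<rho> forces the radius of
      convergence strictly above \<rho>'.\<close>
    have "summable (\<lambda>k. b k * of_real ((\<rho>' + \<rho>) / 2) ^ k)"
      by (rule sums_summable[OF sums], unfold mem_ball_0 norm_of_real) (use \<rho>' in auto)
    from conv_radius_geI[OF this] have "conv_radius b \<ge> ereal ((\<rho>' + \<rho>) / 2)"
      using \<rho>' by (simp only: norm_of_real) simp
    moreover have "ereal \<rho>' < ereal ((\<rho>' + \<rho>) / 2)" using \<rho>' by simp
    ultimately show "ereal \<rho>' < conv_radius b" by (rule less_le_trans[rotated])
  qed
  then have unif: "uniform_limit (cball 0 \<rho>') P h sequentially"
    by (rule uniform_limit_cong'[THEN iffD1, rotated -1])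
      (use \<rho>' sums in \<open>auto simp: P_def sums_iff\<close>)
  have "(\<lambda>n. laurent m ((deriv ^^ 0) (P n))) \<longlonglongrightarrow> laurent m ((deriv ^^ 0) h)"
  proof (rule laurent_tendsto)
    show "boundary_family (\<lambda>i. (deriv ^^ i) h)"
      by (rule boundary_family_holomorphic[OF hol]) (use \<rho> in auto)
    show "boundary_family (\<lambda>i. (deriv ^^ i) (P n))" for n
      by (rule boundary_family_holomorphic[OF holP[of _ UNIV]]) auto
    fix i and e :: real assume e: "e > 0"
    \<comment> \<open>Divides out in advance the factor \<open>fact i / (\<rho>' - 1) ^ i\<close>
      that Cauchy's inequality produces.\<close>
    define e' where "e' = e * (\<rho>' - 1) ^ i / fact i"
    have "e' > 0" using e \<rho>' by (auto simp: e'_def)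
    from uniform_limitD[OF unif this]
    have "\<forall>\<^sub>F n in sequentially. \<forall>z\<in>cball 0 \<rho>'. cmod (P n z - h z) < e'" by (simp add: dist_norm)
    then show "\<forall>\<^sub>F n in sequentially. \<forall>t. cmod ((deriv ^^ i) (P n) (cis t) - (deriv ^^ i) h (cis t)) \<le> e"
    proof eventually_elim
      case (elim n)
      show ?case
      proof
        fix t
        have sub: "cball (cis t) (\<rho>' - 1) \<subseteq> cball 0 \<rho>'"
        proof
          fix x assume "x \<in> cball (cis t) (\<rho>' - 1)"
          then have "cmod (cis t - x) \<le> \<rho>' - 1" by (simp add: dist_norm)
          moreover have "cmod x \<le> cmod (cis t) + cmod (cis t - x)"
            by (metis norm_minus_commute norm_triangle_sub)
          ultimately show "x \<in> cball 0 \<rho>'" by simp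
        qed
        have "cball 0 \<rho>' \<subseteq> ball 0 \<rho>" using \<rho>' by auto
        with sub have sub': "cball (cis t) (\<rho>' - 1) \<subseteq> ball 0 \<rho>" by (rule subset_trans)
        have hold: "(\<lambda>z. P n z - h z) holomorphic_on ball 0 \<rho>" by (intro holomorphic_intros holP hol)
        have "cmod ((deriv ^^ i) (\<lambda>z. P n z - h z) (cis t)) \<le> fact i * e' / (\<rho>' - 1) ^ i"
        proof (rule Cauchy_inequality)
          show "(\<lambda>z. P n z - h z) holomorphic_on ball (cis t) (\<rho>' - 1)"
            by (rule holomorphic_on_subset[OF hold subset_trans[OF ball_subset_cball sub']])
          show "continuous_on (cball (cis t) (\<rho>' - 1)) (\<lambda>z. P n z - h z)"
            by (rule continuous_on_subset[OF holomorphic_on_imp_continuous_on[OF hold] sub'])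
          show "cmod (P n x - h x) \<le> e'" if "cmod (cis t - x) = \<rho>' - 1" for x
          proof -
            have "x \<in> cball (cis t) (\<rho>' - 1)" using that by (simp add: dist_norm)
            then have "x \<in> cball 0 \<rho>'" using sub by (rule subsetD[rotated])
            then show ?thesis using elim by (simp add: less_imp_le)
          qed
        qed (use \<rho>' in auto)
        also have "\<dots> = e" using \<rho>' by (simp add: e'_def)
        also have "(deriv ^^ i) (\<lambda>z. P n z - h z) (cis t) = (deriv ^^ i) (P n) (cis t) - (deriv ^^ i) h (cis t)"
          by (rule higher_deriv_diff[OF holP hol]) (use \<rho> in auto)
        finally show "cmod ((deriv ^^ i) (P n) (cis t) - (deriv ^^ i) h (cis t)) \<le> e" .
      qed
    qed
  qed
  then have "(\<lambda>n. l (laurent m (P n))) \<longlonglongrightarrow> l (laurent m h)"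
    using circle_functional_tendsto[OF l] by simp
  moreover have "l (laurent m (P n)) = 0" for n
  proof -
    have "laurent m (P n) = (\<Sum>k<n. scale_circle (b k) (emode (m + int k)))"
    proof (rule circle_eqI)
      fix t
      have "apply_circle (laurent m (P n)) (cis t) = cis t powi m * P n (cis t)"
        using apply_laurent[OF boundary_family_holomorphic[OF holP[of n UNIV]], of m t] by simp
      also have "\<dots> = (\<Sum>k<n. b k * cis t powi (m + int k))"
        by (simp add: P_def sum_distrib_left power_int_add mult_ac)
      also have "\<dots> = apply_circle (\<Sum>k<n. scale_circle (b k) (emode (m + int k))) (cis t)"
        by (induction n) (auto simp: apply_emode)
      finally show "apply_circle (laurent m (P n)) (cis t)
          = apply_circle (\<Sum>k<n. scale_circle (b k) (emode (m + int k))) (cis t)" .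
    qed
    moreover have "l (scale_circle c f) = c * l f" for c f using l by (simp add: circle_functional_def)
    ultimately show ?thesis using em by (simp add: circle_functional_simps[OF l])
  qed
  ultimately show ?thesis by (simp add: LIMSEQ_const_iff)
qed

text \<open>Holomorphy ends at the circle here, so the previous lemma does not reach
  \<open>A 0\<close> itself. It does reach the dilations \<open>A 0 (r * z)\<close> with
  \<open>r < 1\<close>, which are holomorphic in the disc of radius \<open>1 / r\<close>; uniform
  continuity on the closed disc lets \<open>r\<close> tend to 1 in every derivative.\<close>

lemma
  assumes cont: "\<And>i. continuous_on (cball 0 1) (A i)"
    and der: "\<And>i z. z \<in> ball 0 1 \<Longrightarrow> (A i has_field_derivative A (Suc i) z) (at z)"
  shows boundary_family_disc: "boundary_family A"
    and functional_vanishes_disc: "circle_functional l \<Longrightarrow> (\<And>n::nat. l (emode (m + int n)) = 0) \<Longrightarrow>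
      l (laurent m (A 0)) = 0"
proof -
  define r where "r n = 1 - 1 / (real n + 2)" for n
  have r: "0 < r n" "r n < 1" for n by (auto simp: r_def field_simps)
  have rlim: "r \<longlonglongrightarrow> 1" unfolding r_def by real_asymp
  \<comment> \<open>The factor \<open>r n ^ i\<close> comes from the chain rule and makes
    \<open>B n\<close> again a sequence of successive derivatives.\<close>
  define B where "B n i z = of_real (r n) ^ i * A i (of_real (r n) * z)" for n i z
  have in_ball: "of_real (r n) * cis t \<in> ball 0 1" for n t
    using r[of n] by (simp add: norm_mult)
  have Bder: "((\<lambda>t. B n i (cis t)) has_vector_derivative \<i> * cis t * B n (Suc i) (cis t)) (at t)" for n i t
  proof -
    have "((\<lambda>z. of_real (r n) * z) has_field_derivative of_real (r n)) (at (cis t))"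
      by (auto intro!: derivative_eq_intros)
    from DERIV_cmult[OF DERIV_chain[OF der[OF in_ball] this, of i], of "of_real (r n) ^ i"]
    moreover have "B n i = (\<lambda>z. of_real (r n) ^ i * (A i \<circ> (\<lambda>z. of_real (r n) * z)) z)"
      by (simp add: B_def fun_eq_iff)
    ultimately have "(B n i has_field_derivative B n (Suc i) (cis t)) (at (cis t))"
      by (simp add: B_def mult_ac)
    moreover have "(cis has_vector_derivative \<i> * cis t) (at t)"
      using cis_has_vector_derivative[of 1 t] by simp
    ultimately show ?thesis
      using field_vector_diff_chain_at[of cis "\<i> * cis t" t "B n i"] by (simp add: o_def)
  qed
  have unif: "\<forall>\<^sub>F n in sequentially. \<forall>t. cmod (B n i (cis t) - A i (cis t)) \<le> e" if e: "e > 0" for i and e :: real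
  proof -
    have "uniformly_continuous_on (cball 0 1) (A i)" by (rule compact_uniformly_continuous[OF cont]) simp
    then obtain \<delta> where \<delta>: "\<delta> > 0" "\<And>x y. x \<in> cball 0 1 \<Longrightarrow> y \<in> cball 0 1 \<Longrightarrow> dist x y < \<delta> \<Longrightarrow> dist (A i x) (A i y) < e / 2"
      unfolding uniformly_continuous_on_def using e by (metis half_gt_zero)
    have "bounded (A i ` cball 0 1)" by (intro compact_imp_bounded compact_continuous_image cont) simp
    then obtain K where K: "K > 0" "\<And>z. z \<in> cball 0 1 \<Longrightarrow> cmod (A i z) \<le> K"
      unfolding bounded_pos by auto
    have "(\<lambda>n. r n ^ i) \<longlonglongrightarrow> 1" using tendsto_power[OF rlim, of i] by simp
    then have "\<forall>\<^sub>F n in sequentially. \<bar>r n ^ i - 1\<bar> < e / (2 * K)"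
      using e K(1) by (auto simp: tendsto_iff dist_real_def)
    moreover have "\<forall>\<^sub>F n in sequentially. \<bar>r n - 1\<bar> < \<delta>"
      using rlim \<delta>(1) by (auto simp: tendsto_iff dist_real_def)
    ultimately show ?thesis
    proof eventually_elim
      case (elim n)
      show ?case
      proof
        fix t
        let ?w = "of_real (r n) * cis t"
        have w: "?w \<in> cball 0 1" using in_ball[of n t] by simp
        have "?w - cis t = of_real (r n - 1) * cis t" by (simp add: algebra_simps)
        then have "dist ?w (cis t) = \<bar>r n - 1\<bar>" by (simp only: dist_norm norm_mult norm_of_real norm_cis mult_1_right)
        with \<delta>(2)[OF w, of "cis t"] elim have 1: "cmod (A i ?w - A i (cis t)) < e / 2"
          by (simp add: dist_norm)
        have "B n i (cis t) - A i (cis t) = of_real (r n ^ i - 1) * A i ?w + (A i ?w - A i (cis t))"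
          by (simp add: B_def algebra_simps)
        also have "cmod \<dots> \<le> \<bar>r n ^ i - 1\<bar> * cmod (A i ?w) + cmod (A i ?w - A i (cis t))"
          by (rule order_trans[OF norm_triangle_ineq]) (simp only: norm_mult norm_of_real)
        also have "\<dots> \<le> e / (2 * K) * K + e / 2"
          by (intro add_mono mult_mono) (use elim 1 K w in auto)
        also have "\<dots> = e" using K(1) by simp
        finally show "cmod (B n i (cis t) - A i (cis t)) \<le> e" .
      qed
    qed
  qed
  have Blim: "(\<lambda>n. B n i (cis x)) \<longlonglongrightarrow> A i (cis x)" for i x
  proof (rule tendstoI)
    fix e :: real assume e: "e > 0"
    have "\<forall>\<^sub>F n in sequentially. \<forall>t. cmod (B n i (cis t) - A i (cis t)) \<le> e / 2" by (rule unif) (use e in simp)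
    then show "\<forall>\<^sub>F n in sequentially. dist (B n i (cis x)) (A i (cis x)) < e"
    proof eventually_elim
      case (elim n)
      from elim[THEN spec, of x] e show ?case by (simp add: dist_norm)
    qed
  qed
  show A: "boundary_family A"
    unfolding boundary_family_def
  proof (intro allI)
    fix i t0
    \<comment> \<open>The derivative along the boundary is found as a uniform limit of derivatives
      of the dilated functions.\<close>
    have "\<exists>g. \<forall>x\<in>UNIV. (\<lambda>n. B n i (cis x)) \<longlonglongrightarrow> g x \<and>
        (g has_derivative (\<lambda>h. h *\<^sub>R (\<i> * cis x * A (Suc i) (cis x)))) (at x within UNIV)"
    proof (rule has_derivative_sequence[where ?x0.0 = 0 and l = "A i (cis 0)"])
      show "((\<lambda>x. B n i (cis x)) has_derivative (\<lambda>h. h *\<^sub>R (\<i> * cis x * B n (Suc i) (cis x)))) (at x within UNIV)" for n x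
        using Bder[of n i x] by (simp add: has_vector_derivative_def)
      fix e :: real assume e: "e > 0"
      show "\<forall>\<^sub>F n in sequentially. \<forall>x\<in>UNIV. \<forall>h. norm (h *\<^sub>R (\<i> * cis x * B n (Suc i) (cis x)) -
          h *\<^sub>R (\<i> * cis x * A (Suc i) (cis x))) \<le> e * norm h"
        using unif[OF e, of "Suc i"]
      proof eventually_elim
        case (elim n)
        show ?case
        proof (intro ballI allI)
          fix x h
          have "h *\<^sub>R (\<i> * cis x * B n (Suc i) (cis x)) - h *\<^sub>R (\<i> * cis x * A (Suc i) (cis x))
              = h *\<^sub>R (\<i> * cis x * (B n (Suc i) (cis x) - A (Suc i) (cis x)))" by (simp add: algebra_simps)
          then show "norm (h *\<^sub>R (\<i> * cis x * B n (Suc i) (cis x)) -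
            h *\<^sub>R (\<i> * cis x * A (Suc i) (cis x))) \<le> e * norm h"
            using elim by (auto simp: norm_mult mult.commute[of e] intro!: mult_left_mono)
        qed
      qed
    next
      show "(\<lambda>n. B n i (cis 0)) \<longlonglongrightarrow> A i (cis 0)" by (rule Blim)
    qed auto
    then obtain g where g: "\<And>x. (\<lambda>n. B n i (cis x)) \<longlonglongrightarrow> g x"
      "\<And>x. (g has_derivative (\<lambda>h. h *\<^sub>R (\<i> * cis x * A (Suc i) (cis x)))) (at x)" by auto
    have "g = (\<lambda>x. A i (cis x))" using LIMSEQ_unique[OF g(1) Blim] by blast
    with g(2)[of t0] show "((\<lambda>t. A i (cis t)) has_vector_derivative \<i> * cis t0 * A (Suc i) (cis t0)) (at t0)"
      by (simp add: has_vector_derivative_def)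
  qed
  assume l: "circle_functional l" and em: "\<And>n::nat. l (emode (m + int n)) = 0"
  have "(\<lambda>n. laurent m (B n 0)) \<longlonglongrightarrow> laurent m (A 0)"
    by (rule laurent_tendsto[OF A]) (use Bder unif in \<open>auto simp: boundary_family_def\<close>)
  then have "(\<lambda>n. l (laurent m (B n 0))) \<longlonglongrightarrow> l (laurent m (A 0))"
    by (rule circle_functional_tendsto[OF l])
  moreover have "l (laurent m (B n 0)) = 0" for n
  proof (rule functional_vanishes_laurent[OF l em])
    show "B n 0 holomorphic_on ball 0 (1 / r n)"
    proof (rule holomorphic_onI)
      fix z :: complex assume "z \<in> ball 0 (1 / r n)"
      then have z: "of_real (r n) * z \<in> ball 0 1" using r[of n] by (simp add: norm_mult field_simps)
      have "((\<lambda>z. of_real (r n) * z) has_field_derivative of_real (r n)) (at z)"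
        by (auto intro!: derivative_eq_intros)
      from DERIV_chain[OF der[OF z] this, of 0] have "B n 0 field_differentiable at z"
        by (auto simp: B_def[abs_def] o_def field_differentiable_def)
      then show "B n 0 field_differentiable at z within ball 0 (1 / r n)"
        by (rule field_differentiable_at_within)
    qed
    show "1 < 1 / r n" using r[of n] by (simp add: field_simps)
  qed
  ultimately show "l (laurent m (A 0)) = 0" by (simp add: LIMSEQ_const_iff)
qed

section \<open>The boost coordinate on the upper half circle\<close>

text \<open>In the coordinate \<open>u = ln tan (\<theta>/2)\<close> on the upper half circle the boosts act by
  translation, and \<open>cosh u = 1 / sin \<theta>\<close>.\<close>

definition ucoord :: "complex \<Rightarrow> real" where
  "ucoord z = ln (Im z / (1 + Re z))"

definition arc_fun :: "(real \<Rightarrow> complex) \<Rightarrow> complex \<Rightarrow> complex" where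
  "arc_fun P z = (if Im z > 0 then P (ucoord z) else 0)"

lemma circle_Re_gt:
  assumes "cmod z = 1" "Im z \<noteq> 0" shows "1 + Re z > 0" "1 - Re z > 0"
proof -
  have "(Re z)\<^sup>2 + (Im z)\<^sup>2 = 1" using assms(1) by (simp add: cmod_def)
  moreover have "(Im z)\<^sup>2 > 0" using assms(2) by simp
  ultimately have "(Re z)\<^sup>2 < 1" by linarith
  then have "(Re z)\<^sup>2 < 1\<^sup>2" by simp
  then have "\<bar>Re z\<bar> < 1" by (metis abs_1 abs_le_square_iff not_le)
  then show "1 + Re z > 0" "1 - Re z > 0" by auto
qed

lemma exp_ucoord:
  assumes "cmod z = 1" "Im z > 0"
  shows "exp (ucoord z) = Im z / (1 + Re z)"
  using assms circle_Re_gt[of z] by (simp add: ucoord_def)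

lemma cosh_ucoord:
  assumes "cmod z = 1" "Im z > 0"
  shows "cosh (ucoord z) = 1 / Im z"
proof -
  have sq: "(Re z)\<^sup>2 + (Im z)\<^sup>2 = 1" using assms(1) by (simp add: cmod_def)
  have pos: "1 + Re z > 0" using circle_Re_gt[of z] assms by simp
  have e: "exp (ucoord z) = Im z / (1 + Re z)" by (rule exp_ucoord[OF assms])
  have "cosh (ucoord z) = (Im z / (1 + Re z) + (1 + Re z) / Im z) / 2"
    unfolding cosh_def exp_minus e by simp
  also have "\<dots> = ((Im z)\<^sup>2 + (1 + Re z)\<^sup>2) / (2 * (1 + Re z) * Im z)"
    using pos assms(2) by (simp add: field_simps power2_eq_square)
  also have "(Im z)\<^sup>2 + (1 + Re z)\<^sup>2 = 2 * (1 + Re z)" using sq by (simp add: power2_eq_square algebra_simps)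
  finally show ?thesis using pos by simp
qed

text \<open>The difference quotient is at most \<open>C * \<bar>y - t\<bar>\<close>. This serves at
  the points 1 and -1, where a function on the open arc is continued by zero.\<close>

lemma has_vector_derivative_flat:
  fixes f :: "real \<Rightarrow> complex"
  assumes "f t = 0" "\<And>s. cmod (f s) \<le> C * (s - t)\<^sup>2"
  shows "(f has_vector_derivative 0) (at t)"
  unfolding has_vector_derivative_def has_derivative_iff_norm
proof (intro conjI)
  show "((\<lambda>y. norm (f y - f t - (y - t) *\<^sub>R 0) / norm (y - t)) \<longlongrightarrow> 0) (at t)"
  proof (rule Lim_null_comparison)
    show "\<forall>\<^sub>F y in at t. norm (norm (f y - f t - (y - t) *\<^sub>R 0) / norm (y - t)) \<le> C * \<bar>y - t\<bar>"
    proof (rule eventually_at_filter[THEN iffD2], rule always_eventually, intro allI impI)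
      fix y assume "y \<noteq> t"
      moreover have "cmod (f y) \<le> C * (\<bar>y - t\<bar> * \<bar>y - t\<bar>)"
        using assms(2)[of y] by (simp add: power2_eq_square)
      ultimately show "norm (norm (f y - f t - (y - t) *\<^sub>R 0) / norm (y - t)) \<le> C * \<bar>y - t\<bar>"
        using assms(1) by (simp add: divide_simps mult_ac)
    qed
    have "isCont (\<lambda>y. C * \<bar>y - t\<bar>) t" by (intro continuous_intros)
    then show "((\<lambda>y. C * \<bar>y - t\<bar>) \<longlongrightarrow> 0) (at t)" by (simp add: isCont_def)
  qed
qed simp

text \<open>As \<open>d\<theta> = du / cosh u\<close>, the relation between \<open>P j\<close> and
  \<open>P (Suc j)\<close> is differentiation in the angle. Decay like
  \<open>1 / (cosh u)\<^sup>2 = (sin \<theta>)\<^sup>2\<close> makes every derivative vanish to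
  second order at the ends of the arc, which allows the continuation by zero.\<close>

lemma smooth_family_arc:
  assumes der: "\<And>j u. (P j has_vector_derivative P (Suc j) u / of_real (cosh u)) (at u)"
    and bd: "\<And>j. \<exists>C. \<forall>u. cmod (P j u) * (cosh u)\<^sup>2 \<le> C"
  shows "smooth_family (\<lambda>j t. arc_fun (P j) (cis t))"
  unfolding smooth_family_def
proof (intro allI)
  fix j and t :: real
  consider "sin t > 0" | "sin t < 0" | "sin t = 0" by linarith
  then show "((\<lambda>t. arc_fun (P j) (cis t)) has_vector_derivative arc_fun (P (Suc j)) (cis t)) (at t)"
  proof cases
    case 1
    have op: "open {t. sin t > (0::real)}" by (intro open_Collect_less continuous_intros)
    have pos: "1 + cos t > 0" using circle_Re_gt[of "cis t"] 1 by simp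
    have ch: "cosh (ucoord (cis t)) = 1 / sin t" using cosh_ucoord[of "cis t"] 1 by simp
    have "((\<lambda>t. sin t / (1 + cos t)) has_real_derivative
        (cos t * (1 + cos t) - sin t * (- sin t)) / ((1 + cos t) * (1 + cos t))) (at t)"
      using pos by (auto intro!: derivative_eq_intros)
    from DERIV_chain2[OF DERIV_ln this]
    have "((\<lambda>t. ln (sin t / (1 + cos t))) has_real_derivative
        inverse (sin t / (1 + cos t)) * ((cos t * (1 + cos t) - sin t * (- sin t)) / ((1 + cos t) * (1 + cos t)))) (at t)"
      using 1 pos by simp
    also have "cos t * (1 + cos t) - sin t * (- sin t) = 1 + cos t"
      using sin_cos_squared_add3[of t] by (simp add: algebra_simps)
    also have "inverse (sin t / (1 + cos t)) * ((1 + cos t) / ((1 + cos t) * (1 + cos t))) = 1 / sin t"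
    proof -
      have "inverse (a / b) * (b / (b * b)) = 1 / a" if "a \<noteq> 0" "b \<noteq> 0" for a b :: real
        using that by (simp add: field_simps)
      then show ?thesis using 1 pos by simp
    qed
    finally have "((\<lambda>t. ucoord (cis t)) has_vector_derivative 1 / sin t) (at t)"
      by (simp add: ucoord_def has_real_derivative_iff_has_vector_derivative)
    from vector_diff_chain_at[OF this der[of j]]
    have "((\<lambda>t. P j (ucoord (cis t))) has_vector_derivative (P (Suc j) (ucoord (cis t)))) (at t)"
      unfolding ch using 1 by (simp add: o_def scaleR_conv_of_real)
    then have "((\<lambda>t. arc_fun (P j) (cis t)) has_vector_derivative P (Suc j) (ucoord (cis t))) (at t)"
      by (rule has_vector_derivative_transform_within_open[OF _ op]) (use 1 in \<open>auto simp: arc_fun_def\<close>)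
    then show ?thesis using 1 by (simp add: arc_fun_def)
  next
    case 2
    have op: "open {t. sin t < (0::real)}" by (intro open_Collect_less continuous_intros)
    have "((\<lambda>t. 0) has_vector_derivative (0::complex)) (at t)" by simp
    then have "((\<lambda>t. arc_fun (P j) (cis t)) has_vector_derivative 0) (at t)"
      by (rule has_vector_derivative_transform_within_open[OF _ op]) (use 2 in \<open>auto simp: arc_fun_def\<close>)
    then show ?thesis using 2 by (simp add: arc_fun_def)
  next
    case 3
    obtain C where C: "\<And>u. cmod (P j u) * (cosh u)\<^sup>2 \<le> C" using bd by blast
    have C0: "C \<ge> 0" using C[of 0] by (meson norm_ge_zero mult_nonneg_nonneg order_trans zero_le_power2)
    have "cmod (arc_fun (P j) (cis s)) \<le> C * (s - t)\<^sup>2" for s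
    proof (cases "sin s > 0")
      case True
      have ch: "cosh (ucoord (cis s)) = 1 / sin s" using cosh_ucoord[of "cis s"] True by simp
      from C[of "ucoord (cis s)"] have "cmod (P j (ucoord (cis s))) \<le> C * (sin s)\<^sup>2"
        unfolding ch using True by (simp add: field_simps)
      moreover have "\<bar>sin s\<bar> \<le> \<bar>s - t\<bar>"
        using abs_sin_x_le_abs_x[of "s - t"] 3 sin_diff[of s t] sin_zero_abs_cos_one[OF 3] by (simp add: abs_mult)
      then have "(sin s)\<^sup>2 \<le> (s - t)\<^sup>2" by (rule abs_le_square_iff[THEN iffD1])
      ultimately show ?thesis using C0 True by (auto simp: arc_fun_def intro: order_trans mult_left_mono)
    qed (use C0 in \<open>auto simp: arc_fun_def\<close>)
    from has_vector_derivative_flat[OF _ this] show ?thesis using 3 by (simp add: arc_fun_def)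
  qed
qed

section \<open>Test functions given by rapidly decaying functions of the boost coordinate\<close>

definition rapid_family :: "(nat \<Rightarrow> real \<Rightarrow> complex) \<Rightarrow> bool" where
  "rapid_family q \<longleftrightarrow> smooth_family q \<and> (\<forall>i M. \<exists>C. \<forall>u. cmod (q i u) * cosh u ^ M \<le> C)"

text \<open>\<open>arc_cderiv j q m a i\<close> is the \<open>j\<close>-th derivative of \<open>cosh\<^sup>m sinh\<^sup>a q\<^sub>i\<close> for \<open>d/d\<theta> = cosh u d/du\<close>.\<close>

primrec arc_cderiv :: "nat \<Rightarrow> (nat \<Rightarrow> real \<Rightarrow> complex) \<Rightarrow> int \<Rightarrow> nat \<Rightarrow> nat \<Rightarrow> real \<Rightarrow> complex" where
  "arc_cderiv 0 q m a i u = of_real (cosh u powi m * sinh u ^ a) * q i u"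
| "arc_cderiv (Suc j) q m a i u = of_int m * arc_cderiv j q m (Suc a) i u
     + of_nat a * arc_cderiv j q (m + 2) (a - 1) i u + arc_cderiv j q (m + 1) a (Suc i) u"

lemma arc_cderiv_deriv:
  assumes q: "smooth_family q"
  shows "(arc_cderiv j q m a i has_vector_derivative arc_cderiv (Suc j) q m a i u / of_real (cosh u)) (at u)"
proof (induction j arbitrary: m a i)
  case 0
  have c: "cosh u > 0" by simp
  have "((\<lambda>u. cosh u powi m * sinh u ^ a) has_real_derivative
      (of_int m * cosh u powi (m - 1) * sinh u) * sinh u ^ a + cosh u powi m * (real a * sinh u ^ (a - 1) * cosh u)) (at u)"
    using c by (auto intro!: derivative_eq_intros simp: algebra_simps)
  moreover have "of_int m * cosh u powi (m - 1) * sinh u * sinh u ^ a + cosh u powi m * (real a * sinh u ^ (a - 1) * cosh u)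
      = (of_int m * (cosh u powi m * sinh u ^ Suc a) + real a * (cosh u powi (m + 2) * sinh u ^ (a - 1))) / cosh u"
    using c by (simp add: power_int_diff power_int_add field_simps power2_eq_square)
  ultimately have "((\<lambda>u. cosh u powi m * sinh u ^ a) has_real_derivative
      (of_int m * (cosh u powi m * sinh u ^ Suc a) + real a * (cosh u powi (m + 2) * sinh u ^ (a - 1))) / cosh u) (at u)"
    by simp
  then have "((\<lambda>u. complex_of_real (cosh u powi m * sinh u ^ a)) has_vector_derivative
      of_real ((of_int m * (cosh u powi m * sinh u ^ Suc a) + real a * (cosh u powi (m + 2) * sinh u ^ (a - 1))) / cosh u)) (at u)"
    by (rule has_vector_derivative_of_real[unfolded has_real_derivative_iff_has_vector_derivative[symmetric]])
  from has_vector_derivative_mult[OF this smooth_familyD[OF q, of i u]]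
  have "((\<lambda>u. complex_of_real (cosh u powi m * sinh u ^ a) * q i u) has_vector_derivative
      complex_of_real (cosh u powi m * sinh u ^ a) * q (Suc i) u +
      of_real ((of_int m * (cosh u powi m * sinh u ^ Suc a) + real a * (cosh u powi (m + 2) * sinh u ^ (a - 1))) / cosh u) * q i u) (at u)" .
  moreover have "complex_of_real (cosh u powi m * sinh u ^ a) * q (Suc i) u +
      of_real ((of_int m * (cosh u powi m * sinh u ^ Suc a) + real a * (cosh u powi (m + 2) * sinh u ^ (a - 1))) / cosh u) * q i u
      = arc_cderiv (Suc 0) q m a i u / of_real (cosh u)"
  proof -
    have m1: "cosh u powi (m + 1) = cosh u powi m * cosh u" using c by (simp add: power_int_add)
    have "complex_of_real (cosh u) \<noteq> 0" using c by simp
    then show ?thesis unfolding arc_cderiv.simps m1 by (simp add: field_simps)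
  qed
  ultimately show ?case by simp
next
  case (Suc j)
  have eq: "arc_cderiv (Suc j) q m a i = (\<lambda>u. of_int m * arc_cderiv j q m (Suc a) i u
     + of_nat a * arc_cderiv j q (m + 2) (a - 1) i u + arc_cderiv j q (m + 1) a (Suc i) u)" by (simp add: fun_eq_iff)
  have "((\<lambda>u. of_int m * arc_cderiv j q m (Suc a) i u
     + of_nat a * arc_cderiv j q (m + 2) (a - 1) i u + arc_cderiv j q (m + 1) a (Suc i) u) has_vector_derivative
     of_int m * (arc_cderiv (Suc j) q m (Suc a) i u / of_real (cosh u))
     + of_nat a * (arc_cderiv (Suc j) q (m + 2) (a - 1) i u / of_real (cosh u))
     + arc_cderiv (Suc j) q (m + 1) a (Suc i) u / of_real (cosh u)) (at u)"
    by (intro has_vector_derivative_add has_vector_derivative_mult_right Suc.IH)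
  moreover have "of_int m * (arc_cderiv (Suc j) q m (Suc a) i u / of_real (cosh u))
     + of_nat a * (arc_cderiv (Suc j) q (m + 2) (a - 1) i u / of_real (cosh u))
     + arc_cderiv (Suc j) q (m + 1) a (Suc i) u / of_real (cosh u)
     = arc_cderiv (Suc (Suc j)) q m a i u / of_real (cosh u)"
    unfolding arc_cderiv.simps(2)[of "Suc j"] by (simp only: add_divide_distrib times_divide_eq_right)
  ultimately show ?case unfolding eq by (simp only:)
qed

lemma cosh_power_mono: "M \<le> M' \<Longrightarrow> cosh u ^ M \<le> cosh (u::real) ^ M'"
  by (rule power_increasing) (auto simp: cosh_real_ge_1)

lemma abs_sinh_le_cosh: "\<bar>sinh u\<bar> \<le> cosh (u::real)"
  by (simp add: sinh_def cosh_def abs_le_iff)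

text \<open>\<open>C\<close> and \<open>M\<close> do not depend on \<open>q\<close>, so finitely
  many weighted suprema of \<open>q\<close> control the angular derivatives linearly. The spare
  weight \<open>cosh ^ K\<close> has two uses: \<open>K = 2\<close> gives the flatness required for
  gluing, \<open>K = 0\<close> the bound on the derivative itself.\<close>

lemma arc_cderiv_bound:
  "\<exists>C M. C \<ge> 0 \<and> (\<forall>q e. (\<forall>k\<le>i + j. \<forall>u. cmod (q k u) * cosh u ^ M \<le> e) \<longrightarrow>
     (\<forall>u. cmod (arc_cderiv j q m a i u) * cosh u ^ K \<le> C * e))"
proof (induction j arbitrary: m a i)
  case 0
  show ?case
  \<comment> \<open>\<open>cosh u powi m\<close> and \<open>sinh u ^ a\<close> are each bounded by a
    power of \<open>cosh u\<close>; the requested weight \<open>K\<close> is added.\<close>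
  proof (intro exI[of _ "1 :: real"] exI[of _ "nat \<bar>m\<bar> + a + K"] conjI allI impI)
    fix q :: "nat \<Rightarrow> real \<Rightarrow> complex" and e u :: real
    assume *: "\<forall>k\<le>i + 0. \<forall>u. cmod (q k u) * cosh u ^ (nat \<bar>m\<bar> + a + K) \<le> e"
    have "cosh u powi m \<le> cosh u ^ nat \<bar>m\<bar>"
      using power_int_increasing[of m "\<bar>m\<bar>" "cosh u"] cosh_real_ge_1[of u] by (simp add: power_int_def)
    moreover have "\<bar>sinh u\<bar> ^ a \<le> cosh u ^ a" by (intro power_mono abs_sinh_le_cosh) auto
    ultimately have "cosh u powi m * \<bar>sinh u\<bar> ^ a \<le> cosh u ^ nat \<bar>m\<bar> * cosh u ^ a"
      by (intro mult_mono) auto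
    then have "cosh u powi m * \<bar>sinh u\<bar> ^ a * (cmod (q i u) * cosh u ^ K)
       \<le> cosh u ^ nat \<bar>m\<bar> * cosh u ^ a * (cmod (q i u) * cosh u ^ K)" by (intro mult_right_mono) auto
    also have "\<dots> = cmod (q i u) * cosh u ^ (nat \<bar>m\<bar> + a + K)" by (simp add: power_add mult_ac)
    also have "\<dots> \<le> e" using * by simp
    also have "cosh u powi m * \<bar>sinh u\<bar> ^ a * (cmod (q i u) * cosh u ^ K) = cmod (arc_cderiv 0 q m a i u) * cosh u ^ K"
      by (simp add: norm_mult norm_power abs_mult power_abs mult_ac norm_power_int)
    finally show "cmod (arc_cderiv 0 q m a i u) * cosh u ^ K \<le> 1 * e" by simp
  qed simp
next
  case (Suc j)
  obtain C1 M1 where 1: "C1 \<ge> 0" "\<forall>q e. (\<forall>k\<le>i + j. \<forall>u. cmod (q k u) * cosh u ^ M1 \<le> e) \<longrightarrow>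
     (\<forall>u. cmod (arc_cderiv j q m (Suc a) i u) * cosh u ^ K \<le> C1 * e)" using Suc.IH[of i m "Suc a"] by (elim exE conjE)
  obtain C2 M2 where 2: "C2 \<ge> 0" "\<forall>q e. (\<forall>k\<le>i + j. \<forall>u. cmod (q k u) * cosh u ^ M2 \<le> e) \<longrightarrow>
     (\<forall>u. cmod (arc_cderiv j q (m + 2) (a - 1) i u) * cosh u ^ K \<le> C2 * e)" using Suc.IH[of i "m + 2" "a - 1"] by (elim exE conjE)
  obtain C3 M3 where 3: "C3 \<ge> 0" "\<forall>q e. (\<forall>k\<le>Suc i + j. \<forall>u. cmod (q k u) * cosh u ^ M3 \<le> e) \<longrightarrow>
     (\<forall>u. cmod (arc_cderiv j q (m + 1) a (Suc i) u) * cosh u ^ K \<le> C3 * e)" using Suc.IH[of "Suc i" "m + 1" a] by (elim exE conjE)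
  define M where "M = max M1 (max M2 M3)"
  show ?case
  proof (intro exI[of _ "\<bar>of_int m\<bar> * C1 + real a * C2 + C3"] exI[of _ M] conjI allI impI)
    fix q :: "nat \<Rightarrow> real \<Rightarrow> complex" and e u :: real
    assume *: "\<forall>k\<le>i + Suc j. \<forall>u. cmod (q k u) * cosh u ^ M \<le> e"
    have le: "cmod (q k u) * cosh u ^ M' \<le> e" if "k \<le> i + Suc j" "M' \<le> M" for k u M'
    proof -
      have "cmod (q k u) * cosh u ^ M' \<le> cmod (q k u) * cosh u ^ M"
        by (intro mult_left_mono cosh_power_mono that) auto
      then show ?thesis using * that by (meson order_trans)
    qed
    have b1: "cmod (arc_cderiv j q m (Suc a) i u) * cosh u ^ K \<le> C1 * e"
      by (rule 1(2)[THEN spec, THEN spec, THEN mp, THEN spec]) (auto intro!: le simp: M_def)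
    have b2: "cmod (arc_cderiv j q (m + 2) (a - 1) i u) * cosh u ^ K \<le> C2 * e"
      by (rule 2(2)[THEN spec, THEN spec, THEN mp, THEN spec]) (auto intro!: le simp: M_def)
    have b3: "cmod (arc_cderiv j q (m + 1) a (Suc i) u) * cosh u ^ K \<le> C3 * e"
      by (rule 3(2)[THEN spec, THEN spec, THEN mp, THEN spec]) (auto intro!: le simp: M_def)
    have "cmod (arc_cderiv (Suc j) q m a i u) \<le> \<bar>of_int m\<bar> * cmod (arc_cderiv j q m (Suc a) i u)
        + real a * cmod (arc_cderiv j q (m + 2) (a - 1) i u) + cmod (arc_cderiv j q (m + 1) a (Suc i) u)"
      unfolding arc_cderiv.simps
      by (rule order_trans[OF norm_triangle_ineq] add_mono order_refl)+ (simp_all add: norm_mult)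
    then have "cmod (arc_cderiv (Suc j) q m a i u) * cosh u ^ K
      \<le> (\<bar>of_int m\<bar> * cmod (arc_cderiv j q m (Suc a) i u)
        + real a * cmod (arc_cderiv j q (m + 2) (a - 1) i u) + cmod (arc_cderiv j q (m + 1) a (Suc i) u)) * cosh u ^ K"
      by (rule mult_right_mono) simp
    also have "\<dots> = \<bar>of_int m\<bar> * (cmod (arc_cderiv j q m (Suc a) i u) * cosh u ^ K)
        + real a * (cmod (arc_cderiv j q (m + 2) (a - 1) i u) * cosh u ^ K) + cmod (arc_cderiv j q (m + 1) a (Suc i) u) * cosh u ^ K"
      by (simp only: algebra_simps)
    also have "\<dots> \<le> \<bar>of_int m\<bar> * (C1 * e) + real a * (C2 * e) + C3 * e"
      by (intro add_mono mult_left_mono b1 b2 b3) auto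
    finally show "cmod (arc_cderiv (Suc j) q m a i u) * cosh u ^ K \<le> (\<bar>of_int m\<bar> * C1 + real a * C2 + C3) * e"
      by (simp only: algebra_simps)
  qed (use 1(1) 2(1) 3(1) in auto)
qed

definition arc_embed :: "nat \<Rightarrow> (real \<Rightarrow> complex) \<Rightarrow> smooth_circle" where
  "arc_embed d q = circ (\<lambda>z. if Im z > 0 then of_real (Im z powi (int d - 1)) * q (ucoord z) else 0)"

lemma rapid_family_bound:
  assumes "rapid_family q"
  obtains C where "\<And>k u. k \<le> N \<Longrightarrow> cmod (q k u) * cosh u ^ M \<le> C"
proof -
  have "\<forall>k. \<exists>C. \<forall>u. cmod (q k u) * cosh u ^ M \<le> C" using assms by (auto simp: rapid_family_def)
  then obtain c where c: "\<And>k u. cmod (q k u) * cosh u ^ M \<le> c k" by metis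
  have c0: "0 \<le> c k" for k using c[of k 0] by (meson norm_ge_zero mult_nonneg_nonneg order_trans zero_le_power cosh_real_nonneg)
  show ?thesis
  proof (rule that)
    fix k u assume "k \<le> N"
    then have "c k \<le> (\<Sum>k\<le>N. c k)" using c0 by (intro member_le_sum) auto
    with c[of k u] show "cmod (q k u) * cosh u ^ M \<le> (\<Sum>k\<le>N. c k)" by simp
  qed
qed

lemma
  assumes q: "rapid_family q"
  shows apply_arc_embed: "apply_circle (arc_embed d (q 0)) z =
      (if cmod z = 1 \<and> Im z > 0 then of_real (Im z powi (int d - 1)) * q 0 (ucoord z) else 0)"
    and cderiv_arc_embed: "cderiv (arc_embed d (q 0)) j t = arc_fun (arc_cderiv j q (1 - int d) 0 0) (cis t)"
proof -
  have sq: "smooth_family q" using q by (simp add: rapid_family_def)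
  have *: "smooth_family (\<lambda>j t. arc_fun (arc_cderiv j q (1 - int d) 0 0) (cis t))"
  proof (rule smooth_family_arc)
    show "(arc_cderiv j q (1 - int d) 0 0 has_vector_derivative arc_cderiv (Suc j) q (1 - int d) 0 0 u / of_real (cosh u)) (at u)" for j u
      by (rule arc_cderiv_deriv[OF sq])
    fix j
    obtain C M where C: "\<forall>q e. (\<forall>k\<le>0 + j. \<forall>u. cmod (q k u) * cosh u ^ M \<le> e) \<longrightarrow>
        (\<forall>u. cmod (arc_cderiv j q (1 - int d) 0 0 u) * (cosh u)\<^sup>2 \<le> C * e)"
      using arc_cderiv_bound[of 0 j "1 - int d" 0 2] by (elim exE conjE)
    obtain e where "\<And>k u. k \<le> j \<Longrightarrow> cmod (q k u) * cosh u ^ M \<le> e" using rapid_family_bound[OF q] by metis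
    then have "\<forall>u. cmod (arc_cderiv j q (1 - int d) 0 0 u) * (cosh u)\<^sup>2 \<le> C * e"
      by (intro C[THEN spec, THEN spec, THEN mp]) auto
    then show "\<exists>C. \<forall>u. cmod (arc_cderiv j q (1 - int d) 0 0 u) * (cosh u)\<^sup>2 \<le> C" by blast
  qed
  have eq: "(if Im (cis t) > 0 then of_real (Im (cis t) powi (int d - 1)) * q 0 (ucoord (cis t)) else 0)
      = arc_fun (arc_cderiv 0 q (1 - int d) 0 0) (cis t)" for t
  proof -
    have "cosh (ucoord (cis t)) powi (1 - int d) = sin t powi (int d - 1)" if "sin t > 0"
      using cosh_ucoord[of "cis t"] that power_int_minus[of "sin t" "1 - int d"]
      by (simp add: power_int_one_over power_int_inverse divide_inverse)
    then show ?thesis by (simp add: arc_fun_def)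
  qed
  show "apply_circle (arc_embed d (q 0)) z =
      (if cmod z = 1 \<and> Im z > 0 then of_real (Im z powi (int d - 1)) * q 0 (ucoord z) else 0)"
    unfolding arc_embed_def using apply_circ[OF * eq, of z] by auto
  show "cderiv (arc_embed d (q 0)) j t = arc_fun (arc_cderiv j q (1 - int d) 0 0) (cis t)"
    unfolding arc_embed_def using cderiv_circ[OF * eq] by simp
qed

lemma CN_norm_arc_bound:
  "\<exists>C M. C \<ge> 0 \<and> (\<forall>q e. rapid_family q \<longrightarrow> (\<forall>k\<le>N. \<forall>u. cmod (q k u) * cosh u ^ M \<le> e) \<longrightarrow>
     CN_norm N (arc_embed d (q 0)) \<le> C * e)"
proof -
  have "\<forall>j. \<exists>C M. C \<ge> 0 \<and> (\<forall>q e. (\<forall>k\<le>0 + j. \<forall>u. cmod (q k u) * cosh u ^ M \<le> e) \<longrightarrow>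
        (\<forall>u. cmod (arc_cderiv j q (1 - int d) 0 0 u) * cosh u ^ 0 \<le> C * e))"
    using arc_cderiv_bound by blast
  then obtain C M where CM: "\<And>j. C j \<ge> 0" "\<And>j. \<forall>q e. (\<forall>k\<le>0 + j. \<forall>u. cmod (q k u) * cosh u ^ M j \<le> e) \<longrightarrow>
        (\<forall>u. cmod (arc_cderiv j q (1 - int d) 0 0 u) * cosh u ^ 0 \<le> C j * e)"
    by metis
  define C' where "C' = (\<Sum>j\<le>N. C j)"
  \<comment> \<open>A sum of exponents dominates each of them, and \<open>cosh \<ge> 1\<close> makes
    the larger exponent the stronger weight.\<close>
  define M' where "M' = (\<Sum>j\<le>N. M j)"
  show ?thesis
  proof (intro exI[of _ "(real N + 1) * C'"] exI[of _ M'] conjI allI impI)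
    show "(real N + 1) * C' \<ge> 0" unfolding C'_def by (intro mult_nonneg_nonneg sum_nonneg CM) auto
    fix q :: "nat \<Rightarrow> real \<Rightarrow> complex" and e
    assume q: "rapid_family q" and *: "\<forall>k\<le>N. \<forall>u. cmod (q k u) * cosh u ^ M' \<le> e"
    have e0: "0 \<le> e" using *[rule_format, of 0 0] by (meson norm_ge_zero mult_nonneg_nonneg order_trans zero_le_power cosh_real_nonneg le0)
    have "CN_norm N (arc_embed d (q 0)) \<le> (real N + 1) * (C' * e)"
    proof (rule CN_norm_le)
      fix j t assume j: "j \<le> N"
      have "\<forall>u. cmod (arc_cderiv j q (1 - int d) 0 0 u) * cosh u ^ 0 \<le> C j * e"
      proof (rule CM(2)[THEN spec, THEN spec, THEN mp], intro allI impI)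
        fix k u assume "k \<le> 0 + j"
        then have k: "k \<le> N" using j by simp
        have "M j \<le> M'" unfolding M'_def using j by (intro member_le_sum) auto
        then have "cmod (q k u) * cosh u ^ M j \<le> cmod (q k u) * cosh u ^ M'"
          by (intro mult_left_mono cosh_power_mono) auto
        then show "cmod (q k u) * cosh u ^ M j \<le> e" using * k by (meson order_trans)
      qed
      moreover have "C j * e \<le> C' * e"
        unfolding C'_def using j CM(1) e0 by (intro mult_right_mono member_le_sum) auto
      ultimately have "cmod (arc_cderiv j q (1 - int d) 0 0 u) \<le> C' * e" for u by (simp, meson order_trans)
      moreover have "0 \<le> C' * e" unfolding C'_def by (intro mult_nonneg_nonneg sum_nonneg CM e0)
      ultimately show "cmod (cderiv (arc_embed d (q 0)) j t) \<le> C' * e"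
        unfolding cderiv_arc_embed[OF q] by (simp add: arc_fun_def)
    qed
    then show "CN_norm N (arc_embed d (q 0)) \<le> (real N + 1) * C' * e" by (simp add: mult_ac)
  qed
qed

lemma rapid_family_diff:
  assumes "rapid_family q" "rapid_family q'"
  shows "rapid_family (\<lambda>i u. q i u - q' i u)"
  unfolding rapid_family_def
proof (intro conjI allI)
  show "smooth_family (\<lambda>i u. q i u - q' i u)"
    using assms by (auto simp: rapid_family_def smooth_family_def intro!: has_vector_derivative_diff)
  fix i M
  obtain C C' where C: "\<forall>u. cmod (q i u) * cosh u ^ M \<le> C" "\<forall>u. cmod (q' i u) * cosh u ^ M \<le> C'"
    using assms by (metis rapid_family_def)
  have "cmod (q i u - q' i u) * cosh u ^ M \<le> C + C'" for u
  proof -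
    have "cmod (q i u - q' i u) * cosh u ^ M \<le> (cmod (q i u) + cmod (q' i u)) * cosh u ^ M"
      by (intro mult_right_mono norm_triangle_ineq4) auto
    then show ?thesis using C[THEN spec, of u] by (simp add: algebra_simps)
  qed
  then show "\<exists>C. \<forall>u. cmod (q i u - q' i u) * cosh u ^ M \<le> C" by blast
qed

lemma rapid_family_scale:
  assumes "rapid_family q"
  shows "rapid_family (\<lambda>i u. c * q i u)"
  unfolding rapid_family_def
proof (intro conjI allI)
  show "smooth_family (\<lambda>i u. c * q i u)"
    using assms by (auto simp: rapid_family_def smooth_family_def intro!: has_vector_derivative_mult_right)
  fix i M
  obtain C where C: "\<forall>u. cmod (q i u) * cosh u ^ M \<le> C" using assms by (metis rapid_family_def)
  have "cmod (c * q i u) * cosh u ^ M \<le> cmod c * C" for u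
    unfolding norm_mult mult.assoc using C by (intro mult_left_mono) auto
  then show "\<exists>C. \<forall>u. cmod (c * q i u) * cosh u ^ M \<le> C" by blast
qed

lemma arc_embed_diff:
  assumes "rapid_family q" "rapid_family q'"
  shows "arc_embed d (q 0) - arc_embed d (q' 0) = arc_embed d (\<lambda>u. q 0 u - q' 0 u)"
  by (rule circle_eqI)
    (simp add: apply_arc_embed[OF assms(1)] apply_arc_embed[OF assms(2)] apply_arc_embed[OF rapid_family_diff[OF assms]] algebra_simps)

lemma arc_embed_scale:
  assumes "rapid_family q"
  shows "scale_circle c (arc_embed d (q 0)) = arc_embed d (\<lambda>u. c * q 0 u)"
  by (rule circle_eqI)
    (simp add: apply_arc_embed[OF assms(1)] apply_arc_embed[OF rapid_family_scale[OF assms]] algebra_simps)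

section \<open>The action of boosts and rotations on test functions\<close>

lemma cosh_add_le: "cosh (x + y) \<le> 2 * cosh x * cosh (y::real)"
proof -
  have "sinh x * sinh y \<le> \<bar>sinh x\<bar> * \<bar>sinh y\<bar>" by (metis abs_ge_self abs_mult)
  also have "\<dots> \<le> cosh x * cosh y" by (intro mult_mono abs_sinh_le_cosh) auto
  finally show ?thesis by (simp add: cosh_add)
qed

lemma rapid_family_shift:
  assumes "rapid_family q"
  shows "rapid_family (\<lambda>i u. q i (u - t))"
  unfolding rapid_family_def
proof (intro conjI allI)
  have "((\<lambda>u. q i (u - t)) has_vector_derivative q (Suc i) (u - t)) (at u)" for i u
  proof -
    have "((\<lambda>u. u - t) has_vector_derivative 1) (at u)"
      by (auto intro!: derivative_eq_intros simp: has_real_derivative_iff_has_vector_derivative[symmetric])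
    from vector_diff_chain_at[OF this smooth_familyD[of q i]] show ?thesis
      using assms by (simp add: rapid_family_def o_def)
  qed
  then show "smooth_family (\<lambda>i u. q i (u - t))" by (simp add: smooth_family_def)
  fix i M
  obtain C where C: "\<forall>u. cmod (q i u) * cosh u ^ M \<le> C" using assms by (metis rapid_family_def)
  have "cmod (q i (u - t)) * cosh u ^ M \<le> C * (2 * cosh t) ^ M" for u
  proof -
    have "cosh u \<le> cosh (u - t) * (2 * cosh t)" using cosh_add_le[of "u - t" t] by (simp add: mult_ac)
    then have "cosh u ^ M \<le> (cosh (u - t) * (2 * cosh t)) ^ M" by (intro power_mono) auto
    then have "cmod (q i (u - t)) * cosh u ^ M \<le> cmod (q i (u - t)) * (cosh (u - t) ^ M * (2 * cosh t) ^ M)"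
      by (intro mult_left_mono) (auto simp: power_mult_distrib)
    also have "\<dots> \<le> C * (2 * cosh t) ^ M"
      unfolding mult.assoc[symmetric] using C by (intro mult_right_mono) auto
    finally show ?thesis .
  qed
  then show "\<exists>C. \<forall>u. cmod (q i (u - t)) * cosh u ^ M \<le> C" by blast
qed


text \<open>\<open>w\<close> is the inverse boost of \<open>z\<close>, and
  \<open>(cmod D)\<^sup>2\<close> is the value of \<open>X_mob\<close> there. Since
  \<open>Im / (1 + Re)\<close> is the tangent of half the angle, the last two identities together
  say that the inverse boost multiplies this tangent by \<open>exp (- t)\<close>.\<close>

lemma apply_\<beta>_boost:
  fixes t :: real
  defines "c \<equiv> cosh (t / 2)" and "s \<equiv> sinh (t / 2)"
  assumes z: "cmod z = 1"
  defines "D \<equiv> of_real s * z + of_real c" and "w \<equiv> (of_real c * z + of_real s) / (of_real s * z + of_real c)"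
  shows "apply_circle (\<beta> d (boost t) f) z = of_real ((cmod D)\<^sup>2 powi (int d - 1)) * apply_circle f w"
    and "cmod w = 1" "D \<noteq> 0" "Im w = Im z / (cmod D)\<^sup>2" "1 + Re w = exp t * (1 + Re z) / (cmod D)\<^sup>2"
proof -
  have cs: "c\<^sup>2 - s\<^sup>2 = 1" by (simp add: c_def s_def cosh_square_eq)
  have ab: "(cmod (of_real c))\<^sup>2 - (cmod (- of_real s))\<^sup>2 = 1"
    and ab': "(cmod (of_real c))\<^sup>2 - (cmod (of_real s))\<^sup>2 = 1" using cs by auto
  show D0: "D \<noteq> 0" using mob_denominator_nonzero[OF ab', of z] z by (simp add: D_def)
  have inv: "inv (boost t) z = w"
    unfolding boost_def c_def[symmetric] s_def[symmetric] mob_inverse(3)[OF ab]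
    using z by (simp add: mob_def w_def)
  have w: "w = mob (of_real c) (of_real s) z" using z by (simp add: mob_def w_def)
  show w1: "cmod w = 1" unfolding w using cmod_mob(2)[OF ab', of z] z by simp
  have "X_mob (boost t) w = inverse (of_real ((cmod (- of_real s * w + of_real c))\<^sup>2))"
    unfolding boost_def c_def[symmetric] s_def[symmetric] using X_mob_eq[OF ab w1] by simp
  \<comment> \<open>The denominators of a transformation and of its inverse are reciprocal; this is
    where \<open>c\<^sup>2 - s\<^sup>2 = 1\<close> enters.\<close>
  also have "- of_real s * w + of_real c = 1 / D"
  proof -
    have "(- of_real s * w + of_real c) * D = - of_real s * (w * D) + of_real c * D" by (simp add: algebra_simps)
    also have "w * D = of_real c * z + of_real s" using D0 by (simp add: w_def D_def)
    also have "- of_real s * (of_real c * z + of_real s) + of_real c * D = of_real (c\<^sup>2 - s\<^sup>2)"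
      by (simp add: D_def algebra_simps power2_eq_square)
    finally show ?thesis using D0 cs by (simp add: field_simps)
  qed
  finally have X: "X_mob (boost t) w = of_real ((cmod D)\<^sup>2)" by (simp add: norm_divide power_divide)
  show "apply_circle (\<beta> d (boost t) f) z = of_real ((cmod D)\<^sup>2 powi (int d - 1)) * apply_circle f w"
    unfolding apply_\<beta>[OF boost_in_Mob] inv X by (simp only: of_real_power_int)
  have zz: "(Re z)\<^sup>2 + (Im z)\<^sup>2 = 1" using z by (simp add: cmod_def)
  have DD: "(cmod D)\<^sup>2 = s\<^sup>2 + c\<^sup>2 + 2 * c * s * Re z"
  proof -
    have "(cmod D)\<^sup>2 = (s * Re z + c)\<^sup>2 + (s * Im z)\<^sup>2" by (simp add: D_def cmod_power2)
    also have "\<dots> = s\<^sup>2 * ((Re z)\<^sup>2 + (Im z)\<^sup>2) + c\<^sup>2 + 2 * c * s * Re z" by (simp add: power2_eq_square algebra_simps)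
    finally show ?thesis unfolding zz by simp
  qed
  have "w = (of_real c * z + of_real s) * cnj D / of_real ((cmod D)\<^sup>2)"
    unfolding w_def D_def[symmetric] complex_norm_square using D0 by simp
  moreover have "(of_real c * z + of_real s) * cnj D = Complex (2 * c * s + (c\<^sup>2 + s\<^sup>2) * Re z) (Im z)"
  proof (rule complex_eqI)
    have "Re ((of_real c * z + of_real s) * cnj D) = c * s * ((Re z)\<^sup>2 + (Im z)\<^sup>2) + c * s + (c\<^sup>2 + s\<^sup>2) * Re z"
      by (simp add: D_def power2_eq_square algebra_simps)
    then show "Re ((of_real c * z + of_real s) * cnj D) = Re (Complex (2 * c * s + (c\<^sup>2 + s\<^sup>2) * Re z) (Im z))"
      unfolding zz by simp
    have "Im ((of_real c * z + of_real s) * cnj D) = (c\<^sup>2 - s\<^sup>2) * Im z"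
      by (simp add: D_def power2_eq_square algebra_simps)
    then show "Im ((of_real c * z + of_real s) * cnj D) = Im (Complex (2 * c * s + (c\<^sup>2 + s\<^sup>2) * Re z) (Im z))"
      unfolding cs by simp
  qed
  ultimately have w': "w = Complex (2 * c * s + (c\<^sup>2 + s\<^sup>2) * Re z) (Im z) / of_real ((cmod D)\<^sup>2)" by simp
  have Dp: "(cmod D)\<^sup>2 > 0" using D0 by simp
  show "Im w = Im z / (cmod D)\<^sup>2" unfolding w' by (simp add: Im_divide_of_real)
  have Re: "Re w = (2 * c * s + (c\<^sup>2 + s\<^sup>2) * Re z) / (cmod D)\<^sup>2" unfolding w' by (simp add: Re_divide_of_real)
  have "c + s = exp (t / 2)" by (simp add: c_def s_def cosh_plus_sinh)
  then have "(c + s)\<^sup>2 = exp t" by (simp add: power2_eq_square flip: exp_add)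
  then have "exp t * (1 + Re z) = (cmod D)\<^sup>2 + (2 * c * s + (c\<^sup>2 + s\<^sup>2) * Re z)"
    unfolding DD by (simp add: power2_eq_square algebra_simps flip: \<open>(c + s)\<^sup>2 = exp t\<close>)
  then show "1 + Re w = exp t * (1 + Re z) / (cmod D)\<^sup>2"
    unfolding Re using Dp by (simp add: field_simps)
qed

text \<open>The covariance factor contributes \<open>(cmod D)\<^sup>2\<close> to the power
  \<open>d - 1\<close>, and the imaginary part loses exactly this factor under
  \<open>z \<mapsto> w\<close>. The weight \<open>Im z powi (d - 1)\<close> is thus restored and
  only a translation of the coordinate remains.\<close>

lemma \<beta>_boost_arc:
  assumes q: "rapid_family q"
  shows "\<beta> d (boost t) (arc_embed d (q 0)) = arc_embed d (\<lambda>u. q 0 (u - t))"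
proof (rule circle_eqI)
  fix x
  define z where "z = cis x"
  have z: "cmod z = 1" by (simp add: z_def)
  note B = apply_\<beta>_boost[OF z, where t = t]
  define D where "D = of_real (sinh (t / 2)) * z + of_real (cosh (t / 2))"
  define w where "w = (of_real (cosh (t / 2)) * z + of_real (sinh (t / 2))) / (of_real (sinh (t / 2)) * z + of_real (cosh (t / 2)))"
  note B = B[folded w_def D_def]
  have Dp: "(cmod D)\<^sup>2 > 0" using B(3) by simp
  have sgn: "Im w > 0 \<longleftrightarrow> Im z > 0" using Dp unfolding B(4) by (simp add: zero_less_divide_iff)
  have u: "ucoord w = ucoord z - t" if "Im z > 0"
  proof -
    have "1 + Re z > 0" using circle_Re_gt[of z] z that by simp
    have "Im w / (1 + Re w) = exp (- t) * (Im z / (1 + Re z))"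
      unfolding B(4,5) using Dp by (simp add: field_simps exp_minus)
    then have "ucoord w = ln (exp (- t) * (Im z / (1 + Re z)))" by (simp add: ucoord_def)
    also have "\<dots> = - t + ln (Im z / (1 + Re z))"
      using \<open>1 + Re z > 0\<close> that by (subst ln_mult) auto
    finally show ?thesis by (simp add: ucoord_def)
  qed
  have p: "(cmod D)\<^sup>2 powi (int d - 1) * Im w powi (int d - 1) = Im z powi (int d - 1)"
    unfolding power_int_mult_distrib[symmetric] B(4) using Dp by simp
  have "apply_circle (\<beta> d (boost t) (arc_embed d (q 0))) z =
     (if Im z > 0 then of_real ((cmod D)\<^sup>2 powi (int d - 1) * Im w powi (int d - 1)) * q 0 (ucoord z - t) else 0)"
    unfolding B(1) apply_arc_embed[OF q] using B(2) sgn u by simp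
  then show "apply_circle (\<beta> d (boost t) (arc_embed d (q 0))) (cis x) = apply_circle (arc_embed d (\<lambda>u. q 0 (u - t))) (cis x)"
    unfolding p apply_arc_embed[OF rapid_family_shift[OF q], of d t] using z by (simp add: z_def)
qed

text \<open>Boosts have real coefficients and hence commute with complex conjugation, which on the
  circle is inversion.\<close>

lemma \<beta>_boost_reflect: "\<beta> d (boost t) (reflect_circle f) = reflect_circle (\<beta> d (boost t) f)"
proof (rule circle_eqI)
  fix x
  define z where "z = cis x"
  have z: "cmod z = 1" and zi: "cmod (cnj z) = 1" and iz: "inverse z = cnj z" by (simp_all add: z_def cis_cnj)
  note B = apply_\<beta>_boost[OF z, where t = t] and B' = apply_\<beta>_boost[OF zi, where t = t]
  define D where "D = of_real (sinh (t / 2)) * z + of_real (cosh (t / 2))"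
  define w where "w = (of_real (cosh (t / 2)) * z + of_real (sinh (t / 2))) / (of_real (sinh (t / 2)) * z + of_real (cosh (t / 2)))"
  note B = B[folded w_def D_def]
  have D': "of_real (sinh (t / 2)) * cnj z + of_real (cosh (t / 2)) = cnj D" by (simp add: D_def)
  have w': "(of_real (cosh (t / 2)) * cnj z + of_real (sinh (t / 2))) / cnj D = cnj w" by (simp add: w_def D_def)
  have "w * cnj w = 1" using complex_norm_square[of w] B(2) by simp
  then have "inverse w = cnj w" by (rule inverse_unique)
  then show "apply_circle (\<beta> d (boost t) (reflect_circle f)) (cis x) = apply_circle (reflect_circle (\<beta> d (boost t) f)) (cis x)"
    using B(1) B'(1)[of d f] unfolding D' w' z_def[symmetric] by (simp add: iz)
qed

lemma apply_\<beta>_rot: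
  assumes "cmod z = 1"
  shows "apply_circle (\<beta> d (rot \<theta>) f) z = apply_circle f (cis (- \<theta>) * z)"
proof -
  have ab: "(cmod (cis (\<theta> / 2)))\<^sup>2 - (cmod 0)\<^sup>2 = 1" by simp
  have "cis \<theta> = cis (\<theta> / 2) / cnj (cis (\<theta> / 2))" by (simp add: cis_cnj cis_divide)
  then have r: "rot \<theta> = mob (cis (\<theta> / 2)) 0" by (simp add: rot_def mob_def fun_eq_iff)
  have "cis (- \<theta>) = cis (- \<theta> / 2) / cis (\<theta> / 2)" by (simp add: cis_divide)
  then have i: "inv (rot \<theta>) z = cis (- \<theta>) * z"
    unfolding r mob_inverse(3)[OF ab] using assms by (simp add: mob_def cis_cnj)
  have "X_mob (rot \<theta>) (cis (- \<theta>) * z) = 1"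
    unfolding r using X_mob_eq[OF ab, of "cis (- \<theta>) * z"] assms by (simp add: norm_mult)
  then show ?thesis unfolding apply_\<beta>[OF rot_in_Mob] i by simp
qed

section \<open>Test functions supported in the open upper half circle, seen in the boost
  coordinate\<close>

lemma smooth_family_cosh: "smooth_family (\<lambda>j u. of_real (if even j then cosh u else sinh u))"
  unfolding smooth_family_def
proof (intro allI)
  fix j :: nat and u :: real
  have "((\<lambda>u. if even j then cosh u else sinh u) has_real_derivative (if even (Suc j) then cosh u else sinh u)) (at u)"
    by (cases "even j") (auto intro!: derivative_eq_intros)
  then show "((\<lambda>u. complex_of_real (if even j then cosh u else sinh u)) has_vector_derivative
      of_real (if even (Suc j) then cosh u else sinh u)) (at u)"
    by (rule has_vector_derivative_of_real[unfolded has_real_derivative_iff_has_vector_derivative[symmetric]])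
qed

text \<open>A closed support inside the open half circle is compact, so
  \<open>Im z = 1 / cosh u\<close> is bounded below on it and \<open>u\<close> is bounded. The
  corresponding function of \<open>u\<close> has compact support, which makes its decay
  immediate.\<close>

lemma supp_I_plus_arc:
  assumes "supp_circle f \<subseteq> I_plus"
  obtains q R where "rapid_family q" "\<And>i u. \<bar>u\<bar> > R \<Longrightarrow> q i u = 0" "f = arc_embed d (q 0)"
proof -
  \<comment> \<open>Inverse of the coordinate: the angle is
    \<open>2 * arctan (exp u)\<close>.\<close>
  define h where "h u = 2 * arctan (exp u)" for u
  have hd: "(h has_real_derivative 1 / cosh u) (at u)" for u
  proof -
    have "(h has_real_derivative 2 * (inverse (1 + (exp u)\<^sup>2) * exp u)) (at u)"
      unfolding h_def by (auto intro!: derivative_eq_intros)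
    also have "2 * (inverse (1 + (exp u)\<^sup>2) * exp u) = 1 / cosh u"
      by (simp add: cosh_def exp_minus field_simps power2_eq_square)
    finally show ?thesis .
  qed
  have ch: "diff_times n (\<lambda>u. complex_of_real (cosh u))" for n
    using smooth_family_smooth[OF smooth_family_cosh] by (simp add: smooth_iff)
  have ch0: "complex_of_real (cosh u) \<noteq> 0" for u by simp
  have sf: "smooth (\<lambda>t. apply_circle f (cis t))" using apply_circle[of f] by auto
  \<comment> \<open>The power of \<open>cosh u\<close> undoes the weight
    \<open>Im z powi (d - 1)\<close> built into \<open>arc_embed\<close>.\<close>
  define p where "p u = of_real (cosh u) powi (int d - 1) * apply_circle f (cis (h u))" for u
  have "diff_times n p" for n
    unfolding p_def
  proof (intro diff_times_mult diff_times_powi ch ch0)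
    have "diff_times n (\<lambda>u. inverse (complex_of_real (cosh u)))" by (intro diff_times_inverse ch ch0)
    then have "diff_times n (\<lambda>u. complex_of_real (1 / cosh u))" by (simp add: divide_inverse)
    then show "diff_times n (\<lambda>u. apply_circle f (cis (h u)))"
      by (rule diff_times_compose[OF hd]) (use sf in \<open>auto simp: smooth_iff\<close>)
  qed
  then have "smooth p" by (simp add: smooth_iff)
  define q where "q i = (vderiv ^^ i) p" for i
  have q: "smooth_family q" unfolding q_def by (rule smooth_family_of_smooth[OF \<open>smooth p\<close>])
  have sinh: "Im (cis (h u)) = 1 / cosh u" "Re (cis (h u)) = (1 - (exp u)\<^sup>2) / (1 + (exp u)\<^sup>2)" for u
  proof -
    have c: "cos (arctan (exp u)) > 0" using arctan_bounded[of "exp u"] cos_gt_zero_pi by blast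
    have t: "sin (arctan (exp u)) = exp u * cos (arctan (exp u))"
      using tan_arctan[of "exp u"] c by (simp add: tan_def field_simps)
    have cc: "(cos (arctan (exp u)))\<^sup>2 = 1 / (1 + (exp u)\<^sup>2)"
    proof -
      have "0 < (exp u)\<^sup>2" by simp
      then have "1 + (exp u)\<^sup>2 \<noteq> 0" by linarith
      moreover have "(cos (arctan (exp u)))\<^sup>2 * (1 + (exp u)\<^sup>2) = 1"
        using sin_cos_squared_add[of "arctan (exp u)"] unfolding t by (simp add: power_mult_distrib algebra_simps)
      ultimately show ?thesis by (simp add: eq_divide_eq)
    qed
    have "Im (cis (h u)) = 2 * exp u * (cos (arctan (exp u)))\<^sup>2"
      by (simp add: h_def sin_double t power2_eq_square)
    also have "\<dots> = 1 / cosh u" unfolding cc by (simp add: cosh_def exp_minus field_simps power2_eq_square)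
    finally show "Im (cis (h u)) = 1 / cosh u" .
    have "Re (cis (h u)) = (1 - (exp u)\<^sup>2) * (cos (arctan (exp u)))\<^sup>2"
      by (simp add: h_def cos_double t power_mult_distrib algebra_simps)
    then show "Re (cis (h u)) = (1 - (exp u)\<^sup>2) / (1 + (exp u)\<^sup>2)" unfolding cc by simp
  qed
  have cisinv: "cis (h (ucoord z)) = z" if "cmod z = 1" "Im z > 0" for z
  proof (rule complex_eqI)
    show "Im (cis (h (ucoord z))) = Im z" unfolding sinh(1) using cosh_ucoord[OF that] by simp
    have sq: "(Re z)\<^sup>2 + (Im z)\<^sup>2 = 1" using that by (simp add: cmod_def)
    have pos: "1 + Re z > 0" "1 - Re z > 0" using circle_Re_gt[of z] that by simp_all
    have "(Im z)\<^sup>2 = (1 - Re z) * (1 + Re z)" using sq by (simp add: power2_eq_square algebra_simps)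
    then have "(exp (ucoord z))\<^sup>2 = (1 - Re z) / (1 + Re z)"
      unfolding exp_ucoord[OF that] using pos by (simp add: power_divide power2_eq_square)
    then have "1 - (exp (ucoord z))\<^sup>2 = 2 * Re z / (1 + Re z)" "1 + (exp (ucoord z))\<^sup>2 = 2 / (1 + Re z)"
      using pos by (simp_all add: field_simps)
    then show "Re (cis (h (ucoord z))) = Re z" unfolding sinh(2) using pos by simp
  qed
  have f_eq: "apply_circle f z = (if Im z > 0 then of_real (Im z powi (int d - 1)) * p (ucoord z) else 0)" if z: "cmod z = 1" for z
  proof (cases "Im z > 0")
    case True
    have "complex_of_real (Im z) powi (int d - 1) * (1 / of_real (Im z)) powi (int d - 1) = 1"
      using True by (simp flip: power_int_mult_distrib)
    then show ?thesis using True cosh_ucoord[OF z True] cisinv[OF z True]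
      by (simp add: p_def of_real_power_int flip: mult.assoc)
  next
    case False
    then have "z \<notin> supp_circle f" using assms by (auto simp: I_plus_def)
    then have "apply_circle f z = 0" unfolding supp_circle_def using closure_subset by force
    then show ?thesis using False by simp
  qed
  have "compact (supp_circle f)"
  proof (rule compact_Int_closed[of "sphere 0 1" "supp_circle f", THEN back_subst[of compact]])
    show "sphere 0 1 \<inter> supp_circle f = supp_circle f" using assms by (auto simp: I_plus_def)
  qed (auto simp: supp_circle_def)
  then have "\<exists>e>0. \<forall>z\<in>supp_circle f. Im z \<ge> e"
  proof (cases "supp_circle f = {}")
    case False
    have "continuous_on (supp_circle f) Im" by (intro continuous_intros)
    from continuous_attains_inf[OF \<open>compact (supp_circle f)\<close> False this]
    obtain z where "z \<in> supp_circle f" "\<forall>y\<in>supp_circle f. Im z \<le> Im y" by blast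
    then show ?thesis using assms by (intro exI[of _ "Im z"]) (auto simp: I_plus_def)
  qed (auto intro: exI[of _ 1])
  then obtain e where e: "e > 0" "\<And>z. z \<in> supp_circle f \<Longrightarrow> Im z \<ge> e" by blast
  \<comment> \<open>On the support \<open>e * cosh u \<le> 1\<close>, while
    \<open>\<bar>u\<bar> < 2 * cosh u\<close> always holds.\<close>
  define R where "R = 2 / e"
  have p0: "p u = 0" if "\<bar>u\<bar> > R" for u
  proof (rule ccontr)
    assume "p u \<noteq> 0"
    then have "cis (h u) \<in> {z. apply_circle f z \<noteq> 0}" by (auto simp: p_def)
    then have "cis (h u) \<in> supp_circle f" unfolding supp_circle_def by (rule subsetD[OF closure_subset])
    from e(2)[OF this] have "e * cosh u \<le> 1" unfolding sinh(1) by (simp add: field_simps)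
    moreover have "\<bar>u\<bar> < 2 * cosh u"
    proof -
      have "\<bar>u\<bar> < exp \<bar>u\<bar>" using exp_ge_add_one_self[of "\<bar>u\<bar>"] by linarith
      also have "\<dots> \<le> 2 * cosh u" by (cases "u \<ge> 0") (simp_all add: cosh_def)
      finally show ?thesis .
    qed
    moreover have "e * \<bar>u\<bar> > 2" using that e(1) unfolding R_def by (simp add: field_simps)
    moreover have "e * \<bar>u\<bar> < e * (2 * cosh u)" using \<open>\<bar>u\<bar> < 2 * cosh u\<close> e(1) by simp
    ultimately show False by linarith
  qed
  have q0: "q i u = 0" if "\<bar>u\<bar> > R" for i u
    using that
  proof (induction i arbitrary: u)
    case 0
    then show ?case using p0 by (simp add: q_def)
  next
    case (Suc i)
    have op: "open {u. \<bar>u\<bar> > R}" by (intro open_Collect_less continuous_intros)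
    have "((\<lambda>t. 0) has_vector_derivative (0::complex)) (at u)" by simp
    then have "(q i has_vector_derivative 0) (at u)"
      by (rule has_vector_derivative_transform_within_open[OF _ op]) (use Suc in auto)
    then show ?case using smooth_familyD[OF q, of i u] vector_derivative_unique_at by blast
  qed
  have "rapid_family q"
    unfolding rapid_family_def
  proof (intro conjI allI q)
    fix i M
    have "bounded ((\<lambda>u. of_real (cmod (q i u) * cosh u ^ M) :: complex) ` {-R..R})"
      by (intro compact_imp_bounded compact_continuous_image continuous_intros smooth_family_continuous[OF q]) auto
    then obtain B where B: "B > 0" "\<And>u. u \<in> {-R..R} \<Longrightarrow> cmod (of_real (cmod (q i u) * cosh u ^ M)) \<le> B"
      unfolding bounded_pos by auto
    have "cmod (q i u) * cosh u ^ M \<le> B" for u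
    proof (cases "\<bar>u\<bar> > R")
      case False
      then have "u \<in> {-R..R}" by auto
      from B(2)[OF this] show ?thesis unfolding norm_of_real by simp
    qed (use q0 B in auto)
    then show "\<exists>C. \<forall>u. cmod (q i u) * cosh u ^ M \<le> C" by blast
  qed
  moreover have "f = arc_embed d (q 0)"
    by (rule circle_eqI, unfold apply_arc_embed[OF \<open>rapid_family q\<close>]) (simp add: f_eq q_def)
  ultimately show ?thesis using q0 that by blast
qed

section \<open>Entire functions decaying rapidly in strips\<close>

definition strip_rapid :: "(complex \<Rightarrow> complex) \<Rightarrow> bool" where
  "strip_rapid q \<longleftrightarrow> q holomorphic_on UNIV \<and>
     (\<forall>S M. \<exists>C. \<forall>z. \<bar>Im z\<bar> \<le> S \<longrightarrow> cmod (q z) * cosh (Re z) ^ M \<le> C)"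

lemma cosh_shift_power:
  "cosh (x + y) ^ M \<le> (2 * cosh y) ^ M * cosh (x::real) ^ M"
proof -
  have "cosh (x + y) ^ M \<le> (2 * cosh x * cosh y) ^ M" by (intro power_mono cosh_add_le) auto
  then show ?thesis by (simp add: power_mult_distrib mult_ac)
qed

text \<open>The value is taken at \<open>z'\<close> but the weight at the centre \<open>z\<close>;
  moving by at most 1 costs a constant factor and a strip wider by 1. Cauchy's inequality and the
  Taylor remainder both require a bound of this shape.\<close>

lemma strip_rapid_nearby:
  assumes "strip_rapid q"
  shows "\<exists>C. \<forall>z z'. \<bar>Im z\<bar> \<le> S \<longrightarrow> cmod (z' - z) \<le> 1 \<longrightarrow> cmod (q z') * cosh (Re z) ^ M \<le> C"
proof -
  obtain C where C: "\<And>z. \<bar>Im z\<bar> \<le> S + 1 \<Longrightarrow> cmod (q z) * cosh (Re z) ^ M \<le> C"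
    using assms unfolding strip_rapid_def by blast
  have "cmod (q z') * cosh (Re z) ^ M \<le> (2 * cosh 1) ^ M * C" if "\<bar>Im z\<bar> \<le> S" "cmod (z' - z) \<le> 1" for z z'
  proof -
    have "\<bar>Re (z' - z)\<bar> \<le> 1" "\<bar>Im (z' - z)\<bar> \<le> 1"
      using that(2) abs_Re_le_cmod abs_Im_le_cmod order_trans by blast+
    then have re: "\<bar>Re z - Re z'\<bar> \<le> 1" and im: "\<bar>Im z'\<bar> \<le> S + 1" using that(1) by auto
    have "cosh (Re z - Re z') \<le> cosh (1::real)"
      using re cosh_real_nonneg_le_iff[of "\<bar>Re z - Re z'\<bar>" 1] by (simp add: cosh_real_abs)
    then have "(2 * cosh (Re z - Re z')) ^ M \<le> (2 * cosh 1) ^ M" by (intro power_mono) auto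
    moreover have "cosh (Re z) ^ M \<le> (2 * cosh (Re z - Re z')) ^ M * cosh (Re z') ^ M"
      using cosh_shift_power[of "Re z'" "Re z - Re z'" M] by simp
    ultimately have "cosh (Re z) ^ M \<le> (2 * cosh 1) ^ M * cosh (Re z') ^ M"
      by (meson order_trans mult_right_mono zero_le_power cosh_real_nonneg)
    then have "cmod (q z') * cosh (Re z) ^ M \<le> cmod (q z') * ((2 * cosh 1) ^ M * cosh (Re z') ^ M)"
      by (rule mult_left_mono) simp
    also have "\<dots> = (2 * cosh 1) ^ M * (cmod (q z') * cosh (Re z') ^ M)" by (simp add: mult_ac)
    also have "\<dots> \<le> (2 * cosh 1) ^ M * C" by (intro mult_left_mono C im) auto
    finally show ?thesis .
  qed
  then show ?thesis by blast
qed

lemma strip_rapid_deriv: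
  assumes q: "strip_rapid q" shows "strip_rapid (deriv q)"
  unfolding strip_rapid_def
proof (intro conjI allI)
  have hol: "q holomorphic_on UNIV" using q by (simp add: strip_rapid_def)
  then show "deriv q holomorphic_on UNIV" by (rule holomorphic_deriv) simp
  fix S and M :: nat
  obtain C where C: "\<forall>z z'. \<bar>Im z\<bar> \<le> S \<longrightarrow> cmod (z' - z) \<le> 1 \<longrightarrow> cmod (q z') * cosh (Re z) ^ M \<le> C"
    using strip_rapid_nearby[OF q, of S M] by (elim exE)
  have "cmod (deriv q z) * cosh (Re z) ^ M \<le> C" if z: "\<bar>Im z\<bar> \<le> S" for z
  proof -
    have "cmod ((deriv ^^ 1) q z) \<le> fact 1 * (C / cosh (Re z) ^ M) / 1 ^ 1"
    proof (rule Cauchy_inequality)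
      show "cmod (q x) \<le> C / cosh (Re z) ^ M" if "cmod (z - x) = 1" for x
        using C[THEN spec, of z, THEN spec, of x] z that by (simp add: norm_minus_commute field_simps)
    qed (use hol in \<open>auto intro: holomorphic_on_subset holomorphic_on_imp_continuous_on\<close>)
    then show ?thesis by (simp add: field_simps)
  qed
  then show "\<exists>C. \<forall>z. \<bar>Im z\<bar> \<le> S \<longrightarrow> cmod (deriv q z) * cosh (Re z) ^ M \<le> C" by blast
qed

lemma strip_rapid_higher_deriv: "strip_rapid q \<Longrightarrow> strip_rapid ((deriv ^^ i) q)"
  by (induction i) (auto intro: strip_rapid_deriv)

lemma strip_rapid_has_derivative:
  assumes "strip_rapid q"
  shows "((deriv ^^ i) q has_field_derivative (deriv ^^ Suc i) q z) (at z)"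
  using strip_rapid_higher_deriv[OF assms, of i] holomorphic_derivI[of "(deriv ^^ i) q" UNIV z]
  by (simp add: strip_rapid_def)

text \<open>Boosts with complex parameter: for real \<open>w\<close> this is the family of the
  boosted test function, and at \<open>w = \<i> * pi\<close> its continuation to the other edge of
  the strip.\<close>

definition shifted :: "(complex \<Rightarrow> complex) \<Rightarrow> complex \<Rightarrow> nat \<Rightarrow> real \<Rightarrow> complex" where
  "shifted q w i u = (deriv ^^ i) q (of_real u - w)"

lemma shifted_bound:
  assumes "strip_rapid q"
  shows "\<exists>C. \<forall>w u. \<bar>Im w\<bar> \<le> S \<longrightarrow> cmod (shifted q w i u) * cosh u ^ M \<le> C * cosh (Re w) ^ M"
proof -
  obtain C where C: "\<And>z. \<bar>Im z\<bar> \<le> S \<Longrightarrow> cmod ((deriv ^^ i) q z) * cosh (Re z) ^ M \<le> C"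
    using strip_rapid_higher_deriv[OF assms, of i] unfolding strip_rapid_def by blast
  have "cmod (shifted q w i u) * cosh u ^ M \<le> 2 ^ M * C * cosh (Re w) ^ M" if w: "\<bar>Im w\<bar> \<le> S" for w u
  proof -
    have c: "cosh u ^ M \<le> (2 * cosh (Re w)) ^ M * cosh (u - Re w) ^ M"
      using cosh_shift_power[of "u - Re w" "Re w" M] by simp
    have "cmod (shifted q w i u) * cosh u ^ M
        \<le> cmod (shifted q w i u) * ((2 * cosh (Re w)) ^ M * cosh (u - Re w) ^ M)"
      using c by (rule mult_left_mono) simp
    also have "\<dots> = (2 * cosh (Re w)) ^ M * (cmod (shifted q w i u) * cosh (u - Re w) ^ M)"
      by (simp add: mult_ac)
    also have "\<dots> \<le> (2 * cosh (Re w)) ^ M * C"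
      using C[of "of_real u - w"] w by (intro mult_left_mono) (auto simp: shifted_def)
    finally show ?thesis by (simp add: power_mult_distrib mult_ac)
  qed
  then show ?thesis by blast
qed

lemma rapid_family_shifted:
  assumes q: "strip_rapid q" shows "rapid_family (shifted q w)"
  unfolding rapid_family_def smooth_family_def
proof (intro conjI allI)
  fix i u
  have "((\<lambda>z. (deriv ^^ i) q (z - w)) has_field_derivative (deriv ^^ Suc i) q (of_real u - w)) (at (of_real u))"
  proof -
    have "((\<lambda>z. z - w) has_field_derivative 1) (at (of_real u))" by (auto intro!: derivative_eq_intros)
    from DERIV_chain2[of "(deriv ^^ i) q" "(deriv ^^ Suc i) q (of_real u - w)" "\<lambda>z. z - w" "of_real u" 1 UNIV,
        OF strip_rapid_has_derivative[OF q] this]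
    show ?thesis by simp
  qed
  from has_vector_derivative_real_field[OF this]
  show "(shifted q w i has_vector_derivative shifted q w (Suc i) u) (at u)"
    by (simp add: shifted_def[abs_def])
next
  fix i M
  obtain C where "\<forall>w' u. \<bar>Im w'\<bar> \<le> \<bar>Im w\<bar> \<longrightarrow> cmod (shifted q w' i u) * cosh u ^ M \<le> C * cosh (Re w') ^ M"
    using shifted_bound[OF q] by blast
  then show "\<exists>C. \<forall>u. cmod (shifted q w i u) * cosh u ^ M \<le> C" by blast
qed

text \<open>Moving the weight from \<open>u - Re w\<close> to \<open>u\<close> costs
  \<open>cosh (Re w) ^ M\<close>. The norms thus grow at most exponentially along the strip, which a
  Gaussian factor can absorb.\<close>

lemma CN_norm_shifted_bound:
  assumes q: "strip_rapid q"
  shows "\<exists>C M. C \<ge> 0 \<and> (\<forall>w. \<bar>Im w\<bar> \<le> S \<longrightarrow> CN_norm N (arc_embed d (shifted q w 0)) \<le> C * cosh (Re w) ^ M)"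
proof -
  obtain C M where C: "C \<ge> 0" "\<forall>q e. rapid_family q \<longrightarrow> (\<forall>k\<le>N. \<forall>u. cmod (q k u) * cosh u ^ M \<le> e) \<longrightarrow>
     CN_norm N (arc_embed d (q 0)) \<le> C * e" using CN_norm_arc_bound[of N d] by (elim exE conjE)
  have "\<forall>i. \<exists>c. \<forall>w u. \<bar>Im w\<bar> \<le> S \<longrightarrow> cmod (shifted q w i u) * cosh u ^ M \<le> c * cosh (Re w) ^ M"
    using shifted_bound[OF q] by blast
  then obtain c where c: "\<And>i w u. \<bar>Im w\<bar> \<le> S \<Longrightarrow> cmod (shifted q w i u) * cosh u ^ M \<le> c i * cosh (Re w) ^ M"
    by metis
  define c' where "c' = (\<Sum>i\<le>N. \<bar>c i\<bar>)"
  have "CN_norm N (arc_embed d (shifted q w 0)) \<le> C * (c' * cosh (Re w) ^ M)" if w: "\<bar>Im w\<bar> \<le> S" for w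
  proof (rule C(2)[THEN spec, THEN spec, THEN mp, THEN mp, OF rapid_family_shifted[OF q]], intro allI impI)
    fix k u assume "k \<le> N"
    then have "\<bar>c k\<bar> \<le> c'" unfolding c'_def by (intro member_le_sum) auto
    then have "c k \<le> c'" by linarith
    then have "c k * cosh (Re w) ^ M \<le> c' * cosh (Re w) ^ M" by (intro mult_right_mono) auto
    with c[OF w, of k u] show "cmod (shifted q w k u) * cosh u ^ M \<le> c' * cosh (Re w) ^ M" by linarith
  qed
  moreover have "C * c' \<ge> 0" unfolding c'_def by (intro mult_nonneg_nonneg C sum_nonneg) auto
  ultimately show ?thesis by (intro exI[of _ "C * c'"] exI[of _ M]) (auto simp: mult_ac)
qed

lemma circle_derivI:
  assumes "\<And>N. (\<lambda>h. CN_norm N (scale_circle (inverse h) (c (w + h) - c w) - c')) \<midarrow>0\<rightarrow> 0"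
  shows "circle_deriv c c' w"
  unfolding circle_deriv_def
proof
  show "(\<lambda>h. scale_circle (inverse h) (c (w + h) - c w)) \<midarrow>0\<rightarrow> c'"
    by (rule tendsto_circleI[OF assms])
  show "(\<lambda>h. c (w + h)) \<midarrow>0\<rightarrow> c w"
  proof (rule tendsto_circleI, rule Lim_null_comparison)
    fix N
    let ?q = "\<lambda>h. CN_norm N (scale_circle (inverse h) (c (w + h) - c w) - c')"
    show "\<forall>\<^sub>F h in at 0. norm (CN_norm N (c (w + h) - c w)) \<le> cmod h * (?q h + CN_norm N c')"
    proof (rule eventually_at_filter[THEN iffD2], rule always_eventually, intro allI impI)
      fix h :: complex assume "h \<noteq> 0"
      then have "c (w + h) - c w = scale_circle h ((scale_circle (inverse h) (c (w + h) - c w) - c') + c')"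
        by (simp add: scale_circle_simps)
      then have "CN_norm N (c (w + h) - c w) \<le> cmod h * CN_norm N ((scale_circle (inverse h) (c (w + h) - c w) - c') + c')"
        by (metis CN_norm_scale_le)
      also have "\<dots> \<le> cmod h * (?q h + CN_norm N c')" by (intro mult_left_mono CN_norm_triangle) auto
      finally show "norm (CN_norm N (c (w + h) - c w)) \<le> cmod h * (?q h + CN_norm N c')"
        by (simp add: CN_norm_nonneg)
    qed
    have "(\<lambda>h::complex. cmod h * (?q h + CN_norm N c')) \<midarrow>0\<rightarrow> cmod 0 * (0 + CN_norm N c')"
      by (intro tendsto_intros assms)
    then show "(\<lambda>h::complex. cmod h * (?q h + CN_norm N c')) \<midarrow>0\<rightarrow> 0" by simp
  qed
qed

text \<open>Taylor's formula in \<open>h\<close>, with the quadratic remainder estimated under the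
  weight that controls \<open>CN_norm\<close>. The minus sign comes from
  \<open>u - w\<close>.\<close>

lemma circle_deriv_shifted:
  assumes q: "strip_rapid q"
  shows "circle_deriv (\<lambda>w. arc_embed d (shifted q w 0)) (- arc_embed d (shifted (deriv q) w 0)) w"
proof (rule circle_derivI)
  fix N
  obtain C M where C: "C \<ge> 0" "\<forall>q e. rapid_family q \<longrightarrow> (\<forall>k\<le>N. \<forall>u. cmod (q k u) * cosh u ^ M \<le> e) \<longrightarrow>
     CN_norm N (arc_embed d (q 0)) \<le> C * e" using CN_norm_arc_bound[of N d] by (elim exE conjE)
  \<comment> \<open>Order \<open>i + 2\<close>, since the quadratic remainder of the
    \<open>i\<close>-th derivative involves two further derivatives.\<close>
  have "\<forall>i. \<exists>C. \<forall>z z'. \<bar>Im z\<bar> \<le> \<bar>Im w\<bar> \<longrightarrow> cmod (z' - z) \<le> 1 \<longrightarrow> cmod ((deriv ^^ (i + 2)) q z') * cosh (Re z) ^ M \<le> C"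
    using strip_rapid_nearby[OF strip_rapid_higher_deriv[OF q]] by blast
  then obtain K where K: "\<And>i z z'. \<bar>Im z\<bar> \<le> \<bar>Im w\<bar> \<Longrightarrow> cmod (z' - z) \<le> 1 \<Longrightarrow> cmod ((deriv ^^ (i + 2)) q z') * cosh (Re z) ^ M \<le> K i"
    by metis
  define K' where "K' = (\<Sum>i\<le>N. \<bar>K i\<bar>)"
  have K': "K i \<le> K'" if "i \<le> N" for i
  proof -
    have "\<bar>K i\<bar> \<le> K'" unfolding K'_def using that by (intro member_le_sum) auto
    then show ?thesis by linarith
  qed
  have K'0: "K' \<ge> 0" unfolding K'_def by (intro sum_nonneg) auto
  \<comment> \<open>\<open>K'\<close> controls the remainder with weight at
    \<open>Re x = u - Re w\<close>; the other factor moves the weight to \<open>u\<close>.\<close>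
  define B where "B = (2 * cosh (Re w)) ^ M * K'"
  have main: "CN_norm N (scale_circle (inverse h) (arc_embed d (shifted q (w + h) 0) - arc_embed d (shifted q w 0))
      - - arc_embed d (shifted (deriv q) w 0)) \<le> C * (cmod h * B)" if h: "h \<noteq> 0" "cmod h \<le> 1" for h
  proof -
    define r where "r = (\<lambda>i u. inverse h * (shifted q (w + h) i u - shifted q w i u) - (- 1) * shifted (deriv q) w i u)"
    have r1: "rapid_family (\<lambda>i u. shifted q (w + h) i u - shifted q w i u)"
      by (intro rapid_family_diff rapid_family_shifted q)
    have r2: "rapid_family (shifted (deriv q) w)" by (intro rapid_family_shifted strip_rapid_deriv q)
    have r: "rapid_family r" unfolding r_def by (intro rapid_family_diff rapid_family_scale r1 r2)
    have "scale_circle (inverse h) (arc_embed d (shifted q (w + h) 0) - arc_embed d (shifted q w 0))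
      - - arc_embed d (shifted (deriv q) w 0) = arc_embed d (r 0)"
      unfolding scale_circle_minus1 arc_embed_scale[OF r2] arc_embed_diff[OF rapid_family_shifted[OF q] rapid_family_shifted[OF q]]
        arc_embed_scale[OF r1] arc_embed_diff[OF rapid_family_scale[OF r1] rapid_family_scale[OF r2]] r_def ..
    also have "CN_norm N \<dots> \<le> C * (cmod h * B)"
    proof (rule C(2)[THEN spec, THEN spec, THEN mp, THEN mp, OF r], intro allI impI)
      fix k u assume k: "k \<le> N"
      define x where "x = of_real u - w"
      have shift: "shifted (deriv q) w k u = (deriv ^^ Suc k) q x"
        by (simp add: shifted_def x_def funpow_Suc_right del: funpow.simps)
      have "cmod ((deriv ^^ k) q (x - h) - (\<Sum>i\<le>1. (deriv ^^ (k + i)) q x * ((x - h) - x) ^ i / fact i))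
          \<le> (K' / cosh (Re x) ^ M) * cmod ((x - h) - x) ^ Suc 1 / fact 1"
      proof (rule complex_Taylor[where f = "\<lambda>i. (deriv ^^ (k + i)) q" and S = "cball x 1" and n = 1, simplified add_0_right])
        fix i z
        show "((deriv ^^ (k + i)) q has_field_derivative (deriv ^^ (k + Suc i)) q z) (at z within cball x 1)"
          using strip_rapid_has_derivative[OF q, of "k + i" z] by (auto intro: has_field_derivative_at_within)
      next
        fix z assume "z \<in> cball x 1"
        then have "cmod ((deriv ^^ (k + 2)) q z) * cosh (Re x) ^ M \<le> K k"
          by (intro K) (auto simp: dist_norm norm_minus_commute x_def)
        also have "\<dots> \<le> K'" by (rule K'[OF k])
        finally show "cmod ((deriv ^^ (k + Suc 1)) q z) \<le> K' / cosh (Re x) ^ M"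
          by (simp add: field_simps numeral_2_eq_2)
      qed (use h in \<open>auto simp: dist_norm\<close>)
      then have T: "cmod ((deriv ^^ k) q (x - h) - (deriv ^^ k) q x + h * (deriv ^^ Suc k) q x)
          \<le> (K' / cosh (Re x) ^ M) * (cmod h)\<^sup>2"
        by (simp add: algebra_simps power2_eq_square)
      have "r k u = inverse h * ((deriv ^^ k) q (x - h) - (deriv ^^ k) q x + h * (deriv ^^ Suc k) q x)"
        unfolding r_def shift using h by (simp add: shifted_def x_def algebra_simps del: funpow.simps)
      then have "cmod (r k u) = inverse (cmod h) * cmod ((deriv ^^ k) q (x - h) - (deriv ^^ k) q x + h * (deriv ^^ Suc k) q x)"
        by (simp only: norm_mult norm_inverse)
      also have "\<dots> \<le> inverse (cmod h) * ((K' / cosh (Re x) ^ M) * (cmod h)\<^sup>2)"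
        by (rule mult_left_mono[OF T]) simp
      also have "\<dots> = cmod h * (K' / cosh (Re x) ^ M)" using h by (simp add: field_simps power2_eq_square)
      finally have "cmod (r k u) * cosh u ^ M \<le> cmod h * (K' / cosh (Re x) ^ M) * cosh u ^ M"
        by (intro mult_right_mono) auto
      also have "\<dots> \<le> cmod h * (K' / cosh (Re x) ^ M) * ((2 * cosh (Re w)) ^ M * cosh (Re x) ^ M)"
        using cosh_shift_power[of "Re x" "Re w" M] K'0 by (intro mult_left_mono) (auto simp: x_def)
      also have "\<dots> = cmod h * B" unfolding B_def by (simp add: field_simps)
      finally show "cmod (r k u) * cosh u ^ M \<le> cmod h * B" .
    qed
    finally show ?thesis .
  qed
  show "(\<lambda>h. CN_norm N (scale_circle (inverse h) (arc_embed d (shifted q (w + h) 0) - arc_embed d (shifted q w 0))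
      - - arc_embed d (shifted (deriv q) w 0))) \<midarrow>0\<rightarrow> 0"
  proof (rule Lim_null_comparison)
    show "\<forall>\<^sub>F h in at 0. norm (CN_norm N (scale_circle (inverse h) (arc_embed d (shifted q (w + h) 0) - arc_embed d (shifted q w 0))
      - - arc_embed d (shifted (deriv q) w 0))) \<le> C * (cmod h * B)"
      unfolding eventually_at by (intro exI[of _ 1]) (use main in \<open>auto simp: CN_norm_nonneg\<close>)
    have "(\<lambda>h::complex. C * (cmod h * B)) \<midarrow>0\<rightarrow> C * (cmod 0 * B)" by (intro tendsto_intros)
    then show "(\<lambda>h::complex. C * (cmod h * B)) \<midarrow>0\<rightarrow> 0" by simp
  qed
qed

section \<open>Continuation through the disc\<close>

text \<open>The \<open>j\<close>-th complex derivative of the function in the first clause. The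
  Cayley transform sends the disc to the right half plane and its logarithm sends it to a strip of
  width \<pi>, whose edges are the two half circles; the shift by \<open>\<i> * pi / 2\<close> puts
  the lower half circle on the real line. The recursion is the product rule, the logarithm having
  derivative \<open>2 / (z\<^sup>2 - 1)\<close>. For \<open>a = 0\<close> the truncated
  \<open>a - 1\<close> occurs with coefficient 0.\<close>

primrec disc_deriv :: "nat \<Rightarrow> (complex \<Rightarrow> complex) \<Rightarrow> nat \<Rightarrow> int \<Rightarrow> nat \<Rightarrow> complex \<Rightarrow> complex" where
  "disc_deriv 0 q a m i z = z ^ a * (z\<^sup>2 - 1) powi m * (deriv ^^ i) q (Ln ((1 - z) / (1 + z)) - \<i> * (pi / 2))"
| "disc_deriv (Suc j) q a m i z = of_nat a * disc_deriv j q (a - 1) m i z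
     + 2 * of_int m * disc_deriv j q (Suc a) (m - 1) i z + 2 * disc_deriv j q a (m - 1) (Suc i) z"

lemma cayley_half_plane:
  assumes "cmod z \<le> 1" "z\<^sup>2 \<noteq> 1"
  shows "1 - z \<noteq> 0" "1 + z \<noteq> 0" "Re ((1 - z) / (1 + z)) \<ge> 0" "(1 - z) / (1 + z) \<notin> \<real>\<^sub>\<le>\<^sub>0"
proof -
  show nz: "1 - z \<noteq> 0" "1 + z \<noteq> 0" using assms(2) by (auto simp: add_eq_0_iff)
  have "Re ((1 - z) * cnj (1 + z)) = 1 - (cmod z)\<^sup>2" unfolding cmod_power2 by (simp add: algebra_simps power2_eq_square)
  moreover have "(cmod z)\<^sup>2 \<le> 1" using assms(1) by (simp add: power_le_one)
  moreover have "(1 - z) / (1 + z) = (1 - z) * cnj (1 + z) / of_real ((cmod (1 + z))\<^sup>2)"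
    unfolding complex_norm_square
    by (rule sym, rule nonzero_mult_divide_mult_cancel_right) (use nz in \<open>simp only: complex_cnj_zero_iff not_False_eq_True\<close>)
  ultimately show re: "Re ((1 - z) / (1 + z)) \<ge> 0"
    by (simp only: Re_divide_of_real) simp
  show "(1 - z) / (1 + z) \<notin> \<real>\<^sub>\<le>\<^sub>0"
  proof
    assume "(1 - z) / (1 + z) \<in> \<real>\<^sub>\<le>\<^sub>0"
    then have "(1 - z) / (1 + z) = 0" using re by (auto simp: complex_nonpos_Reals_iff complex_eq_iff)
    then show False using nz by simp
  qed
qed

lemma disc_deriv_deriv:
  assumes q: "strip_rapid q" and z: "cmod z \<le> 1" "z\<^sup>2 \<noteq> 1"
  shows "(disc_deriv j q a m i has_field_derivative disc_deriv (Suc j) q a m i z) (at z)"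
proof (induction j arbitrary: a m i)
  case 0
  note h = cayley_half_plane[OF z]
  have w: "z\<^sup>2 - 1 \<noteq> 0" using z(2) by simp
  define L where "L = (\<lambda>z. Ln ((1 - z) / (1 + z)) - \<i> * (pi / 2))"
  have "((\<lambda>z. (1 - z) / (1 + z)) has_field_derivative (- (1 + z) - (1 - z)) / ((1 + z) * (1 + z))) (at z)"
    using h by (auto intro!: derivative_eq_intros)
  from DERIV_chain2[OF has_field_derivative_Ln[OF h(4)] this]
  have "((\<lambda>z. Ln ((1 - z) / (1 + z))) has_field_derivative inverse ((1 - z) / (1 + z)) * ((- (1 + z) - (1 - z)) / ((1 + z) * (1 + z)))) (at z)" .
  also have "inverse ((1 - z) / (1 + z)) * ((- (1 + z) - (1 - z)) / ((1 + z) * (1 + z))) = 2 / (z\<^sup>2 - 1)"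
  proof -
    have "z\<^sup>2 - 1 = - ((1 - z) * (1 + z))" by (simp add: power2_eq_square algebra_simps)
    moreover have "- (1 + z) - (1 - z) = - 2" by simp
    moreover have "inverse (a / b) * (- 2 / (b * b)) = 2 / - (a * b)" if "a \<noteq> 0" "b \<noteq> 0" for a b :: complex
      using that by (simp add: field_simps)
    ultimately show ?thesis using h(1,2) by (simp only: not_False_eq_True)
  qed
  finally have "((\<lambda>z. Ln ((1 - z) / (1 + z))) has_field_derivative 2 / (z\<^sup>2 - 1)) (at z)" .
  from DERIV_diff[OF this DERIV_const, of "\<i> * (pi / 2)"]
  have Ld: "(L has_field_derivative 2 / (z\<^sup>2 - 1)) (at z)" unfolding L_def by simp
  from DERIV_chain2[OF strip_rapid_has_derivative[OF q, of i] Ld]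
  have Q: "((\<lambda>z. (deriv ^^ i) q (L z)) has_field_derivative (deriv ^^ Suc i) q (L z) * (2 / (z\<^sup>2 - 1))) (at z)" .
  have P: "((\<lambda>z. z ^ a * (z\<^sup>2 - 1) powi m) has_field_derivative
      of_nat a * z ^ (a - 1) * (z\<^sup>2 - 1) powi m + z ^ a * (of_int m * (z\<^sup>2 - 1) powi (m - 1) * (2 * z))) (at z)"
    using w by (auto intro!: derivative_eq_intros simp: mult_ac)
  from DERIV_mult[OF P Q]
  have "((\<lambda>z. z ^ a * (z\<^sup>2 - 1) powi m * (deriv ^^ i) q (L z)) has_field_derivative
     (of_nat a * z ^ (a - 1) * (z\<^sup>2 - 1) powi m + z ^ a * (of_int m * (z\<^sup>2 - 1) powi (m - 1) * (2 * z))) * (deriv ^^ i) q (L z)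
     + (deriv ^^ Suc i) q (L z) * (2 / (z\<^sup>2 - 1)) * (z ^ a * (z\<^sup>2 - 1) powi m)) (at z)" .
  moreover have "(z\<^sup>2 - 1) powi m / (z\<^sup>2 - 1) = (z\<^sup>2 - 1) powi (m - 1)" using w by (simp add: power_int_diff)
  then have "(deriv ^^ Suc i) q (L z) * (2 / (z\<^sup>2 - 1)) * (z ^ a * (z\<^sup>2 - 1) powi m)
     = 2 * (z ^ a * (z\<^sup>2 - 1) powi (m - 1) * (deriv ^^ Suc i) q (L z))"
    by (simp add: mult_ac del: funpow.simps flip: \<open>(z\<^sup>2 - 1) powi m / (z\<^sup>2 - 1) = (z\<^sup>2 - 1) powi (m - 1)\<close>)
  ultimately show ?case
    by (simp add: L_def algebra_simps del: funpow.simps)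
next
  case (Suc j)
  have eq: "disc_deriv (Suc j) q a m i = (\<lambda>z. of_nat a * disc_deriv j q (a - 1) m i z
     + 2 * of_int m * disc_deriv j q (Suc a) (m - 1) i z + 2 * disc_deriv j q a (m - 1) (Suc i) z)"
    by (simp add: fun_eq_iff)
  have "((\<lambda>z. of_nat a * disc_deriv j q (a - 1) m i z
     + 2 * of_int m * disc_deriv j q (Suc a) (m - 1) i z + 2 * disc_deriv j q a (m - 1) (Suc i) z) has_field_derivative
     of_nat a * disc_deriv (Suc j) q (a - 1) m i z
     + 2 * of_int m * disc_deriv (Suc j) q (Suc a) (m - 1) i z + 2 * disc_deriv (Suc j) q a (m - 1) (Suc i) z) (at z)"
    by (intro DERIV_add DERIV_cmult Suc.IH)
  then show ?case unfolding eq by simp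
qed

text \<open>Near 1 and -1 the real part of the logarithm is unbounded, and its \<open>cosh\<close>
  is at least \<open>1 / cmod (z\<^sup>2 - 1)\<close>. Rapid decay of \<open>q\<close> thus becomes
  vanishing of arbitrary order at these two points.\<close>

lemma disc_deriv_bound:
  assumes q: "strip_rapid q"
  shows "\<exists>C. \<forall>z. cmod z \<le> 1 \<longrightarrow> z\<^sup>2 \<noteq> 1 \<longrightarrow> cmod (disc_deriv j q a m i z) \<le> C * cmod (z\<^sup>2 - 1)"
proof (induction j arbitrary: a m i)
  case 0
  \<comment> \<open>\<open>nat \<bar>m\<bar>\<close> powers compensate a negative \<open>m\<close>;
    one more supplies the factor \<open>cmod (z\<^sup>2 - 1)\<close> of the claim.\<close>
  define M where "M = Suc (nat \<bar>m\<bar>)"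
  obtain C where C: "\<And>z. \<bar>Im z\<bar> \<le> pi \<Longrightarrow> cmod ((deriv ^^ i) q z) * cosh (Re z) ^ M \<le> C"
    using strip_rapid_higher_deriv[OF q, of i] unfolding strip_rapid_def by blast
  have "0 \<le> cmod ((deriv ^^ i) q 0) * cosh (Re 0) ^ M" by simp
  also have "\<dots> \<le> C" by (rule C) simp
  finally have C0: "C \<ge> 0" .
  have "cmod (disc_deriv 0 q a m i z) \<le> (C * 2 ^ (2 * nat \<bar>m\<bar>)) * cmod (z\<^sup>2 - 1)" if z: "cmod z \<le> 1" "z\<^sup>2 \<noteq> 1" for z
  proof -
    note h = cayley_half_plane[OF z]
    define \<zeta> where "\<zeta> = (1 - z) / (1 + z)"
    have \<zeta>: "\<zeta> \<noteq> 0" "Re \<zeta> \<ge> 0" using h by (auto simp: \<zeta>_def)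
    have "\<bar>Im (Ln \<zeta>)\<bar> \<le> pi / 2" using Re_Ln_pos_le[OF \<zeta>(1)] \<zeta>(2) by simp
    then have im: "\<bar>Im (Ln \<zeta> - \<i> * (pi / 2))\<bar> \<le> pi" by (simp add: abs_le_iff)
    define n where "n = cmod (z\<^sup>2 - 1)"
    have n: "n > 0" using z(2) by (simp add: n_def)
    have n2: "n \<le> 2"
    proof -
      have "n \<le> cmod (z\<^sup>2) + cmod 1" unfolding n_def by (rule norm_triangle_ineq4)
      then show ?thesis using z(1) power_le_one[of "cmod z" 2] by (simp add: norm_power)
    qed
    have nn: "n = cmod (1 - z) * cmod (1 + z)"
    proof -
      have "z\<^sup>2 - 1 = - ((1 - z) * (1 + z))" by (simp add: power2_eq_square algebra_simps)
      then show ?thesis by (simp add: n_def norm_mult)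
    qed
    have "cosh (Re (Ln \<zeta>)) = (cmod \<zeta> + inverse (cmod \<zeta>)) / 2"
      using \<zeta>(1) by (simp add: cosh_def exp_minus)
    also have "\<dots> = ((cmod (1 - z))\<^sup>2 + (cmod (1 + z))\<^sup>2) / (2 * n)"
      unfolding \<zeta>_def norm_divide nn using h by (simp add: field_simps power2_eq_square)
    \<comment> \<open>Parallelogram law; the sum is at least 2 whatever \<open>z\<close> is.\<close>
    also have "(cmod (1 - z))\<^sup>2 + (cmod (1 + z))\<^sup>2 = 2 + 2 * (cmod z)\<^sup>2"
      unfolding cmod_power2 by (simp add: power2_eq_square algebra_simps)
    also have "(2 + 2 * (cmod z)\<^sup>2) / (2 * n) \<ge> 1 / n" using n by (simp add: field_simps)
    finally have ch: "1 / n \<le> cosh (Re (Ln \<zeta> - \<i> * (pi / 2)))" by simp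
    define Q where "Q = cmod ((deriv ^^ i) q (Ln \<zeta> - \<i> * (pi / 2)))"
    have "Q * (1 / n) ^ M \<le> Q * cosh (Re (Ln \<zeta> - \<i> * (pi / 2))) ^ M"
      using ch n by (intro mult_left_mono power_mono) (auto simp: Q_def)
    also have "\<dots> \<le> C" unfolding Q_def by (rule C[OF im])
    finally have Q: "Q \<le> C * n ^ M" using n by (simp add: field_simps power_divide)
    have "cmod (disc_deriv 0 q a m i z) = cmod z ^ a * n powi m * Q"
      unfolding disc_deriv.simps Q_def \<zeta>_def n_def by (simp add: norm_mult norm_power norm_power_int)
    also have "\<dots> \<le> 1 * n powi m * (C * n ^ M)"
      using z(1) n Q by (intro mult_mono) (auto simp: power_le_one Q_def)
    also have "\<dots> = C * (n powi (m + int (nat \<bar>m\<bar>))) * n"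
      using n by (simp add: M_def power_int_add mult_ac flip: power_int_of_nat)
    \<comment> \<open>The combined exponent \<open>m + \<bar>m\<bar>\<close> is never negative, so
      \<open>n \<le> 2\<close> bounds this power.\<close>
    also have "n powi (m + int (nat \<bar>m\<bar>)) = n ^ nat (m + \<bar>m\<bar>)"
      by (simp add: power_int_def)
    also have "n ^ nat (m + \<bar>m\<bar>) \<le> 2 ^ nat (m + \<bar>m\<bar>)" using n n2 by (intro power_mono) auto
    also have "(2::real) ^ nat (m + \<bar>m\<bar>) \<le> 2 ^ (2 * nat \<bar>m\<bar>)" by (intro power_increasing) auto
    finally show ?thesis using C0 n by (simp add: n_def mult_left_mono mult_right_mono)
  qed
  then show ?case by blast
next
  case (Suc j)
  obtain C1 where C1: "\<forall>z. cmod z \<le> 1 \<longrightarrow> z\<^sup>2 \<noteq> 1 \<longrightarrow> cmod (disc_deriv j q (a - 1) m i z) \<le> C1 * cmod (z\<^sup>2 - 1)"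
    using Suc[of "a - 1" m i] by (elim exE)
  obtain C2 where C2: "\<forall>z. cmod z \<le> 1 \<longrightarrow> z\<^sup>2 \<noteq> 1 \<longrightarrow> cmod (disc_deriv j q (Suc a) (m - 1) i z) \<le> C2 * cmod (z\<^sup>2 - 1)"
    using Suc[of "Suc a" "m - 1" i] by (elim exE)
  obtain C3 where C3: "\<forall>z. cmod z \<le> 1 \<longrightarrow> z\<^sup>2 \<noteq> 1 \<longrightarrow> cmod (disc_deriv j q a (m - 1) (Suc i) z) \<le> C3 * cmod (z\<^sup>2 - 1)"
    using Suc[of a "m - 1" "Suc i"] by (elim exE)
  have "cmod (disc_deriv (Suc j) q a m i z) \<le> (real a * C1 + 2 * \<bar>of_int m\<bar> * C2 + 2 * C3) * cmod (z\<^sup>2 - 1)"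
    if z: "cmod z \<le> 1" "z\<^sup>2 \<noteq> 1" for z
  proof -
    have "cmod (disc_deriv (Suc j) q a m i z) \<le> real a * cmod (disc_deriv j q (a - 1) m i z)
      + 2 * \<bar>of_int m\<bar> * cmod (disc_deriv j q (Suc a) (m - 1) i z) + 2 * cmod (disc_deriv j q a (m - 1) (Suc i) z)"
      unfolding disc_deriv.simps
      by (rule order_trans[OF norm_triangle_ineq] add_mono order_refl)+ (simp_all add: norm_mult)
    also have "\<dots> \<le> real a * (C1 * cmod (z\<^sup>2 - 1)) + 2 * \<bar>of_int m\<bar> * (C2 * cmod (z\<^sup>2 - 1)) + 2 * (C3 * cmod (z\<^sup>2 - 1))"
      by (intro add_mono mult_left_mono C1[rule_format] C2[rule_format] C3[rule_format] z) auto
    finally show ?thesis by (simp add: algebra_simps)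
  qed
  then show ?case by blast
qed

text \<open>On the circle \<open>z\<^sup>2 - 1 = 2 * \<i> * z * Im z\<close>, so
  \<open>z powi (1 - d)\<close> times \<open>(z\<^sup>2 - 1) powi (d - 1)\<close> is a constant
  times the weight of \<open>arc_embed\<close>. With these exponents a single function of the disc
  has both test functions as boundary values, while only modes from \<open>1 - d\<close> upwards
  occur in it.\<close>

lemma vacuum_continuation:
  assumes q: "strip_rapid q" and l: "circle_functional l"
    and em: "\<And>n::nat. l (emode (1 - int d + int n)) = 0"
  shows "l (arc_embed d (shifted q (\<i> * pi) 0)) = (- 1) ^ d * l (reflect_circle (arc_embed d (shifted q 0 0)))"
proof -
  \<comment> \<open>The logarithm is of no use at 1 and -1, where the value is set to 0;
    \<open>disc_deriv_bound\<close> makes every \<open>A j\<close> continuous there.\<close>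
  define A where "A = (\<lambda>j z. if z\<^sup>2 = 1 then 0 else disc_deriv j q 0 (int d - 1) 0 z)"
  have op: "open {z::complex. z\<^sup>2 \<noteq> 1}" by (intro open_Collect_neq continuous_intros)
  have Ader: "(A j has_field_derivative A (Suc j) z) (at z)" if "cmod z \<le> 1" "z\<^sup>2 \<noteq> 1" for j z
  proof -
    have "(A j has_field_derivative disc_deriv (Suc j) q 0 (int d - 1) 0 z) (at z)"
      by (rule has_field_derivative_transform_within_open[OF disc_deriv_deriv[OF q that] op])
        (use that in \<open>auto simp: A_def\<close>)
    then show ?thesis using that by (simp add: A_def)
  qed
  have cont: "continuous_on (cball 0 1) (A j)" for j
    unfolding continuous_on_eq_continuous_within
  proof
    fix z :: complex assume z: "z \<in> cball 0 1"
    show "continuous (at z within cball 0 1) (A j)"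
    proof (cases "z\<^sup>2 = 1")
      case False
      then have "isCont (A j) z" using Ader[of z j] z by (auto intro: DERIV_isCont)
      then show ?thesis by (rule continuous_at_imp_continuous_within)
    next
      case True
      obtain C where C: "\<forall>z. cmod z \<le> 1 \<longrightarrow> z\<^sup>2 \<noteq> 1 \<longrightarrow> cmod (disc_deriv j q 0 (int d - 1) 0 z) \<le> C * cmod (z\<^sup>2 - 1)"
        using disc_deriv_bound[OF q, of j 0 "int d - 1" 0] by (elim exE)
      have "(A j \<longlongrightarrow> 0) (at z within cball 0 1)"
      proof (rule Lim_null_comparison)
        show "\<forall>\<^sub>F x in at z within cball 0 1. cmod (A j x) \<le> C * cmod (x\<^sup>2 - 1)"
          unfolding eventually_at_filter by (rule always_eventually) (use C in \<open>auto simp: A_def\<close>)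
        have "isCont (\<lambda>x. C * cmod (x\<^sup>2 - 1)) z" by (intro continuous_intros)
        then have "((\<lambda>x. C * cmod (x\<^sup>2 - 1)) \<longlongrightarrow> 0) (at z)" using True by (simp add: isCont_def)
        then show "((\<lambda>x. C * cmod (x\<^sup>2 - 1)) \<longlongrightarrow> 0) (at z within cball 0 1)"
          by (rule tendsto_within_subset) simp
      qed
      then show ?thesis using True by (simp add: continuous_within A_def)
    qed
  qed
  have der: "(A j has_field_derivative A (Suc j) z) (at z)" if "z \<in> ball 0 1" for j z
  proof (rule Ader)
    show "cmod z \<le> 1" using that by simp
    show "z\<^sup>2 \<noteq> 1"
    proof
      assume "z\<^sup>2 = 1"
      then have "z = 1 \<or> z = - 1" by (simp add: power2_eq_1_iff)
      then show False using that by auto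
    qed
  qed
  have bf: "boundary_family A" by (rule boundary_family_disc[of A, OF cont der])
  have "l (laurent (1 - int d) (A 0)) = 0" by (rule functional_vanishes_disc[of A, OF cont der l em])
  note r1 = rapid_family_shifted[OF q, of "\<i> * pi"] and r2 = rapid_family_shifted[OF q, of 0]
  have "laurent (1 - int d) (A 0) = scale_circle ((2 * \<i>) powi (int d - 1))
      (arc_embed d (shifted q (\<i> * pi) 0) - scale_circle ((- 1) ^ d) (reflect_circle (arc_embed d (shifted q 0 0))))"
  proof (rule circle_eqI)
    fix t
    define z where "z = cis t"
    have z1: "cmod z = 1" "cmod (inverse z) = 1" and iz: "inverse z = cnj z" and z0: "z \<noteq> 0"
      by (simp_all add: z_def cis_cnj)
    have zz: "z * cnj z = 1" using complex_norm_square[of z] z1 by simp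
    have lhs: "apply_circle (laurent (1 - int d) (A 0)) z = z powi (1 - int d) * A 0 z"
      unfolding z_def by (rule apply_laurent[OF bf])
    have z2: "z\<^sup>2 - 1 = z * (2 * \<i> * of_real (Im z))"
    proof -
      have "z\<^sup>2 - 1 = z * (z - cnj z)" using zz by (simp add: power2_eq_square algebra_simps)
      then show ?thesis by (simp add: complex_diff_cnj mult_ac)
    qed
    have pw: "z powi (1 - int d) * (z\<^sup>2 - 1) powi (int d - 1) = (2 * \<i>) powi (int d - 1) * of_real (Im z) powi (int d - 1)" if "Im z \<noteq> 0"
    proof -
      have "z powi (1 - int d) * z powi (int d - 1) = 1" using z0 by (simp flip: power_int_add)
      then show ?thesis unfolding z2 power_int_mult_distrib by (metis mult.assoc mult_1)
    qed
    have sq1: "z\<^sup>2 = 1 \<longleftrightarrow> Im z = 0"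
      using z2 z0 by (metis eq_iff_diff_eq_0 complex_i_not_zero mult_eq_0_iff mult_zero_right of_real_0 of_real_eq_0_iff zero_neq_numeral)
    have rhs: "apply_circle (scale_circle ((2 * \<i>) powi (int d - 1))
      (arc_embed d (shifted q (\<i> * pi) 0) - scale_circle ((- 1) ^ d) (reflect_circle (arc_embed d (shifted q 0 0))))) z
      = (2 * \<i>) powi (int d - 1) * ((if Im z > 0 then of_real (Im z powi (int d - 1)) * q (of_real (ucoord z) - \<i> * pi) else 0)
        - (- 1) ^ d * (if Im z < 0 then of_real ((- Im z) powi (int d - 1)) * q (of_real (ucoord (cnj z))) else 0))"
      using z1 by (simp add: apply_arc_embed[OF r1] apply_arc_embed[OF r2] iz shifted_def)
    have cay: "(1 - z) / (1 + z) = - \<i> * of_real (Im z / (1 + Re z))" if "Im z \<noteq> 0"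
    proof -
      have p: "1 + Re z > 0" using circle_Re_gt[of z] z1 that by simp
      then have "1 + z \<noteq> 0" by (auto simp: complex_eq_iff)
      moreover have "(1 - z) * of_real (1 + Re z) = - \<i> * of_real (Im z) * (1 + z)"
      proof (rule complex_eqI)
        have sq: "(Re z)\<^sup>2 + (Im z)\<^sup>2 = 1" using z1 by (simp add: cmod_def)
        then show "Re ((1 - z) * of_real (1 + Re z)) = Re (- \<i> * of_real (Im z) * (1 + z))"
          by (simp add: algebra_simps power2_eq_square)
      qed (simp add: algebra_simps)
      ultimately show ?thesis using p by (simp add: divide_simps) (simp add: complex_eq_iff)?
    qed
    have e2: "exp (\<i> * complex_of_real pi / 2) = \<i>" using cis_conv_exp[of "pi / 2"] by simp
    have e2': "exp (complex_of_real x) = of_real (exp x)" for x by (rule exp_of_real)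
    have Lexp: "Ln (exp w) = w" if "\<bar>Im w\<bar> \<le> pi / 2" for w
      by (rule Ln_exp) (use that pi_gt_zero in linarith)+
    consider "Im z > 0" | "Im z < 0" | "Im z = 0" by linarith
    then have "z powi (1 - int d) * A 0 z = (2 * \<i>) powi (int d - 1) * ((if Im z > 0 then of_real (Im z powi (int d - 1)) * q (of_real (ucoord z) - \<i> * pi) else 0)
        - (- 1) ^ d * (if Im z < 0 then of_real ((- Im z) powi (int d - 1)) * q (of_real (ucoord (cnj z))) else 0))"
    proof cases
      case 1
      \<comment> \<open>The upper half circle goes to the negative imaginary axis, so the logarithm
        has imaginary part \<open>- pi / 2\<close>, shifted to \<open>- pi\<close>. On the lower
        half circle it is \<open>pi / 2\<close>, shifted to 0.\<close>
      have "(1 - z) / (1 + z) = of_real (exp (ucoord z)) * (- \<i>)"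
        using cay exp_ucoord[OF z1(1) 1] 1 by (simp add: mult_ac)
      also have "\<dots> = exp (of_real (ucoord z) - \<i> * (pi / 2))"
        by (simp add: exp_diff e2 e2')
      finally have "Ln ((1 - z) / (1 + z)) = of_real (ucoord z) - \<i> * (pi / 2)"
        by (simp only:) (rule Lexp, simp)
      then have L: "Ln ((1 - z) / (1 + z)) - \<i> * (pi / 2) = of_real (ucoord z) - \<i> * pi" by simp
      have "z powi (1 - int d) * A 0 z = (z powi (1 - int d) * (z\<^sup>2 - 1) powi (int d - 1)) * q (of_real (ucoord z) - \<i> * pi)"
        using 1 sq1 L by (simp add: A_def)
      then show ?thesis using 1 pw by (simp add: of_real_power_int)
    next
      case 2
      have "(1 - z) / (1 + z) = of_real (exp (ucoord (cnj z))) * \<i>"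
        using cay exp_ucoord[of "cnj z"] 2 z1 by (simp add: mult_ac)
      also have "\<dots> = exp (of_real (ucoord (cnj z)) + \<i> * (pi / 2))"
        by (simp add: exp_add e2 e2')
      finally have "Ln ((1 - z) / (1 + z)) = of_real (ucoord (cnj z)) + \<i> * (pi / 2)"
        by (simp only:) (rule Lexp, simp)
      then have L: "Ln ((1 - z) / (1 + z)) - \<i> * (pi / 2) = of_real (ucoord (cnj z))" by simp
      have "z powi (1 - int d) * A 0 z = (z powi (1 - int d) * (z\<^sup>2 - 1) powi (int d - 1)) * q (of_real (ucoord (cnj z)))"
        using 2 sq1 L by (simp add: A_def)
      \<comment> \<open>A negative \<open>Im z\<close> contributes
        \<open>(- 1) powi (d - 1) = - ((- 1) ^ d)\<close>, the source of the sign in the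
        conclusion.\<close>
      moreover have "complex_of_real (Im z) powi (int d - 1) = - ((- 1) ^ d * of_real ((- Im z) powi (int d - 1)))"
      proof -
        have "complex_of_real (Im z) powi (int d - 1) = (- 1 * of_real (- Im z)) powi (int d - 1)" by simp
        also have "\<dots> = (- 1) powi (int d - 1) * of_real ((- Im z) powi (int d - 1))"
          unfolding power_int_mult_distrib by (simp add: of_real_power_int)
        also have "(- 1 :: complex) powi (int d - 1) = - ((- 1) ^ d)"
          by (simp add: power_int_diff)
        finally show ?thesis by simp
      qed
      ultimately show ?thesis using 2 pw by simp
    next
      case 3
      then show ?thesis using sq1 by (simp add: A_def)
    qed
    then show "apply_circle (laurent (1 - int d) (A 0)) (cis t) = apply_circle (scale_circle ((2 * \<i>) powi (int d - 1))
      (arc_embed d (shifted q (\<i> * pi) 0) - scale_circle ((- 1) ^ d) (reflect_circle (arc_embed d (shifted q 0 0))))) (cis t)"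
      using lhs rhs unfolding z_def by simp
  qed
  with \<open>l (laurent (1 - int d) (A 0)) = 0\<close>
  have "(2 * \<i>) powi (int d - 1) * (l (arc_embed d (shifted q (\<i> * pi) 0))
      - (- 1) ^ d * l (reflect_circle (arc_embed d (shifted q 0 0)))) = 0"
    using l circle_functional_simps(3)[OF l] by (simp add: circle_functional_def)
  then show ?thesis by (simp add: power_int_eq_0_iff)
qed

section \<open>Approximation by functions supported inside the upper half circle\<close>

lemma Arg_cis_pos: "0 < t \<Longrightarrow> t < pi \<Longrightarrow> Arg (cis t) = t"
  by (rule cis_Arg_unique) (auto simp: sgn_eq)

text \<open>Near any angle the periodic function agrees with a single translate of \<open>G\<close>,
  because \<open>G\<close> vanishes on the remainder of a window of length
  \<open>3 * pi\<close>.\<close>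

lemma smooth_family_periodize:
  assumes G: "smooth_family G" and zero: "\<And>j t. t \<le> 0 \<or> pi \<le> t \<Longrightarrow> G j t = 0"
  shows "smooth_family (\<lambda>j t. if sin t > 0 then G j (Arg (cis t)) else 0)"
  unfolding smooth_family_def
proof (intro allI)
  fix j and t :: real
  \<comment> \<open>Shifts \<open>t\<close> into \<open>(- pi, pi]\<close>. This lies inside the
    open window \<open>(- pi, 2 * pi)\<close> on which \<open>eq\<close> holds, so that even
    \<open>t = pi\<close> becomes an interior point.\<close>
  define n where "n = \<lceil>(t - pi) / (2 * pi)\<rceil>"
  have "(t - pi) / (2 * pi) \<le> of_int n" "of_int n < (t - pi) / (2 * pi) + 1" unfolding n_def by linarith+
  then have t: "t - 2 * pi * of_int n \<le> pi" "- pi < t - 2 * pi * of_int n" by (simp_all add: field_simps)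
  have eq: "(if sin s > 0 then G j (Arg (cis s)) else 0) = G j (s - 2 * pi * of_int n)"
    if s: "- pi < s - 2 * pi * of_int n" "s - 2 * pi * of_int n < 2 * pi" for s j
  proof -
    define s' where "s' = s - 2 * pi * of_int n"
    have cis: "cis s = cis s'"
    proof -
      have "cis s = cis s' * cis (2 * pi * of_int n)" by (simp only: s'_def cis_mult diff_add_cancel)
      then show ?thesis by (simp add: cis_multiple_2pi)
    qed
    then have sin: "sin s = sin s'" by (metis cis.sel(2))
    have s': "- pi < s'" "s' < 2 * pi" using s by (simp_all only: s'_def)
    consider "s' \<le> 0" | "0 < s'" "s' < pi" | "pi \<le> s'" by linarith
    then show ?thesis
    proof cases
      case 1
      then have "sin s' \<le> 0" using s' sin_ge_zero[of "- s'"] by simp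
      then show ?thesis using zero[of s' j] 1 sin by (simp add: s'_def)
    next
      case 2
      then have "sin s' > 0" by (rule sin_gt_zero)
      then show ?thesis using Arg_cis_pos[OF 2] cis sin by (simp add: s'_def)
    next
      case 3
      then have "sin s' \<le> 0" using s' sin_le_zero[of s'] by simp
      then show ?thesis using zero[of s' j] 3 sin by (simp add: s'_def)
    qed
  qed
  have "((\<lambda>s. s - 2 * pi * of_int n) has_vector_derivative 1) (at t)"
    by (auto intro!: derivative_eq_intros simp: has_real_derivative_iff_has_vector_derivative[symmetric])
  from vector_diff_chain_at[OF this smooth_familyD[OF G]]
  have "((\<lambda>s. G j (s - 2 * pi * of_int n)) has_vector_derivative G (Suc j) (t - 2 * pi * of_int n)) (at t)"
    by (simp add: o_def)
  then have "((\<lambda>s. if sin s > 0 then G j (Arg (cis s)) else 0) has_vector_derivative G (Suc j) (t - 2 * pi * of_int n)) (at t)"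
    by (rule has_vector_derivative_transform_within_open[where S = "{2 * pi * of_int n - pi<..<2 * pi * of_int n + 2 * pi}"])
      (use t eq in auto)
  also have "G (Suc j) (t - 2 * pi * of_int n) = (if sin t > 0 then G (Suc j) (Arg (cis t)) else 0)"
    by (rule eq[symmetric]) (use t pi_gt_zero in linarith)+
  finally show "((\<lambda>s. if sin s > 0 then G j (Arg (cis s)) else 0) has_vector_derivative
      (if sin t > 0 then G (Suc j) (Arg (cis t)) else 0)) (at t)" .
qed

lemma supp_reflect_arc_embed:
  assumes "rapid_family q"
  shows "supp_circle (reflect_circle (arc_embed d (q 0))) \<subseteq> {z. Im z \<le> 0}"
  unfolding supp_circle_def
proof (rule closure_minimal)
  show "closed {z. Im z \<le> 0}" by (intro closed_Collect_le continuous_intros)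
  show "{z. apply_circle (reflect_circle (arc_embed d (q 0))) z \<noteq> 0} \<subseteq> {z. Im z \<le> 0}"
  proof clarify
    fix z assume nz: "apply_circle (reflect_circle (arc_embed d (q 0))) z \<noteq> 0"
    then have "cmod (inverse z) = 1" "Im (inverse z) > 0"
      by (auto simp: apply_arc_embed[OF assms] split: if_splits)
    moreover have "z * cnj z = 1" using complex_norm_square[of z] \<open>cmod (inverse z) = 1\<close> by (simp add: norm_inverse)
    then have "inverse z = cnj z" by (rule inverse_unique)
    ultimately show "Im z \<le> 0" by simp
  qed
qed

text \<open>The support of \<open>arc_embed d (q 0)\<close> can reach 1 and -1. Dilating the angle
  about \<open>pi / 2\<close> by a factor slightly above 1 squeezes it into the open half circle,
  and uniform continuity makes the dilated derivatives converge.\<close>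

lemma arc_embed_approx:
  assumes q: "rapid_family q"
  obtains f :: "nat \<Rightarrow> smooth_circle" where "f \<longlonglongrightarrow> arc_embed d (q 0)" "\<And>n. supp_circle (f n) \<subseteq> I_plus"
proof -
  define P where "P = (\<lambda>j. arc_cderiv j q (1 - int d) 0 0)"
  have cd: "cderiv (arc_embed d (q 0)) j t = arc_fun (P j) (cis t)" for j t
    unfolding P_def by (rule cderiv_arc_embed[OF q])
  \<comment> \<open>The dilation lives on the line, not on the circle, so the upper arc is unrolled
    and everything else set to 0.\<close>
  define F where "F j t = (if - pi < t \<and> t < 2 * pi then arc_fun (P j) (cis t) else 0)" for j t
  have F0: "F j t = 0" if "t \<le> 0 \<or> pi \<le> t" for j t
  proof (cases "- pi < t \<and> t < 2 * pi")
    case True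
    have "sin t \<le> 0" using that
    proof
      assume "t \<le> 0"
      then show ?thesis using True sin_ge_zero[of "- t"] by simp
    next
      assume "pi \<le> t"
      then show ?thesis using True sin_le_zero[of t] by simp
    qed
    then show ?thesis by (simp add: F_def arc_fun_def)
  qed (auto simp: F_def)
  have F: "smooth_family F"
    unfolding smooth_family_def
  proof (intro allI)
    fix j t
    show "(F j has_vector_derivative F (Suc j) t) (at t)"
    proof (cases "- pi < t \<and> t < 2 * pi")
      case True
      have "((\<lambda>t. arc_fun (P j) (cis t)) has_vector_derivative arc_fun (P (Suc j)) (cis t)) (at t)"
        using smooth_familyD[OF smooth_family_cderiv[of "arc_embed d (q 0)"], of j t]
        by (simp add: cd[abs_def])
      then have "(F j has_vector_derivative arc_fun (P (Suc j)) (cis t)) (at t)"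
        by (rule has_vector_derivative_transform_within_open[where S = "{- pi<..<2 * pi}"])
          (use True in \<open>auto simp: F_def\<close>)
      then show ?thesis using True by (simp add: F_def)
    next
      case False
      then have t: "t < 0 \<or> t > pi" using pi_gt_zero by linarith
      have "((\<lambda>t. 0) has_vector_derivative (0::complex)) (at t)" by simp
      then have "(F j has_vector_derivative 0) (at t)"
        by (rule has_vector_derivative_transform_within_open[where S = "{..<0} \<union> {pi<..}"])
          (use t F0 in auto)
      then show ?thesis using t F0[of t "Suc j"] by auto
    qed
  qed
  \<comment> \<open>Factors in \<open>(1, 3 / 2]\<close> move an angle in \<open>(0, pi)\<close> by
    at most \<open>pi / 4\<close>, hence dilated angles stay in the compact interval used for
    uniform continuity.\<close>
  define \<kappa> where "\<kappa> n = 1 + 1 / (real n + 2)" for n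
  have \<kappa>: "1 < \<kappa> n" "\<kappa> n \<le> 3 / 2" for n by (auto simp: \<kappa>_def field_simps)
  have \<kappa>lim: "\<kappa> \<longlonglongrightarrow> 1" unfolding \<kappa>_def by real_asymp
  define r where "r n t = \<kappa> n * (t - pi / 2) + pi / 2" for n t
  define G where "G n j t = of_real (\<kappa> n ^ j) * F j (r n t)" for n j t
  have G: "smooth_family (G n)" for n
    unfolding smooth_family_def
  proof (intro allI)
    fix j t
    have "(r n has_vector_derivative \<kappa> n) (at t)"
      unfolding r_def
      by (auto intro!: derivative_eq_intros simp: has_real_derivative_iff_has_vector_derivative[symmetric])
    from has_vector_derivative_mult_right[OF vector_diff_chain_at[OF this smooth_familyD[OF F]], of "of_real (\<kappa> n ^ j)" j]
    show "(G n j has_vector_derivative G n (Suc j) t) (at t)"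
      by (simp add: G_def[abs_def] o_def scaleR_conv_of_real mult_ac)
  qed
  have range: "0 < r n t \<and> r n t < pi" if "G n j t \<noteq> 0" for n j t
  proof (rule ccontr)
    assume "\<not> (0 < r n t \<and> r n t < pi)"
    then have "r n t \<le> 0 \<or> pi \<le> r n t" by linarith
    then show False using that F0 by (simp add: G_def)
  qed
  have inner: "\<bar>t - pi / 2\<bar> < pi / (2 * \<kappa> n)" if "G n j t \<noteq> 0" for n j t
  proof -
    have "\<bar>\<kappa> n * (t - pi / 2)\<bar> < pi / 2" using range[OF that] by (auto simp: r_def)
    then have "\<kappa> n * \<bar>t - pi / 2\<bar> < pi / 2" using \<kappa>[of n] by (simp add: abs_mult)
    then show ?thesis using \<kappa>[of n] by (simp add: field_simps)
  qed
  have less: "pi / (2 * \<kappa> n) < pi / 2" for n using \<kappa>(1)[of n] by (simp add: field_simps)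
  have G0: "G n j t = 0" if "t \<le> 0 \<or> pi \<le> t" for n j t
  proof (rule ccontr)
    assume "G n j t \<noteq> 0"
    from order_less_trans[OF inner[OF this] less] have "\<bar>t - pi / 2\<bar> < pi / 2" .
    then show False using that unfolding abs_less_iff by linarith
  qed
  define f where "f n = circ (\<lambda>z. if Im z > 0 then G n 0 (Arg z) else 0)" for n
  note per = smooth_family_periodize[OF G G0]
  have cf: "cderiv (f n) j t = (if sin t > 0 then G n j (Arg (cis t)) else 0)" for n j t
    unfolding f_def by (subst cderiv_circ[OF per[of n]]) auto
  have af: "apply_circle (f n) z = (if cmod z = 1 \<and> Im z > 0 then G n 0 (Arg z) else 0)" for n z
    unfolding f_def by (subst apply_circ[OF per[of n]]) auto
  have supp: "supp_circle (f n) \<subseteq> I_plus" for n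
  proof -
    \<comment> \<open>The function lives on angles within \<open>pi / (2 * \<kappa> n)\<close> of
      \<open>pi / 2\<close>, where \<open>Im z\<close> is at least this cosine. The condition is
      closed, so it survives taking the closure.\<close>
    define c where "c = cos (pi / (2 * \<kappa> n))"
    have c: "c > 0" unfolding c_def using less[of n] \<kappa>[of n] by (intro cos_gt_zero) auto
    have "supp_circle (f n) \<subseteq> {z. cmod z = 1 \<and> c \<le> Im z}"
      unfolding supp_circle_def
    proof (rule closure_minimal)
      show "closed {z. cmod z = 1 \<and> c \<le> Im z}"
        by (intro closed_Collect_conj closed_Collect_eq closed_Collect_le continuous_intros)
      show "{z. apply_circle (f n) z \<noteq> 0} \<subseteq> {z. cmod z = 1 \<and> c \<le> Im z}"
      proof clarify
        fix z assume nz: "apply_circle (f n) z \<noteq> 0"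
        then have z: "cmod z = 1" "G n 0 (Arg z) \<noteq> 0" by (auto simp: af split: if_splits)
        have "z = cis (Arg z)" using rcis_cmod_Arg[of z] z by (simp add: rcis_def)
        then have "Im z = sin (Arg z)" by (metis cis.sel(2))
        also have "\<dots> = cos \<bar>Arg z - pi / 2\<bar>" by (simp add: cos_diff abs_if)
        also have "\<dots> \<ge> c" unfolding c_def using inner[OF z(2)] less[of n] pi_gt_zero
          by (intro cos_monotone_0_pi_le) linarith+
        finally show "cmod z = 1 \<and> c \<le> Im z" using z by simp
      qed
    qed
    then show ?thesis using c by (auto simp: I_plus_def)
  qed
  have "f \<longlonglongrightarrow> arc_embed d (q 0)"
  proof (rule tendsto_circleI_cderiv)
    fix j and e :: real assume e: "e > 0"
    have co: "continuous_on {- pi..2 * pi} (F j)" by (rule smooth_family_continuous[OF F])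
    have "uniformly_continuous_on {- pi..2 * pi} (F j)" by (rule compact_uniformly_continuous[OF co]) simp
    then obtain \<delta> where \<delta>: "\<delta> > 0" "\<And>x y. x \<in> {- pi..2 * pi} \<Longrightarrow> y \<in> {- pi..2 * pi} \<Longrightarrow> dist x y < \<delta> \<Longrightarrow> dist (F j x) (F j y) < e / 2"
      unfolding uniformly_continuous_on_def using e by (metis half_gt_zero)
    have "bounded (F j ` {- pi..2 * pi})" by (intro compact_imp_bounded compact_continuous_image co) simp
    then obtain K where K: "K > 0" "\<And>x. x \<in> {- pi..2 * pi} \<Longrightarrow> cmod (F j x) \<le> K"
      unfolding bounded_pos by auto
    have "(\<lambda>n. \<kappa> n ^ j) \<longlonglongrightarrow> 1" using tendsto_power[OF \<kappa>lim, of j] by simp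
    then have "\<forall>\<^sub>F n in sequentially. \<bar>\<kappa> n ^ j - 1\<bar> < e / (2 * K)"
      using e K(1) by (auto simp: tendsto_iff dist_real_def)
    moreover have "\<forall>\<^sub>F n in sequentially. \<bar>\<kappa> n - 1\<bar> < \<delta> / pi"
      using \<kappa>lim \<delta>(1) by (auto simp: tendsto_iff dist_real_def)
    ultimately show "\<forall>\<^sub>F n in sequentially. \<forall>t. cmod (cderiv (f n) j t - cderiv (arc_embed d (q 0)) j t) \<le> e"
    proof eventually_elim
      case (elim n)
      show ?case
      proof
        fix t
        show "cmod (cderiv (f n) j t - cderiv (arc_embed d (q 0)) j t) \<le> e"
        proof (cases "sin t > 0")
          case False
          then show ?thesis using e by (simp add: cf cd arc_fun_def)
        next
          case True
          define s where "s = Arg (cis t)"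
          have cs: "cis s = cis t" using rcis_cmod_Arg[of "cis t"] by (simp add: s_def rcis_def)
          have s: "0 < s" "s < pi"
          proof -
            have "- pi < s" "s \<le> pi" using Arg_bounded[of "cis t"] by (auto simp: s_def)
            moreover have "sin s > 0" using True cs by (metis cis.sel(2))
            ultimately show "0 < s" "s < pi"
              using sin_ge_zero[of "- s"] sin_pi by (smt (verit) sin_minus)+
          qed
          have Fs: "cderiv (arc_embed d (q 0)) j t = F j s" using s cs by (simp add: cd F_def)
          have Gs: "cderiv (f n) j t = G n j s" using True by (simp add: cf s_def)
          have ab: "\<bar>s - pi / 2\<bar> < pi / 2" using s by (simp add: abs_if)
          have "r n s - s = (\<kappa> n - 1) * (s - pi / 2)" by (simp add: r_def field_simps)
          then have "\<bar>r n s - s\<bar> = \<bar>\<kappa> n - 1\<bar> * \<bar>s - pi / 2\<bar>" by (simp only: abs_mult)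
          also have "\<dots> \<le> \<bar>\<kappa> n - 1\<bar> * (pi / 2)" using ab by (intro mult_left_mono) auto
          finally have d1: "\<bar>r n s - s\<bar> \<le> \<bar>\<kappa> n - 1\<bar> * (pi / 2)" .
          have "\<bar>\<kappa> n - 1\<bar> * (pi / 2) \<le> (1 / 2) * (pi / 2)" using \<kappa>[of n] by (intro mult_right_mono) auto
          with d1 have "\<bar>r n s - s\<bar> \<le> (1 / 2) * (pi / 2)" by (rule order_trans)
          then have rs: "r n s \<in> {- pi..2 * pi}" using s unfolding abs_le_iff atLeastAtMost_iff by linarith
          have "\<bar>\<kappa> n - 1\<bar> * pi < \<delta>" using elim by (simp add: field_simps)
          then have "\<bar>r n s - s\<bar> < \<delta>" using d1 abs_ge_zero[of "r n s - s"] by linarith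
          then have 1: "cmod (F j (r n s) - F j s) < e / 2"
            using \<delta>(2)[OF rs, of s] s by (simp add: dist_norm dist_real_def)
          have "G n j s - F j s = of_real (\<kappa> n ^ j - 1) * F j (r n s) + (F j (r n s) - F j s)"
            by (simp add: G_def algebra_simps)
          also have "cmod \<dots> \<le> \<bar>\<kappa> n ^ j - 1\<bar> * cmod (F j (r n s)) + cmod (F j (r n s) - F j s)"
            by (rule order_trans[OF norm_triangle_ineq]) (simp only: norm_mult norm_of_real)
          also have "\<dots> \<le> e / (2 * K) * K + e / 2"
            by (intro add_mono mult_mono) (use elim 1 K rs in auto)
          also have "\<dots> = e" using K(1) by simp
          finally show ?thesis unfolding Fs Gs .
        qed
      qed
    qed
  qed
  with supp show ?thesis using that by blast
qed

section \<open>Gaussian regularisation\<close>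

definition gauss :: "real \<Rightarrow> complex \<Rightarrow> complex" where
  "gauss \<sigma> z = of_real (1 / sqrt (2 * pi * \<sigma>\<^sup>2)) * exp (- z\<^sup>2 / of_real (2 * \<sigma>\<^sup>2))"

text \<open>Integration over a compact interval, outside of which \<open>p\<close> is meant to
  vanish, makes the result entire by differentiation under the integral; at real \<open>z\<close> it
  is convolution with the normal density.\<close>

definition gauss_conv :: "(real \<Rightarrow> complex) \<Rightarrow> real \<Rightarrow> real \<Rightarrow> complex \<Rightarrow> complex" where
  "gauss_conv p R \<sigma> z = integral {- R..R} (\<lambda>s. p s * gauss \<sigma> (z - of_real s))"

lemma gauss_real: "gauss \<sigma> (of_real x - of_real s) = of_real (normal_density x \<sigma> s)"
  by (simp add: gauss_def normal_density_def power2_commute[of s x] flip: exp_of_real)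

lemma gauss_has_derivative:
  assumes "\<sigma> > 0"
  shows "(gauss \<sigma> has_field_derivative - (z / of_real (\<sigma>\<^sup>2)) * gauss \<sigma> z) (at z)"
  unfolding gauss_def using assms by (auto intro!: derivative_eq_intros simp: field_simps)

lemma cmod_gauss: "cmod (gauss \<sigma> z) = 1 / sqrt (2 * pi * \<sigma>\<^sup>2) * exp (((Im z)\<^sup>2 - (Re z)\<^sup>2) / (2 * \<sigma>\<^sup>2))"
proof -
  have "Re (- z\<^sup>2 / of_real (2 * \<sigma>\<^sup>2)) = ((Im z)\<^sup>2 - (Re z)\<^sup>2) / (2 * \<sigma>\<^sup>2)"
    by (simp only: Re_divide_of_real) (simp add: power2_eq_square)
  moreover have "cmod (of_real (1 / sqrt (2 * pi * \<sigma>\<^sup>2))) = 1 / sqrt (2 * pi * \<sigma>\<^sup>2)"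
    by (simp only: norm_of_real) simp
  ultimately show ?thesis unfolding gauss_def norm_mult norm_exp_eq_Re by simp
qed

lemma continuous_on_gauss [continuous_intros]:
  "continuous_on S f \<Longrightarrow> continuous_on S (\<lambda>x. gauss \<sigma> (f x))"
  unfolding gauss_def by (cases "\<sigma> = 0") (auto intro!: continuous_intros)

text \<open>Differentiation under the integral falls on the Gaussian, and integration by parts moves
  it to \<open>p\<close>, the boundary terms being zero. Regularisation thus commutes with
  differentiation, and one estimate for all \<open>p i\<close> controls all derivatives.\<close>

lemma gauss_conv_derivative:
  assumes \<sigma>: "\<sigma> > 0" and p: "smooth_family p" and R: "R \<ge> 0" and zero: "p i R = 0" "p i (- R) = 0"
  shows "(gauss_conv (p i) R \<sigma> has_field_derivative gauss_conv (p (Suc i)) R \<sigma> z) (at z)"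
proof -
  have cp: "continuous_on S (p i)" for S i by (rule smooth_family_continuous[OF p])
  define g' where "g' z = - (z / of_real (\<sigma>\<^sup>2)) * gauss \<sigma> z" for z
  have gd: "((\<lambda>z. gauss \<sigma> (z - of_real s)) has_field_derivative g' (z - of_real s)) (at z)" for z s
  proof -
    have "((\<lambda>z. z - of_real s) has_field_derivative 1) (at z)" by (auto intro!: derivative_eq_intros)
    from DERIV_chain2[of "gauss \<sigma>" "g' (z - of_real s)" "\<lambda>z. z - of_real s" z 1 UNIV, OF _ this]
    show ?thesis using gauss_has_derivative[OF \<sigma>, of "z - of_real s"] by (simp add: g'_def)
  qed
  have cp': "continuous_on S (\<lambda>x. p i (h x))" if "continuous_on S h" for S :: "(complex \<times> real) set" and h
    by (rule continuous_on_compose2[OF cp[of UNIV] that]) simp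
  have "((\<lambda>z. integral (cbox (- R) R) (\<lambda>s. p i s * gauss \<sigma> (z - of_real s))) has_field_derivative
      integral (cbox (- R) R) (\<lambda>s. p i s * g' (z - of_real s))) (at z within UNIV)"
  proof (rule leibniz_rule_field_derivative)
    show "((\<lambda>z. p i s * gauss \<sigma> (z - of_real s)) has_field_derivative p i s * g' (z - of_real s)) (at z within UNIV)" for z s
      by (rule DERIV_cmult) (use gd in simp)
    show "(\<lambda>s. p i s * gauss \<sigma> (z - of_real s)) integrable_on cbox (- R) R" for z
      by (intro integrable_continuous continuous_intros cp)
    show "continuous_on (UNIV \<times> cbox (- R) R) (\<lambda>(x, t). p i t * g' (x - of_real t))"
      unfolding g'_def case_prod_unfold using \<sigma> by (intro continuous_intros cp') auto
  qed auto
  moreover have "((\<lambda>s. p (Suc i) s * gauss \<sigma> (z - of_real s) - p i s * g' (z - of_real s)) has_integral 0) {- R..R}"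
  proof -
    have "((\<lambda>s. p i s * gauss \<sigma> (z - of_real s)) has_vector_derivative
        p (Suc i) s * gauss \<sigma> (z - of_real s) - p i s * g' (z - of_real s)) (at s)" for s
    proof -
      have "((\<lambda>w. gauss \<sigma> (z - w)) has_field_derivative - g' (z - w)) (at w)" for w
      proof -
        have "((\<lambda>w. z - w) has_field_derivative - 1) (at w)" by (auto intro!: derivative_eq_intros)
        from DERIV_chain2[of "gauss \<sigma>" "g' (z - w)" "\<lambda>w. z - w" w "- 1" UNIV, OF _ this]
        show ?thesis using gauss_has_derivative[OF \<sigma>, of "z - w"] by (simp add: g'_def)
      qed
      from has_vector_derivative_real_field[OF this, of s UNIV]
      have "((\<lambda>s. gauss \<sigma> (z - of_real s)) has_vector_derivative - g' (z - of_real s)) (at s)" .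
      from has_vector_derivative_mult[OF smooth_familyD[OF p] this, of i]
      show ?thesis by (simp add: algebra_simps)
    qed
    then have "((\<lambda>s. p (Suc i) s * gauss \<sigma> (z - of_real s) - p i s * g' (z - of_real s)) has_integral
        p i R * gauss \<sigma> (z - of_real R) - p i (- R) * gauss \<sigma> (z - of_real (- R))) {- R..R}"
      using R by (intro fundamental_theorem_of_calculus) (auto intro: has_vector_derivative_at_within)
    then show ?thesis by (simp add: zero)
  qed
  then have "integral {- R..R} (\<lambda>s. p (Suc i) s * gauss \<sigma> (z - of_real s) - p i s * g' (z - of_real s)) = 0"
    by (rule integral_unique)
  moreover have "integral {- R..R} (\<lambda>s. p (Suc i) s * gauss \<sigma> (z - of_real s) - p i s * g' (z - of_real s))
     = integral {- R..R} (\<lambda>s. p (Suc i) s * gauss \<sigma> (z - of_real s)) - integral {- R..R} (\<lambda>s. p i s * g' (z - of_real s))"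
    unfolding g'_def using \<sigma> by (intro integral_diff integrable_continuous_real continuous_intros cp) auto
  ultimately show ?thesis by (simp add: gauss_conv_def[abs_def])
qed

lemma cosh_power_le_exp: "cosh x ^ M \<le> exp (real M * \<bar>x\<bar>)"
proof -
  have "cosh x \<le> exp \<bar>x\<bar>" by (cases "x \<ge> 0") (simp_all add: cosh_def)
  then have "cosh x ^ M \<le> exp \<bar>x\<bar> ^ M" by (intro power_mono) auto
  then show ?thesis by (simp flip: exp_of_nat_mult)
qed

text \<open>In a strip the Gaussian is at most a constant times
  \<open>exp (- (Re z - s)\<^sup>2 / (2 * \<sigma>\<^sup>2))\<close>, which beats every power of
  \<open>cosh (Re z)\<close> because \<open>s\<close> stays in a bounded interval.\<close>

lemma strip_rapid_gauss_conv:
  assumes \<sigma>: "\<sigma> > 0" and p: "smooth_family p" and R: "R \<ge> 0" and zero: "\<And>i. p i R = 0" "\<And>i. p i (- R) = 0"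
  shows "strip_rapid (gauss_conv (p 0) R \<sigma>)"
  unfolding strip_rapid_def
proof (intro conjI allI)
  show "gauss_conv (p 0) R \<sigma> holomorphic_on UNIV"
    using gauss_conv_derivative[OF \<sigma> p R zero, of 0] by (auto simp: holomorphic_on_def field_differentiable_def)
  fix S and M :: nat
  have cp: "continuous_on A (p 0)" for A by (rule smooth_family_continuous[OF p])
  have "bounded (p 0 ` {- R..R})" by (intro compact_imp_bounded compact_continuous_image cp) simp
  then obtain B where B: "B > 0" "\<And>s. s \<in> {- R..R} \<Longrightarrow> cmod (p 0 s) \<le> B" unfolding bounded_pos by auto
  define c where "c = 1 / sqrt (2 * pi * \<sigma>\<^sup>2)"
  have c: "c \<ge> 0" by (simp add: c_def)
  \<comment> \<open>Three factors: growth of the Gaussian in the imaginary direction, the weight at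
    distance \<open>R\<close> from the origin, and the maximum of
    \<open>exp (M * v - v\<^sup>2 / (2 * \<sigma>\<^sup>2))\<close>, found by completing the
    square.\<close>
  define E where "E = exp (S\<^sup>2 / (2 * \<sigma>\<^sup>2)) * (exp (real M * R) * exp ((real M * \<sigma>)\<^sup>2 / 2))"
  have "cmod (gauss_conv (p 0) R \<sigma> z) * cosh (Re z) ^ M \<le> B * (c * E) * (2 * R)" if z: "\<bar>Im z\<bar> \<le> S" for z
  proof -
    define h where "h = (\<lambda>s. (p 0 s * gauss \<sigma> (z - of_real s)) * of_real (cosh (Re z) ^ M))"
    have "(h has_integral gauss_conv (p 0) R \<sigma> z * of_real (cosh (Re z) ^ M)) (cbox (- R) R)"
      unfolding h_def gauss_conv_def cbox_interval
      by (intro has_integral_mult_left integrable_integral integrable_continuous_real continuous_intros cp)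
    then have "norm (gauss_conv (p 0) R \<sigma> z * of_real (cosh (Re z) ^ M)) \<le> B * (c * E) * measure lborel (cbox (- R) R)"
    proof (rule has_integral_bound[rotated])
      show "0 \<le> B * (c * E)" using B c by (auto simp: E_def)
      fix s assume "s \<in> cbox (- R) R"
      then have s: "s \<in> {- R..R}" by simp
      define v where "v = Re z - s"
      have "(Im z)\<^sup>2 \<le> S\<^sup>2" using z by (metis abs_ge_zero abs_le_square_iff abs_of_nonneg order_trans)
      then have im: "exp ((Im z)\<^sup>2 / (2 * \<sigma>\<^sup>2)) \<le> exp (S\<^sup>2 / (2 * \<sigma>\<^sup>2))" using \<sigma> by (simp add: divide_right_mono)
      have "0 \<le> (\<bar>v\<bar> / \<sigma> - real M * \<sigma>)\<^sup>2" by simp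
      also have "\<dots> = v\<^sup>2 / \<sigma>\<^sup>2 - 2 * real M * \<bar>v\<bar> + (real M * \<sigma>)\<^sup>2"
        using \<sigma> by (simp add: power2_diff power_divide)
      finally have "real M * \<bar>v\<bar> - v\<^sup>2 / (2 * \<sigma>\<^sup>2) \<le> (real M * \<sigma>)\<^sup>2 / 2" by simp
      then have e2: "exp (real M * \<bar>v\<bar>) * exp (- (v\<^sup>2 / (2 * \<sigma>\<^sup>2))) \<le> exp ((real M * \<sigma>)\<^sup>2 / 2)"
        by (simp flip: exp_add)
      have "\<bar>Re z\<bar> \<le> R + \<bar>v\<bar>" using s by (auto simp: v_def)
      then have "real M * \<bar>Re z\<bar> \<le> real M * R + real M * \<bar>v\<bar>"
        by (metis distrib_left mult_left_mono of_nat_0_le_iff)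
      then have ch: "cosh (Re z) ^ M \<le> exp (real M * R) * exp (real M * \<bar>v\<bar>)"
        using cosh_power_le_exp[of "Re z" M] by (simp flip: exp_add) (meson exp_le_cancel_iff order_trans)
      have "cmod (gauss \<sigma> (z - of_real s)) * cosh (Re z) ^ M
          = c * (exp ((Im z)\<^sup>2 / (2 * \<sigma>\<^sup>2)) * (exp (- (v\<^sup>2 / (2 * \<sigma>\<^sup>2))) * cosh (Re z) ^ M))"
      proof -
        have "cmod (gauss \<sigma> (z - of_real s)) = c * (exp ((Im z)\<^sup>2 / (2 * \<sigma>\<^sup>2)) * exp (- (v\<^sup>2 / (2 * \<sigma>\<^sup>2))))"
          by (simp add: cmod_gauss c_def v_def diff_divide_distrib flip: exp_add)
        then show ?thesis by (simp only: mult_ac)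
      qed
      also have "\<dots> \<le> c * (exp (S\<^sup>2 / (2 * \<sigma>\<^sup>2)) * (exp (- (v\<^sup>2 / (2 * \<sigma>\<^sup>2))) * (exp (real M * R) * exp (real M * \<bar>v\<bar>))))"
        by (intro mult_left_mono mult_mono im ch c) auto
      also have "\<dots> = c * (exp (S\<^sup>2 / (2 * \<sigma>\<^sup>2)) * (exp (real M * R) * (exp (real M * \<bar>v\<bar>) * exp (- (v\<^sup>2 / (2 * \<sigma>\<^sup>2))))))"
        by (simp only: mult_ac)
      also have "\<dots> \<le> c * E" unfolding E_def by (intro mult_left_mono e2 c) auto
      finally have g: "cmod (gauss \<sigma> (z - of_real s)) * cosh (Re z) ^ M \<le> c * E" .
      have "cmod (p 0 s) * (cmod (gauss \<sigma> (z - of_real s)) * cosh (Re z) ^ M) \<le> B * (c * E)"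
        by (rule mult_mono[OF B(2)[OF s] g]) (use B(1) in auto)
      then show "norm (h s) \<le> B * (c * E)"
        by (simp add: h_def norm_mult norm_power mult_ac)
    qed
    then show ?thesis using R by (simp add: norm_mult norm_power)
  qed
  then show "\<exists>C. \<forall>z. \<bar>Im z\<bar> \<le> S \<longrightarrow> cmod (gauss_conv (p 0) R \<sigma> z) * cosh (Re z) ^ M \<le> C" by blast
qed

lemma higher_deriv_gauss_conv:
  assumes "\<sigma> > 0" "smooth_family p" "R \<ge> 0" "\<And>i. p i R = 0" "\<And>i. p i (- R) = 0"
  shows "(deriv ^^ i) (gauss_conv (p 0) R \<sigma>) = gauss_conv (p i) R \<sigma>"
proof (induction i)
  case (Suc i)
  have "deriv (gauss_conv (p i) R \<sigma>) = gauss_conv (p (Suc i)) R \<sigma>"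
    by (rule ext, rule DERIV_imp_deriv, rule gauss_conv_derivative) (use assms in auto)
  with Suc show ?case by simp
qed simp

text \<open>The Lipschitz condition contributes \<open>\<bar>s - x\<bar>\<close>, which is of size
  \<sigma> under the Gaussian. Half of the Gaussian exponent absorbs this factor together with the
  weight; the other half is again a normal density and integrates to 1.\<close>

lemma gauss_conv_approx:
  assumes cont: "\<And>S. continuous_on S p" and lip: "\<And>x y. cmod (p x - p y) \<le> L * \<bar>x - y\<bar>"
    and zero: "\<And>x. \<bar>x\<bar> > R \<Longrightarrow> p x = 0" and R: "R \<ge> 0"
  shows "\<exists>K. \<forall>\<sigma> x. 0 < \<sigma> \<longrightarrow> \<sigma> \<le> 1 \<longrightarrow> cmod (gauss_conv p R \<sigma> (of_real x) - p x) * cosh x ^ M \<le> K * \<sigma>"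
proof -
  have L: "L \<ge> 0" using order_trans[OF norm_ge_zero lip[of 1 0]] by simp
  define K where "K = L * exp (real M * R) * exp ((real M + 1)\<^sup>2) * sqrt 2"
  have "cmod (gauss_conv p R \<sigma> (of_real x) - p x) * cosh x ^ M \<le> K * \<sigma>" if \<sigma>: "0 < \<sigma>" "\<sigma> \<le> 1" for \<sigma> x
  proof -
    let ?N = "normal_density x \<sigma>"
    have "bounded (p ` {- R..R})" by (intro compact_imp_bounded compact_continuous_image cont) simp
    then obtain B where B: "B > 0" "\<And>s. s \<in> {- R..R} \<Longrightarrow> cmod (p s) \<le> B" unfolding bounded_pos by auto
    have B': "cmod (p s) \<le> B" for s
    proof (cases "\<bar>s\<bar> > R")
      case False
      then have "s \<in> {- R..R}" unfolding atLeastAtMost_iff by linarith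
      then show ?thesis by (rule B(2))
    qed (use B(1) zero in simp)
    have pm [measurable]: "p \<in> borel_measurable borel"
      by (rule borel_measurable_continuous_onI[OF cont])
    have iN: "integrable lborel (\<lambda>s. of_real (?N s) :: complex)" using \<sigma> by simp
    have ipN: "integrable lborel (\<lambda>s. p s * of_real (?N s))"
    proof (rule Bochner_Integration.integrable_bound)
      show "integrable lborel (\<lambda>s. B * ?N s)" using \<sigma> by simp
      show "AE s in lborel. norm (p s * of_real (?N s)) \<le> norm (B * ?N s)"
        using B' B(1) by (intro AE_I2) (auto simp: norm_mult abs_mult intro!: mult_right_mono)
    qed simp
    have "gauss_conv p R \<sigma> (of_real x) = integral {- R..R} (\<lambda>s. p s * of_real (?N s))"
      unfolding gauss_conv_def gauss_real ..
    also have "\<dots> = integral UNIV (\<lambda>s. if s \<in> {- R..R} then p s * of_real (?N s) else 0)"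
      by (rule integral_restrict_UNIV[symmetric])
    also have "(\<lambda>s. if s \<in> {- R..R} then p s * of_real (?N s) else 0) = (\<lambda>s. p s * of_real (?N s))"
      using zero by (auto simp: fun_eq_iff abs_if)
    also have "integral UNIV \<dots> = (\<integral>s. p s * of_real (?N s) \<partial>lborel)" by (rule integral_lborel[OF ipN])
    finally have 1: "gauss_conv p R \<sigma> (of_real x) = (\<integral>s. p s * of_real (?N s) \<partial>lborel)" .
    have 2: "p x = (\<integral>s. p x * of_real (?N s) \<partial>lborel)"
      using \<sigma> by simp
    have ipx: "integrable lborel (\<lambda>s. p x * of_real (?N s))" using iN by simp
    have 3: "(gauss_conv p R \<sigma> (of_real x) - p x) * of_real (cosh x ^ M)
        = (\<integral>s. (p s - p x) * of_real (?N s) * of_real (cosh x ^ M) \<partial>lborel)"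
    proof -
      have "gauss_conv p R \<sigma> (of_real x) - p x = (\<integral>s. p s * of_real (?N s) - p x * of_real (?N s) \<partial>lborel)"
        unfolding Bochner_Integration.integral_diff[OF ipN ipx] using 1 2 by simp
      then have "(gauss_conv p R \<sigma> (of_real x) - p x) * of_real (cosh x ^ M)
          = (\<integral>s. (p s * of_real (?N s) - p x * of_real (?N s)) * of_real (cosh x ^ M) \<partial>lborel)"
        by (simp only: integral_mult_left_zero)
      then show ?thesis by (simp only: left_diff_distrib)
    qed
    \<comment> \<open>Standard deviation of the Gaussian with half the exponent.\<close>
    define T where "T = sqrt 2 * \<sigma>"
    have T: "T > 0" using \<sigma> by (simp add: T_def)
    have bound: "norm ((p s - p x) * of_real (?N s) * of_real (cosh x ^ M)) \<le> K * \<sigma> * normal_density x T s" for s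
    proof (cases "\<bar>s\<bar> > R \<and> \<bar>x\<bar> > R")
      case True
      then have "p s = 0" "p x = 0" using zero by auto
      then show ?thesis using L \<sigma> by (simp add: K_def)
    next
      \<comment> \<open>Now \<open>s\<close> or \<open>x\<close> lies in \<open>[- R, R]\<close>, so
        \<open>x\<close> is no further than \<open>\<bar>s - x\<bar>\<close> from that interval and
        its weight is controlled by the distance.\<close>
      case False
      define v where "v = \<bar>s - x\<bar>"
      have v: "v \<ge> 0" by (simp add: v_def)
      have "\<bar>x\<bar> \<le> R + v" using False by (auto simp: v_def)
      then have "real M * \<bar>x\<bar> \<le> real M * R + real M * v" by (metis distrib_left mult_left_mono of_nat_0_le_iff)
      then have ch: "cosh x ^ M \<le> exp (real M * R) * exp (real M * v)"
        using cosh_power_le_exp[of x M] by (simp flip: exp_add) (meson exp_le_cancel_iff order_trans)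
      have q: "v * exp (real M * v) * exp (- (v\<^sup>2 / (2 * \<sigma>\<^sup>2))) \<le> \<sigma> * exp ((real M + 1)\<^sup>2) * exp (- (v\<^sup>2 / (2 * T\<^sup>2)))"
      proof -
        define w where "w = v / \<sigma>"
        have w: "w \<ge> 0" "v = \<sigma> * w" using v \<sigma> by (auto simp: w_def)
        \<comment> \<open>Here \<sigma> \<le> 1 enters; replacing \<open>v\<close> by
          \<open>w\<close> in the weight makes the bound independent of \<sigma>.\<close>
        have "v \<le> w" using w \<sigma> by (simp add: mult_left_le_one_le)
        then have "exp (real M * v) \<le> exp (real M * w)" by (simp add: mult_left_mono)
        moreover have "w \<le> exp w" using exp_ge_add_one_self[of w] by linarith
        ultimately have "w * exp (real M * v) \<le> exp w * exp (real M * w)" using w by (intro mult_mono) auto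
        also have "\<dots> = exp ((real M + 1) * w)" by (simp add: algebra_simps flip: exp_add)
        also have "\<dots> \<le> exp ((real M + 1)\<^sup>2 + w\<^sup>2 / 4)"
        proof -
          have "0 \<le> (w / 2 - (real M + 1))\<^sup>2" by simp
          also have "\<dots> = w\<^sup>2 / 4 - (real M + 1) * w + (real M + 1)\<^sup>2"
            by (simp add: power2_eq_square field_simps)
          finally show ?thesis by simp
        qed
        finally have w1: "w * exp (real M * v) \<le> exp ((real M + 1)\<^sup>2) * exp (w\<^sup>2 / 4)" by (simp add: exp_add)
        have e: "v\<^sup>2 / (2 * \<sigma>\<^sup>2) = w\<^sup>2 / 2" "v\<^sup>2 / (2 * T\<^sup>2) = w\<^sup>2 / 4"
          using \<sigma> by (simp_all add: w(2) T_def power_mult_distrib)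
        have "v * exp (real M * v) * exp (- (w\<^sup>2 / 2)) = \<sigma> * (w * exp (real M * v)) * exp (- (w\<^sup>2 / 2))"
          by (simp add: w(2))
        also have "\<dots> \<le> \<sigma> * (exp ((real M + 1)\<^sup>2) * exp (w\<^sup>2 / 4)) * exp (- (w\<^sup>2 / 2))"
          using w1 \<sigma> by (intro mult_right_mono mult_left_mono) auto
        also have "\<dots> = \<sigma> * exp ((real M + 1)\<^sup>2) * exp (- (w\<^sup>2 / 4))"
          by (simp add: mult.assoc flip: exp_add)
        finally show ?thesis unfolding e .
      qed
      have nN: "?N s = 1 / sqrt (2 * pi * \<sigma>\<^sup>2) * exp (- (v\<^sup>2 / (2 * \<sigma>\<^sup>2)))"
        by (simp add: normal_density_def v_def)
      have nT: "normal_density x T s = 1 / sqrt (2 * pi * T\<^sup>2) * exp (- (v\<^sup>2 / (2 * T\<^sup>2)))"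
        by (simp add: normal_density_def v_def)
      have sq: "1 / sqrt (2 * pi * \<sigma>\<^sup>2) = sqrt 2 * (1 / sqrt (2 * pi * T\<^sup>2))"
      proof -
        have "2 * pi * T\<^sup>2 = 2 * (2 * pi * \<sigma>\<^sup>2)" by (simp add: T_def power_mult_distrib)
        then have "sqrt (2 * pi * T\<^sup>2) = sqrt 2 * sqrt (2 * pi * \<sigma>\<^sup>2)" by (simp only: real_sqrt_mult)
        then show ?thesis by (simp only:) simp
      qed
      have "norm ((p s - p x) * of_real (?N s) * of_real (cosh x ^ M)) = cmod (p s - p x) * ?N s * cosh x ^ M"
        by (simp add: norm_mult norm_power)
      also have "\<dots> \<le> (L * v) * ?N s * (exp (real M * R) * exp (real M * v))"
        by (intro mult_mono ch) (use lip[of s x] L v in \<open>auto simp: v_def\<close>)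
      also have "\<dots> = L * exp (real M * R) * (sqrt 2 * (1 / sqrt (2 * pi * T\<^sup>2))) * (v * exp (real M * v) * exp (- (v\<^sup>2 / (2 * \<sigma>\<^sup>2))))"
        unfolding nN sq by (simp only: mult_ac)
      also have "\<dots> \<le> L * exp (real M * R) * (sqrt 2 * (1 / sqrt (2 * pi * T\<^sup>2))) * (\<sigma> * exp ((real M + 1)\<^sup>2) * exp (- (v\<^sup>2 / (2 * T\<^sup>2))))"
        by (rule mult_left_mono[OF q]) (use L in auto)
      also have "\<dots> = K * \<sigma> * normal_density x T s" unfolding nT K_def by (simp only: mult_ac)
      finally show ?thesis .
    qed
    have "norm ((gauss_conv p R \<sigma> (of_real x) - p x) * of_real (cosh x ^ M)) \<le> (\<integral>s. K * \<sigma> * normal_density x T s \<partial>lborel)"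
      unfolding 3
    proof (rule Bochner_Integration.integral_norm_bound_integral)
      have "integrable lborel (\<lambda>s. p s * of_real (?N s) - p x * of_real (?N s))" using ipN ipx by simp
      then have "integrable lborel (\<lambda>s. (p s * of_real (?N s) - p x * of_real (?N s)) * of_real (cosh x ^ M))"
        by (intro integrable_mult_left)
      then show "integrable lborel (\<lambda>s. (p s - p x) * of_real (?N s) * of_real (cosh x ^ M))"
        by (simp only: left_diff_distrib)
      show "integrable lborel (\<lambda>s. K * \<sigma> * normal_density x T s)" using T by simp
    qed (rule bound)
    also have "\<dots> = K * \<sigma>" using T by simp
    finally show ?thesis by (simp add: norm_mult norm_power)
  qed
  then show ?thesis by blast
qed

text \<open>The width of the Gaussian is \<open>1 / (n + 1)\<close>, and the Lipschitz constant of
  each \<open>p i\<close> is a bound of \<open>p (Suc i)\<close>. An explicit rate is kept so that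
  it can be common to all fields and all boost parameters.\<close>

lemma gaussian_approximation:
  assumes p: "smooth_family p" and zero: "\<And>i x. \<bar>x\<bar> > R \<Longrightarrow> p i x = 0"
  obtains Q :: "nat \<Rightarrow> complex \<Rightarrow> complex" where "\<And>n. strip_rapid (Q n)"
    "\<And>i M. \<exists>K. \<forall>n u. cmod ((deriv ^^ i) (Q n) (of_real u) - p i u) * cosh u ^ M \<le> K / (real n + 1)"
proof -
  \<comment> \<open>The larger radius makes \<open>p\<close> vanish at the end points too, as
    integration by parts demands.\<close>
  define R' where "R' = \<bar>R\<bar> + 1"
  have R': "R' \<ge> 0" "\<And>i. p i R' = 0" "\<And>i. p i (- R') = 0" "\<And>i x. \<bar>x\<bar> > R' \<Longrightarrow> p i x = 0"
    by (auto simp: R'_def intro!: zero)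
  define Q where "Q n = gauss_conv (p 0) R' (1 / (real n + 1))" for n
  have pos: "0 < 1 / (real n + 1)" "1 / (real n + 1) \<le> 1" for n by auto
  show ?thesis
  proof (rule that)
    show "strip_rapid (Q n)" for n
      unfolding Q_def by (rule strip_rapid_gauss_conv[OF pos(1) p R'(1-3)])
    fix i M
    have "bounded (p (Suc i) ` {- R'..R'})"
      by (intro compact_imp_bounded compact_continuous_image smooth_family_continuous[OF p]) simp
    then obtain B where B: "B > 0" "\<And>s. s \<in> {- R'..R'} \<Longrightarrow> cmod (p (Suc i) s) \<le> B" unfolding bounded_pos by auto
    have B': "cmod (p (Suc i) s) \<le> B" for s
    proof (cases "\<bar>s\<bar> > R'")
      case False
      then have "s \<in> {- R'..R'}" unfolding atLeastAtMost_iff by linarith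
      then show ?thesis by (rule B(2))
    qed (use B(1) R'(4) in simp)
    have "cmod (p i x - p i y) \<le> B * \<bar>x - y\<bar>" for x y
    proof -
      have "norm (p i x - p i y) \<le> B * norm (x - y)"
      proof (rule differentiable_bound[of UNIV])
        show "(p i has_derivative (\<lambda>h. h *\<^sub>R p (Suc i) x)) (at x within UNIV)" for x
          using smooth_familyD[OF p, of i x] by (simp add: has_vector_derivative_def)
        show "onorm (\<lambda>h. h *\<^sub>R p (Suc i) x) \<le> B" for x
          by (rule onorm_le) (use B' in \<open>auto simp: mult.commute[of B] intro!: mult_left_mono\<close>)
      qed auto
      then show ?thesis by simp
    qed
    then have "\<exists>K. \<forall>\<sigma> x. 0 < \<sigma> \<longrightarrow> \<sigma> \<le> 1 \<longrightarrow> cmod (gauss_conv (p i) R' \<sigma> (of_real x) - p i x) * cosh x ^ M \<le> K * \<sigma>"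
      by (rule gauss_conv_approx[OF smooth_family_continuous[OF p]]) (use R' in auto)
    then obtain K where K: "\<forall>\<sigma> x. 0 < \<sigma> \<longrightarrow> \<sigma> \<le> 1 \<longrightarrow> cmod (gauss_conv (p i) R' \<sigma> (of_real x) - p i x) * cosh x ^ M \<le> K * \<sigma>"
      by (elim exE)
    show "\<exists>K. \<forall>n u. cmod ((deriv ^^ i) (Q n) (of_real u) - p i u) * cosh u ^ M \<le> K / (real n + 1)"
    proof (intro exI[of _ K] allI)
      fix n u
      show "cmod ((deriv ^^ i) (Q n) (of_real u) - p i u) * cosh u ^ M \<le> K / (real n + 1)"
        unfolding Q_def higher_deriv_gauss_conv[OF pos(1) p R'(1-3)]
        using K[rule_format, OF pos(1)[of n] pos(2)[of n], of u] by simp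
    qed
  qed
qed

section \<open>Limits of holomorphic functions on a strip\<close>

lemma strip_i_pi: "strip (\<i> * of_real pi) = {z. 0 \<le> Im z \<and> Im z \<le> pi}"
  by (simp add: strip_def)

lemma interior_strip_i_pi: "interior (strip (\<i> * of_real pi)) = {z. 0 < Im z \<and> Im z < pi}"
proof (rule interior_unique)
  show "{z. 0 < Im z \<and> Im z < pi} \<subseteq> strip (\<i> * of_real pi)" by (auto simp: strip_i_pi)
  show "open {z. 0 < Im z \<and> Im z < pi}"
    by (intro open_Collect_conj open_Collect_less continuous_intros)
  fix T assume T: "T \<subseteq> strip (\<i> * of_real pi)" "open T"
  show "T \<subseteq> {z. 0 < Im z \<and> Im z < pi}"
  proof
    fix z assume "z \<in> T"
    with T(2) obtain e where e: "e > 0" "ball z e \<subseteq> T" by (rule openE)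
    have "z + \<i> * of_real (e / 2) \<in> ball z e" "z - \<i> * of_real (e / 2) \<in> ball z e"
      using e(1) by (auto simp: dist_norm norm_mult)
    then have "z + \<i> * of_real (e / 2) \<in> strip (\<i> * of_real pi)" "z - \<i> * of_real (e / 2) \<in> strip (\<i> * of_real pi)"
      using e T(1) by blast+
    then show "z \<in> {z. 0 < Im z \<and> Im z < pi}" using e(1) unfolding strip_i_pi by auto
  qed
qed

lemma gauss_weight_le: "exp (- x\<^sup>2) * cosh x ^ M \<le> exp ((real M)\<^sup>2 / 4)"
proof -
  have "0 \<le> (\<bar>x\<bar> - real M / 2)\<^sup>2" by simp
  also have "\<dots> = x\<^sup>2 - real M * \<bar>x\<bar> + (real M)\<^sup>2 / 4" by (simp add: power2_eq_square algebra_simps)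
  finally have "- x\<^sup>2 + real M * \<bar>x\<bar> \<le> (real M)\<^sup>2 / 4" by simp
  then have "exp (- x\<^sup>2) * exp (real M * \<bar>x\<bar>) \<le> exp ((real M)\<^sup>2 / 4)" by (simp flip: exp_add)
  moreover have "exp (- x\<^sup>2) * cosh x ^ M \<le> exp (- x\<^sup>2) * exp (real M * \<bar>x\<bar>)"
    by (intro mult_left_mono cosh_power_le_exp) auto
  ultimately show ?thesis by linarith
qed

lemma cmod_exp_minus_square: "cmod (exp (- z\<^sup>2)) = exp ((Im z)\<^sup>2) * exp (- (Re z)\<^sup>2)"
proof -
  have "Re (- z\<^sup>2) = (Im z)\<^sup>2 + - (Re z)\<^sup>2" by (simp add: power2_eq_square)
  then show ?thesis by (simp add: exp_add flip: exp_add)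
qed

text \<open>The factor \<open>exp (- z\<^sup>2)\<close> turns exponential growth along the strip into decay, so that the
  maximum principle on long rectangles applies.\<close>

lemma strip_maximum:
  assumes hol: "D holomorphic_on UNIV"
    and growth: "\<And>z. 0 \<le> Im z \<Longrightarrow> Im z \<le> pi \<Longrightarrow> cmod (D z) \<le> C * cosh (Re z) ^ N"
    and bot: "\<And>t. cmod (D (of_real t)) \<le> e * cosh t ^ M"
    and top: "\<And>t. cmod (D (\<i> * of_real pi + of_real t)) \<le> e * cosh t ^ M"
    and z: "0 \<le> Im z" "Im z \<le> pi"
  shows "cmod (exp (- z\<^sup>2) * D z) \<le> exp (pi\<^sup>2) * exp ((real M)\<^sup>2 / 4) * e"
proof -
  define A where "A = exp (pi\<^sup>2) * exp ((real M)\<^sup>2 / 4)"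
  have A: "A > 0" by (simp add: A_def)
  have e: "e \<ge> 0" using order_trans[OF norm_ge_zero bot[of 0]] by simp
  have C: "C \<ge> 0" using order_trans[OF norm_ge_zero growth[of 0]] by simp
  have im2: "exp ((Im w)\<^sup>2) \<le> exp (pi\<^sup>2)" if "0 \<le> Im w" "Im w \<le> pi" for w
    using that by (simp add: power_mono)
  have "cmod (exp (- z\<^sup>2) * D z) \<le> A * e + \<eta>" if \<eta>: "\<eta> > 0" for \<eta>
  proof -
    \<comment> \<open>The Gaussian absorbs \<open>Suc N\<close> powers of \<open>cosh\<close>:
      \<open>N\<close> pay for the growth of \<open>D\<close>, and one is left over as
      decay.\<close>
    define c where "c = exp (pi\<^sup>2) * C * exp ((real (Suc N))\<^sup>2 / 4)"
    have c: "c \<ge> 0" using C by (simp add: c_def)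
    have decay: "cmod (exp (- w\<^sup>2) * D w) \<le> c / cosh (Re w)" if w: "0 \<le> Im w" "Im w \<le> pi" for w
    proof -
      have "cmod (exp (- w\<^sup>2) * D w) * cosh (Re w) \<le> (exp (pi\<^sup>2) * exp (- (Re w)\<^sup>2)) * (C * cosh (Re w) ^ N) * cosh (Re w)"
        unfolding norm_mult cmod_exp_minus_square
        by (intro mult_right_mono mult_mono im2 growth w) auto
      also have "\<dots> = exp (pi\<^sup>2) * C * (exp (- (Re w)\<^sup>2) * cosh (Re w) ^ Suc N)" by (simp add: mult_ac)
      also have "\<dots> \<le> c" unfolding c_def using C by (intro mult_left_mono gauss_weight_le) auto
      finally show ?thesis by (simp add: field_simps)
    qed
    \<comment> \<open>The rectangle contains \<open>z\<close> and is so long that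
      \<open>c / cosh L \<le> \<eta>\<close> on the vertical sides, because
      \<open>cosh L \<ge> L \<ge> c / \<eta>\<close>.\<close>
    define L where "L = \<bar>Re z\<bar> + c / \<eta> + 1"
    have "c / \<eta> \<ge> 0" using c \<eta> by simp
    then have L: "\<bar>Re z\<bar> \<le> L" "L > 0" "c / \<eta> \<le> L" unfolding L_def by linarith+
    have chL: "cosh L \<ge> L"
    proof -
      have "0 \<le> (L - 1)\<^sup>2 + 1" by simp
      then have "2 * L \<le> 1 + L + L\<^sup>2 / 2" by (simp add: power2_eq_square algebra_simps)
      also have "\<dots> \<le> exp L" using exp_lower_Taylor_quadratic[of L] L(2) by simp
      also have "\<dots> \<le> 2 * cosh L" by (simp add: cosh_def)
      finally show ?thesis by simp
    qed
    have "c / cosh L \<le> \<eta>"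
    proof -
      have "c / \<eta> \<le> cosh L" using L chL by linarith
      then show ?thesis using \<eta> by (simp add: field_simps)
    qed
    let ?Q = "cbox (Complex (- L) 0) (Complex L pi)"
    have mem: "w \<in> ?Q \<longleftrightarrow> - L \<le> Re w \<and> Re w \<le> L \<and> 0 \<le> Im w \<and> Im w \<le> pi" for w
      by (auto simp: in_cbox_complex_iff)
    have memb: "w \<in> box (Complex (- L) 0) (Complex L pi) \<longleftrightarrow> - L < Re w \<and> Re w < L \<and> 0 < Im w \<and> Im w < pi" for w
      by (auto simp: in_box_complex_iff)
    have hol': "(\<lambda>w. exp (- w\<^sup>2) * D w) holomorphic_on S" for S
      by (intro holomorphic_intros holomorphic_on_subset[OF hol]) auto
    show ?thesis
    proof (rule maximum_modulus_frontier[of "\<lambda>w. exp (- w\<^sup>2) * D w" ?Q])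
      show "(\<lambda>w. exp (- w\<^sup>2) * D w) holomorphic_on interior ?Q" by (rule hol')
      show "continuous_on (closure ?Q) (\<lambda>w. exp (- w\<^sup>2) * D w)" by (rule holomorphic_on_imp_continuous_on[OF hol'])
      show "bounded ?Q" by simp
      show "z \<in> ?Q" using L z by (simp add: mem abs_le_iff)
      fix w assume "w \<in> frontier ?Q"
      then have w: "w \<in> ?Q" "w \<notin> box (Complex (- L) 0) (Complex L pi)"
        by (auto simp: frontier_def interior_cbox)
      then consider "Im w = 0" | "Im w = pi" | "\<bar>Re w\<bar> = L" unfolding mem memb by linarith
      then show "cmod (exp (- w\<^sup>2) * D w) \<le> A * e + \<eta>"
      proof cases
        case 1
        then have "w = of_real (Re w)" by (simp add: complex_eq_iff)
        then have "cmod (D w) \<le> e * cosh (Re w) ^ M" using bot[of "Re w"] by simp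
        then have "cmod (exp (- w\<^sup>2) * D w) \<le> (exp (pi\<^sup>2) * exp (- (Re w)\<^sup>2)) * (e * cosh (Re w) ^ M)"
          unfolding norm_mult cmod_exp_minus_square using 1 by (intro mult_mono) auto
        also have "\<dots> = exp (pi\<^sup>2) * e * (exp (- (Re w)\<^sup>2) * cosh (Re w) ^ M)" by (simp add: mult_ac)
        also have "\<dots> \<le> exp (pi\<^sup>2) * e * exp ((real M)\<^sup>2 / 4)" using e by (intro mult_left_mono gauss_weight_le) auto
        finally show ?thesis using \<eta> by (simp add: A_def mult_ac)
      next
        case 2
        then have "w = \<i> * of_real pi + of_real (Re w)" by (simp add: complex_eq_iff)
        then have "cmod (D w) \<le> e * cosh (Re w) ^ M" using top[of "Re w"] by simp
        then have "cmod (exp (- w\<^sup>2) * D w) \<le> (exp (pi\<^sup>2) * exp (- (Re w)\<^sup>2)) * (e * cosh (Re w) ^ M)"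
          unfolding norm_mult cmod_exp_minus_square using 2 by (intro mult_mono) auto
        also have "\<dots> = exp (pi\<^sup>2) * e * (exp (- (Re w)\<^sup>2) * cosh (Re w) ^ M)" by (simp add: mult_ac)
        also have "\<dots> \<le> exp (pi\<^sup>2) * e * exp ((real M)\<^sup>2 / 4)" using e by (intro mult_left_mono gauss_weight_le) auto
        finally show ?thesis using \<eta> by (simp add: A_def mult_ac)
      next
        case 3
        have ch: "cosh (Re w) = cosh L" using 3 cosh_real_abs[of "Re w"] by simp
        then have "cmod (exp (- w\<^sup>2) * D w) \<le> c / cosh L" using decay[of w, unfolded ch] w(1) by (simp add: mem)
        also have "\<dots> \<le> \<eta>" by fact
        finally show ?thesis using A e by (simp add: add_increasing)
      qed
    qed
  qed
  then show ?thesis unfolding A_def by (rule field_le_epsilon)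
qed

text \<open>The growth constants may depend on \<open>n\<close>; they only license the maximum
  principle. The uniform Cauchy property comes from the edges alone, where \<open>G n\<close> stays
  within \<open>\<epsilon> n * cosh t ^ M\<close> of its limit.\<close>

lemma strip_limit:
  fixes G :: "nat \<Rightarrow> complex \<Rightarrow> complex"
  assumes hol: "\<And>n. G n holomorphic_on UNIV"
    and growth: "\<And>n. \<exists>C N. \<forall>z. 0 \<le> Im z \<longrightarrow> Im z \<le> pi \<longrightarrow> cmod (G n z) \<le> C * cosh (Re z) ^ N"
    and bot: "\<And>n t. cmod (G n (of_real t) - a t) \<le> \<epsilon> n * cosh t ^ M"
    and top: "\<And>n t. cmod (G n (\<i> * of_real pi + of_real t) - b t) \<le> \<epsilon> n * cosh t ^ M"
    and \<epsilon>: "\<epsilon> \<longlonglongrightarrow> 0"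
  shows "\<exists>H. continuous_on (strip (\<i> * of_real pi)) H \<and> H holomorphic_on interior (strip (\<i> * of_real pi)) \<and>
    (\<forall>t. H (of_real t) = a t \<and> H (\<i> * of_real pi + of_real t) = b t)"
proof -
  let ?S = "strip (\<i> * of_real pi)"
  define A where "A = exp (pi\<^sup>2) * exp ((real M)\<^sup>2 / 4)"
  have A: "A > 0" by (simp add: A_def)
  define K where "K n z = exp (- z\<^sup>2) * G n z" for n z
  have diff: "cmod (K n z - K m z) \<le> A * (\<epsilon> n + \<epsilon> m)" if z: "z \<in> ?S" for n m z
  proof -
    obtain C N where C: "\<And>z. 0 \<le> Im z \<Longrightarrow> Im z \<le> pi \<Longrightarrow> cmod (G n z) \<le> C * cosh (Re z) ^ N"
      using growth[of n] by blast
    obtain C' N' where C': "\<And>z. 0 \<le> Im z \<Longrightarrow> Im z \<le> pi \<Longrightarrow> cmod (G m z) \<le> C' * cosh (Re z) ^ N'"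
      using growth[of m] by blast
    have C0: "C \<ge> 0" "C' \<ge> 0" using order_trans[OF norm_ge_zero C[of 0]] order_trans[OF norm_ge_zero C'[of 0]] by auto
    have "cmod (exp (- z\<^sup>2) * (G n z - G m z)) \<le> A * (\<epsilon> n + \<epsilon> m)"
      unfolding A_def
    proof (rule strip_maximum)
      show "(\<lambda>z. G n z - G m z) holomorphic_on UNIV" by (intro holomorphic_intros hol)
      show "cmod (G n z - G m z) \<le> (C + C') * cosh (Re z) ^ (N + N')" if "0 \<le> Im z" "Im z \<le> pi" for z
      proof -
        have "cmod (G n z - G m z) \<le> C * cosh (Re z) ^ N + C' * cosh (Re z) ^ N'"
          using norm_triangle_ineq4[of "G n z" "G m z"] C[OF that] C'[OF that] by linarith
        also have "\<dots> \<le> C * cosh (Re z) ^ (N + N') + C' * cosh (Re z) ^ (N + N')"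
          by (intro add_mono mult_left_mono cosh_power_mono C0) auto
        finally show ?thesis by (simp add: algebra_simps)
      qed
      have tri: "cmod (x - y) \<le> (\<epsilon> n + \<epsilon> m) * w" if "cmod (x - v) \<le> \<epsilon> n * w" "cmod (y - v) \<le> \<epsilon> m * w" for x y v w
        using norm_triangle_ineq4[of "x - v" "y - v"] that by (simp add: algebra_simps)
      show "cmod (G n (of_real t) - G m (of_real t)) \<le> (\<epsilon> n + \<epsilon> m) * cosh t ^ M" for t
        by (rule tri[OF bot bot])
      show "cmod (G n (\<i> * of_real pi + of_real t) - G m (\<i> * of_real pi + of_real t)) \<le> (\<epsilon> n + \<epsilon> m) * cosh t ^ M" for t
        by (rule tri[OF top top])
    qed (use z in \<open>auto simp: strip_i_pi\<close>)
    then show ?thesis by (simp add: K_def right_diff_distrib)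
  qed
  have "uniformly_Cauchy_on ?S K"
    unfolding uniformly_Cauchy_on_def
  proof (intro allI impI)
    fix e :: real assume e: "e > 0"
    have "\<forall>\<^sub>F n in sequentially. \<epsilon> n < e / (2 * A)"
      using \<epsilon> by (rule order_tendstoD) (use e A in simp)
    then obtain n0 where n0: "\<And>n. n \<ge> n0 \<Longrightarrow> \<epsilon> n < e / (2 * A)" by (auto simp: eventually_sequentially)
    have "dist (K m x) (K n x) < e" if "x \<in> ?S" "m \<ge> n0" "n \<ge> n0" for x m n
    proof -
      have "dist (K m x) (K n x) \<le> A * (\<epsilon> m + \<epsilon> n)" using diff[OF that(1)] by (simp add: dist_norm)
      also have "\<dots> < A * (e / (2 * A) + e / (2 * A))"
        using A n0[OF that(2)] n0[OF that(3)] by (intro mult_strict_left_mono add_strict_mono)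
      also have "\<dots> = e" using A by (simp add: field_simps)
      finally show ?thesis .
    qed
    then show "\<exists>M. \<forall>x\<in>?S. \<forall>m\<ge>M. \<forall>n\<ge>M. dist (K m x) (K n x) < e" by blast
  qed
  then obtain k where k: "uniform_limit ?S K k sequentially"
    using Cauchy_uniformly_convergent unfolding uniformly_convergent_on_def by blast
  have holK: "K n holomorphic_on S" for n S
    unfolding K_def by (intro holomorphic_intros holomorphic_on_subset[OF hol]) auto
  have kc: "continuous_on ?S k"
    by (rule uniform_limit_theorem[OF _ k]) (auto intro!: always_eventually holomorphic_on_imp_continuous_on holK)
  have kh: "k holomorphic_on interior ?S"
  proof (rule holomorphic_uniform_sequence[of _ K])
    fix x assume "x \<in> interior ?S"
    then obtain d where d: "d > 0" "cball x d \<subseteq> interior ?S" using open_contains_cball[of "interior ?S"] by auto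
    moreover have "uniform_limit (cball x d) K k sequentially"
      by (rule uniform_limit_on_subset[OF k]) (use d interior_subset in blast)
    ultimately show "\<exists>d>0. cball x d \<subseteq> interior ?S \<and> uniform_limit (cball x d) K k sequentially" by blast
  qed (auto intro: holK)
  have lim: "k z = exp (- z\<^sup>2) * v" if z: "z \<in> ?S" and v: "\<And>n. cmod (G n z - v) \<le> \<epsilon> n * B" for z v B
  proof -
    have "(\<lambda>n. G n z - v) \<longlonglongrightarrow> 0"
    proof (rule Lim_null_comparison)
      show "\<forall>\<^sub>F n in sequentially. cmod (G n z - v) \<le> \<epsilon> n * B" using v by (intro always_eventually) auto
      show "(\<lambda>n. \<epsilon> n * B) \<longlonglongrightarrow> 0" using tendsto_mult_right[OF \<epsilon>, of B] by simp
    qed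
    then have "(\<lambda>n. G n z) \<longlonglongrightarrow> v" by (simp add: LIM_zero_iff)
    then have "(\<lambda>n. K n z) \<longlonglongrightarrow> exp (- z\<^sup>2) * v" unfolding K_def by (intro tendsto_intros)
    with tendsto_uniform_limitI[OF k z] show ?thesis by (rule LIMSEQ_unique)
  qed
  \<comment> \<open>Removes the factor \<open>exp (- z\<^sup>2)\<close> again.\<close>
  define H where "H z = exp (z\<^sup>2) * k z" for z
  have "H (of_real t) = a t \<and> H (\<i> * of_real pi + of_real t) = b t" for t
  proof
    have e: "exp w * (exp (- w) * v) = v" for w v :: complex by (simp add: exp_minus)
    show "H (of_real t) = a t"
      unfolding H_def using lim[of "of_real t" "a t", OF _ bot] e by (simp add: strip_i_pi)
    show "H (\<i> * of_real pi + of_real t) = b t"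
      unfolding H_def using lim[of "\<i> * of_real pi + of_real t" "b t", OF _ top] e by (simp add: strip_i_pi)
  qed
  moreover have "continuous_on ?S H" unfolding H_def by (intro continuous_intros kc)
  moreover have "H holomorphic_on interior ?S" unfolding H_def by (intro holomorphic_intros kh)
  ultimately show ?thesis by blast
qed

text \<open>Continued by zero below the real line, \<open>H\<close> is continuous and therefore
  holomorphic across it; the identity theorem makes it vanish in the open strip, and continuity
  extends this to the upper edge. This yields the uniqueness of the continued boost.\<close>

lemma strip_zero:
  assumes cont: "continuous_on (strip (\<i> * of_real pi)) H" and hol: "H holomorphic_on interior (strip (\<i> * of_real pi))"
    and zero: "\<And>t. H (of_real t) = 0"
  shows "H (\<i> * of_real pi + of_real t) = 0"
proof -
  define S where "S = {z. Im z < pi}"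
  define H' where "H' z = (if 0 \<le> Im z then H z else 0)" for z
  have S: "open S" "connected S"
    unfolding S_def by (auto intro!: open_Collect_less continuous_intros convex_connected simp: convex_halfspace_Im_lt)
  have "continuous_on S H'"
  proof -
    have U: "{z \<in> S. 0 \<le> Im z} \<union> {z \<in> S. Im z \<le> 0} = S" by auto
    have cl: "closed {z. 0 \<le> Im z}" "closed {z. Im z \<le> 0}" by (intro closed_Collect_le continuous_intros)+
    have eq: "{z \<in> S. 0 \<le> Im z} = S \<inter> {z. 0 \<le> Im z}" "{z \<in> S. Im z \<le> 0} = S \<inter> {z. Im z \<le> 0}" by auto
    have "continuous_on ({z \<in> S. 0 \<le> Im z} \<union> {z \<in> S. Im z \<le> 0}) (\<lambda>z. if 0 \<le> Im z then H z else 0)"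
    proof (rule continuous_on_cases_local, unfold U)
      show "closedin (top_of_set S) {z \<in> S. 0 \<le> Im z}" "closedin (top_of_set S) {z \<in> S. Im z \<le> 0}"
        unfolding eq by (intro closedin_closed_Int cl)+
      show "continuous_on {z \<in> S. 0 \<le> Im z} H"
        by (rule continuous_on_subset[OF cont]) (auto simp: strip_i_pi S_def)
      fix z assume "z \<in> {z \<in> S. 0 \<le> Im z} \<and> \<not> 0 \<le> Im z \<or> z \<in> {z \<in> S. Im z \<le> 0} \<and> 0 \<le> Im z"
      then have "Im z = 0" by auto
      then have "z = of_real (Re z)" by (simp add: complex_eq_iff)
      then show "H z = 0" using zero by metis
    qed auto
    then show ?thesis unfolding H'_def U .
  qed
  then have "H' holomorphic_on S"
  proof (rule holomorphic_on_paste_across_line[of S \<i> _ 0, rotated -1])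
    show "H' holomorphic_on S \<inter> {z. \<i> \<bullet> z < 0}"
      by (rule holomorphic_transform[of "\<lambda>_. 0"]) (auto simp: H'_def inner_complex_def)
    show "H' holomorphic_on S \<inter> {z. 0 < \<i> \<bullet> z}"
      by (rule holomorphic_transform[of H], rule holomorphic_on_subset[OF hol])
        (auto simp: H'_def inner_complex_def interior_strip_i_pi S_def)
  qed (use S in auto)
  then have H'0: "H' w = 0" if "w \<in> S" for w
  proof (rule analytic_continuation[of H' S "{z. Im z < 0}" "- \<i>"])
    have "open {z. Im z < 0}" by (intro open_Collect_less continuous_intros)
    moreover have "- \<i> \<in> {z. Im z < 0}" by simp
    ultimately show "- \<i> islimpt {z. Im z < 0}" by (simp add: interior_limit_point interior_open)
  qed (use S that in \<open>auto simp: H'_def S_def intro!: less_trans[OF _ pi_gt_zero]\<close>)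
  let ?p = "\<i> * of_real pi + of_real t"
  define w where "w n = of_real t + \<i> * of_real (pi - pi / (real n + 2))" for n
  have n2: "pi / (real n + 2) < pi" "0 < pi / (real n + 2)" for n by (simp_all add: field_simps add_pos_nonneg)
  have wS: "w n \<in> strip (\<i> * of_real pi)" "w n \<in> S" "0 \<le> Im (w n)" for n
    using n2[of n] by (auto simp: w_def strip_i_pi S_def)
  have "(\<lambda>n. pi - pi / (real n + 2)) \<longlonglongrightarrow> pi" by real_asymp
  then have "(\<lambda>n. of_real t + \<i> * complex_of_real (pi - pi / (real n + 2))) \<longlonglongrightarrow> of_real t + \<i> * complex_of_real pi"
    by (intro tendsto_intros)
  then have "w \<longlonglongrightarrow> ?p" by (simp add: w_def[abs_def] add.commute)
  then have "(\<lambda>n. H (w n)) \<longlonglongrightarrow> H ?p"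
    by (rule continuous_on_tendsto_compose[OF cont]) (use wS in \<open>auto simp: strip_i_pi\<close>)
  moreover have "H (w n) = 0" for n using H'0[OF wS(2)[of n]] wS(3)[of n] by (simp add: H'_def)
  ultimately show ?thesis by (simp add: LIMSEQ_const_iff)
qed

section \<open>Products of field operators\<close>

primrec field_prod :: "('v opdist \<times> smooth_circle) list \<Rightarrow> 'v \<Rightarrow> 'v" where
  "field_prod [] \<Phi> = \<Phi>"
| "field_prod (x # ws) \<Phi> = fst x (snd x) (field_prod ws \<Phi>)"

lemma field_prod_append: "field_prod (ws @ ws') \<Phi> = field_prod ws (field_prod ws' \<Phi>)"
  by (induction ws) auto

lemma field_prod_foldr: "field_prod ws \<Phi> = foldr (\<lambda>x. fst x (snd x)) ws \<Phi>"
  by (induction ws) auto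

text \<open>Lists of pairs suit inductions that move one field past the others, whereas joint
  continuity is formulated for indexed words.\<close>

lemma field_prod_word:
  "field_prod (map (\<lambda>x. (\<phi> x, c x)) ws) \<Phi> = word (map \<phi> ws) (\<lambda>j. c (ws ! j)) \<Phi>"
proof -
  have "map (\<lambda>x. (\<phi> x, c x)) ws = map (\<lambda>j. (map \<phi> ws ! j, c (ws ! j))) [0..<length ws]"
    by (rule nth_equalityI) auto
  then show ?thesis
    by (simp add: field_prod_foldr word_def foldr_map o_def)
qed

context wightman_cft
begin

interpretation V: vector_space scaleV by (rule vector_space)

section \<open>Linearity, continuity and covariance of products of fields\<close>

lemma field_linear:
  assumes "\<phi> \<in> F"
  shows "\<phi> f (\<Phi> + \<Psi>) = \<phi> f \<Phi> + \<phi> f \<Psi>" "\<phi> f (scaleV c \<Phi>) = scaleV c (\<phi> f \<Phi>)"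
    "\<phi> (f + g) \<Phi> = \<phi> f \<Phi> + \<phi> g \<Phi>" "\<phi> (scale_circle c f) \<Phi> = scaleV c (\<phi> f \<Phi>)"
  using distributions[OF assms] by (auto simp: operator_valued_distribution_def Vector_Spaces.linear_iff)

lemma field_zero: "\<phi> \<in> F \<Longrightarrow> \<phi> f 0 = 0"
  using field_linear(2)[of \<phi> f 0 0] by simp

lemma foldr_fields_linear:
  assumes "\<And>j. j \<in> set js \<Longrightarrow> \<phi> j \<in> F"
  shows "foldr (\<lambda>j. \<phi> j (f j)) js (\<Phi> + \<Psi>) = foldr (\<lambda>j. \<phi> j (f j)) js \<Phi> + foldr (\<lambda>j. \<phi> j (f j)) js \<Psi>"
    "foldr (\<lambda>j. \<phi> j (f j)) js (scaleV c \<Phi>) = scaleV c (foldr (\<lambda>j. \<phi> j (f j)) js \<Phi>)"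
  using assms by (induction js) (auto simp: field_linear)

lemma field_prod_linear:
  assumes "fst ` set ws \<subseteq> F"
  shows "field_prod ws (\<Phi> + \<Psi>) = field_prod ws \<Phi> + field_prod ws \<Psi>"
    "field_prod ws (scaleV c \<Phi>) = scaleV c (field_prod ws \<Phi>)"
  using assms by (induction ws) (auto simp: field_linear)

lemma cont_multilinear_word:
  assumes l: "compatible_functional scaleV F l" and \<phi>s: "set \<phi>s \<subseteq> F"
  shows "cont_multilinear (length \<phi>s) (\<lambda>f. l (word \<phi>s f \<Phi>))"
  unfolding cont_multilinear_def multilinear_def
proof (intro conjI allI impI)
  have ll: "l (\<Phi> + \<Psi>) = l \<Phi> + l \<Psi>" "l (scaleV c \<Phi>) = c * l \<Phi>" for \<Phi> \<Psi> c
    using l by (auto simp: compatible_functional_def Vector_Spaces.linear_iff)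
  \<comment> \<open>Isolates slot \<open>i\<close>: the fields to its left act linearly on the
    result, those to its right do not see it.\<close>
  have split: "word \<phi>s (f(i := g)) \<Phi> = foldr (\<lambda>j. (\<phi>s ! j) (f j)) [0..<i]
      ((\<phi>s ! i) g (foldr (\<lambda>j. (\<phi>s ! j) (f j)) [Suc i..<length \<phi>s] \<Phi>))" if i: "i < length \<phi>s" for f i g
  proof -
    have "[0..<length \<phi>s] = [0..<i] @ i # [Suc i..<length \<phi>s]"
      using i by (metis le0 less_imp_le_nat upt_add_eq_append upt_conv_Cons le_add_diff_inverse add.left_neutral)
    then have "word \<phi>s (f(i := g)) \<Phi> = foldr (\<lambda>j. (\<phi>s ! j) ((f(i := g)) j)) [0..<i]
      ((\<phi>s ! i) g (foldr (\<lambda>j. (\<phi>s ! j) ((f(i := g)) j)) [Suc i..<length \<phi>s] \<Phi>))"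
      by (simp add: word_def)
    also have "foldr (\<lambda>j. (\<phi>s ! j) ((f(i := g)) j)) [Suc i..<length \<phi>s] \<Phi> = foldr (\<lambda>j. (\<phi>s ! j) (f j)) [Suc i..<length \<phi>s] \<Phi>"
      by (rule foldr_cong) auto
    also have "foldr (\<lambda>j. (\<phi>s ! j) ((f(i := g)) j)) [0..<i] \<Psi> = foldr (\<lambda>j. (\<phi>s ! j) (f j)) [0..<i] \<Psi>" for \<Psi>
      by (rule foldr_cong) auto
    finally show ?thesis .
  qed
  have F: "\<phi>s ! i \<in> F" if "i < length \<phi>s" for i using \<phi>s that by (meson nth_mem subsetD)
  fix f i assume i: "i < length \<phi>s"
  have js: "\<And>j. j \<in> set [0..<i] \<Longrightarrow> \<phi>s ! j \<in> F" using F i by auto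
  have lin1: "foldr (\<lambda>j. (\<phi>s ! j) (f j)) [0..<i] (x + y)
      = foldr (\<lambda>j. (\<phi>s ! j) (f j)) [0..<i] x + foldr (\<lambda>j. (\<phi>s ! j) (f j)) [0..<i] y" for x y
    using foldr_fields_linear(1)[of "[0..<i]" "\<lambda>j. \<phi>s ! j" f x y] js by blast
  have lin2: "foldr (\<lambda>j. (\<phi>s ! j) (f j)) [0..<i] (scaleV c x) = scaleV c (foldr (\<lambda>j. (\<phi>s ! j) (f j)) [0..<i] x)" for x c
    using foldr_fields_linear(2)[of "[0..<i]" "\<lambda>j. \<phi>s ! j" f c x] js by blast
  show "l (word \<phi>s (f(i := g + h)) \<Phi>) = l (word \<phi>s (f(i := g)) \<Phi>) + l (word \<phi>s (f(i := h)) \<Phi>)" for g h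
    by (simp only: split[OF i] field_linear(3)[OF F[OF i]] lin1 lin2 ll)
  show "l (word \<phi>s (f(i := scale_circle c g)) \<Phi>) = c * l (word \<phi>s (f(i := g)) \<Phi>)" for c g
    by (simp only: split[OF i] field_linear(4)[OF F[OF i]] lin1 lin2 ll)
next
  fix f f' :: "nat \<Rightarrow> smooth_circle" assume "\<forall>i<length \<phi>s. f i = f' i"
  then have "word \<phi>s f \<Phi> = word \<phi>s f' \<Phi>" unfolding word_def by (intro foldr_cong) auto
  then show "l (word \<phi>s f \<Phi>) = l (word \<phi>s f' \<Phi>)" by simp
next
  show "continuous_map (circle_power_topology (length \<phi>s)) euclidean (\<lambda>f. l (word \<phi>s f \<Phi>))"
    using l \<phi>s by (auto simp: compatible_functional_def)
qed

lemma word_singleton: "word [\<phi>] f \<Phi> = \<phi> (f 0) \<Phi>"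
  by (simp add: word_def)

lemma word_pair: "word [\<phi>, \<psi>] f \<Phi> = \<phi> (f 0) (\<psi> (f (Suc 0)) \<Phi>)"
  by (simp add: word_def upt_rec)

lemma circle_functional_field:
  assumes "compatible_functional scaleV F l" "\<phi> \<in> F"
  shows "circle_functional (\<lambda>f. l (\<phi> f \<Phi>))"
proof -
  have "circle_functional (\<lambda>f. l (word [\<phi>] ((\<lambda>_. 0)(0 := f)) \<Phi>))"
    by (rule multilinear_slot_functional[OF cont_multilinear_word]) (use assms in auto)
  then show ?thesis by (simp add: word_singleton)
qed

lemma circle_functional_field2:
  assumes "compatible_functional scaleV F l" "\<phi> \<in> F" "\<psi> \<in> F"
  shows "circle_functional (\<lambda>f. l (\<phi> g (\<psi> f \<Phi>)))"
proof -
  have "circle_functional (\<lambda>f. l (word [\<phi>, \<psi>] ((\<lambda>_. g)(Suc 0 := f)) \<Phi>))"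
    by (rule multilinear_slot_functional[OF cont_multilinear_word]) (use assms in auto)
  then show ?thesis by (simp add: word_pair)
qed

lemma U_inverse: "\<gamma> \<in> Mob \<Longrightarrow> U \<gamma> (U (inv \<gamma>) \<Phi>) = \<Phi>" "\<gamma> \<in> Mob \<Longrightarrow> U (inv \<gamma>) (U \<gamma> \<Phi>) = \<Phi>"
proof -
  assume \<gamma>: "\<gamma> \<in> Mob"
  then have "\<gamma> \<circ> inv \<gamma> = id" "inv \<gamma> \<circ> \<gamma> = id"
    using inv_in_Mob(1)[OF \<gamma>] by (simp_all only: bij_is_surj[THEN surj_iff[THEN iffD1]] bij_is_inj[THEN inj_iff[THEN iffD1]])
  then show "U \<gamma> (U (inv \<gamma>) \<Phi>) = \<Phi>" "U (inv \<gamma>) (U \<gamma> \<Phi>) = \<Phi>"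
    using U_comp[OF \<gamma> inv_in_Mob(2)[OF \<gamma>]] U_comp[OF inv_in_Mob(2)[OF \<gamma>] \<gamma>] U_id
    by (metis comp_apply id_apply)+
qed

lemma U_linear:
  assumes "\<gamma> \<in> Mob"
  shows "U \<gamma> (\<Phi> + \<Psi>) = U \<gamma> \<Phi> + U \<gamma> \<Psi>" "U \<gamma> (scaleV c \<Phi>) = scaleV c (U \<gamma> \<Phi>)"
  using U_End[OF assms] by (auto simp: End_op_def Vector_Spaces.linear_iff)

lemma U_field:
  assumes "\<phi> \<in> F" "\<gamma> \<in> Mob"
  shows "U \<gamma> (\<phi> f \<Phi>) = \<phi> (\<beta> (d \<phi>) \<gamma> f) (U \<gamma> \<Phi>)"
proof -
  have "inj (U \<gamma>)" by (metis U_inverse(2)[OF assms(2)] injI)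
  then have "inv (U \<gamma>) (U \<gamma> \<Phi>) = \<Phi>" by (rule inv_f_f)
  then show ?thesis using covariance[OF assms, of f] by (metis comp_apply)
qed

lemma U_field_prod:
  assumes "\<gamma> \<in> Mob" "fst ` set ws \<subseteq> F"
  shows "U \<gamma> (field_prod ws \<Phi>) = field_prod (map (\<lambda>x. (fst x, \<beta> (d (fst x)) \<gamma> (snd x))) ws) (U \<gamma> \<Phi>)"
  using assms(2) by (induction ws) (auto simp: U_field assms(1))

lemma compatible_separates:
  assumes "\<And>l. compatible_functional scaleV F l \<Longrightarrow> l \<Phi> = l \<Psi>"
  shows "\<Phi> = \<Psi>"
  using regular assms unfolding acts_regularly_def by blast

subsection \<open>Modes annihilating the vacuum\<close>

lemma U_rot_mode:
  assumes "\<phi> \<in> F"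
  shows "U (rot \<theta>) (\<phi> (emode n) \<Omega>) = scaleV (cis (- of_int n * \<theta>)) (\<phi> (emode n) \<Omega>)"
proof -
  have "\<beta> (d \<phi>) (rot \<theta>) (emode n) = scale_circle (cis (- of_int n * \<theta>)) (emode n)"
  proof (rule circle_eqI)
    fix t
    have "apply_circle (\<beta> (d \<phi>) (rot \<theta>) (emode n)) (cis t) = apply_circle (emode n) (cis (t - \<theta>))"
      by (subst apply_\<beta>_rot) (simp_all add: cis_mult)
    also have "\<dots> = cis (- of_int n * \<theta>) * cis (of_int n * t)"
      unfolding apply_emode cis_powi cis_mult by (simp add: algebra_simps)
    finally show "apply_circle (\<beta> (d \<phi>) (rot \<theta>) (emode n)) (cis t)
        = apply_circle (scale_circle (cis (- of_int n * \<theta>)) (emode n)) (cis t)"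
      by (simp add: apply_emode cis_powi)
  qed
  then show ?thesis using assms by (simp add: U_field rot_in_Mob vacuum_invariant field_linear)
qed

text \<open>The vector has rotation weight \<open>- n\<close>, which the spectrum condition
  excludes.\<close>

lemma vacuum_positive_mode:
  assumes "\<phi> \<in> F" "n > 0"
  shows "\<phi> (emode n) \<Omega> = 0"
  by (rule spectrum[of "- n"]) (use assms U_rot_mode[OF assms(1), of _ n] in auto)

text \<open>The covariance factor is kept as a product rather than as a squared modulus, so that its
  factors can cancel the denominators arising from the mode.\<close>

lemma mob_action_mode:
  fixes a b :: real
  assumes ab: "a\<^sup>2 - b\<^sup>2 = 1" and z: "cmod z = 1"
  shows "apply_circle (\<beta> k (mob (of_real a) (- of_real b)) (emode n)) z =
    ((of_real b * z + of_real a) * (of_real b * cnj z + of_real a)) powi (int k - 1) *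
    ((of_real a * z + of_real b) / (of_real b * z + of_real a)) powi n"
proof -
  have AB: "(cmod (of_real a))\<^sup>2 - (cmod (- of_real b))\<^sup>2 = 1" and AB': "(cmod (of_real a))\<^sup>2 - (cmod (of_real b))\<^sup>2 = 1"
    using ab by auto
  define D where "D = of_real b * z + of_real a"
  define w where "w = (of_real a * z + of_real b) / D"
  have D0: "D \<noteq> 0" using mob_denominator_nonzero[OF AB', of z] z by (simp add: D_def)
  have inv: "inv (mob (of_real a) (- of_real b)) z = w"
    unfolding mob_inverse(3)[OF AB] using z by (simp add: mob_def w_def D_def)
  have w1: "cmod w = 1"
    using cmod_mob(2)[OF AB', of z] z by (simp add: mob_def w_def D_def)
  have "X_mob (mob (of_real a) (- of_real b)) w = inverse (of_real ((cmod (- of_real b * w + of_real a))\<^sup>2))"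
    using X_mob_eq[OF AB w1] by simp
  also have "- of_real b * w + of_real a = 1 / D"
  proof -
    have "(- of_real b * w + of_real a) * D = - of_real b * (w * D) + of_real a * D" by (simp add: algebra_simps)
    also have "w * D = of_real a * z + of_real b" using D0 by (simp add: w_def)
    also have "- of_real b * (of_real a * z + of_real b) + of_real a * D = of_real (a\<^sup>2 - b\<^sup>2)"
      by (simp add: D_def algebra_simps power2_eq_square)
    finally show ?thesis using D0 ab by (simp add: field_simps)
  qed
  finally have X: "X_mob (mob (of_real a) (- of_real b)) w = of_real ((cmod D)\<^sup>2)" by (simp add: norm_divide power_divide)
  have cD: "cnj D = of_real b * cnj z + of_real a" by (simp add: D_def)
  have m: "mob (of_real a) (- of_real b) \<in> Mob" unfolding Mob_def using AB by blast
  have wc: "w = cis (Arg w)" using rcis_cmod_Arg[of w] w1 by (simp add: rcis_def)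
  have "apply_circle (emode n) w = w powi n" by (subst (1 2) wc) (rule apply_emode)
  then show ?thesis
    unfolding apply_\<beta>[OF m] inv X complex_norm_square cD[symmetric] D_def[symmetric] w_def[symmetric] by simp
qed

text \<open>Rotating the relation turns it into a trigonometric polynomial that vanishes identically.\<close>

lemma mode_components_vanish:
  assumes \<phi>: "\<phi> \<in> F" and l: "compatible_functional scaleV F l"
    and sum: "(\<Sum>k\<le>N. scaleV (c k) (\<phi> (emode (m + int k)) \<Omega>)) = 0" and k: "k \<le> N" "c k \<noteq> 0"
  shows "l (\<phi> (emode (m + int k)) \<Omega>) = 0"
proof -
  have ll: "l (\<Phi> + \<Psi>) = l \<Phi> + l \<Psi>" "l (scaleV c \<Phi>) = c * l \<Phi>" for \<Phi> \<Psi> c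
    using l by (auto simp: compatible_functional_def Vector_Spaces.linear_iff)
  have l0: "l 0 = 0" using ll(2)[of 0 0] by simp
  have lsum: "l (sum f A) = (\<Sum>x\<in>A. l (f x))" for f :: "nat \<Rightarrow> 'v" and A
    by (induction A rule: infinite_finite_induct) (auto simp: ll l0)
  have Usum: "U (rot \<theta>) (sum f A) = (\<Sum>x\<in>A. U (rot \<theta>) (f x))" for f :: "nat \<Rightarrow> 'v" and A \<theta>
  proof -
    have "U (rot \<theta>) 0 = 0" using U_linear(2)[OF rot_in_Mob, of \<theta> 0 0] by simp
    then show ?thesis by (induction A rule: infinite_finite_induct) (auto simp: U_linear rot_in_Mob)
  qed
  define v where "v k = l (\<phi> (emode (m + int k)) \<Omega>)" for k
  have "(\<Sum>k\<le>N. (c k * v k) * cis \<theta> ^ k) = 0" for \<theta>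
  proof -
    have R: "U (rot (- \<theta>)) (\<phi> (emode (m + int k)) \<Omega>) = scaleV (cis (of_int (m + int k) * \<theta>)) (\<phi> (emode (m + int k)) \<Omega>)" for k
      using U_rot_mode[OF \<phi>, of "- \<theta>" "m + int k"] by (simp only: minus_mult_minus)
    have "0 = l (U (rot (- \<theta>)) (\<Sum>k\<le>N. scaleV (c k) (\<phi> (emode (m + int k)) \<Omega>)))"
      unfolding sum using U_linear(2)[OF rot_in_Mob, of "- \<theta>" 0 0] l0 by simp
    also have "\<dots> = (\<Sum>k\<le>N. c k * (cis (of_int (m + int k) * \<theta>) * v k))"
      by (simp only: Usum lsum U_linear rot_in_Mob R ll v_def)
    also have "\<dots> = cis (of_int m * \<theta>) * (\<Sum>k\<le>N. (c k * v k) * cis \<theta> ^ k)"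
      unfolding sum_distrib_left
      by (rule sum.cong) (simp_all add: Complex.DeMoivre algebra_simps flip: cis_mult)
    finally show ?thesis by simp
  qed
  then have "{cis \<theta> | \<theta>. True} \<subseteq> {z. (\<Sum>k\<le>N. (c k * v k) * z ^ k) = 0}" by auto
  moreover have "infinite {cis \<theta> | \<theta>. True}"
  proof -
    have "inj_on cis {0<..<pi}" by (rule inj_on_inverseI[of _ Arg]) (auto intro: Arg_cis_pos)
    then have "infinite (cis ` {0<..<pi})" by (simp add: finite_image_iff)
    then show ?thesis by (rule infinite_super[rotated]) auto
  qed
  ultimately have "infinite {z. (\<Sum>k\<le>N. (c k * v k) * z ^ k) = 0}" by (rule infinite_super)
  then have "c k * v k = 0" using polyfun_finite_roots[of "\<lambda>k. c k * v k" N] k(1) by auto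
  then show ?thesis using k(2) by (simp add: v_def)
qed

text \<open>Positive modes are settled by the spectrum condition. For
  \<open>d \<phi> \<ge> 2\<close> the mode \<open>d \<phi> - 1\<close> is positive, and a
  non-rotation sends it to \<open>z powi (1 - d \<phi>) * (sqrt 2 * z + 1) ^ (2 * (d \<phi> -
  1))\<close>, where every mode from \<open>1 - d \<phi>\<close> to \<open>d \<phi> - 1\<close> has
  a nonzero coefficient; \<open>mode_components_vanish\<close> separates them. For dimension 1 only
  mode 0 is left; there mode 1 is transformed, and its image is a multiple of mode 0 plus a series
  of positive modes.\<close>

lemma vacuum_mode:
  assumes \<phi>: "\<phi> \<in> F" and l: "compatible_functional scaleV F l"
  shows "l (\<phi> (emode (1 - int (d \<phi>) + int n)) \<Omega>) = 0"
proof -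
  have ll: "l (\<Phi> + \<Psi>) = l \<Phi> + l \<Psi>" "l (scaleV c \<Phi>) = c * l \<Phi>" for \<Phi> \<Psi> c
    using l by (auto simp: compatible_functional_def Vector_Spaces.linear_iff)
  have l0: "l 0 = 0" using ll(2)[of 0 0] by simp
  have lf: "circle_functional (\<lambda>f. l (\<phi> f \<Omega>))" by (rule circle_functional_field[OF l \<phi>])
  show ?thesis
  proof (cases "1 - int (d \<phi>) + int n > 0")
    case True
    then show ?thesis using vacuum_positive_mode[OF \<phi>] l0 by simp
  next
    case False
    then have nd: "n < d \<phi>" by simp
    \<comment> \<open>Coefficients \<open>sqrt 2\<close> and 1 satisfy the determinant condition;
      the second is nonzero, so the transformation mixes modes.\<close>
    have ab: "(sqrt 2)\<^sup>2 - (1::real)\<^sup>2 = 1" by simp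
    have AB: "(cmod (of_real (sqrt 2)))\<^sup>2 - (cmod (- of_real 1))\<^sup>2 = 1" by simp
    define \<gamma> where "\<gamma> = mob (of_real (sqrt 2)) (- of_real 1)"
    have \<gamma>: "\<gamma> \<in> Mob" unfolding \<gamma>_def Mob_def using AB by blast
    let ?a = "complex_of_real (sqrt 2)"
    show ?thesis
    proof (cases "d \<phi> = 1")
      case True
      then have n0: "n = 0" using nd by simp
      \<comment> \<open>Chosen so that \<open>(?a * z + 1) / (z + ?a) = 1 / ?a + z * g z\<close>;
        the pole lies at \<open>- sqrt 2\<close>, outside the closed unit disc.\<close>
      define g where "g z = (?a - 1 / ?a) / (z + ?a)" for z :: complex
      have "g holomorphic_on ball 0 (sqrt 2)"
        unfolding g_def
      proof (intro holomorphic_intros)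
        fix z :: complex assume "z \<in> ball 0 (sqrt 2)"
        then have z: "cmod z < sqrt 2" by simp
        show "z + ?a \<noteq> 0"
        proof
          assume "z + ?a = 0"
          then have "z = - ?a" by (simp add: add_eq_0_iff2)
          then show False using z by (metis norm_minus_cancel norm_of_real abs_of_nonneg less_irrefl real_sqrt_ge_zero zero_le_numeral)
        qed
      qed
      then have "(\<lambda>f. l (\<phi> f \<Omega>)) (laurent 1 g) = 0"
        using vacuum_positive_mode[OF \<phi>] l0
        by (intro functional_vanishes_laurent[OF lf]) auto
      moreover have "\<beta> (d \<phi>) \<gamma> (emode 1) = scale_circle (1 / ?a) (emode 0) + laurent 1 g"
      proof (rule circle_eqI)
        fix t
        let ?z = "cis t"
        have za: "?z + ?a \<noteq> 0"
          using mob_denominator_nonzero[of ?a 1 ?z] by simp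
        have bf: "boundary_family (\<lambda>i. (deriv ^^ i) g)"
          by (rule boundary_family_holomorphic[OF \<open>g holomorphic_on ball 0 (sqrt 2)\<close>]) auto
        have "apply_circle (laurent 1 g) ?z = ?z powi 1 * g ?z"
          using apply_laurent[OF bf, of 1 t] by simp
        moreover have "apply_circle (\<beta> (d \<phi>) \<gamma> (emode 1)) ?z = (?a * ?z + 1) / (?z + ?a)"
          unfolding \<gamma>_def True using mob_action_mode[OF ab, of ?z 1 1] by simp
        moreover have "(?a * ?z + 1) / (?z + ?a) = 1 / ?a + ?z * g ?z"
        proof -
          have a0: "?a \<noteq> 0" by simp
          have "1 / ?a + ?z * g ?z = ((1 / ?a) * (?z + ?a) + ?z * (?a - 1 / ?a)) / (?z + ?a)"
            unfolding g_def add_divide_distrib using za by simp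
          also have "(1 / ?a) * (?z + ?a) + ?z * (?a - 1 / ?a) = ?a * ?z + (1 / ?a) * ?a"
            by (simp only: algebra_simps)
          also have "(1 / ?a) * ?a = 1" using a0 by simp
          finally show ?thesis by simp
        qed
        ultimately show "apply_circle (\<beta> (d \<phi>) \<gamma> (emode 1)) ?z = apply_circle (scale_circle (1 / ?a) (emode 0) + laurent 1 g) ?z"
          by (simp add: apply_emode)
      qed
      moreover have "\<phi> (\<beta> (d \<phi>) \<gamma> (emode 1)) \<Omega> = 0"
        using U_field[OF \<phi> \<gamma>, of "emode 1" \<Omega>] vacuum_positive_mode[OF \<phi>, of 1] vacuum_invariant[OF \<gamma>]
          U_linear(2)[OF \<gamma>, of 0 0] by simp
      ultimately have e: "scaleV (1 / ?a) (\<phi> (emode 0) \<Omega>) + \<phi> (laurent 1 g) \<Omega> = 0" "l (\<phi> (laurent 1 g) \<Omega>) = 0"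
        using field_linear[OF \<phi>] by simp_all
      have "l (scaleV (1 / ?a) (\<phi> (emode 0) \<Omega>) + \<phi> (laurent 1 g) \<Omega>) = 0" unfolding e(1) l0 ..
      then have "(1 / ?a) * l (\<phi> (emode 0) \<Omega>) = 0" unfolding ll e(2) by simp
      then show ?thesis using True n0 by simp
    next
      case False
      define N where "N = 2 * (d \<phi> - 1)"
      have d2: "d \<phi> \<ge> 2" using False nd by simp
      define c where "c k = of_nat (N choose k) * ?a ^ k" for k
      have "\<beta> (d \<phi>) \<gamma> (emode (int (d \<phi>) - 1)) = (\<Sum>k\<le>N. scale_circle (c k) (emode (1 - int (d \<phi>) + int k)))"
      proof (rule circle_eqI)
        fix t
        let ?z = "cis t"
        define e where "e = d \<phi> - 1"
        have e: "int (d \<phi>) - 1 = int e" "1 - int (d \<phi>) = - int e" "N = 2 * e" using d2 by (auto simp: e_def N_def)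
        have za: "?z + ?a \<noteq> 0" using mob_denominator_nonzero[of ?a 1 ?z] by simp
        have zz: "cnj ?z * ?z = 1" by (simp add: cis_cnj cis_mult)
        have "apply_circle (\<beta> (d \<phi>) \<gamma> (emode (int (d \<phi>) - 1))) ?z
            = ((?z + ?a) * (cnj ?z + ?a) * ((?a * ?z + 1) / (?z + ?a))) ^ e"
          unfolding \<gamma>_def mob_action_mode[OF ab norm_cis]
          by (simp only: e(1) power_int_of_nat power_mult_distrib of_real_1 mult_1)
        also have "(?z + ?a) * (cnj ?z + ?a) * ((?a * ?z + 1) / (?z + ?a)) = (cnj ?z + ?a) * (?a * ?z + 1)"
          using za by simp
        also have "cnj ?z + ?a = cnj ?z * (?a * ?z + 1)" using zz by (simp add: algebra_simps)
        also have "(cnj ?z * (?a * ?z + 1) * (?a * ?z + 1)) ^ e = cnj ?z ^ e * (?a * ?z + 1) ^ N"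
          unfolding e(3) by (simp add: power_mult_distrib power_mult power2_eq_square)
        also have "\<dots> = cnj ?z ^ e * (\<Sum>k\<le>N. c k * ?z ^ k)"
          unfolding binomial_ring c_def by (simp add: power_mult_distrib mult_ac)
        also have "\<dots> = (\<Sum>k\<le>N. c k * ?z powi (1 - int (d \<phi>) + int k))"
        proof -
          have "cnj ?z ^ e = ?z powi (- int e)"
            by (simp add: power_int_minus cis_cnj power_inverse flip: cis_inverse)
          moreover have "?z powi (- int e + int k) = ?z powi (- int e) * ?z ^ k" for k
            by (subst power_int_add) auto
          ultimately show ?thesis unfolding sum_distrib_left e(2) by (simp only: mult_ac)
        qed
        also have "\<dots> = apply_circle (\<Sum>k\<le>N. scale_circle (c k) (emode (1 - int (d \<phi>) + int k))) ?z"
          by (induction N) (auto simp: apply_emode)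
        finally show "apply_circle (\<beta> (d \<phi>) \<gamma> (emode (int (d \<phi>) - 1))) ?z
            = apply_circle (\<Sum>k\<le>N. scale_circle (c k) (emode (1 - int (d \<phi>) + int k))) ?z" .
      qed
      moreover have "\<phi> (\<beta> (d \<phi>) \<gamma> (emode (int (d \<phi>) - 1))) \<Omega> = 0"
        using U_field[OF \<phi> \<gamma>, of "emode (int (d \<phi>) - 1)" \<Omega>] vacuum_positive_mode[OF \<phi>, of "int (d \<phi>) - 1"]
          vacuum_invariant[OF \<gamma>] U_linear(2)[OF \<gamma>, of 0 0] d2 by simp
      moreover have "\<phi> (sum f A) \<Omega> = (\<Sum>x\<in>A. \<phi> (f x) \<Omega>)" for f :: "nat \<Rightarrow> smooth_circle" and A
      proof -
        have "\<phi> 0 \<Omega> = 0" using field_linear(4)[OF \<phi>, of 0 0 \<Omega>] by (simp add: scale_circle_simps)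
        then show ?thesis by (induction A rule: infinite_finite_induct) (auto simp: field_linear[OF \<phi>])
      qed
      ultimately have "(\<Sum>k\<le>N. scaleV (c k) (\<phi> (emode (1 - int (d \<phi>) + int k)) \<Omega>)) = 0"
        using field_linear[OF \<phi>] by simp
      then show ?thesis
        by (rule mode_components_vanish[OF \<phi> l]) (use nd d2 in \<open>auto simp: N_def c_def\<close>)
    qed
  qed
qed

subsection \<open>Continuation of vacuum vectors to the opposite half circle\<close>

text \<open>Compatible functionals separate points, and each of them turns the field acting on the
  vacuum into a continuous functional of the test function.\<close>

lemma field_vacuum_continuation:
  assumes \<phi>: "\<phi> \<in> F" and q: "strip_rapid q"
  shows "\<phi> (arc_embed (d \<phi>) (shifted q (\<i> * pi) 0)) \<Omega>
    = scaleV ((- 1) ^ d \<phi>) (\<phi> (reflect_circle (arc_embed (d \<phi>) (shifted q 0 0))) \<Omega>)"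
proof (rule compatible_separates)
  fix l assume l: "compatible_functional scaleV F l"
  have "l (scaleV c \<Phi>) = c * l \<Phi>" for \<Phi> c
    using l by (auto simp: compatible_functional_def Vector_Spaces.linear_iff)
  then show "l (\<phi> (arc_embed (d \<phi>) (shifted q (\<i> * pi) 0)) \<Omega>)
    = l (scaleV ((- 1) ^ d \<phi>) (\<phi> (reflect_circle (arc_embed (d \<phi>) (shifted q 0 0))) \<Omega>))"
    using vacuum_continuation[OF q circle_functional_field[OF l \<phi>], of "d \<phi>" \<Omega>] vacuum_mode[OF \<phi> l] by simp
qed

text \<open>The two closed supports may share the points 1 and -1, so locality is available for the
  approximants from \<open>arc_embed_approx\<close> only. Both orders pass to the limit when tested
  on compatible functionals.\<close>

lemma fields_commute:
  assumes \<phi>: "\<phi> \<in> F" "\<psi> \<in> F" and q: "rapid_family q" "rapid_family r"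
  shows "\<phi> (arc_embed k (q 0)) (\<psi> (reflect_circle (arc_embed k' (r 0))) \<Phi>)
    = \<psi> (reflect_circle (arc_embed k' (r 0))) (\<phi> (arc_embed k (q 0)) \<Phi>)"
proof (rule compatible_separates)
  fix l assume l: "compatible_functional scaleV F l"
  let ?h = "reflect_circle (arc_embed k' (r 0))"
  obtain f where f: "f \<longlonglongrightarrow> arc_embed k (q 0)" "\<And>n. supp_circle (f n) \<subseteq> I_plus"
    using arc_embed_approx[OF q(1), of k] by blast
  have "supp_circle (f n) \<inter> supp_circle ?h = {}" for n
    using f(2)[of n] supp_reflect_arc_embed[OF q(2), of k'] by (force simp: I_plus_def)
  then have eq: "\<phi> (f n) (\<psi> ?h \<Phi>) = \<psi> ?h (\<phi> (f n) \<Phi>)" for n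
    using locality[OF \<phi>, of "f n" ?h] by (metis comp_apply)
  have "(\<lambda>n. l (\<phi> (f n) (\<psi> ?h \<Phi>))) \<longlonglongrightarrow> l (\<phi> (arc_embed k (q 0)) (\<psi> ?h \<Phi>))"
    using circle_functional_tendsto[OF circle_functional_field[OF l \<phi>(1)] f(1)] .
  moreover have "(\<lambda>n. l (\<psi> ?h (\<phi> (f n) \<Phi>))) \<longlonglongrightarrow> l (\<psi> ?h (\<phi> (arc_embed k (q 0)) \<Phi>))"
    using circle_functional_tendsto[OF circle_functional_field2[OF l \<phi>(2) \<phi>(1)] f(1)] .
  ultimately show "l (\<phi> (arc_embed k (q 0)) (\<psi> ?h \<Phi>)) = l (\<psi> ?h (\<phi> (arc_embed k (q 0)) \<Phi>))"
    unfolding eq by (rule LIMSEQ_unique)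
qed

lemma field_prod_commute:
  assumes "fst ` set ws \<subseteq> F" "\<psi> \<in> F" "\<And>x. x \<in> set ws \<Longrightarrow> strip_rapid (snd x)" "rapid_family r"
  shows "field_prod (map (\<lambda>x. (fst x, arc_embed (d (fst x)) (shifted (snd x) w 0))) ws) (\<psi> (reflect_circle (arc_embed k (r 0))) \<Phi>)
    = \<psi> (reflect_circle (arc_embed k (r 0))) (field_prod (map (\<lambda>x. (fst x, arc_embed (d (fst x)) (shifted (snd x) w 0))) ws) \<Phi>)"
  using assms(1,3)
proof (induction ws)
  case (Cons x ws)
  then show ?case
    by (simp add: fields_commute[OF _ assms(2) rapid_family_shifted assms(4)])
qed simp

text \<open>The sign accumulated by continuing every field to the other edge; the daggers in
  \<open>PCT_adj\<close> produce the same product.\<close>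

definition dim_sign :: "'v opdist list \<Rightarrow> complex" where
  "dim_sign \<phi>s = (\<Prod>\<phi>\<leftarrow>\<phi>s. (- 1) ^ d \<phi>)"

lemma field_prod_vacuum_continuation:
  assumes "fst ` set ws \<subseteq> F" "\<And>x. x \<in> set ws \<Longrightarrow> strip_rapid (snd x)"
  shows "field_prod (map (\<lambda>x. (fst x, arc_embed (d (fst x)) (shifted (snd x) (\<i> * pi) 0))) ws) \<Omega>
    = scaleV (dim_sign (map fst ws)) (field_prod (rev (map (\<lambda>x. (fst x, reflect_circle (arc_embed (d (fst x)) (shifted (snd x) 0 0)))) ws)) \<Omega>)"
  using assms
proof (induction ws rule: rev_induct)
  case Nil
  then show ?case by (simp add: dim_sign_def)
next
  case (snoc x ws)
  let ?A = "map (\<lambda>x. (fst x, arc_embed (d (fst x)) (shifted (snd x) (\<i> * pi) 0))) ws"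
  let ?h = "reflect_circle (arc_embed (d (fst x)) (shifted (snd x) 0 0))"
  have x: "fst x \<in> F" "strip_rapid (snd x)" and ws: "fst ` set ws \<subseteq> F" "\<And>y. y \<in> set ws \<Longrightarrow> strip_rapid (snd y)"
    using snoc.prems by auto
  have A: "fst ` set ?A \<subseteq> F" using ws(1) by auto
  have "field_prod ?A (fst x (arc_embed (d (fst x)) (shifted (snd x) (\<i> * pi) 0)) \<Omega>)
      = scaleV ((- 1) ^ d (fst x)) (field_prod ?A (fst x ?h \<Omega>))"
    unfolding field_vacuum_continuation[OF x] field_prod_linear(2)[OF A] ..
  \<comment> \<open>\<open>?h\<close> belongs to the closed lower half circle, the fields in
    \<open>?A\<close> to the upper one.\<close>
  also have "field_prod ?A (fst x ?h \<Omega>) = fst x ?h (field_prod ?A \<Omega>)"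
    by (rule field_prod_commute[OF ws(1) x(1) ws(2) rapid_family_shifted[OF x(2)]])
  finally show ?case
    using snoc.IH[OF ws] x(1)
    by (simp add: field_prod_append dim_sign_def field_linear mult_ac)
qed

end

section \<open>Convergence estimates for multilinear functionals\<close>

text \<open>Approximation of boosted test functions at rate \<open>1 / (n + 1)\<close>, with growth
  in the boost parameter measured by powers of \<open>cosh t\<close>. The bound on \<open>B\<close>
  is included because telescoping a product leaves factors that are not differences.\<close>

definition boost_approx :: "(nat \<Rightarrow> real \<Rightarrow> smooth_circle) \<Rightarrow> (real \<Rightarrow> smooth_circle) \<Rightarrow> bool" where
  "boost_approx A B \<longleftrightarrow> (\<forall>N. \<exists>K m. \<forall>n t. CN_norm N (A n t - B t) \<le> K * cosh t ^ m / (real n + 1) \<and>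
     CN_norm N (B t) \<le> K * cosh t ^ m)"

text \<open>Telescoping over the slots: one slot carries the difference and the rate
  \<open>1 / (n + 1)\<close>, the others only contribute powers of \<open>cosh t\<close>.\<close>

lemma boost_approx_multilinear:
  assumes M: "cont_multilinear k M" and AB: "\<And>i. i < k \<Longrightarrow> boost_approx (\<lambda>n t. A n t i) (\<lambda>t. B t i)"
  shows "\<exists>K m. \<forall>n t. cmod (M (A n t) - M (B t)) \<le> K * cosh t ^ m / (real n + 1)"
proof -
  have ml: "multilinear k M" using M by (simp add: cont_multilinear_def)
  obtain C N where C: "C \<ge> 0" "\<And>f. cmod (M f) \<le> C * (\<Prod>i<k. CN_norm N (f i))"
    using cont_multilinear_bound[OF M] by blast
  have "\<forall>i. \<exists>K m. i < k \<longrightarrow> (\<forall>n t. CN_norm N (A n t i - B t i) \<le> K * cosh t ^ m / (real n + 1) \<and>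
     CN_norm N (B t i) \<le> K * cosh t ^ m)"
    using AB unfolding boost_approx_def by meson
  then obtain K m where Km: "\<And>i n t. i < k \<Longrightarrow> CN_norm N (A n t i - B t i) \<le> K i * cosh t ^ m i / (real n + 1)"
    "\<And>i n t. i < k \<Longrightarrow> CN_norm N (B t i) \<le> K i * cosh t ^ m i"
    by metis
  define K' where "K' = (\<Sum>i<k. \<bar>K i\<bar>)"
  define m' where "m' = (\<Sum>i<k. m i)"
  have K'0: "K' \<ge> 0" unfolding K'_def by (intro sum_nonneg) auto
  have up: "K i * cosh t ^ m i \<le> K' * cosh t ^ m'" if "i < k" for i and t :: real
  proof -
    have "\<bar>K i\<bar> \<le> K'" unfolding K'_def using that by (intro member_le_sum) auto
    moreover have "m i \<le> m'" unfolding m'_def using that by (intro member_le_sum) auto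
    ultimately show ?thesis using K'0 by (intro mult_mono cosh_power_mono) auto
  qed
  have dif: "CN_norm N (A n t i - B t i) \<le> K' * cosh t ^ m' / (real n + 1)" if "i < k" for i n t
  proof -
    have "K i * cosh t ^ m i / (real n + 1) \<le> K' * cosh t ^ m' / (real n + 1)"
      by (intro divide_right_mono up that) auto
    with Km(1)[OF that, of n t] show ?thesis by linarith
  qed
  have bB: "CN_norm N (B t i) \<le> 2 * K' * cosh t ^ m'" if "i < k" for i t
  proof -
    have "0 \<le> K' * cosh t ^ m'" using K'0 by simp
    then show ?thesis using Km(2)[OF that, of t] up[OF that, of t] by linarith
  qed
  have bA: "CN_norm N (A n t i) \<le> 2 * K' * cosh t ^ m'" if "i < k" for i n t
  proof -
    have "CN_norm N (A n t i) = CN_norm N ((A n t i - B t i) + B t i)" by simp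
    also have "\<dots> \<le> CN_norm N (A n t i - B t i) + CN_norm N (B t i)" by (rule CN_norm_triangle)
    also have "\<dots> \<le> K' * cosh t ^ m' / (real n + 1) + K' * cosh t ^ m'"
      using dif[OF that, of n t] Km(2)[OF that, of t] up[OF that, of t] by linarith
    also have "K' * cosh t ^ m' / (real n + 1) \<le> K' * cosh t ^ m' / 1"
      using K'0 by (intro divide_left_mono) auto
    finally show ?thesis by simp
  qed
  \<comment> \<open>The factor 2 lets one bound serve \<open>A\<close> and \<open>B\<close>, whose
    difference is at most \<open>K' * cosh t ^ m'\<close>.\<close>
  define D where "D t = 2 * K' * cosh t ^ m'" for t
  have D0: "D t \<ge> 0" for t using K'0 by (simp add: D_def)
  define H where "H j n t = (\<lambda>i. if i < j then A n t i else B t i)" for j n t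
  have step: "cmod (M (H (Suc j) n t) - M (H j n t)) \<le> C * D t ^ k / (real n + 1)" if j: "j < k" for j n t
  proof -
    have 1: "H (Suc j) n t = (H j n t)(j := (A n t j - B t j) + B t j)" "(H j n t)(j := B t j) = H j n t"
      by (auto simp: H_def fun_eq_iff less_Suc_eq)
    have "M (H (Suc j) n t) = M ((H j n t)(j := A n t j - B t j)) + M (H j n t)"
      using ml j 1(2) unfolding 1(1) multilinear_def by metis
    then have "cmod (M (H (Suc j) n t) - M (H j n t)) = cmod (M ((H j n t)(j := A n t j - B t j)))" by simp
    also have "\<dots> \<le> C * (\<Prod>i<k. CN_norm N (((H j n t)(j := A n t j - B t j)) i))" by (rule C(2))
    also have "(\<Prod>i<k. CN_norm N (((H j n t)(j := A n t j - B t j)) i)) \<le> (\<Prod>i<k. if i = j then D t / (real n + 1) else D t)"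
    proof (rule prod_mono)
      fix i assume "i \<in> {..<k}"
      then have i: "i < k" by simp
      have "K' * cosh t ^ m' / (real n + 1) \<le> D t / (real n + 1)"
        using D0[of t] by (intro divide_right_mono) (auto simp: D_def)
      then show "0 \<le> CN_norm N (((H j n t)(j := A n t j - B t j)) i) \<and>
          CN_norm N (((H j n t)(j := A n t j - B t j)) i) \<le> (if i = j then D t / (real n + 1) else D t)"
        using dif[OF j, of n t] bA[OF i, of n t] bB[OF i, of t] by (auto simp: CN_norm_nonneg H_def D_def)
    qed
    also have "\<dots> = (D t / (real n + 1)) * (\<Prod>i\<in>{..<k} - {j}. D t)"
      using j by (subst prod.remove[of _ j]) (auto intro!: prod.cong)
    also have "\<dots> = D t ^ k / (real n + 1)"
      using j by (simp add: prod_constant power_eq_if)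
    finally show ?thesis using C(1) by (simp add: mult_left_mono)
  qed
  have "cmod (M (H j n t) - M (H 0 n t)) \<le> real j * (C * D t ^ k / (real n + 1))" if "j \<le> k" for j n t
    using that
  proof (induction j)
    case (Suc j)
    have "cmod (M (H (Suc j) n t) - M (H 0 n t)) \<le> cmod (M (H (Suc j) n t) - M (H j n t)) + cmod (M (H j n t) - M (H 0 n t))"
      using norm_triangle_ineq[of "M (H (Suc j) n t) - M (H j n t)" "M (H j n t) - M (H 0 n t)"] by simp
    also have "\<dots> \<le> C * D t ^ k / (real n + 1) + real j * (C * D t ^ k / (real n + 1))"
      using Suc step[of j n t] by (intro add_mono) auto
    also have "\<dots> = real (Suc j) * (C * D t ^ k / (real n + 1))"
      by (simp only: of_nat_Suc distrib_right mult_1_left)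
    finally show ?case .
  qed simp
  from this[of k] have "cmod (M (H k n t) - M (H 0 n t)) \<le> real k * (C * D t ^ k / (real n + 1))" for n t by simp
  moreover have "M (H k n t) = M (A n t)" "M (H 0 n t) = M (B t)" for n t
    by (rule multilinear_cong[OF ml], simp add: H_def)+
  ultimately have "cmod (M (A n t) - M (B t)) \<le> (real k * C * (2 * K') ^ k) * cosh t ^ (m' * k) / (real n + 1)" for n t
    by (simp add: D_def power_mult_distrib mult.assoc flip: power_mult)
  then show ?thesis by blast
qed

section \<open>Stability of the approximation under reflection and translation\<close>

lemma cderiv_reflect: "cderiv (reflect_circle f) j t = (- 1) ^ j * cderiv f j (- t)"
proof -
  have "cderiv (reflect_circle f) = (\<lambda>j t. (- 1) ^ j * cderiv f j (- t))"
  proof (rule cderiv_eqI)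
    show "smooth_family (\<lambda>j t. (- 1) ^ j * cderiv f j (- t))"
      unfolding smooth_family_def
    proof (intro allI)
      fix j t
      have "((\<lambda>t::real. - t) has_vector_derivative - 1) (at t)"
        by (auto intro!: derivative_eq_intros simp: has_real_derivative_iff_has_vector_derivative[symmetric])
      from has_vector_derivative_mult_right[OF vector_diff_chain_at[OF this smooth_familyD[OF smooth_family_cderiv]], of "(- 1) ^ j" f j]
      show "((\<lambda>t. (- 1) ^ j * cderiv f j (- t)) has_vector_derivative (- 1) ^ Suc j * cderiv f (Suc j) (- t)) (at t)"
        by (simp add: o_def)
    qed
  qed (simp add: cderiv_0)
  then show ?thesis by simp
qed

lemma CN_norm_reflect_le: "CN_norm N (reflect_circle f) \<le> CN_norm N f"
  unfolding CN_norm_alt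
  by (intro sum_mono cSUP_least) (auto simp: cderiv_reflect norm_mult norm_power intro: cderiv_le_SUP)

lemma reflect_circle_diff: "reflect_circle (f - g) = reflect_circle f - reflect_circle g"
  by (rule circle_eqI) simp

lemma boost_approx_reflect:
  assumes "boost_approx A B"
  shows "boost_approx (\<lambda>n t. reflect_circle (A n t)) (\<lambda>t. reflect_circle (B t))"
  using assms unfolding boost_approx_def reflect_circle_diff[symmetric]
  by (meson CN_norm_reflect_le order_trans)

text \<open>Translation by \<open>t\<close> changes the weight \<open>cosh u ^ M\<close> by at most
  \<open>(2 * cosh t) ^ M\<close>, while the rate in \<open>n\<close> is inherited from the
  approximation of \<open>p\<close>.\<close>

lemma boost_approx_shifted:
  assumes p: "rapid_family p" and Q: "\<And>n. strip_rapid (Q n)"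
    and appr: "\<And>i M. \<exists>K. \<forall>n u. cmod ((deriv ^^ i) (Q n) (of_real u) - p i u) * cosh u ^ M \<le> K / (real n + 1)"
  shows "boost_approx (\<lambda>n t. arc_embed d (shifted (Q n) (of_real t) 0)) (\<lambda>t. arc_embed d (\<lambda>u. p 0 (u - t)))"
  unfolding boost_approx_def
proof
  fix N
  obtain C M where C: "C \<ge> 0" "\<forall>q e. rapid_family q \<longrightarrow> (\<forall>k\<le>N. \<forall>u. cmod (q k u) * cosh u ^ M \<le> e) \<longrightarrow>
     CN_norm N (arc_embed d (q 0)) \<le> C * e" using CN_norm_arc_bound[of N d] by (elim exE conjE)
  have "\<forall>i. \<exists>K. \<forall>n u. cmod ((deriv ^^ i) (Q n) (of_real u) - p i u) * cosh u ^ M \<le> K / (real n + 1)"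
    using appr by blast
  from choice[OF this] obtain K where "\<forall>i n u. cmod ((deriv ^^ i) (Q n) (of_real u) - p i u) * cosh u ^ M \<le> K i / (real n + 1)" ..
  then have K: "cmod ((deriv ^^ i) (Q n) (of_real u) - p i u) * cosh u ^ M \<le> K i / (real n + 1)" for i n u by blast
  obtain L where L: "\<And>k u. k \<le> N \<Longrightarrow> cmod (p k u) * cosh u ^ M \<le> L" using rapid_family_bound[OF p] by metis
  define K' where "K' = (\<Sum>i\<le>N. \<bar>K i\<bar>) + \<bar>L\<bar>"
  have K': "K i \<le> K'" if "i \<le> N" for i
  proof -
    have "\<bar>K i\<bar> \<le> (\<Sum>i\<le>N. \<bar>K i\<bar>)" using that by (intro member_le_sum) auto
    then show ?thesis unfolding K'_def by linarith
  qed
  have L': "L \<le> K'" unfolding K'_def by (intro add_increasing sum_nonneg) auto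
  have shift: "cmod (g (u - t)) * cosh u ^ M \<le> (2 * cosh t) ^ M * e" if "\<And>u. cmod (g u) * cosh u ^ M \<le> e" for g :: "real \<Rightarrow> complex" and u t e
  proof -
    have "cmod (g (u - t)) * cosh u ^ M \<le> cmod (g (u - t)) * ((2 * cosh t) ^ M * cosh (u - t) ^ M)"
      using cosh_shift_power[of "u - t" t M] by (intro mult_left_mono) auto
    also have "\<dots> = (2 * cosh t) ^ M * (cmod (g (u - t)) * cosh (u - t) ^ M)" by (simp only: mult_ac)
    also have "\<dots> \<le> (2 * cosh t) ^ M * e" by (intro mult_left_mono that) auto
    finally show ?thesis .
  qed
  show "\<exists>K m. \<forall>n t. CN_norm N (arc_embed d (shifted (Q n) (of_real t) 0) - arc_embed d (\<lambda>u. p 0 (u - t))) \<le> K * cosh t ^ m / (real n + 1) \<and>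
     CN_norm N (arc_embed d (\<lambda>u. p 0 (u - t))) \<le> K * cosh t ^ m"
  proof (intro exI[of _ "C * 2 ^ M * K'"] exI[of _ M] allI conjI)
    fix n t
    note r1 = rapid_family_shifted[OF Q, of n "of_real t"] and r2 = rapid_family_shift[OF p, of t]
    have "CN_norm N (arc_embed d (shifted (Q n) (of_real t) 0) - arc_embed d (\<lambda>u. p 0 (u - t)))
        \<le> C * ((2 * cosh t) ^ M * (K' / (real n + 1)))"
      unfolding arc_embed_diff[OF r1 r2]
    proof (rule C(2)[THEN spec, THEN spec, THEN mp, THEN mp, OF rapid_family_diff[OF r1 r2]], intro allI impI)
      fix k u assume k: "k \<le> N"
      have "cmod ((deriv ^^ k) (Q n) (of_real u) - p k u) * cosh u ^ M \<le> K' / (real n + 1)" for u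
        by (rule order_trans[OF K divide_right_mono[OF K'[OF k]]]) simp
      from shift[of "\<lambda>u. (deriv ^^ k) (Q n) (of_real u) - p k u", OF this]
      show "cmod (shifted (Q n) (of_real t) k u - p k (u - t)) * cosh u ^ M \<le> (2 * cosh t) ^ M * (K' / (real n + 1))"
        by (simp add: shifted_def)
    qed
    then show "CN_norm N (arc_embed d (shifted (Q n) (of_real t) 0) - arc_embed d (\<lambda>u. p 0 (u - t))) \<le> C * 2 ^ M * K' * cosh t ^ M / (real n + 1)"
      by (simp add: power_mult_distrib mult_ac)
    have "CN_norm N (arc_embed d (\<lambda>u. p 0 (u - t))) \<le> C * ((2 * cosh t) ^ M * K')"
    proof (rule C(2)[THEN spec, THEN spec, THEN mp, THEN mp, OF r2], intro allI impI)
      fix k u assume k: "k \<le> N"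
      show "cmod (p k (u - t)) * cosh u ^ M \<le> (2 * cosh t) ^ M * K'"
        by (rule shift) (rule order_trans[OF L[OF k] L'])
    qed
    then show "CN_norm N (arc_embed d (\<lambda>u. p 0 (u - t))) \<le> C * 2 ^ M * K' * cosh t ^ M"
      by (simp add: power_mult_distrib mult_ac)
  qed
qed

lemma strip_rapid_translate:
  assumes "strip_rapid q" shows "strip_rapid (\<lambda>z. q (z - of_real t))"
  unfolding strip_rapid_def
proof (intro conjI allI)
  have "q holomorphic_on UNIV" using assms by (simp add: strip_rapid_def)
  then show "(\<lambda>z. q (z - of_real t)) holomorphic_on UNIV"
    using holomorphic_on_compose_gen[of "\<lambda>z. z - of_real t" UNIV q UNIV]
    by (simp add: o_def holomorphic_on_diff holomorphic_on_ident holomorphic_on_const)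
  fix S and M :: nat
  obtain C where C: "\<And>z. \<bar>Im z\<bar> \<le> S \<Longrightarrow> cmod (q z) * cosh (Re z) ^ M \<le> C"
    using assms unfolding strip_rapid_def by blast
  have "cmod (q (z - of_real t)) * cosh (Re z) ^ M \<le> (2 * cosh t) ^ M * C" if z: "\<bar>Im z\<bar> \<le> S" for z
  proof -
    have "cmod (q (z - of_real t)) * cosh (Re z) ^ M \<le> cmod (q (z - of_real t)) * ((2 * cosh t) ^ M * cosh (Re z - t) ^ M)"
      using cosh_shift_power[of "Re z - t" t M] by (intro mult_left_mono) auto
    also have "\<dots> = (2 * cosh t) ^ M * (cmod (q (z - of_real t)) * cosh (Re (z - of_real t)) ^ M)" by (simp add: mult_ac)
    also have "\<dots> \<le> (2 * cosh t) ^ M * C" by (intro mult_left_mono C) (use z in auto)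
    finally show ?thesis .
  qed
  then show "\<exists>C. \<forall>z. \<bar>Im z\<bar> \<le> S \<longrightarrow> cmod (q (z - of_real t)) * cosh (Re z) ^ M \<le> C" by blast
qed

section \<open>The boosted vacuum vectors\<close>

lemma supp_rotate:
  assumes "\<gamma> = rot pi" "supp_circle f \<subseteq> I_minus"
  shows "supp_circle (\<beta> k \<gamma> f) \<subseteq> I_plus"
proof -
  have m: "\<gamma> \<in> Mob" by (simp add: assms(1) rot_in_Mob)
  have "apply_circle (\<beta> k \<gamma> f) z = apply_circle f (- z)" for z
  proof (cases "cmod z = 1")
    case True
    have "cis (- pi) * z = - z" by (simp add: complex_eq_iff)
    then show ?thesis using apply_\<beta>_rot[OF True, of k pi f] by (simp add: assms(1))
  next
    case False
    then have "cmod (- z) \<noteq> 1" by simp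
    then show ?thesis using apply_circle[of f] apply_circle[of "\<beta> k \<gamma> f"] False by auto
  qed
  then have "supp_circle (\<beta> k \<gamma> f) = closure {z. apply_circle f (- z) \<noteq> 0}" by (simp add: supp_circle_def)
  also have "{z. apply_circle f (- z) \<noteq> 0} = uminus ` {z. apply_circle f z \<noteq> 0}"
    by (auto simp: image_iff) (metis minus_minus)
  also have "closure \<dots> \<subseteq> uminus ` supp_circle f"
  proof (rule closure_minimal)
    show "uminus ` {z. apply_circle f z \<noteq> 0} \<subseteq> uminus ` supp_circle f"
      unfolding supp_circle_def by (intro image_mono closure_subset)
    show "closed (uminus ` supp_circle f)" unfolding supp_circle_def by (intro closed_negations closed_closure)
  qed
  also have "\<dots> \<subseteq> I_plus" using assms(2) by (auto simp: I_plus_def I_minus_def)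
  finally show ?thesis .
qed

lemma \<beta>_rot_reflect: "\<beta> k (rot pi) (reflect_circle f) = reflect_circle (\<beta> k (rot pi) f)"
proof (rule circle_eqI)
  fix t
  have a: "cis (- pi) * z = - z" for z by (simp add: complex_eq_iff)
  have "cmod (inverse (cis t)) = 1" by (simp add: norm_inverse)
  then show "apply_circle (\<beta> k (rot pi) (reflect_circle f)) (cis t) = apply_circle (reflect_circle (\<beta> k (rot pi) f)) (cis t)"
    using apply_\<beta>_rot[of "cis t" k pi "reflect_circle f"] apply_\<beta>_rot[of "inverse (cis t)" k pi f]
    unfolding a by (simp del: cis_inverse)
qed

text \<open>The rotation by \<pi> is \<open>z \<mapsto> - z\<close> on the disc; it exchanges the
  fixed points 1 and -1 of the boosts and so reverses their direction.\<close>

lemma boost_rot: "boost (- t) \<circ> rot pi = rot pi \<circ> boost t"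
proof
  fix z
  have AB: "(cmod (of_real (cosh (t / 2))))\<^sup>2 - (cmod (- of_real (sinh (t / 2))))\<^sup>2 = 1" by (simp add: cosh_square_eq)
  show "(boost (- t) \<circ> rot pi) z = (rot pi \<circ> boost t) z"
  proof (cases "cmod z \<le> 1")
    case True
    have "cmod (boost t z) \<le> 1" unfolding boost_def by (rule cmod_mob(1)[OF AB True])
    then have "rot pi (boost t z) = - boost t z" by (simp add: rot_def)
    moreover have "rot pi z = - z" using True by (simp add: rot_def)
    moreover have "boost (- t) (- z) = - boost t z"
    proof -
      define c s where "c = complex_of_real (cosh (t / 2))" and "s = complex_of_real (sinh (t / 2))"
      have 1: "boost (- t) (- z) = (c * (- z) + s) / (s * (- z) + c)"
        using True by (simp add: boost_def mob_def c_def s_def)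
      have 2: "boost t z = (c * z + - s) / (- s * z + c)"
        using True by (simp add: boost_def mob_def c_def s_def)
      have "c * (- z) + s = - (c * z + - s)" "s * (- z) + c = - s * z + c" by simp_all
      then show ?thesis unfolding 1 2 by (simp only: minus_divide_left)
    qed
    ultimately show ?thesis by simp
  qed (simp add: boost_def rot_def mob_def)
qed

lemma strip_minus_i_pi: "strip (- \<i> * of_real pi) = uminus ` strip (\<i> * of_real pi)"
proof -
  have "strip (- \<i> * of_real pi) = {z. - pi \<le> Im z \<and> Im z \<le> 0}" by (auto simp: strip_def)
  moreover have "z \<in> uminus ` S \<longleftrightarrow> - z \<in> S" for z :: complex and S
    unfolding image_iff by (metis minus_minus)
  ultimately show ?thesis by (intro set_eqI) (auto simp: strip_i_pi)
qed

context involutive_wightman_cft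
begin

interpretation V: vector_space scaleV by (rule vector_space)

section \<open>Matrix elements of the Hermitian form and their continuation\<close>

lemma form_linear1: "form (\<Phi> + \<Phi>') \<Psi> = form \<Phi> \<Psi> + form \<Phi>' \<Psi>" "form (scaleV c \<Phi>) \<Psi> = c * form \<Phi> \<Psi>"
  using form_linear[of \<Psi>] by (auto simp: Vector_Spaces.linear_iff)

lemma form_linear2: "form \<Phi> (\<Psi> + \<Psi>') = form \<Phi> \<Psi> + form \<Phi> \<Psi>'" "form \<Phi> (scaleV c \<Psi>) = cnj c * form \<Phi> \<Psi>"
  by (metis form_hermitian form_linear1(1) complex_cnj_add complex_cnj_cnj)
    (metis form_hermitian form_linear1(2) complex_cnj_mult complex_cnj_cnj)

lemma form_eqI:
  assumes "\<And>\<Phi>'. form \<Phi> \<Phi>' = form \<Psi> \<Phi>'" shows "\<Phi> = \<Psi>"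
proof -
  have "form (\<Phi> + scaleV (- 1) \<Psi>) \<Phi>' = 0" for \<Phi>' by (simp only: form_linear1 assms) simp
  then have "\<Phi> + scaleV (- 1) \<Psi> = 0" using form_nondegenerate by blast
  then show ?thesis by (simp add: add_eq_0_iff)
qed

lemma form_eqI2:
  assumes "\<And>\<Phi>'. form \<Phi>' \<Phi> = form \<Phi>' \<Psi>" shows "\<Phi> = \<Psi>"
  by (rule form_eqI) (metis assms form_hermitian)

text \<open>Joint continuity of the form gives continuity in the first variable, and words are
  continuous for the strong topology. Matrix elements thereby fall under the estimates for
  continuous multilinear functionals.\<close>

lemma compatible_form: "compatible_functional scaleV F (\<lambda>\<Phi>. form \<Phi> \<Phi>')"
  unfolding compatible_functional_def
proof (intro conjI allI impI)
  let ?S = "strong_topology scaleV F"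
  have top: "topspace ?S = UNIV" by (rule topspace_strong_topology[OF vector_space])
  have "continuous_map ?S (prod_topology ?S ?S) (\<lambda>\<Phi>. (\<Phi>, \<Phi>'))"
    by (intro continuous_map_pairedI) (auto simp: top)
  from continuous_map_compose[OF this form_continuous]
  have c: "continuous_map ?S euclidean (\<lambda>\<Phi>. form \<Phi> \<Phi>')" by (simp add: o_def)
  fix \<phi>s \<Phi> assume "set \<phi>s \<subseteq> F"
  then have "continuous_map (circle_power_topology (length \<phi>s)) ?S (\<lambda>f. word \<phi>s f \<Phi>)"
    using words_continuous_strong_topology[OF vector_space] by (auto simp: words_continuous_def)
  from continuous_map_compose[OF this c]
  show "continuous_map (circle_power_topology (length \<phi>s)) euclidean (\<lambda>f. form (word \<phi>s f \<Phi>) \<Phi>')" by (simp add: o_def)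
qed (rule form_linear)

text \<open>Both edge values are limits of expressions in the same approximants: \<open>G n\<close>
  is entire, tends to \<open>B\<close> on the real line, and on the upper line tends to
  \<open>T\<close>, which carries the reversed and reflected fields.\<close>

lemma boost_graph_compact:
  assumes F: "fst ` set ws \<subseteq> F"
    and p: "\<And>x. x \<in> set ws \<Longrightarrow> rapid_family (snd x) \<and> (\<exists>R. \<forall>i u. \<bar>u\<bar> > R \<longrightarrow> snd x i u = 0)"
  shows "boost_graph U form (\<i> * of_real pi)
    (field_prod (map (\<lambda>x. (fst x, arc_embed (d (fst x)) (snd x 0))) ws) \<Omega>)
    (scaleV (dim_sign (map fst ws)) (field_prod (rev (map (\<lambda>x. (fst x, reflect_circle (arc_embed (d (fst x)) (snd x 0)))) ws)) \<Omega>))"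
  unfolding boost_graph_def
proof
  fix \<Phi>'
  let ?l = "\<lambda>\<Phi>. form \<Phi> \<Phi>'"
  note l = compatible_form[of \<Phi>']
  have "\<forall>x. \<exists>Q. x \<in> set ws \<longrightarrow> (\<forall>n. strip_rapid (Q n)) \<and>
      (\<forall>i M. \<exists>K. \<forall>n u. cmod ((deriv ^^ i) (Q n) (of_real u) - snd x i u) * cosh u ^ M \<le> K / (real n + 1))"
  proof
    fix x
    show "\<exists>Q. x \<in> set ws \<longrightarrow> (\<forall>n. strip_rapid (Q n)) \<and>
      (\<forall>i M. \<exists>K. \<forall>n u. cmod ((deriv ^^ i) (Q n) (of_real u) - snd x i u) * cosh u ^ M \<le> K / (real n + 1))"
    proof (cases "x \<in> set ws")
      case True
      then obtain R where R: "\<And>i u. \<bar>u\<bar> > R \<Longrightarrow> snd x i u = 0" and sf: "smooth_family (snd x)"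
        using p[OF True] by (auto simp: rapid_family_def)
      obtain Q where "\<And>n. strip_rapid (Q n)"
        "\<And>i M. \<exists>K. \<forall>n u. cmod ((deriv ^^ i) (Q n) (of_real u) - snd x i u) * cosh u ^ M \<le> K / (real n + 1)"
        using gaussian_approximation[OF sf R] by (metis (no_types))
      then show ?thesis by blast
    qed simp
  qed
  then obtain Q where Q: "\<And>x n. x \<in> set ws \<Longrightarrow> strip_rapid (Q x n)"
    "\<And>x i M. x \<in> set ws \<Longrightarrow> \<exists>K. \<forall>n u. cmod ((deriv ^^ i) (Q x n) (of_real u) - snd x i u) * cosh u ^ M \<le> K / (real n + 1)"
    by metis
  define c where "c n w x = arc_embed (d (fst x)) (shifted (Q x n) w 0)" for n w x
  define b where "b t x = arc_embed (d (fst x)) (\<lambda>u. snd x (0 :: nat) (u - t))" for t x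
  have c: "boost_approx (\<lambda>n t. c n (of_real t) x) (\<lambda>t. b t x)" if "x \<in> set ws" for x
    unfolding c_def b_def using p[OF that] by (intro boost_approx_shifted Q that) auto
  define G where "G n w = ?l (field_prod (map (\<lambda>x. (fst x, c n w x)) ws) \<Omega>)" for n w
  define B where "B t = ?l (field_prod (map (\<lambda>x. (fst x, b t x)) ws) \<Omega>)" for t
  define s where "s = dim_sign (map fst ws)"
  define T where "T t = s * ?l (field_prod (map (\<lambda>x. (fst x, reflect_circle (b t x))) (rev ws)) \<Omega>)" for t
  have nth: "ws ! j \<in> set ws" if "j < length ws" for j using that by simp
  have Fr: "set (map fst ws) \<subseteq> F" "set (map fst (rev ws)) \<subseteq> F" using F by auto
  let ?M = "\<lambda>f. ?l (word (map fst ws) f \<Omega>)" and ?R = "\<lambda>f. ?l (word (map fst (rev ws)) f \<Omega>)"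
  have M: "cont_multilinear (length ws) ?M" using cont_multilinear_word[OF l Fr(1)] by simp
  have R: "cont_multilinear (length ws) ?R" using cont_multilinear_word[OF l Fr(2)] by simp
  have GM: "G n w = ?M (\<lambda>j. c n w (ws ! j))" for n w unfolding G_def field_prod_word ..
  have holG: "G n holomorphic_on UNIV" for n
  proof -
    have "(\<lambda>w. ?M (\<lambda>j. c n w (ws ! j))) field_differentiable (at w)" for w
      unfolding c_def by (rule cont_multilinear_differentiable[OF M circle_deriv_shifted[OF Q(1)[OF nth]]])
    then show ?thesis unfolding holomorphic_on_def GM[abs_def] by auto
  qed
  have growth: "\<exists>C N. \<forall>z. 0 \<le> Im z \<longrightarrow> Im z \<le> pi \<longrightarrow> cmod (G n z) \<le> C * cosh (Re z) ^ N" for n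
  proof -
    obtain C N where C: "C \<ge> 0" "\<And>f. cmod (?M f) \<le> C * (\<Prod>i<length ws. CN_norm N (f i))"
      using cont_multilinear_bound[OF M] by blast
    have "\<forall>i. \<exists>K m. i < length ws \<longrightarrow> (\<forall>w. \<bar>Im w\<bar> \<le> pi \<longrightarrow> CN_norm N (c n w (ws ! i)) \<le> K * cosh (Re w) ^ m)"
      unfolding c_def using CN_norm_shifted_bound[OF Q(1)[OF nth], of _ pi N] by meson
    then obtain K m where Km: "\<And>i w. i < length ws \<Longrightarrow> \<bar>Im w\<bar> \<le> pi \<Longrightarrow> CN_norm N (c n w (ws ! i)) \<le> K i * cosh (Re w) ^ m i"
      by metis
    have "cmod (G n z) \<le> (C * (\<Prod>i<length ws. K i)) * cosh (Re z) ^ (\<Sum>i<length ws. m i)" if "0 \<le> Im z" "Im z \<le> pi" for z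
    proof -
      have "cmod (G n z) \<le> C * (\<Prod>i<length ws. CN_norm N (c n z (ws ! i)))" unfolding GM by (rule C(2))
      also have "\<dots> \<le> C * (\<Prod>i<length ws. K i * cosh (Re z) ^ m i)"
        using that by (intro mult_left_mono C prod_mono conjI CN_norm_nonneg Km) auto
      also have "\<dots> = (C * (\<Prod>i<length ws. K i)) * cosh (Re z) ^ (\<Sum>i<length ws. m i)"
        by (simp add: prod.distrib power_sum mult_ac)
      finally show ?thesis .
    qed
    then show ?thesis by blast
  qed
  have "\<exists>K m. \<forall>n t. cmod (?M (\<lambda>j. c n (of_real t) (ws ! j)) - ?M (\<lambda>j. b t (ws ! j))) \<le> K * cosh t ^ m / (real n + 1)"
    by (rule boost_approx_multilinear[OF M]) (use c nth in auto)
  then obtain K1 m1 where b1: "\<And>n t. cmod (G n (of_real t) - B t) \<le> K1 * cosh t ^ m1 / (real n + 1)"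
    unfolding GM B_def field_prod_word by blast
  have rnth: "rev ws ! j \<in> set ws" if "j < length ws" for j using that by (metis length_rev nth_mem set_rev)
  have "\<exists>K m. \<forall>n t. cmod (?R (\<lambda>j. reflect_circle (c n (of_real t) (rev ws ! j))) - ?R (\<lambda>j. reflect_circle (b t (rev ws ! j)))) \<le> K * cosh t ^ m / (real n + 1)"
    by (rule boost_approx_multilinear[OF R]) (use boost_approx_reflect[OF c] rnth in auto)
  then obtain K2 m2 where b2: "\<And>n t. cmod (?R (\<lambda>j. reflect_circle (c n (of_real t) (rev ws ! j))) - ?R (\<lambda>j. reflect_circle (b t (rev ws ! j)))) \<le> K2 * cosh t ^ m2 / (real n + 1)"
    by blast
  have s1: "cmod s = 1" unfolding s_def dim_sign_def by (induction ws) (auto simp: norm_mult norm_power)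
  have top: "G n (\<i> * of_real pi + of_real t) = s * ?R (\<lambda>j. reflect_circle (c n (of_real t) (rev ws ! j)))" for n t
  proof -
    \<comment> \<open>The value at \<open>\<i> * pi + t\<close> is the value at
      \<open>\<i> * pi\<close> for approximants translated by \<open>t\<close>, to which the vacuum
      continuation applies.\<close>
    define ws' where "ws' = map (\<lambda>x. (fst x, \<lambda>z. Q x n (z - of_real t))) ws"
    have e: "shifted (\<lambda>z. Q x n (z - of_real t)) w 0 = shifted (Q x n) (w + of_real t) 0" for x w
      by (auto simp: shifted_def fun_eq_iff diff_diff_eq)
    have "field_prod (map (\<lambda>x. (fst x, arc_embed (d (fst x)) (shifted (snd x) (\<i> * pi) 0))) ws') \<Omega>
      = scaleV (dim_sign (map fst ws')) (field_prod (rev (map (\<lambda>x. (fst x, reflect_circle (arc_embed (d (fst x)) (shifted (snd x) 0 0)))) ws')) \<Omega>)"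
      by (rule field_prod_vacuum_continuation) (use F Q(1) in \<open>auto simp: ws'_def intro!: strip_rapid_translate\<close>)
    then have "field_prod (map (\<lambda>x. (fst x, c n (\<i> * of_real pi + of_real t) x)) ws) \<Omega>
      = scaleV s (field_prod (map (\<lambda>x. (fst x, reflect_circle (c n (of_real t) x))) (rev ws)) \<Omega>)"
      by (simp add: ws'_def o_def e c_def s_def rev_map)
    then show ?thesis unfolding G_def by (simp add: form_linear1 field_prod_word)
  qed
  have b2': "cmod (G n (\<i> * of_real pi + of_real t) - T t) \<le> K2 * cosh t ^ m2 / (real n + 1)" for n t
  proof -
    have "G n (\<i> * of_real pi + of_real t) - T t = s * (?R (\<lambda>j. reflect_circle (c n (of_real t) (rev ws ! j))) - ?R (\<lambda>j. reflect_circle (b t (rev ws ! j))))"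
      unfolding top T_def field_prod_word by (simp add: right_diff_distrib)
    then show ?thesis using b2 s1 by (simp add: norm_mult)
  qed
  \<comment> \<open>One rate for both edges, as the limit theorem on the strip requires.\<close>
  define \<epsilon> where "\<epsilon> n = (\<bar>K1\<bar> + \<bar>K2\<bar>) / (real n + 1)" for n
  have up: "x \<le> \<epsilon> n * cosh t ^ (m1 + m2)" if "x \<le> K * cosh t ^ m / (real n + 1)" "\<bar>K\<bar> \<le> \<bar>K1\<bar> + \<bar>K2\<bar>" "m \<le> m1 + m2" for x K m n and t :: real
  proof -
    have "K * cosh t ^ m \<le> (\<bar>K1\<bar> + \<bar>K2\<bar>) * cosh t ^ (m1 + m2)"
      using that by (intro mult_mono cosh_power_mono) auto
    then have "K * cosh t ^ m / (real n + 1) \<le> (\<bar>K1\<bar> + \<bar>K2\<bar>) * cosh t ^ (m1 + m2) / (real n + 1)"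
      by (intro divide_right_mono) auto
    with that(1) show ?thesis by (simp add: \<epsilon>_def)
  qed
  have "\<exists>H. continuous_on (strip (\<i> * of_real pi)) H \<and> H holomorphic_on interior (strip (\<i> * of_real pi)) \<and>
      (\<forall>t. H (of_real t) = B t \<and> H (\<i> * of_real pi + of_real t) = T t)"
  proof (rule strip_limit[OF holG growth])
    show "cmod (G n (of_real t) - B t) \<le> \<epsilon> n * cosh t ^ (m1 + m2)" for n t by (rule up[OF b1]) auto
    show "cmod (G n (\<i> * of_real pi + of_real t) - T t) \<le> \<epsilon> n * cosh t ^ (m1 + m2)" for n t by (rule up[OF b2']) auto
    show "\<epsilon> \<longlonglongrightarrow> 0" unfolding \<epsilon>_def by real_asymp
  qed
  moreover have \<beta>b: "\<beta> (d (fst x)) (boost t) (arc_embed (d (fst x)) (snd x 0)) = b t x" if "x \<in> set ws" for x t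
    unfolding b_def using p[OF that] by (intro \<beta>_boost_arc) auto
  have "B t = form (U (boost t) (field_prod (map (\<lambda>x. (fst x, arc_embed (d (fst x)) (snd x 0))) ws) \<Omega>)) \<Phi>'" for t
  proof -
    have "U (boost t) (field_prod (map (\<lambda>x. (fst x, arc_embed (d (fst x)) (snd x 0))) ws) \<Omega>)
        = field_prod (map (\<lambda>x. (fst x, b t x)) ws) \<Omega>"
      using F \<beta>b by (subst U_field_prod) (auto simp: boost_in_Mob vacuum_invariant intro!: arg_cong[of _ _ "\<lambda>ws. field_prod ws \<Omega>"])
    then show ?thesis by (simp add: B_def)
  qed
  moreover have "T t = form (U (boost t) (scaleV (dim_sign (map fst ws)) (field_prod (rev (map (\<lambda>x. (fst x, reflect_circle (arc_embed (d (fst x)) (snd x 0)))) ws)) \<Omega>))) \<Phi>'" for t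
  proof -
    have "U (boost t) (field_prod (map (\<lambda>x. (fst x, reflect_circle (arc_embed (d (fst x)) (snd x 0)))) (rev ws)) \<Omega>)
        = field_prod (map (\<lambda>x. (fst x, reflect_circle (b t x))) (rev ws)) \<Omega>"
      using F \<beta>b by (subst U_field_prod) (auto simp: boost_in_Mob vacuum_invariant \<beta>_boost_reflect intro!: arg_cong[of _ _ "\<lambda>ws. field_prod ws \<Omega>"])
    then show ?thesis by (simp add: T_def s_def U_linear boost_in_Mob form_linear1 rev_map)
  qed
  ultimately show "\<exists>G. continuous_on (strip (\<i> * of_real pi)) G \<and> G holomorphic_on interior (strip (\<i> * of_real pi)) \<and>
      (\<forall>t. G (of_real t) = form (U (boost t) (field_prod (map (\<lambda>x. (fst x, arc_embed (d (fst x)) (snd x 0))) ws) \<Omega>)) \<Phi>' \<and>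
        G (\<i> * of_real pi + of_real t) = form (U (boost t) (scaleV (dim_sign (map fst ws)) (field_prod (rev (map (\<lambda>x. (fst x, reflect_circle (arc_embed (d (fst x)) (snd x 0)))) ws)) \<Omega>))) \<Phi>')"
    by simp
qed

text \<open>This is \<open>\<Theta>\<close> applied to the adjoint of the product acting on the
  vacuum, as \<open>PCT_adj\<close> and \<open>PCT_vacuum\<close> show.\<close>

definition reflected :: "('v opdist \<times> smooth_circle) list \<Rightarrow> 'v" where
  "reflected ws = scaleV (dim_sign (map fst ws)) (field_prod (rev (map (\<lambda>x. (fst x, reflect_circle (snd x))) ws)) \<Omega>)"

lemma boost_graph_plus:
  assumes F: "fst ` set ws \<subseteq> F" and supp: "\<And>x. x \<in> set ws \<Longrightarrow> supp_circle (snd x) \<subseteq> I_plus"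
  shows "boost_graph U form (\<i> * of_real pi) (field_prod ws \<Omega>) (reflected ws)"
proof -
  have "\<forall>x. \<exists>q. x \<in> set ws \<longrightarrow> rapid_family q \<and> (\<exists>R. \<forall>i u. \<bar>u\<bar> > R \<longrightarrow> q i u = 0) \<and> snd x = arc_embed (d (fst x)) (q 0)"
    using supp supp_I_plus_arc by metis
  then obtain q where q: "\<And>x. x \<in> set ws \<Longrightarrow> rapid_family (q x) \<and> (\<exists>R. \<forall>i u. \<bar>u\<bar> > R \<longrightarrow> q x i u = 0)"
    "\<And>x. x \<in> set ws \<Longrightarrow> snd x = arc_embed (d (fst x)) (q x 0)" by metis
  define ws' where "ws' = map (\<lambda>x. (fst x, q x)) ws"
  have e: "map (\<lambda>x. (fst x, arc_embed (d (fst x)) (snd x 0))) ws' = ws"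
    "map (\<lambda>x. (fst x, reflect_circle (arc_embed (d (fst x)) (snd x 0)))) ws' = map (\<lambda>x. (fst x, reflect_circle (snd x))) ws"
    "map fst ws' = map fst ws"
    unfolding ws'_def map_map by (rule map_idI, simp add: prod_eq_iff q(2)) (simp_all add: q(2))
  have "boost_graph U form (\<i> * of_real pi)
    (field_prod (map (\<lambda>x. (fst x, arc_embed (d (fst x)) (snd x 0))) ws') \<Omega>)
    (scaleV (dim_sign (map fst ws')) (field_prod (rev (map (\<lambda>x. (fst x, reflect_circle (arc_embed (d (fst x)) (snd x 0)))) ws')) \<Omega>))"
  proof (rule boost_graph_compact)
    show "fst ` set ws' \<subseteq> F" using F by (auto simp: ws'_def)
    fix y assume "y \<in> set ws'"
    then obtain x where "x \<in> set ws" "y = (fst x, q x)" by (auto simp: ws'_def)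
    then show "rapid_family (snd y) \<and> (\<exists>R. \<forall>i u. \<bar>u\<bar> > R \<longrightarrow> snd y i u = 0)" using q(1) by simp
  qed
  then show ?thesis unfolding e reflected_def .
qed

text \<open>The rotation by \<pi> carries the lower half circle to the upper one, commutes with the
  reflection of test functions and reverses the boosts. As it preserves the form, the continuation
  for the upper half circle, run backwards, serves here.\<close>

lemma boost_graph_minus:
  assumes F: "fst ` set ws \<subseteq> F" and supp: "\<And>x. x \<in> set ws \<Longrightarrow> supp_circle (snd x) \<subseteq> I_minus"
  shows "boost_graph U form (- \<i> * of_real pi) (field_prod ws \<Omega>) (reflected ws)"
  unfolding boost_graph_def
proof
  fix \<Phi>'
  define ws' where "ws' = map (\<lambda>x. (fst x, \<beta> (d (fst x)) (rot pi) (snd x))) ws"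
  have r: "rot pi \<in> Mob" by (rule rot_in_Mob)
  have 1: "field_prod ws' \<Omega> = U (rot pi) (field_prod ws \<Omega>)"
    unfolding ws'_def U_field_prod[OF r F] vacuum_invariant[OF r] ..
  have 2: "reflected ws' = U (rot pi) (reflected ws)"
  proof -
    have F': "fst ` set (rev (map (\<lambda>x. (fst x, reflect_circle (snd x))) ws)) \<subseteq> F" using F by auto
    show ?thesis
      unfolding reflected_def U_linear[OF r] U_field_prod[OF r F'] vacuum_invariant[OF r]
      by (simp add: ws'_def o_def \<beta>_rot_reflect rev_map)
  qed
  have "boost_graph U form (\<i> * of_real pi) (field_prod ws' \<Omega>) (reflected ws')"
    by (rule boost_graph_plus) (use F supp in \<open>auto simp: ws'_def intro!: supp_rotate[THEN subsetD]\<close>)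
  then obtain G where G: "continuous_on (strip (\<i> * of_real pi)) G" "G holomorphic_on interior (strip (\<i> * of_real pi))"
    "\<And>t. G (of_real t) = form (U (boost t) (field_prod ws' \<Omega>)) (U (rot pi) \<Phi>')"
    "\<And>t. G (\<i> * of_real pi + of_real t) = form (U (boost t) (reflected ws')) (U (rot pi) \<Phi>')"
    unfolding boost_graph_def by meson
  have rotate: "form (U (boost (- t)) (U (rot pi) \<Psi>)) (U (rot pi) \<Phi>') = form (U (boost t) \<Psi>) \<Phi>'" for t \<Psi>
  proof -
    have "U (boost (- t)) (U (rot pi) \<Psi>) = U (rot pi) (U (boost t) \<Psi>)"
      using U_comp[OF boost_in_Mob r, of "- t"] U_comp[OF r boost_in_Mob, of t] unfolding boost_rot
      by (metis comp_apply)
    then show ?thesis using form_Mob_invariant[OF r] by simp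
  qed
  note strip = strip_minus_i_pi
  have int: "interior (strip (- \<i> * of_real pi)) = uminus ` interior (strip (\<i> * of_real pi))"
    unfolding strip by (rule interior_negations)
  show "\<exists>G. continuous_on (strip (- \<i> * of_real pi)) G \<and> G holomorphic_on interior (strip (- \<i> * of_real pi)) \<and>
      (\<forall>t. G (of_real t) = form (U (boost t) (field_prod ws \<Omega>)) \<Phi>' \<and>
        G (- \<i> * of_real pi + of_real t) = form (U (boost t) (reflected ws)) \<Phi>')"
  \<comment> \<open>Reversing the boosts negates the parameter, which exchanges the two
    strips.\<close>
  proof (intro exI[of _ "\<lambda>z. G (- z)"] conjI allI)
    show "continuous_on (strip (- \<i> * of_real pi)) (\<lambda>z. G (- z))"
      unfolding strip by (rule continuous_on_compose2[OF G(1)]) (auto intro!: continuous_intros)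
    show "(\<lambda>z. G (- z)) holomorphic_on interior (strip (- \<i> * of_real pi))"
      unfolding int by (rule holomorphic_on_compose_gen[of "\<lambda>z. - z" _ G, unfolded o_def, OF _ G(2)])
        (auto intro!: holomorphic_intros)
    fix t
    show "G (- of_real t) = form (U (boost t) (field_prod ws \<Omega>)) \<Phi>'"
      using G(3)[of "- t"] unfolding 1 rotate by simp
    show "G (- (- \<i> * of_real pi + of_real t)) = form (U (boost t) (reflected ws)) \<Phi>'"
      using G(4)[of "- t"] unfolding 2 rotate by simp
  qed
qed

end

section \<open>Adjoints in the local algebras\<close>

context wightman_cft
begin

interpretation V: vector_space scaleV by (rule vector_space)

lemma locally_convex_strong: "locally_convex_topology scaleV (strong_topology scaleV F)"
  by (rule locally_convex_strong_topology[OF vector_space])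

lemma topspace_strong: "topspace (strong_topology scaleV F) = UNIV"
  by (rule topspace_strong_topology[OF vector_space])

text \<open>Since the strong topology is the finest one with its defining properties, it is enough that
  its preimage topology under \<open>\<phi> f\<close> has them.\<close>

lemma field_End_op:
  assumes \<phi>: "\<phi> \<in> F" shows "\<phi> f \<in> End_op scaleV F"
proof -
  let ?S = "strong_topology scaleV F"
  let ?T = "pullback_topology UNIV (\<phi> f) ?S"
  have S: "continuous_map (prod_topology ?S ?S) ?S (\<lambda>(x, y). x + y)"
    "continuous_map (prod_topology euclidean ?S) ?S (\<lambda>(c, x). scaleV c x)"
    "\<And>W. openin ?S W \<Longrightarrow> 0 \<in> W \<Longrightarrow> \<exists>C. openin ?S C \<and> 0 \<in> C \<and> C \<subseteq> W \<and>
        (\<forall>x\<in>C. \<forall>y\<in>C. \<forall>t\<in>{0..1}. scaleV (of_real (1 - t)) x + scaleV (of_real t) y \<in> C)"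
    using locally_convex_strong by (auto simp: locally_convex_topology_def)
  have top: "topspace ?T = UNIV" by (simp add: topspace_pullback_topology topspace_strong)
  have pull: "continuous_map ?T ?S (\<phi> f)"
    using continuous_map_pullback[of ?S ?S id UNIV "\<phi> f"] by simp
  have into: "continuous_map X ?T g" if "continuous_map X ?S (\<lambda>x. \<phi> f (g x))" for X :: "'x topology" and g
    by (rule continuous_map_pullback') (use that in \<open>auto simp: o_def\<close>)
  have "locally_convex_topology scaleV ?T"
    unfolding locally_convex_topology_def
  proof (intro conjI allI impI top)
    show "continuous_map (prod_topology ?T ?T) ?T (\<lambda>(x, y). x + y)"
    proof (rule into)
      have "continuous_map (prod_topology ?T ?T) (prod_topology ?S ?S) (\<lambda>(x, y). (\<phi> f x, \<phi> f y))"
        by (intro continuous_map_prod_top[THEN iffD2] disjI2 conjI pull)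
      from continuous_map_compose[OF this S(1)]
      show "continuous_map (prod_topology ?T ?T) ?S (\<lambda>x. \<phi> f (case x of (x, y) \<Rightarrow> x + y))"
        by (simp add: o_def case_prod_unfold field_linear[OF \<phi>])
    qed
    show "continuous_map (prod_topology euclidean ?T) ?T (\<lambda>(c, x). scaleV c x)"
    proof (rule into)
      have "continuous_map (prod_topology euclidean ?T) (prod_topology euclidean ?S) (\<lambda>(c, x). (id c, \<phi> f x))"
        by (intro continuous_map_prod_top[THEN iffD2] disjI2 conjI pull continuous_map_id)
      from continuous_map_compose[OF this S(2)]
      show "continuous_map (prod_topology euclidean ?T) ?S (\<lambda>x. \<phi> f (case x of (c, x) \<Rightarrow> scaleV c x))"
        by (simp add: o_def case_prod_unfold field_linear[OF \<phi>])
    qed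
    fix W assume W: "openin ?T W \<and> 0 \<in> W"
    then obtain W' where W': "openin ?S W'" "W = \<phi> f -` W'" by (auto simp: openin_pullback_topology)
    then have "0 \<in> W'" using W field_zero[OF \<phi>] by auto
    then obtain C where C: "openin ?S C" "0 \<in> C" "C \<subseteq> W'"
        "\<forall>x\<in>C. \<forall>y\<in>C. \<forall>t\<in>{0..1}. scaleV (of_real (1 - t)) x + scaleV (of_real t) y \<in> C"
      using S(3)[OF W'(1)] by blast
    show "\<exists>C. openin ?T C \<and> 0 \<in> C \<and> C \<subseteq> W \<and>
        (\<forall>x\<in>C. \<forall>y\<in>C. \<forall>t\<in>{0..1}. scaleV (of_real (1 - t)) x + scaleV (of_real t) y \<in> C)"
    proof (intro exI[of _ "\<phi> f -` C"] conjI)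
      show "openin ?T (\<phi> f -` C)" using C(1) by (auto simp: openin_pullback_topology)
      show "0 \<in> \<phi> f -` C" using C(2) field_zero[OF \<phi>] by simp
      show "\<phi> f -` C \<subseteq> W" using C(3) W'(2) by auto
      show "\<forall>x\<in>\<phi> f -` C. \<forall>y\<in>\<phi> f -` C. \<forall>t\<in>{0..1}. scaleV (of_real (1 - t)) x + scaleV (of_real t) y \<in> \<phi> f -` C"
        using C(4) by (simp add: field_linear[OF \<phi>] vimage_def)
    qed
  qed
  moreover have "words_continuous F ?T"
    unfolding words_continuous_def
  proof (intro allI impI into)
    fix \<phi>s \<Phi> assume \<phi>s: "set \<phi>s \<subseteq> F"
    \<comment> \<open>Prepending the fixed \<open>f\<close> turns \<open>\<phi> f\<close> after a
      word into a longer word; the restriction makes the result an extensional function, a point of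
      the product space.\<close>
    define e where "e g = (\<lambda>j\<in>{..<Suc (length \<phi>s)}. case j of 0 \<Rightarrow> f | Suc i \<Rightarrow> g i)" for g :: "nat \<Rightarrow> smooth_circle"
    have "continuous_map (circle_power_topology (length \<phi>s)) (circle_power_topology (Suc (length \<phi>s))) e"
      unfolding circle_power_topology_def continuous_map_componentwise
    proof (intro conjI ballI)
      show "e ` topspace (product_topology (\<lambda>_. euclidean) {..<length \<phi>s}) \<subseteq> extensional {..<Suc (length \<phi>s)}"
        by (auto simp: e_def)
      fix j assume j: "j \<in> {..<Suc (length \<phi>s)}"
      show "continuous_map (product_topology (\<lambda>_. euclidean) {..<length \<phi>s}) euclidean (\<lambda>g. e g j)"
      proof (cases j)
        case 0
        then show ?thesis by (simp add: e_def)
      next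
        case (Suc i)
        then have "i \<in> {..<length \<phi>s}" using j by simp
        then have "continuous_map (product_topology (\<lambda>_. euclidean :: smooth_circle topology) {..<length \<phi>s}) euclidean (\<lambda>g. g i)"
          by (rule continuous_map_product_projection)
        then show ?thesis using j Suc by (simp add: e_def)
      qed
    qed
    moreover have "continuous_map (circle_power_topology (length (\<phi> # \<phi>s))) ?S (\<lambda>g. word (\<phi> # \<phi>s) g \<Phi>)"
    proof -
      have "set (\<phi> # \<phi>s) \<subseteq> F" using \<phi> \<phi>s by simp
      then show ?thesis using words_continuous_strong_topology[OF vector_space, of F] unfolding words_continuous_def by blast
    qed
    ultimately have "continuous_map (circle_power_topology (length \<phi>s)) ?S ((\<lambda>g. word (\<phi> # \<phi>s) g \<Phi>) \<circ> e)"
      by (intro continuous_map_compose) auto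
    moreover have "word (\<phi> # \<phi>s) (e g) \<Phi> = \<phi> f (word \<phi>s g \<Phi>)" for g
    proof -
      have "word (\<phi> # \<phi>s) (e g) \<Phi> = \<phi> f (foldr (\<lambda>j. ((\<phi> # \<phi>s) ! j) (e g j)) (map Suc [0..<length \<phi>s]) \<Phi>)"
        by (simp add: word_def upt_conv_Cons map_Suc_upt e_def del: upt_Suc)
      also have "foldr (\<lambda>j. ((\<phi> # \<phi>s) ! j) (e g j)) (map Suc [0..<length \<phi>s]) \<Phi> = word \<phi>s g \<Phi>"
        unfolding word_def foldr_map by (rule foldr_cong) (auto simp: e_def)
      finally show ?thesis .
    qed
    ultimately show "continuous_map (circle_power_topology (length \<phi>s)) ?S (\<lambda>g. \<phi> f (word \<phi>s g \<Phi>))"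
      by (simp add: o_def)
  qed
  ultimately have "openin ?S (\<phi> f -` W)" if "openin ?S W" for W
    using that openin_strong_topology[of scaleV ?T F "\<phi> f -` W"] by (auto simp: openin_pullback_topology)
  then have "continuous_map ?S ?S (\<phi> f)"
    unfolding continuous_map_def by (simp add: topspace_strong vimage_def)
  then show ?thesis
    using vector_space by (simp add: End_op_def Vector_Spaces.linear_iff field_linear[OF \<phi>])
qed

section \<open>Closure properties of the continuous operators\<close>

lemma End_op_id: "(\<lambda>\<Phi>. \<Phi>) \<in> End_op scaleV F"
  using vector_space by (simp add: End_op_def Vector_Spaces.linear_iff)

lemma End_op_comp:
  assumes "x \<in> End_op scaleV F" "y \<in> End_op scaleV F"
  shows "(\<lambda>\<Phi>. x (y \<Phi>)) \<in> End_op scaleV F"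
  using assms continuous_map_compose[of "strong_topology scaleV F" "strong_topology scaleV F" y "strong_topology scaleV F" x]
  by (auto simp: End_op_def Vector_Spaces.linear_iff o_def)

lemma End_op_add:
  assumes "x \<in> End_op scaleV F" "y \<in> End_op scaleV F"
  shows "(\<lambda>\<Phi>. x \<Phi> + y \<Phi>) \<in> End_op scaleV F"
proof -
  let ?S = "strong_topology scaleV F"
  have "continuous_map ?S (prod_topology ?S ?S) (\<lambda>\<Phi>. (x \<Phi>, y \<Phi>))"
    using assms by (intro continuous_map_pairedI) (auto simp: End_op_def)
  moreover have "continuous_map (prod_topology ?S ?S) ?S (\<lambda>(x, y). x + y)"
    using locally_convex_strong by (auto simp: locally_convex_topology_def)
  ultimately have "continuous_map ?S ?S (\<lambda>\<Phi>. x \<Phi> + y \<Phi>)"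
    using continuous_map_compose by (fastforce simp: o_def)
  then show ?thesis using assms by (auto simp: End_op_def Vector_Spaces.linear_iff V.scale_right_distrib)
qed

lemma End_op_scale:
  assumes "x \<in> End_op scaleV F"
  shows "(\<lambda>\<Phi>. scaleV c (x \<Phi>)) \<in> End_op scaleV F"
proof -
  let ?S = "strong_topology scaleV F"
  have "continuous_map ?S (prod_topology euclidean ?S) (\<lambda>\<Phi>. (c, x \<Phi>))"
    using assms by (intro continuous_map_pairedI) (auto simp: End_op_def)
  moreover have "continuous_map (prod_topology euclidean ?S) ?S (\<lambda>(c, x). scaleV c x)"
    using locally_convex_strong by (auto simp: locally_convex_topology_def)
  ultimately have "continuous_map ?S ?S (\<lambda>\<Phi>. scaleV c (x \<Phi>))"
    using continuous_map_compose by (fastforce simp: o_def)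
  then show ?thesis using assms by (auto simp: End_op_def Vector_Spaces.linear_iff V.scale_right_distrib mult.commute)
qed

section \<open>Elements of the local algebras as linear combinations of words\<close>

definition combination :: "(complex \<times> ('v opdist \<times> smooth_circle) list) list \<Rightarrow> 'v \<Rightarrow> 'v" where
  "combination L \<Phi> = (\<Sum>x\<leftarrow>L. scaleV (fst x) (field_prod (snd x) \<Phi>))"

definition local_words :: "complex set \<Rightarrow> ('v opdist \<times> smooth_circle) list set" where
  "local_words I = {ws. fst ` set ws \<subseteq> F \<and> (\<forall>x\<in>set ws. supp_circle (snd x) \<subseteq> I)}"

text \<open>Products distribute and words concatenate, so combinations of words are closed under all
  generating operations. In this form both the adjoint and the continuation can be written
  down.\<close>

lemma local_alg_combination:
  assumes "x \<in> local_alg scaleV F I"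
  obtains L where "snd ` set L \<subseteq> local_words I" "x = combination L"
proof -
  have "\<exists>L. snd ` set L \<subseteq> local_words I \<and> x = combination L"
    using assms
  proof induction
    case id
    show ?case by (intro exI[of _ "[(1, [])]"]) (auto simp: local_words_def combination_def)
  next
    case (field \<phi> f)
    then show ?case by (intro exI[of _ "[(1, [(\<phi>, f)])]"]) (auto simp: local_words_def combination_def)
  next
    case (comp x y)
    then obtain L L' where L: "snd ` set L \<subseteq> local_words I" "x = combination L"
      "snd ` set L' \<subseteq> local_words I" "y = combination L'" by auto
    define P where "P = concat (map (\<lambda>x. map (\<lambda>y. (fst x * fst y, snd x @ snd y)) L') L)"
    have 1: "scaleV c (field_prod ws (combination L' \<Phi>)) = combination (map (\<lambda>y. (c * fst y, ws @ snd y)) L') \<Phi>"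
      if ws: "ws \<in> local_words I" for c ws \<Phi>
    proof -
      have F: "fst ` set ws \<subseteq> F" using ws by (simp add: local_words_def)
      have "field_prod ws 0 = 0" using field_prod_linear(2)[OF F, of 0 0] by simp
      then show ?thesis
        by (induction L') (auto simp: combination_def field_prod_linear[OF F] field_prod_append V.scale_right_distrib)
    qed
    have "combination L (combination L' \<Phi>) = combination P \<Phi>" for \<Phi>
      using L(1) unfolding P_def
    proof (induction L)
      case (Cons x L)
      then have "scaleV (fst x) (field_prod (snd x) (combination L' \<Phi>)) = combination (map (\<lambda>y. (fst x * fst y, snd x @ snd y)) L') \<Phi>"
        by (intro 1) auto
      then show ?case using Cons by (simp add: combination_def)
    qed (simp add: combination_def)
    then have "x \<circ> y = combination P" unfolding L by (simp add: fun_eq_iff)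
    moreover have "snd ` set P \<subseteq> local_words I"
    proof -
      have "ws @ ws' \<in> local_words I" if "ws \<in> local_words I" "ws' \<in> local_words I" for ws ws'
        using that by (auto simp: local_words_def)
      then show ?thesis using L(1,3) by (simp add: P_def image_subset_iff)
    qed
    ultimately show ?case by blast
  next
    case (add x y)
    then obtain L L' where L: "snd ` set L \<subseteq> local_words I" "x = combination L"
      "snd ` set L' \<subseteq> local_words I" "y = combination L'" by auto
    then show ?case by (intro exI[of _ "L @ L'"]) (auto simp: combination_def fun_eq_iff)
  next
    case (smult x c)
    then obtain L where L: "snd ` set L \<subseteq> local_words I" "x = combination L" by auto
    have "scaleV c (combination L \<Phi>) = combination (map (\<lambda>x. (c * fst x, snd x)) L) \<Phi>" for \<Phi>
      by (induction L) (auto simp: combination_def V.scale_right_distrib)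
    then show ?case using L by (intro exI[of _ "map (\<lambda>x. (c * fst x, snd x)) L"]) (auto simp: fun_eq_iff)
  qed
  then show ?thesis using that by blast
qed

end

context involutive_wightman_cft
begin

interpretation V: vector_space scaleV by (rule vector_space)

section \<open>Adjoints of words and the PCT operator\<close>

primrec adj :: "('v opdist \<times> smooth_circle) list \<Rightarrow> 'v \<Rightarrow> 'v" where
  "adj [] \<Psi> = \<Psi>"
| "adj (x # ws) \<Psi> = adj ws (dagger scaleV d \<Theta> (fst x) (cnj_circle (snd x)) \<Psi>)"

lemma form_adj:
  "fst ` set ws \<subseteq> F \<Longrightarrow> form (field_prod ws \<Phi>) \<Psi> = form \<Phi> (adj ws \<Psi>)"
  by (induction ws arbitrary: \<Psi>) (auto simp: form_invariant)

text \<open>\<open>dagger_closed\<close> makes the dagger a field up to the sign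
  \<open>(- 1) ^ d \<phi>\<close>, and this sign squares to 1.\<close>

lemma dagger_End_op:
  assumes "\<phi> \<in> F" shows "dagger scaleV d \<Theta> \<phi> g \<in> End_op scaleV F"
proof -
  have "(\<lambda>\<Psi>. scaleV ((- 1) ^ d \<phi>) (scaleV ((- 1) ^ d \<phi>) (dagger scaleV d \<Theta> \<phi> g \<Psi>))) \<in> End_op scaleV F"
    by (rule End_op_scale) (rule field_End_op[OF dagger_closed[OF assms]])
  moreover have "(- 1 :: complex) ^ k * (- 1) ^ k = 1" for k by (simp flip: power_mult_distrib)
  ultimately show ?thesis by simp
qed

lemma adj_End_op: "fst ` set ws \<subseteq> F \<Longrightarrow> adj ws \<in> End_op scaleV F"
proof (induction ws)
  case Nil
  have "adj [] = (\<lambda>\<Phi>. \<Phi>)" by (simp add: fun_eq_iff)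
  then show ?case using End_op_id by simp
next
  case (Cons x ws)
  have "adj (x # ws) = (\<lambda>\<Psi>. adj ws (dagger scaleV d \<Theta> (fst x) (cnj_circle (snd x)) \<Psi>))" by (simp add: fun_eq_iff)
  then show ?case using Cons by (auto intro: End_op_comp dagger_End_op)
qed

text \<open>The outer \<open>\<Theta>\<close> of each dagger cancels, as do the two conjugations of
  the test function, leaving the sign and the reflection; the adjoint of a product reverses its
  order.\<close>

lemma PCT_adj:
  assumes "fst ` set ws \<subseteq> F"
  shows "\<Theta> (adj ws \<Psi>) = scaleV (dim_sign (map fst ws)) (field_prod (rev (map (\<lambda>x. (fst x, reflect_circle (snd x))) ws)) (\<Theta> \<Psi>))"
  using assms
proof (induction ws arbitrary: \<Psi>)
  case Nil
  then show ?case by (simp add: dim_sign_def)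
next
  case (Cons x ws)
  have "cnj_circle (cnj_circle f) = f" for f by (rule circle_eqI) simp
  then have dag: "\<Theta> (dagger scaleV d \<Theta> (fst x) (cnj_circle (snd x)) \<Psi>)
      = scaleV ((- 1) ^ d (fst x)) (fst x (reflect_circle (snd x)) (\<Theta> \<Psi>))"
    by (simp add: dagger_def PCT_scale PCT_involution)
  have F: "fst ` set (rev (map (\<lambda>x. (fst x, reflect_circle (snd x))) ws)) \<subseteq> F" using Cons.prems by auto
  have "\<Theta> (adj (x # ws) \<Psi>) = scaleV (dim_sign (map fst ws))
      (field_prod (rev (map (\<lambda>x. (fst x, reflect_circle (snd x))) ws)) (\<Theta> (dagger scaleV d \<Theta> (fst x) (cnj_circle (snd x)) \<Psi>)))"
    using Cons by simp
  also have "\<dots> = scaleV (dim_sign (map fst (x # ws)))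
      (field_prod (rev (map (\<lambda>x. (fst x, reflect_circle (snd x))) (x # ws))) (\<Theta> \<Psi>))"
    unfolding dag field_prod_linear(2)[OF F] by (simp add: field_prod_append dim_sign_def mult.commute)
  finally show ?case .
qed

definition adj_combination :: "(complex \<times> ('v opdist \<times> smooth_circle) list) list \<Rightarrow> 'v \<Rightarrow> 'v" where
  "adj_combination L \<Psi> = (\<Sum>x\<leftarrow>L. scaleV (cnj (fst x)) (adj (snd x) \<Psi>))"

lemma form_zero: "form 0 \<Psi> = 0" "form \<Phi> 0 = 0"
  using form_linear1(2)[of 0 0 \<Psi>] form_linear2(2)[of \<Phi> 0 0] by simp_all

text \<open>\<open>adjoint_op\<close> is a definite description within \<open>End_op\<close>:
  existence rests on the continuity of the daggers, uniqueness on the nondegeneracy of the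
  form.\<close>

lemma adjoint_op_combination:
  assumes "snd ` set L \<subseteq> local_words I"
  shows "adjoint_op scaleV F form (combination L) = adj_combination L"
proof -
  have 1: "adj_combination L \<in> End_op scaleV F"
    using assms
  proof (induction L)
    case Nil
    have "adj_combination [] = (\<lambda>\<Phi>. scaleV 0 \<Phi>)" by (simp add: adj_combination_def fun_eq_iff)
    then show ?case using End_op_scale[OF End_op_id, of 0] by simp
  next
    case (Cons x L)
    have "adj_combination (x # L) = (\<lambda>\<Psi>. scaleV (cnj (fst x)) (adj (snd x) \<Psi>) + adj_combination L \<Psi>)"
      by (simp add: adj_combination_def fun_eq_iff)
    moreover have "fst ` set (snd x) \<subseteq> F" using Cons.prems by (auto simp: local_words_def)
    ultimately show ?case using Cons by (auto intro!: End_op_add End_op_scale adj_End_op)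
  qed
  have 2: "form (combination L \<Phi>) \<Psi> = form \<Phi> (adj_combination L \<Psi>)" for \<Phi> \<Psi>
    using assms
  proof (induction L)
    case Nil
    then show ?case by (simp add: combination_def adj_combination_def form_zero)
  next
    case (Cons x L)
    have "fst ` set (snd x) \<subseteq> F" using Cons.prems by (auto simp: local_words_def)
    then show ?case
      using Cons by (auto simp: combination_def adj_combination_def form_linear1 form_linear2 form_adj)
  qed
  show ?thesis
    unfolding adjoint_op_def
  proof (rule the_equality)
    show "adj_combination L \<in> End_op scaleV F \<and> (\<forall>\<Phi> \<Psi>. form (combination L \<Phi>) \<Psi> = form \<Phi> (adj_combination L \<Psi>))"
      using 1 2 by blast
    fix y assume y: "y \<in> End_op scaleV F \<and> (\<forall>\<Phi> \<Psi>. form (combination L \<Phi>) \<Psi> = form \<Phi> (y \<Psi>))"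
    show "y = adj_combination L"
      by (rule ext, rule form_eqI2) (use y 2 in metis)
  qed
qed

section \<open>Linearity and uniqueness of the continued boost\<close>

lemma boost_graph_add:
  assumes "boost_graph U form \<tau> \<Phi> \<Psi>" "boost_graph U form \<tau> \<Phi>2 \<Psi>2"
  shows "boost_graph U form \<tau> (\<Phi> + \<Phi>2) (\<Psi> + \<Psi>2)"
  unfolding boost_graph_def
proof
  fix \<Phi>'
  obtain G where G: "continuous_on (strip \<tau>) G" "G holomorphic_on interior (strip \<tau>)"
    "\<And>t. G (of_real t) = form (U (boost t) \<Phi>) \<Phi>' \<and> G (\<tau> + of_real t) = form (U (boost t) \<Psi>) \<Phi>'"
    using assms(1) unfolding boost_graph_def by meson
  obtain H where H: "continuous_on (strip \<tau>) H" "H holomorphic_on interior (strip \<tau>)"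
    "\<And>t. H (of_real t) = form (U (boost t) \<Phi>2) \<Phi>' \<and> H (\<tau> + of_real t) = form (U (boost t) \<Psi>2) \<Phi>'"
    using assms(2) unfolding boost_graph_def by meson
  show "\<exists>G. continuous_on (strip \<tau>) G \<and> G holomorphic_on interior (strip \<tau>) \<and>
      (\<forall>t. G (of_real t) = form (U (boost t) (\<Phi> + \<Phi>2)) \<Phi>' \<and> G (\<tau> + of_real t) = form (U (boost t) (\<Psi> + \<Psi>2)) \<Phi>')"
    by (intro exI[of _ "\<lambda>z. G z + H z"])
      (use G H in \<open>auto simp: U_linear boost_in_Mob form_linear1 intro!: continuous_intros holomorphic_intros\<close>)
qed

lemma boost_graph_scale:
  assumes "boost_graph U form \<tau> \<Phi> \<Psi>"
  shows "boost_graph U form \<tau> (scaleV c \<Phi>) (scaleV c \<Psi>)"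
  unfolding boost_graph_def
proof
  fix \<Phi>'
  obtain G where G: "continuous_on (strip \<tau>) G" "G holomorphic_on interior (strip \<tau>)"
    "\<And>t. G (of_real t) = form (U (boost t) \<Phi>) \<Phi>' \<and> G (\<tau> + of_real t) = form (U (boost t) \<Psi>) \<Phi>'"
    using assms unfolding boost_graph_def by meson
  show "\<exists>G. continuous_on (strip \<tau>) G \<and> G holomorphic_on interior (strip \<tau>) \<and>
      (\<forall>t. G (of_real t) = form (U (boost t) (scaleV c \<Phi>)) \<Phi>' \<and> G (\<tau> + of_real t) = form (U (boost t) (scaleV c \<Psi>)) \<Phi>')"
    by (intro exI[of _ "\<lambda>z. c * G z"])
      (use G in \<open>auto simp: U_linear boost_in_Mob form_linear1 intro!: continuous_intros holomorphic_intros\<close>)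
qed

lemma boost_graph_zero: "boost_graph U form \<tau> 0 0"
proof -
  have "U (boost t) 0 = 0" for t using U_linear(2)[OF boost_in_Mob, of t 0 0] by simp
  then show ?thesis unfolding boost_graph_def by (auto simp: form_zero intro!: exI[of _ "\<lambda>_. 0"])
qed

text \<open>Taking adjoints and applying \<open>\<Theta>\<close> are both antilinear, so the
  coefficients reappear unconjugated and the statement is linear in the words.\<close>

lemma boost_graph_combination:
  assumes L: "snd ` set L \<subseteq> local_words I"
    and words: "\<And>ws. ws \<in> local_words I \<Longrightarrow> boost_graph U form \<tau> (field_prod ws \<Omega>) (reflected ws)"
  shows "boost_graph U form \<tau> (combination L \<Omega>) (\<Theta> (adj_combination L \<Omega>))"
  using L
proof (induction L)
  case Nil
  have "\<Theta> 0 = 0" using PCT_scale[of 0 0] by simp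
  then show ?case by (simp add: combination_def adj_combination_def boost_graph_zero)
next
  case (Cons x L)
  have ws: "snd x \<in> local_words I" and F: "fst ` set (snd x) \<subseteq> F" using Cons.prems by (auto simp: local_words_def)
  have "combination (x # L) \<Omega> = scaleV (fst x) (field_prod (snd x) \<Omega>) + combination L \<Omega>"
    by (simp add: combination_def)
  moreover have "\<Theta> (adj_combination (x # L) \<Omega>) = scaleV (fst x) (reflected (snd x)) + \<Theta> (adj_combination L \<Omega>)"
    by (simp add: adj_combination_def PCT_add PCT_scale PCT_adj[OF F] PCT_vacuum reflected_def)
  ultimately show ?case using Cons words[OF ws] by (auto intro: boost_graph_add boost_graph_scale)
qed

text \<open>The difference of two continuations vanishes on the real line, hence on the other edge
  by \<open>strip_zero\<close>, and at \<open>t = 0\<close> the boost is the identity. The lower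
  strip is brought to the upper one by \<open>z \<mapsto> - z\<close>.\<close>

lemma boost_graph_unique:
  assumes \<tau>: "\<tau> = \<i> * of_real pi \<or> \<tau> = - \<i> * of_real pi"
    and g: "boost_graph U form \<tau> \<Phi> \<Psi>" "boost_graph U form \<tau> \<Phi> \<Psi>'"
  shows "\<Psi> = \<Psi>'"
proof (rule form_eqI)
  fix \<Phi>'
  obtain G where G: "continuous_on (strip \<tau>) G" "G holomorphic_on interior (strip \<tau>)"
    "\<And>t. G (of_real t) = form (U (boost t) \<Phi>) \<Phi>' \<and> G (\<tau> + of_real t) = form (U (boost t) \<Psi>) \<Phi>'"
    using g(1) unfolding boost_graph_def by meson
  obtain H where H: "continuous_on (strip \<tau>) H" "H holomorphic_on interior (strip \<tau>)"
    "\<And>t. H (of_real t) = form (U (boost t) \<Phi>) \<Phi>' \<and> H (\<tau> + of_real t) = form (U (boost t) \<Psi>') \<Phi>'"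
    using g(2) unfolding boost_graph_def by meson
  define E where "E z = G z - H z" for z
  have E: "continuous_on (strip \<tau>) E" "E holomorphic_on interior (strip \<tau>)" "\<And>t. E (of_real t) = 0"
    unfolding E_def using G H by (auto intro!: continuous_intros holomorphic_intros)
  have "E \<tau> = 0"
    using \<tau>
  proof
    assume "\<tau> = \<i> * of_real pi"
    then show ?thesis using strip_zero[of E 0] E by simp
  next
    assume t: "\<tau> = - \<i> * of_real pi"
    have S: "(\<lambda>z. - z) ` strip (\<i> * of_real pi) = strip \<tau>"
      unfolding t strip_minus_i_pi ..
    then have int: "(\<lambda>z. - z) ` interior (strip (\<i> * of_real pi)) = interior (strip \<tau>)"
      by (simp flip: interior_negations)
    have "E (- (\<i> * of_real pi + of_real 0)) = 0"
    proof (rule strip_zero[of "\<lambda>z. E (- z)" 0])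
      show "continuous_on (strip (\<i> * of_real pi)) (\<lambda>z. E (- z))"
        by (rule continuous_on_compose2[OF E(1)]) (use S in \<open>auto intro!: continuous_intros\<close>)
      show "(\<lambda>z. E (- z)) holomorphic_on interior (strip (\<i> * of_real pi))"
        by (rule holomorphic_on_compose_gen[of "\<lambda>z. - z" _ E, unfolded o_def, OF _ E(2)])
          (use int in \<open>auto intro!: holomorphic_intros\<close>)
      show "E (- of_real t) = 0" for t using E(3)[of "- t"] by simp
    qed
    then show ?thesis by (simp add: t)
  qed
  moreover have "boost 0 = id" by (simp add: boost_def mob_id)
  ultimately show "form \<Psi> \<Phi>' = form \<Psi>' \<Phi>'"
    using G(3)[of 0] H(3)[of 0] U_id by (simp add: E_def)
qed

lemma boost_op_combination:
  assumes \<tau>: "\<tau> = \<i> * of_real pi \<or> \<tau> = - \<i> * of_real pi"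
    and words: "\<And>ws. ws \<in> local_words I \<Longrightarrow> boost_graph U form \<tau> (field_prod ws \<Omega>) (reflected ws)"
    and x: "x \<in> local_alg scaleV F I"
  shows "x \<Omega> \<in> boost_dom U form \<tau>" "boost_op U form \<tau> (x \<Omega>) = \<Theta> (adjoint_op scaleV F form x \<Omega>)"
proof -
  obtain L where L: "snd ` set L \<subseteq> local_words I" "x = combination L"
    using local_alg_combination[OF x] by blast
  have g: "boost_graph U form \<tau> (x \<Omega>) (\<Theta> (adjoint_op scaleV F form x \<Omega>))"
    unfolding L(2) adjoint_op_combination[OF L(1)] by (rule boost_graph_combination[OF L(1) words])
  then show "x \<Omega> \<in> boost_dom U form \<tau>" by (auto simp: boost_dom_def)
  show "boost_op U form \<tau> (x \<Omega>) = \<Theta> (adjoint_op scaleV F form x \<Omega>)"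
    unfolding boost_op_def by (rule the_equality, rule g) (rule boost_graph_unique[OF \<tau> _ g])
qed

end

theorem theorem2:
  fixes scaleV :: "complex \<Rightarrow> 'v \<Rightarrow> 'v::ab_group_add"
    and F :: "'v opdist set"
    and d :: "'v opdist \<Rightarrow> nat"
    and U :: "(complex \<Rightarrow> complex) \<Rightarrow> 'v \<Rightarrow> 'v"
    and \<Omega> :: 'v
    and form :: "'v \<Rightarrow> 'v \<Rightarrow> complex"
    and \<Theta> :: "'v \<Rightarrow> 'v"
  assumes "involutive_wightman_cft scaleV F d U \<Omega> form \<Theta>"
  shows "(\<lambda>x. x \<Omega>) ` local_alg scaleV F I_plus \<subseteq> boost_dom U form (\<i> * of_real pi) \<and>
      (\<forall>x \<in> local_alg scaleV F I_plus.
         boost_op U form (\<i> * of_real pi) (x \<Omega>) = \<Theta> (adjoint_op scaleV F form x \<Omega>)) \<and>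
      (\<lambda>x. x \<Omega>) ` local_alg scaleV F I_minus \<subseteq> boost_dom U form (- \<i> * of_real pi) \<and>
      (\<forall>x \<in> local_alg scaleV F I_minus.
         boost_op U form (- \<i> * of_real pi) (x \<Omega>) = \<Theta> (adjoint_op scaleV F form x \<Omega>))"
proof -
  interpret involutive_wightman_cft scaleV F d U \<Omega> form \<Theta> by fact
  have plus: "boost_graph U form (\<i> * of_real pi) (field_prod ws \<Omega>) (reflected ws)" if "ws \<in> local_words I_plus" for ws
    using that by (intro boost_graph_plus) (auto simp: local_words_def)
  have minus: "boost_graph U form (- \<i> * of_real pi) (field_prod ws \<Omega>) (reflected ws)" if "ws \<in> local_words I_minus" for ws
    using that by (intro boost_graph_minus) (auto simp: local_words_def)
  show ?thesis
    using boost_op_combination[OF disjI1[OF refl] plus] boost_op_combination[OF disjI2[OF refl] minus]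
    by (intro conjI image_subsetI ballI) auto
qed

end
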